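(* Let $\mathfrak a,\mathfrak b\in\mathbb Z$ with $\mathfrak a\ge 0$, let $\eta\in H^{\mathfrak a}_0(B_a)$ and let $\phi=u-u_i$ be the corresponding scattering data. Put $$C:=\|\mathcal K_1\|_{\mathfrak b\mathfrak a}\exp\left(\frac{1}{1-(\mu_{\mathfrak a\mathfrak b}+\nu_{\mathfrak a\mathfrak b})\|\mathcal K_1\|_{\mathfrak b\mathfrak a}}\right),\qquad C^*:=\max\left\{\frac{1}{\mu_{\mathfrak a\mathfrak b}+\nu_{\mathfrak a\mathfrak b}},\,C\right\},$$ $$\mathcal M:=\max\{\|\eta\|_{H^{\mathfrak a}},\|\mathcal K_1K_1\eta\|_{H^{\mathfrak a}}\},\qquad C_{\mathfrak a\mathfrak b}:=\frac{C^*(\mu_{\mathfrak a\mathfrak b}+\nu_{\mathfrak a\mathfrak b})}{(1-(\mu_{\mathfrak a\mathfrak b}+\nu_{\mathfrak a\mathfrak b})\mathcal M)^2}.$$ If $$\|\mathcal K_1\|_{\mathfrak b\mathfrak a}<\frac1{\mu_{\mathfrak a\mathfrak b}+\nu_{\mathfrak a\mathfrak b}},\qquad \|\mathcal K_1\phi\|_{H^{\mathfrak a}}<\frac1{\mu_{\mathfrak a\mathfrak b}+\nu_{\mathfrak a\mathfrak b}},\qquad \mathcal M<\frac1{\mu_{\mathfrak a\mathfrak b}+\nu_{\mathfrak a\mathfrak b}},$$ then for every $N\ge1$ the partial sum of the inverse scattering series satisfies $$\Big\|\eta-\sum_{j=1}^N\mathcal K_j\,\phi\otimes\cdots\otimes\phi\Big\|_{H^{\mathfrak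 a}}\le C_{\mathfrak a\mathfrak b}\,\|(I-\mathcal K_1K_1)\eta\|_{H^{\mathfrak a}}+C\,\frac{\left[(\mu_{\mathfrak a\mathfrak b}+\nu_{\mathfrak a\mathfrak b})\|\mathcal K_1\phi\|_{H^{\mathfrak a}}\right]^{N+1}}{1-(\mu_{\mathfrak a\mathfrak b}+\nu_{\mathfrak a\mathfrak b})\|\mathcal K_1\phi\|_{H^{\mathfrak a}}}.$$
   Context: **Waves.** Fix $k>0$, a dimension $n$, and a ball $B_a\subset\mathbb R^n$ of radius $a$. $G(x,y)$ is the outgoing Green's function of the Helmholtz equation ($\Delta_xG+k^2G=-\delta(x-y)$: $\frac{i}{2k}e^{ik|x-y|}$ for $n=1$, $\frac i4H_0^{(1)}(k|x-y|)$ for $n=2$, $\frac{e^{ik|x-y|}}{4\pi|x-y|}$ for $n=3$) or the Green's function of the diffuse wave equation ($\Delta_xG-k^2G=-\delta(x-y)$: $\frac{1}{2k}e^{-k|x-y|}$, $\frac1{2\pi}K_0(k|x-y|)$ with $K_0$ the modified Bessel function, $\frac{e^{-k|x-y|}}{4\pi|x-y|}$ for $n=1,2,3$). $u_i(x,x_1)$ is the incident field generated in the homogeneous medium ($\eta=0$) by a source located at $x_1$, i.e. $\Delta_xu_i\pm k^2u_i=-S(x-x_1)$ ($+$ Helmholtz, $-$ diffuse). $\eta$ is supported in $B_a$ and $u$ is the total field in the medium with $k^2$ replaced by $k^2(1+\eta)$. **Sobolev spaces.** For an integer $s\ge0$, $\|f\|_{H^s(B_a)}^2=\sum_{|\alpha|\le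 s}\|D^\alpha f\|_{L^2(B_a)}^2$, and $H^s_0(B_a)$ is the space of $f\in H^s(B_a)$ with compact support. $\Omega\subset\mathbb R^n$ is a bounded domain with $\inf_{x\in\partial\Omega,y\in B_a}|x-y|>0$ whose boundary is described by finitely many local charts: there are $\lambda,\gamma>0$, local Cartesian coordinate systems $(x_r',x_{rn})$, $r=1,\dots,m$, and continuous functions $a_r$ on the closed cubes $\overline{\Delta_r}=\{|x_{ri}|\le\lambda,\ 1\le i\le n-1\}$ such that every point of $\partial\Omega$ equals $(x_r',a_r(x_r'))$ for at least one $r$, points with $a_r(x_r')<x_{rn}<a_r(x_r')+\gamma$ lie in $\Omega$, and points with $a_r(x_r')-\gamma<x_{rn}<a_r(x_r')$ lie outside $\overline\Omega$. If $\mathfrak b\neq0$, $\Omega$ is of type $\mathfrak R^{|\mathfrak b|-1,1}$, i.e. the $a_r$ have continuous derivatives of order $\le|\mathfrak b|-1$, all of which are Lipschitz. For an integer $s\ge0$, $\|f\|_{H^s(\partial\Omega)}^2=\sum_{r=1}^m\|f_r\|_{H^s(\Delta_r)}^2$ with $f_r(x_r')=f(x_r',a_r(x_r'))$; $L^2(\partial\Omega)=H^0(\partial\Omega)$. For $s>0$, $H^{-s}(\partial\Omega)$ is the dual space with $\|f\|_{H^{-s}(\partial\Omega)}=\sup_{g\in H^s(\partial\Omega)}\langle f,g\rangle_{L^2(\partial\Omega)}/\|g\|_{H^s(\partial\Omega)}$. The data space $H^{\mathfrak b}(\partial\Omega)\times L^2(\partial\Omega)$ consists of functions $\phi(x,x_1)$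 with norm $\|\phi\|^2=\sum_{r_1}\int_{\Delta_{r_1}}\|\phi(\cdot,x_1)\|_{H^{\mathfrak b}(\partial\Omega)}^2dx_{r_1}'$, where $x_1=(x_{r_1}',a_{r_1}(x_{r_1}'))$. **Forward operators.** For $j\ge1$ and a function $f$ of $(y_1,\dots,y_j)\in B_a^j$, $$(K_jf)(x,x_1)=k^{2j}\int_{B_a^j}G(x,y_1)G(y_1,y_2)\cdots G(y_{j-1},y_j)\,u_i(y_j,x_1)\,f(y_1,\dots,y_j)\,dy_1\cdots dy_j .$$ The forward series is $\phi=u-u_i=\sum_{j\ge1}K_j\,\eta\otimes\cdots\otimes\eta$, where $(\eta\otimes\cdots\otimes\eta)(y_1,\dots,y_j)=\eta(y_1)\cdots\eta(y_j)$; this defines the data of $\eta$. **Inverse operators.** $\mathcal K_1=K_1^+$ is a regularized pseudoinverse of $K_1$, a bounded linear operator from the data space $H^{\mathfrak b}(\partial\Omega)\times L^2(\partial\Omega)$ to the parameter space $H^{\mathfrak a}_0(B_a)$ (no particular regularization is prescribed). For $j\ge2$, $$\mathcal K_j=-\Big(\sum_{m=1}^{j-1}\mathcal K_m\sum_{i_1+\cdots+i_m=j,\ i_l\ge1}K_{i_1}\otimes\cdots\otimes K_{i_m}\Big)\mathcal K_1\otimes\cdots\otimes\mathcal K_1 ,$$ a $j$-linear operator on the data space. $\|\mathcal K_j\|_{\mathfrak b\mathfrak a}$ is its operator norm, the least $c$ with $\|\mathcal K_j\phi_1\otimes\cdots\otimes\phi_j\|_{H^{\mathfrak a}}\le c\prod_l\|\phi_l\|$.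 The inverse scattering series is $\sum_{j\ge1}\mathcal K_j\,\phi\otimes\cdots\otimes\phi$. **Constants.** $P(s,a,n)=\Big(\sum_{j=0}^s\binom{n+j-1}{n-1}(2a^2)^{-j}\Big)^{-1/2}$, $C_a=|B_a|^{1/2}\sup_{y\in B_a}\|u_i(y,\cdot)\|_{L^2(\partial\Omega)}$, $$\mu_{\mathfrak a\mathfrak b}=k^2P(\mathfrak a,a,n)\sup_{y\in B_a}\|G(y,\cdot)\|_{L^2(B_a)},\qquad \nu_{\mathfrak a\mathfrak b}=k^2P(\mathfrak a,a,n)\,C_a\sup_{y\in B_a}\|G(y,\cdot)\|_{H^{\mathfrak b}(\partial\Omega)} .$$ *)

theory Defs
  imports "HOL-Analysis.Analysis"
begin

section \<open>Coordinate space\<close>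

text \<open>
  Points of \<open>\<real>\<^sup>d\<close> are the functions in \<open>{..<d} \<rightarrow>\<^sub>E UNIV\<close>. The explicit carrier is needed
  because the local charts relate \<open>\<real>\<^sup>n\<close> and \<open>\<real>\<^bsup>n-1\<^esup>\<close>, including \<open>\<real>\<^sup>0\<close> (one point, of
  measure 1). The carrier is closed in the type \<open>nat \<Rightarrow> real\<close> with its product topology and
  inherits the Euclidean topology from it, so \<open>compact\<close>, \<open>closure\<close>, \<open>connected\<close> and
  \<open>continuous_on\<close> keep their meaning on subsets of the carrier; openness and frontier have to be
  taken relative to it.
\<close>

type_synonym pt = "nat \<Rightarrow> real"

definition Rsp :: "nat \<Rightarrow> pt set" where
  "Rsp d = ({..<d} \<rightarrow>\<^sub>E UNIV)"

definition edist :: "nat \<Rightarrow> pt \<Rightarrow> pt \<Rightarrow> real" where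
  "edist d x y = L2_set (\<lambda>i. x i - y i) {..<d}"

definition vadd :: "nat \<Rightarrow> pt \<Rightarrow> pt \<Rightarrow> pt" where
  "vadd d x y = (\<lambda>i\<in>{..<d}. x i + y i)"

definition oball :: "nat \<Rightarrow> pt \<Rightarrow> real \<Rightarrow> pt set" where
  "oball d c r = {x \<in> Rsp d. edist d c x < r}"

definition cube :: "nat \<Rightarrow> real \<Rightarrow> pt set" where
  "cube d l = {x \<in> Rsp d. \<forall>i<d. \<bar>x i\<bar> < l}"

definition ccube :: "nat \<Rightarrow> real \<Rightarrow> pt set" where
  "ccube d l = {x \<in> Rsp d. \<forall>i<d. \<bar>x i\<bar> \<le> l}"

definition leb :: "nat \<Rightarrow> pt set \<Rightarrow> pt measure" where
  "leb d U = restrict_space (\<Pi>\<^sub>M i\<in>{..<d}. lborel) U"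

definition bdry :: "nat \<Rightarrow> pt set \<Rightarrow> pt set" where
  "bdry n \<Omega> = top_of_set (Rsp n) frontier_of \<Omega>"

definition esqrt :: "ennreal \<Rightarrow> ennreal" where
  "esqrt x = (if x = \<infinity> then \<infinity> else ennreal (sqrt (enn2real x)))"

section \<open>Derivatives\<close>

text \<open>One-sided at the faces of a closed cube \<open>S\<close>, two-sided at interior points of \<open>S\<close>.\<close>

definition partial :: "pt set \<Rightarrow> nat \<Rightarrow> (pt \<Rightarrow> 'b::real_normed_vector) \<Rightarrow> pt \<Rightarrow> 'b" where
  "partial S i f x = vector_derivative (\<lambda>t. f (x(i := t))) (at (x i) within {t. x(i := t) \<in> S})"

fun Cm_on :: "nat \<Rightarrow> pt set \<Rightarrow> nat \<Rightarrow> (pt \<Rightarrow> 'b::real_normed_vector) \<Rightarrow> bool" where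
  "Cm_on d S 0 f \<longleftrightarrow> continuous_on S f"
| "Cm_on d S (Suc m) f \<longleftrightarrow> continuous_on S f \<and>
     (\<forall>i<d. (\<forall>x\<in>S. (\<lambda>t. f (x(i := t))) differentiable (at (x i) within {t. x(i := t) \<in> S}))
          \<and> Cm_on d S m (partial S i f))"

text \<open>\<open>mderiv S \<alpha> d f\<close> is the derivative of multi-index \<open>\<alpha>\<close>; it is used only for functions with
  continuous derivatives of order \<open>|\<alpha>|\<close>, where the order of differentiation is immaterial.\<close>

primrec mderiv :: "pt set \<Rightarrow> (nat \<Rightarrow> nat) \<Rightarrow> nat \<Rightarrow> (pt \<Rightarrow> 'b::real_normed_vector) \<Rightarrow> pt \<Rightarrow> 'b" where
  "mderiv S \<alpha> 0 f = f"
| "mderiv S \<alpha> (Suc i) f = (partial S i ^^ \<alpha> i) (mderiv S \<alpha> i f)"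

definition multi :: "nat \<Rightarrow> nat \<Rightarrow> (nat \<Rightarrow> nat) set" where
  "multi d s = {\<alpha> \<in> {..<d} \<rightarrow>\<^sub>E UNIV. (\<Sum>i<d. \<alpha> i) \<le> s}"

definition laplace :: "nat \<Rightarrow> (pt \<Rightarrow> complex) \<Rightarrow> pt \<Rightarrow> complex" where
  "laplace n \<psi> x = (\<Sum>i<n. partial (Rsp n) i (partial (Rsp n) i \<psi>) x)"

section \<open>Sobolev spaces on open sets\<close>

text \<open>
  Elements of all spaces are represented by Borel functions, and almost everywhere equal functions
  are not identified. Norms take the value \<open>\<infinity>\<close> outside the space.
\<close>

definition l2norm :: "nat \<Rightarrow> pt set \<Rightarrow> (pt \<Rightarrow> complex) \<Rightarrow> ennreal" where
  "l2norm d U f = esqrt (\<integral>\<^sup>+ x. ennreal ((cmod (f x))\<^sup>2) \<partial>leb d U)"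

definition L2 :: "nat \<Rightarrow> pt set \<Rightarrow> (pt \<Rightarrow> complex) set" where
  "L2 d U = {f \<in> borel_measurable (leb d U). l2norm d U f < \<infinity>}"

definition test_fun :: "nat \<Rightarrow> pt set \<Rightarrow> (pt \<Rightarrow> complex) set" where
  "test_fun d U = {\<psi>. (\<forall>m. Cm_on d (Rsp d) m \<psi>) \<and>
     (\<exists>K. compact K \<and> K \<subseteq> U \<and> (\<forall>x\<in>Rsp d - K. \<psi> x = 0))}"

definition is_weak_deriv ::
    "nat \<Rightarrow> pt set \<Rightarrow> (nat \<Rightarrow> nat) \<Rightarrow> (pt \<Rightarrow> complex) \<Rightarrow> (pt \<Rightarrow> complex) \<Rightarrow> bool" where
  "is_weak_deriv d U \<alpha> f g \<longleftrightarrow> g \<in> L2 d U \<and>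
     (\<forall>\<psi>\<in>test_fun d U.
        (\<integral>x. f x * mderiv (Rsp d) \<alpha> d \<psi> x \<partial>leb d U)
          = (- 1) ^ (\<Sum>i<d. \<alpha> i) * (\<integral>x. g x * \<psi> x \<partial>leb d U))"

definition weak_deriv :: "nat \<Rightarrow> pt set \<Rightarrow> (nat \<Rightarrow> nat) \<Rightarrow> (pt \<Rightarrow> complex) \<Rightarrow> pt \<Rightarrow> complex" where
  "weak_deriv d U \<alpha> f = (SOME g. is_weak_deriv d U \<alpha> f g)"

definition sobolev :: "nat \<Rightarrow> pt set \<Rightarrow> nat \<Rightarrow> (pt \<Rightarrow> complex) set" where
  "sobolev d U s = {f \<in> L2 d U. \<forall>\<alpha>\<in>multi d s. \<exists>g. is_weak_deriv d U \<alpha> f g}"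

definition sobolev_norm :: "nat \<Rightarrow> pt set \<Rightarrow> nat \<Rightarrow> (pt \<Rightarrow> complex) \<Rightarrow> ennreal" where
  "sobolev_norm d U s f =
     (if f \<in> sobolev d U s then esqrt (\<Sum>\<alpha>\<in>multi d s. (l2norm d U (weak_deriv d U \<alpha> f))\<^sup>2) else \<infinity>)"

definition sobolev0 :: "nat \<Rightarrow> pt set \<Rightarrow> nat \<Rightarrow> (pt \<Rightarrow> complex) set" where
  "sobolev0 d U s = {f \<in> sobolev d U s.
     \<exists>K. compact K \<and> K \<subseteq> U \<and> (AE x in leb d U. x \<notin> K \<longrightarrow> f x = 0)}"

section \<open>The boundary and its Sobolev spaces\<close>

text \<open>\<open>coord r\<close> maps the coordinates of a point in the \<open>r\<close>-th local Cartesian system to the point;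
  the coordinate \<open>x\<^sub>r\<^sub>n\<close> has index \<open>n - 1\<close>.\<close>

record atlas =
  charts :: nat
  halfwidth :: real
  height :: real
  coord :: "nat \<Rightarrow> pt \<Rightarrow> pt"
  graph :: "nat \<Rightarrow> pt \<Rightarrow> real"

definition chart :: "nat \<Rightarrow> atlas \<Rightarrow> nat \<Rightarrow> pt \<Rightarrow> pt" where
  "chart n A r x' = coord A r (x'(n - 1 := graph A r x'))"

definition lipschitz_derivs :: "nat \<Rightarrow> real \<Rightarrow> nat \<Rightarrow> (pt \<Rightarrow> real) \<Rightarrow> bool" where
  "lipschitz_derivs d l m h \<longleftrightarrow> Cm_on d (ccube d l) m h \<and>
     (\<forall>\<alpha>\<in>multi d m. \<exists>L. \<forall>x\<in>ccube d l. \<forall>y\<in>ccube d l.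
        \<bar>mderiv (ccube d l) \<alpha> d h x - mderiv (ccube d l) \<alpha> d h y\<bar> \<le> L * edist d x y)"

definition bounded_domain :: "nat \<Rightarrow> pt set \<Rightarrow> bool" where
  "bounded_domain n \<Omega> \<longleftrightarrow> \<Omega> \<noteq> {} \<and> openin (top_of_set (Rsp n)) \<Omega> \<and> connected \<Omega> \<and>
     (\<exists>R. \<forall>x\<in>\<Omega>. \<forall>y\<in>\<Omega>. edist n x y \<le> R)"

definition boundary_atlas :: "nat \<Rightarrow> pt set \<Rightarrow> atlas \<Rightarrow> int \<Rightarrow> bool" where
  "boundary_atlas n \<Omega> A \<bb> \<longleftrightarrow>
     0 < halfwidth A \<and> 0 < height A \<and>
     (\<forall>r<charts A. coord A r ` Rsp n \<subseteq> Rsp n \<and>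
        (\<forall>x\<in>Rsp n. \<forall>y\<in>Rsp n. edist n (coord A r x) (coord A r y) = edist n x y)) \<and>
     (\<forall>r<charts A. continuous_on (ccube (n - 1) (halfwidth A)) (graph A r)) \<and>
     (\<forall>x\<in>bdry n \<Omega>. \<exists>r<charts A. \<exists>x'\<in>ccube (n - 1) (halfwidth A). x = chart n A r x') \<and>
     (\<forall>r<charts A. \<forall>x'\<in>ccube (n - 1) (halfwidth A). \<forall>t.
        (graph A r x' < t \<and> t < graph A r x' + height A \<longrightarrow> coord A r (x'(n - 1 := t)) \<in> \<Omega>) \<and>
        (graph A r x' - height A < t \<and> t < graph A r x' \<longrightarrow>
           coord A r (x'(n - 1 := t)) \<notin> closure \<Omega>)) \<and>
     (\<bb> \<noteq> 0 \<longrightarrow>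
        (\<forall>r<charts A. lipschitz_derivs (n - 1) (halfwidth A) (nat (\<bar>\<bb>\<bar> - 1)) (graph A r)))"

abbreviation Delta :: "nat \<Rightarrow> atlas \<Rightarrow> pt set" where
  "Delta n A \<equiv> cube (n - 1) (halfwidth A)"

definition bd_sobolev :: "nat \<Rightarrow> atlas \<Rightarrow> nat \<Rightarrow> (pt \<Rightarrow> complex) set" where
  "bd_sobolev n A s = {f. \<forall>r<charts A. (\<lambda>x'. f (chart n A r x')) \<in> sobolev (n - 1) (Delta n A) s}"

definition bd_norm_pos :: "nat \<Rightarrow> atlas \<Rightarrow> nat \<Rightarrow> (pt \<Rightarrow> complex) \<Rightarrow> ennreal" where
  "bd_norm_pos n A s f =
     esqrt (\<Sum>r<charts A. (sobolev_norm (n - 1) (Delta n A) s (\<lambda>x'. f (chart n A r x')))\<^sup>2)"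

text \<open>The inner product belonging to \<open>bd_norm_pos n A 0\<close>.\<close>

definition bd_pairing :: "nat \<Rightarrow> atlas \<Rightarrow> (pt \<Rightarrow> complex) \<Rightarrow> (pt \<Rightarrow> complex) \<Rightarrow> complex" where
  "bd_pairing n A f g = (\<Sum>r<charts A.
     \<integral>x'. f (chart n A r x') * cnj (g (chart n A r x')) \<partial>leb (n - 1) (Delta n A))"

definition bd_pairable :: "nat \<Rightarrow> atlas \<Rightarrow> (pt \<Rightarrow> complex) \<Rightarrow> (pt \<Rightarrow> complex) \<Rightarrow> bool" where
  "bd_pairable n A f g \<longleftrightarrow> (\<forall>r<charts A.
     integrable (leb (n - 1) (Delta n A)) (\<lambda>x'. f (chart n A r x') * cnj (g (chart n A r x'))))"

text \<open>The negative norms are dual norms. In \<open>ennreal\<close> we have \<open>0 / 0 = 0\<close>, so that \<open>g = 0\<close>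
  does not contribute to the supremum.\<close>

definition bd_norm_neg :: "nat \<Rightarrow> atlas \<Rightarrow> nat \<Rightarrow> (pt \<Rightarrow> complex) \<Rightarrow> ennreal" where
  "bd_norm_neg n A s f =
     (if (\<forall>r<charts A. (\<lambda>x'. f (chart n A r x')) \<in> borel_measurable (leb (n - 1) (Delta n A))) \<and>
         (\<forall>g\<in>bd_sobolev n A s. bd_pairable n A f g)
      then SUP g\<in>bd_sobolev n A s. ennreal (cmod (bd_pairing n A f g)) / bd_norm_pos n A s g
      else \<infinity>)"

definition bd_norm :: "nat \<Rightarrow> atlas \<Rightarrow> int \<Rightarrow> (pt \<Rightarrow> complex) \<Rightarrow> ennreal" where
  "bd_norm n A \<bb> f = (if 0 \<le> \<bb> then bd_norm_pos n A (nat \<bb>) f else bd_norm_neg n A (nat (- \<bb>)) f)"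

section \<open>The data space\<close>

type_synonym param = "pt \<Rightarrow> complex"
type_synonym data = "pt \<Rightarrow> pt \<Rightarrow> complex"

definition data_norm :: "nat \<Rightarrow> atlas \<Rightarrow> int \<Rightarrow> data \<Rightarrow> ennreal" where
  "data_norm n A \<bb> \<phi> = esqrt (\<Sum>r<charts A.
     \<integral>\<^sup>+ x1'. (bd_norm n A \<bb> (\<lambda>x. \<phi> x (chart n A r x1')))\<^sup>2 \<partial>leb (n - 1) (Delta n A))"

definition data_space :: "nat \<Rightarrow> atlas \<Rightarrow> int \<Rightarrow> data set" where
  "data_space n A \<bb> = {\<phi>.
     (\<forall>r<charts A. \<forall>q<charts A. (\<lambda>(x', x1'). \<phi> (chart n A r x') (chart n A q x1'))
        \<in> borel_measurable (leb (n - 1) (Delta n A) \<Otimes>\<^sub>M leb (n - 1) (Delta n A))) \<and>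
     data_norm n A \<bb> \<phi> < \<infinity>}"

section \<open>Waves\<close>

datatype wave = Helmholtz | Diffuse

text \<open>The usual power series at \<open>0\<close>: \<open>J\<^sub>0\<close>, \<open>Y\<^sub>0\<close>, \<open>H\<^sub>0\<^bsup>(1)\<^esup> = J\<^sub>0 + i Y\<^sub>0\<close>, \<open>I\<^sub>0\<close>, \<open>K\<^sub>0\<close>.\<close>

definition bessel_J0 :: "real \<Rightarrow> real" where
  "bessel_J0 r = (\<Sum>m. (- 1) ^ m * (r\<^sup>2 / 4) ^ m / (fact m)\<^sup>2)"

definition bessel_Y0 :: "real \<Rightarrow> real" where
  "bessel_Y0 r = 2 / pi * (ln (r / 2) + euler_mascheroni) * bessel_J0 r
     - 2 / pi * (\<Sum>m. (- 1) ^ m * harm m * (r\<^sup>2 / 4) ^ m / (fact m)\<^sup>2)"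

definition hankel_H0 :: "real \<Rightarrow> complex" where
  "hankel_H0 r = Complex (bessel_J0 r) (bessel_Y0 r)"

definition bessel_I0 :: "real \<Rightarrow> real" where
  "bessel_I0 r = (\<Sum>m. (r\<^sup>2 / 4) ^ m / (fact m)\<^sup>2)"

definition bessel_K0 :: "real \<Rightarrow> real" where
  "bessel_K0 r = - (ln (r / 2) + euler_mascheroni) * bessel_I0 r
     + (\<Sum>m. harm m * (r\<^sup>2 / 4) ^ m / (fact m)\<^sup>2)"

text \<open>Meant for \<open>n \<in> {1, 2, 3}\<close> only.\<close>

definition green :: "wave \<Rightarrow> nat \<Rightarrow> real \<Rightarrow> pt \<Rightarrow> pt \<Rightarrow> complex" where
  "green w n k x y = (let r = edist n x y in
     case w of
       Helmholtz \<Rightarrow>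
         if n = 1 then \<i> / (2 * of_real k) * exp (\<i> * of_real (k * r))
         else if n = 2 then \<i> / 4 * hankel_H0 (k * r)
         else exp (\<i> * of_real (k * r)) / of_real (4 * pi * r)
     | Diffuse \<Rightarrow>
         if n = 1 then of_real (1 / (2 * k) * exp (- k * r))
         else if n = 2 then of_real (1 / (2 * pi) * bessel_K0 (k * r))
         else of_real (exp (- k * r) / (4 * pi * r)))"

definition wave_sign :: "wave \<Rightarrow> complex" where
  "wave_sign w = (case w of Helmholtz \<Rightarrow> 1 | Diffuse \<Rightarrow> - 1)"

text \<open>
  The equation \<open>\<Delta>\<^sub>x u\<^sub>i \<plusminus> k\<^sup>2 u\<^sub>i = - S(x - x\<^sub>1)\<close> in the sense of distributions, for sources
  \<open>x\<^sub>1 \<in> \<partial>\<Omega>\<close>. The source \<open>S\<close> is a functional on test functions (\<open>\<lambda>\<psi>. \<psi> 0\<close> for a point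
  source); linearity and continuity of \<open>S\<close> follow from the equation. Joint measurability makes
  the integrals of \<open>u\<^sub>i\<close> over \<open>B \<times> \<partial>\<Omega>\<close> meaningful.
\<close>

definition incident_field ::
    "wave \<Rightarrow> nat \<Rightarrow> real \<Rightarrow> ((pt \<Rightarrow> complex) \<Rightarrow> complex) \<Rightarrow> pt set \<Rightarrow> pt set \<Rightarrow> atlas \<Rightarrow> data \<Rightarrow> bool" where
  "incident_field w n k S B \<Omega> A ui \<longleftrightarrow>
     (\<forall>x1\<in>bdry n \<Omega>.
        (\<forall>K. compact K \<and> K \<subseteq> Rsp n \<longrightarrow> integrable (leb n K) (\<lambda>x. ui x x1)) \<and>
        (\<forall>\<psi>\<in>test_fun n (Rsp n).
           (\<integral>x. ui x x1 * (laplace n \<psi> x + wave_sign w * of_real (k\<^sup>2) * \<psi> x) \<partial>leb n (Rsp n))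
             = - S (\<lambda>z. \<psi> (vadd n z x1)))) \<and>
     (\<forall>r<charts A. (\<lambda>(y, x1'). ui y (chart n A r x1'))
        \<in> borel_measurable (leb n B \<Otimes>\<^sub>M leb (n - 1) (Delta n A)))"

section \<open>Forward operators\<close>

text \<open>A function of \<open>(y\<^sub>1, \<dots>, y\<^sub>j)\<close> takes a tuple indexed from \<open>0\<close>.\<close>

definition forward_op :: "wave \<Rightarrow> nat \<Rightarrow> real \<Rightarrow> pt set \<Rightarrow> data \<Rightarrow> nat \<Rightarrow>
    ((nat \<Rightarrow> pt) \<Rightarrow> complex) \<Rightarrow> data" where
  "forward_op w n k B ui j f x x1 = of_real (k ^ (2 * j)) *
     (\<integral>y. green w n k x (y 0) * (\<Prod>l<j - 1. green w n k (y l) (y (Suc l))) * ui (y (j - 1)) x1 * f y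
        \<partial>(\<Pi>\<^sub>M l\<in>{..<j}. leb n B))"

definition tensor :: "param list \<Rightarrow> (nat \<Rightarrow> pt) \<Rightarrow> complex" where
  "tensor fs y = (\<Prod>l<length fs. (fs ! l) (y l))"

text \<open>The forward series; \<open>F j\<close> is the \<open>j\<close>-th forward operator.\<close>

definition scattered :: "(nat \<Rightarrow> ((nat \<Rightarrow> pt) \<Rightarrow> complex) \<Rightarrow> data) \<Rightarrow> param \<Rightarrow> data" where
  "scattered F \<eta> x x1 = (\<Sum>j. F (Suc j) (tensor (replicate (Suc j) \<eta>)) x x1)"

section \<open>Inverse operators\<close>

definition bounded_inverse ::
    "nat \<Rightarrow> atlas \<Rightarrow> int \<Rightarrow> pt set \<Rightarrow> nat \<Rightarrow> (data \<Rightarrow> param) \<Rightarrow> bool" where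
  "bounded_inverse n A \<bb> B s T \<longleftrightarrow>
     (\<forall>\<phi>\<in>data_space n A \<bb>. T \<phi> \<in> sobolev0 n B s) \<and>
     (\<forall>\<phi>\<in>data_space n A \<bb>. \<forall>\<psi>\<in>data_space n A \<bb>. \<forall>\<alpha> \<beta>.
        AE y in leb n B. T (\<lambda>x x1. \<alpha> * \<phi> x x1 + \<beta> * \<psi> x x1) y = \<alpha> * T \<phi> y + \<beta> * T \<psi> y) \<and>
     (\<exists>c<\<infinity>. \<forall>\<phi>\<in>data_space n A \<bb>. sobolev_norm n B s (T \<phi>) \<le> c * data_norm n A \<bb> \<phi>)"

definition inverse_norm ::
    "nat \<Rightarrow> atlas \<Rightarrow> int \<Rightarrow> pt set \<Rightarrow> nat \<Rightarrow> (data \<Rightarrow> param) \<Rightarrow> ennreal" where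
  "inverse_norm n A \<bb> B s T =
     Inf {c. \<forall>\<phi>\<in>data_space n A \<bb>. sobolev_norm n B s (T \<phi>) \<le> c * data_norm n A \<bb> \<phi>}"

definition compositions :: "nat \<Rightarrow> nat \<Rightarrow> nat list set" where
  "compositions j m = {ns. length ns = m \<and> sum_list ns = j \<and> (\<forall>i\<in>set ns. 1 \<le> i)}"

primrec blocks :: "nat list \<Rightarrow> 'a list \<Rightarrow> 'a list list" where
  "blocks [] xs = []"
| "blocks (i # ns) xs = take i xs # blocks ns (drop i xs)"

text \<open>
  \<open>inverse_op F T j [\<phi>\<^sub>1, \<dots>, \<phi>\<^sub>j]\<close> is the \<open>j\<close>-th inverse operator at \<open>\<phi>\<^sub>1 \<otimes> \<dots> \<otimes> \<phi>\<^sub>j\<close> for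
  \<open>T = \<K>\<^sub>1\<close>. On an elementary tensor of \<open>j = i\<^sub>1 + \<dots> + i\<^sub>m\<close> factors the operator
  \<open>K\<^bsub>i\<^sub>1\<^esub> \<otimes> \<dots> \<otimes> K\<^bsub>i\<^sub>m\<^esub>\<close> lets its factors act on consecutive blocks of lengths \<open>i\<^sub>1, \<dots>, i\<^sub>m\<close>.
\<close>

function inverse_op :: "(nat \<Rightarrow> ((nat \<Rightarrow> pt) \<Rightarrow> complex) \<Rightarrow> data) \<Rightarrow> (data \<Rightarrow> param) \<Rightarrow>
    nat \<Rightarrow> data list \<Rightarrow> param" where
  "inverse_op F T j \<phi>s =
     (if j \<le> 1 then T (hd \<phi>s)
      else (\<lambda>y. - (\<Sum>m\<in>{1..j - 1}. \<Sum>ns\<in>compositions j m.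
              inverse_op F T m (map (\<lambda>fs. F (length fs) (tensor fs)) (blocks ns (map T \<phi>s))) y)))"
  by auto
termination
  by (relation "Wellfounded.measure (\<lambda>(F, T, j, \<phi>s). j)") auto

declare inverse_op.simps [simp del]

section \<open>Constants\<close>

definition Pconst :: "nat \<Rightarrow> real \<Rightarrow> nat \<Rightarrow> real" where
  "Pconst s a n =
     (\<Sum>j\<le>s. real ((n + j - 1) choose (n - 1)) * inverse ((2 * a\<^sup>2) ^ j)) powr (- 1 / 2)"

text \<open>
  The suprema are taken in \<open>ennreal\<close>; a hypothesis \<open>x < 1 / (mu + nu)\<close> excludes the value
  \<open>\<infinity>\<close>, since \<open>1 / \<infinity> = 0\<close>.
\<close>

definition Ca :: "nat \<Rightarrow> pt set \<Rightarrow> atlas \<Rightarrow> data \<Rightarrow> ennreal" where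
  "Ca n B A ui = esqrt (emeasure (leb n B) B) * (SUP y\<in>B. bd_norm n A 0 (\<lambda>x1. ui y x1))"

definition mu :: "wave \<Rightarrow> nat \<Rightarrow> real \<Rightarrow> real \<Rightarrow> pt set \<Rightarrow> nat \<Rightarrow> ennreal" where
  "mu w n k a B s =
     ennreal (k\<^sup>2 * Pconst s a n) * (SUP y\<in>B. l2norm n B (\<lambda>x. green w n k y x))"

definition nu ::
    "wave \<Rightarrow> nat \<Rightarrow> real \<Rightarrow> real \<Rightarrow> pt set \<Rightarrow> atlas \<Rightarrow> data \<Rightarrow> nat \<Rightarrow> int \<Rightarrow> ennreal" where
  "nu w n k a B A ui s \<bb> =
     ennreal (k\<^sup>2 * Pconst s a n) * Ca n B A ui * (SUP y\<in>B. bd_norm n A \<bb> (\<lambda>x. green w n k y x))"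

end

theory Submission
  imports Defs "HOL-Library.Function_Algebras"
begin

text \<open>
  Write \<open>T\<close> for the regularized inverse, \<open>A_i = T K_i\<close>, \<open>\<kappa> = \<mu> + \<nu>\<close> and \<open>Q_j\<close> for the recursion of
  the inverse operators after \<open>T\<close> has been applied to every argument, so that the \<open>j\<close>-th inverse
  operator at \<open>\<phi>, \<dots>, \<phi>\<close> is \<open>Q_j (T \<phi>, \<dots>, T \<phi>)\<close>. The error
  estimate uses only that \<open>A_i\<close> is multilinear, that \<open>\<parallel>A_i\<parallel> \<le> \<parallel>T\<parallel> \<nu> \<mu>\<^bsup>i-1\<^esup>\<close>, and that the forward
  series converges.

  \<^bold>\<open>The algebra.\<close> The sum of \<open>\<nu> \<mu>\<^bsup>i-1\<^esup>\<close>-weights over all compositions of \<open>j\<close> is at most \<open>\<kappa>\<^bsup>j\<^esup>\<close>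
  (\<open>sum_wt\<close>), which turns the recursion for \<open>Q_j\<close> into \<open>\<parallel>Q_j\<parallel> \<le> C \<kappa>\<^bsup>j\<^esup>\<close> (\<open>Q_in_bound\<close>, \<open>R_le\<close>). Now insert
  \<open>T \<phi> = \<Sum>\<^sub>i A_i \<eta>\<^bsup>\<otimes>i\<^esup>\<close> into the inverse series and collect the terms that are homogeneous of order \<open>j\<close>
  in \<open>\<eta>\<close>. By the recursion they add up to \<open>Q_j (\<zeta>, \<dots>, \<zeta>) - Q_j (\<eta>, \<dots>, \<eta>)\<close> with
  \<open>\<zeta> = T K_1 \<eta>\<close>, and for \<open>j = 1\<close> to \<open>\<eta>\<close> plus this difference. Such a difference is of size \<open>C \<kappa>\<^bsup>j\<^esup> j M\<^bsup>j-1\<^esup> \<parallel>\<eta> - \<zeta>\<parallel>\<close> (\<open>Q_telescope\<close>), and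
  \<open>\<Sum> j x\<^bsup>j-1\<^esup> = 1 / (1 - x)\<^sup>2\<close> gives the first term of the bound. The second term is the geometric tail
  of the inverse series beyond order \<open>N\<close> (\<open>inverse_series_error\<close>).

  \<^bold>\<open>The bound for the forward operators.\<close> Peeling off one scatterer after the other shows that
  \<open>K_j\<close> at \<open>f_1 \<otimes> \<dots> \<otimes> f_j\<close> is the potential \<open>\<integral> G(x,y) \<rho>(y) dy\<close> of a density with
  \<open>\<integral> |\<rho>| \<le> k\<^bsup>2j\<^esup> \<Prod> \<parallel>f_l\<parallel> g\<^bsup>j-1\<^esup> \<parallel>u_i\<parallel>\<close>, all norms in \<open>L\<^sup>2(B)\<close> and \<open>g\<close> the supremum of
  \<open>\<parallel>G(y,\<cdot>)\<parallel>\<close> (\<open>chain_integral\<close>, \<open>ndens_L1\<close>). The norm of a potential on the boundary is at most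
  \<open>W \<integral> |\<rho>|\<close> with \<open>W\<close> the supremum of the boundary norms of \<open>G(y,\<cdot>)\<close> (\<open>bd_norm_pot\<close>); this is an
  integral form of the triangle inequality, and is obtained by duality because the Sobolev norms are
  defined through weak derivatives and test functions. Finally \<open>L\<^sup>2\<close> norms on the ball are
  compared with Sobolev norms by a Poincare inequality whose constant is \<open>P\<close> (\<open>poincare\<close>).

  \<^bold>\<open>Degenerate sources.\<close> If \<open>W \<noteq> 0\<close>, finiteness of \<open>\<nu>\<close> bounds the incident fields, so that for
  almost every source all the integrals converge. If \<open>W = 0\<close> there is no such bound and integrals may
  diverge; but \<open>G\<close> has no zeros between the ball and the boundary, so that convergence does not
  depend on the receiver, and every field that occurs is still the potential of some integrable
  density. All data then have norm \<open>0\<close> (\<open>forward_is_pot\<close>, \<open>scattered_is_pot\<close>).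
\<close>

section \<open>Compositions and blocks\<close>

lemma length_blocks [simp]: "length (blocks ns xs) = length ns"
  by (induction ns arbitrary: xs) auto

lemma blocks_nonempty:
  "sum_list ns = length xs \<Longrightarrow> \<forall>i\<in>set ns. 1 \<le> i \<Longrightarrow> b \<in> set (blocks ns xs) \<Longrightarrow> b \<noteq> []"
proof (induction ns arbitrary: xs)
  case (Cons i ns)
  have "sum_list ns = length (drop i xs)" using Cons.prems by auto
  then show ?case using Cons.IH[of "drop i xs"] Cons.prems by auto
qed simp

lemma blocks_subset: "b \<in> set (blocks ns xs) \<Longrightarrow> set b \<subseteq> set xs"
proof (induction ns arbitrary: xs)
  case (Cons i ns)
  then show ?case
    by (metis blocks.simps(2) dual_order.trans set_ConsD set_drop_subset set_take_subset)
qed simp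

text \<open>
  The arguments of a multilinear map are varied one at a time; a single slot lies in a single block, and
  the remaining blocks do not see it.
\<close>

lemma blocks_split:
  assumes "sum_list ns = Suc (length us + length vs)"
  shows "\<exists>bs u v cs. (\<forall>z. blocks ns (us @ z # vs) = bs @ (u @ z # v) # cs)"
  using assms
proof (induction ns arbitrary: us)
  case (Cons i ns)
  show ?case
  proof (cases "i \<le> length us")
    case True
    then have "sum_list ns = Suc (length (drop i us) + length vs)"
      using Cons.prems by auto
    from Cons.IH[OF this] obtain bs u v cs
      where *: "\<And>z. blocks ns (drop i us @ z # vs) = bs @ (u @ z # v) # cs" by blast
    have "blocks (i # ns) (us @ z # vs) = (take i us # bs) @ (u @ z # v) # cs" for z
      using True * by simp
    then show ?thesis by blast
  next
    case False
    then obtain k where k: "i - length us = Suc k" by (metis diff_is_0_eq not0_implies_Suc)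
    have "blocks (i # ns) (us @ z # vs) = [] @ (us @ z # take k vs) # blocks ns (drop k vs)" for z
      using False k by simp
    then show ?thesis by blast
  qed
qed simp

lemma map_blocks_replicate:
  assumes "sum_list ns = j"
  shows "map f (blocks ns (replicate j x)) = map (\<lambda>i. f (replicate i x)) ns"
  using assms
proof (induction ns arbitrary: j)
  case (Cons i ns)
  then show ?case by (auto simp: min_def)
qed simp

lemma finite_comps: "finite {ns. sum_list ns = j \<and> (\<forall>i\<in>set ns. (1::nat) \<le> i)}"
proof (rule finite_subset)
  have "length ns \<le> sum_list ns" if "\<forall>i\<in>set ns. 1 \<le> i" for ns :: "nat list"
    using that by (induction ns) auto
  then show "{ns. sum_list ns = j \<and> (\<forall>i\<in>set ns. 1 \<le> i)} \<subseteq> {ns. set ns \<subseteq> {..j} \<and> length ns \<le> j}"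
    by (auto dest: member_le_sum_list)
  show "finite {ns. set ns \<subseteq> {..j} \<and> length ns \<le> j}"
    by (rule finite_lists_length_le) simp
qed

lemma finite_compositions [simp]: "finite (compositions j m)"
  by (rule finite_subset[OF _ finite_comps[of j]]) (auto simp: compositions_def)

lemma compositions_le: "ns \<in> compositions j m \<Longrightarrow> m \<le> j"
proof -
  have "length ns \<le> sum_list ns" if "\<forall>i\<in>set ns. 1 \<le> i" for ns :: "nat list"
    using that by (induction ns) auto
  then show "ns \<in> compositions j m \<Longrightarrow> m \<le> j" by (auto simp: compositions_def)
qed

text \<open>
  Only the composition into ones has \<open>j\<close> parts. This term of the resummed series
  reproduces \<open>Q_j\<close> itself at the arguments \<open>A [f]\<close>.
\<close>

lemma compositions_full: "compositions j j = {replicate j 1}"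
proof -
  have "ns = replicate (length ns) 1" if "\<forall>i\<in>set ns. 1 \<le> i" "sum_list ns = length ns" for ns :: "nat list"
    using that
  proof (induction ns)
    case (Cons i ns)
    have "length ns \<le> sum_list ns" using Cons.prems(1) by (induction ns) auto
    with Cons show ?case by auto
  qed simp
  then show ?thesis by (force simp: compositions_def sum_list_replicate)
qed

text \<open>
  The weight of a composition is the product of the bounds of the forward operators acting on its blocks.
\<close>

definition wt :: "real \<Rightarrow> real \<Rightarrow> nat list \<Rightarrow> real" where
  "wt \<mu> \<nu> ns = prod_list (map (\<lambda>i. \<nu> * \<mu> ^ (i - 1)) ns)"

lemma wt_nonneg: "0 \<le> \<mu> \<Longrightarrow> 0 \<le> \<nu> \<Longrightarrow> 0 \<le> wt \<mu> \<nu> ns"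
  unfolding wt_def by (induction ns) auto

text \<open>
  Either the first part of the composition is \<open>1\<close> and is split off, with weight \<open>\<nu>\<close>, or it can be
  lowered by one, with weight \<open>\<mu>\<close>. This is where \<open>\<mu> + \<nu>\<close> comes from.
\<close>

lemma sum_wt:
  "(\<Sum>ns | sum_list ns = Suc j \<and> (\<forall>i\<in>set ns. 1 \<le> i). wt \<mu> \<nu> ns) = \<nu> * (\<mu> + \<nu>) ^ j"
proof (induction j)
  case 0
  have "{ns. sum_list ns = Suc 0 \<and> (\<forall>i\<in>set ns. 1 \<le> i)} = {[1]}"
  proof (intro equalityI subsetI)
    fix ns assume a: "ns \<in> {ns. sum_list ns = Suc 0 \<and> (\<forall>i\<in>set ns. 1 \<le> i)}"
    then obtain i ms where "ns = i # ms" by (cases ns) auto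
    with a show "ns \<in> {[1]}" by (cases ms) auto
  qed auto
  then show ?case by (simp add: wt_def)
next
  case (Suc j)
  define D where "D = (\<lambda>j. {ns. sum_list ns = j \<and> (\<forall>i\<in>set ns. (1::nat) \<le> i)})"
  define e where "e = (\<lambda>ns. Suc (hd ns) # tl ns)"
  have ne: "ns \<noteq> []" if "ns \<in> D (Suc j)" for ns using that by (auto simp: D_def)
  have U: "D (Suc (Suc j)) = (#) 1 ` D (Suc j) \<union> e ` D (Suc j)"
  proof (intro equalityI subsetI)
    fix ns assume a: "ns \<in> D (Suc (Suc j))"
    then obtain i ms where ns: "ns = i # ms" by (cases ns) (auto simp: D_def)
    show "ns \<in> (#) 1 ` D (Suc j) \<union> e ` D (Suc j)"
    proof (cases "i = 1")
      case True then show ?thesis using a ns by (auto simp: D_def)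
    next
      case False
      then have "ns = e ((i - 1) # ms)" "(i - 1) # ms \<in> D (Suc j)" using a ns by (auto simp: D_def e_def)
      then show ?thesis by blast
    qed
  next
    fix ns assume "ns \<in> (#) 1 ` D (Suc j) \<union> e ` D (Suc j)"
    then show "ns \<in> D (Suc (Suc j))"
    proof
      assume "ns \<in> e ` D (Suc j)"
      then obtain ms where "ms \<in> D (Suc j)" "ns = e ms" by blast
      then show ?thesis using ne by (cases ms) (auto simp: D_def e_def)
    qed (auto simp: D_def)
  qed
  have dis: "(#) 1 ` D (Suc j) \<inter> e ` D (Suc j) = {}"
  proof -
    have "hd (e ns) \<noteq> 1" if "ns \<in> D (Suc j)" for ns
      using that ne[OF that] by (cases ns) (auto simp: e_def D_def)
    show ?thesis
    proof (rule ccontr)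
      assume "(#) 1 ` D (Suc j) \<inter> e ` D (Suc j) \<noteq> {}"
      then obtain ms ns where "1 # ms = e ns" "ns \<in> D (Suc j)" by blast
      then show False using \<open>\<And>ns. ns \<in> D (Suc j) \<Longrightarrow> hd (e ns) \<noteq> 1\<close> by (metis list.sel(1))
    qed
  qed
  have fin: "finite (D k)" for k unfolding D_def by (rule finite_comps)
  have inj: "inj_on e (D (Suc j))"
    using ne by (auto simp: inj_on_def e_def intro: list.expand)
  have e: "wt \<mu> \<nu> (e ns) = \<mu> * wt \<mu> \<nu> ns" if "ns \<in> D (Suc j)" for ns
  proof -
    have "ns \<noteq> []" using ne[OF that] .
    then obtain i ms where "ns = i # ms" by (meson neq_Nil_conv)
    moreover have "1 \<le> i" using that calculation by (auto simp: D_def)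
    ultimately show ?thesis by (cases i) (auto simp: e_def wt_def)
  qed
  have "sum (wt \<mu> \<nu>) (D (Suc (Suc j))) = (\<Sum>ns\<in>D (Suc j). wt \<mu> \<nu> (1 # ns)) + (\<Sum>ns\<in>D (Suc j). wt \<mu> \<nu> (e ns))"
    unfolding U using fin dis inj
    by (subst sum.union_disjoint) (auto simp: sum.reindex)
  also have "\<dots> = \<nu> * sum (wt \<mu> \<nu>) (D (Suc j)) + \<mu> * sum (wt \<mu> \<nu>) (D (Suc j))"
    using e by (simp add: sum_distrib_left wt_def)
  finally show ?case using Suc unfolding D_def by (simp add: algebra_simps)
qed

section \<open>The inversion of a power series of multilinear operators\<close>

text \<open>
  The inverse operators in terms of their images under \<open>T\<close>: for \<open>A fs = T (K fs)\<close> the inverse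
  operator at \<open>\<phi>\<^sub>1 \<otimes> \<dots> \<otimes> \<phi>\<^sub>j\<close> is \<open>inv_tensor A j [T \<phi>\<^sub>1, \<dots>, T \<phi>\<^sub>j]\<close>.
\<close>

function inv_tensor :: "('v::ab_group_add list \<Rightarrow> 'v) \<Rightarrow> nat \<Rightarrow> 'v list \<Rightarrow> 'v" where
  "inv_tensor A j fs = (if j \<le> 1 then hd fs
     else - (\<Sum>m\<in>{1..j - 1}. \<Sum>ns\<in>compositions j m. inv_tensor A m (map A (blocks ns fs))))"
  by auto
termination
  by (relation "Wellfounded.measure (\<lambda>(A, j, fs). j)") auto

declare inv_tensor.simps [simp del]

text \<open>
  Elements of Sobolev spaces are functions that are not identified almost everywhere, so that \<open>p\<close> is only
  a seminorm, and linearity of operators has to be expressed by differences of seminorm zero.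
\<close>

locale seminormed_group =
  fixes X :: "'v::ab_group_add set" and p :: "'v \<Rightarrow> real"
  assumes zero_in: "0 \<in> X" and diff_in: "f \<in> X \<Longrightarrow> g \<in> X \<Longrightarrow> f - g \<in> X"
    and p_zero: "p 0 = 0" and p_nonneg: "0 \<le> p f"
    and p_diff: "f \<in> X \<Longrightarrow> g \<in> X \<Longrightarrow> p (f - g) \<le> p f + p g"
begin

lemma uminus_in: "f \<in> X \<Longrightarrow> - f \<in> X" using diff_in[OF zero_in] by simp
lemma add_in: "f \<in> X \<Longrightarrow> g \<in> X \<Longrightarrow> f + g \<in> X" using diff_in[OF _ uminus_in] by force
lemma sum_in: "(\<And>i. i \<in> I \<Longrightarrow> a i \<in> X) \<Longrightarrow> sum a I \<in> X"
  by (induction I rule: infinite_finite_induct) (auto simp: zero_in add_in)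

lemma p_uminus: "f \<in> X \<Longrightarrow> p (- f) = p f"
  using p_diff[OF zero_in, of f] p_diff[OF zero_in uminus_in, of f] by (simp add: p_zero)
lemma p_add: "f \<in> X \<Longrightarrow> g \<in> X \<Longrightarrow> p (f + g) \<le> p f + p g"
  using p_diff[OF _ uminus_in, of f g] by (simp add: p_uminus)
lemma p_commute: "f \<in> X \<Longrightarrow> g \<in> X \<Longrightarrow> p (f - g) = p (g - f)"
  using p_uminus[OF diff_in, of g f] by simp
lemma p_sum: "(\<And>i. i \<in> I \<Longrightarrow> a i \<in> X) \<Longrightarrow> p (sum a I) \<le> (\<Sum>i\<in>I. p (a i))"
proof (induction I rule: infinite_finite_induct)
  case (insert i I)
  have "p (a i + sum a I) \<le> p (a i) + p (sum a I)" by (rule p_add) (use insert in \<open>auto intro: sum_in\<close>)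
  with insert show ?case by auto
qed (auto simp: p_zero)

lemma p_triangle: "f \<in> X \<Longrightarrow> g \<in> X \<Longrightarrow> h \<in> X \<Longrightarrow> p (f - h) \<le> p (f - g) + p (g - h)"
  using p_add[of "f - g" "g - h"] by (simp add: diff_in)

lemma p_eq0_trans: "f \<in> X \<Longrightarrow> g \<in> X \<Longrightarrow> h \<in> X \<Longrightarrow> p (f - g) = 0 \<Longrightarrow> p (g - h) = 0 \<Longrightarrow> p (f - h) = 0"
  using p_triangle[of f g h] p_nonneg[of "f - h"] by simp

lemma p_eq0_sum:
  assumes "\<And>i. i \<in> I \<Longrightarrow> a i \<in> X" "\<And>i. i \<in> I \<Longrightarrow> b i \<in> X" "\<And>i. i \<in> I \<Longrightarrow> p (a i - b i) = 0"
  shows "p (sum a I - sum b I) = 0"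
proof -
  have "p (\<Sum>i\<in>I. a i - b i) \<le> (\<Sum>i\<in>I. p (a i - b i))" by (rule p_sum) (auto intro: diff_in assms)
  then show ?thesis using assms p_nonneg[of "sum a I - sum b I"] by (simp add: sum_subtractf)
qed

lemma p_eq0_cong: "f \<in> X \<Longrightarrow> g \<in> X \<Longrightarrow> p (f - g) = 0 \<Longrightarrow> p f = p g"
  using p_add[of "f - g" g] p_add[of "g - f" f] p_commute[of f g] by (simp add: diff_in)

end

locale forward_series = seminormed_group X p
  for X :: "'v::ab_group_add set" and p :: "'v \<Rightarrow> real" +
  fixes A :: "'v list \<Rightarrow> 'v" and \<tau> \<mu> \<nu> :: real
  assumes A_in: "fs \<noteq> [] \<Longrightarrow> set fs \<subseteq> X \<Longrightarrow> A fs \<in> X"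
    and A_bound: "fs \<noteq> [] \<Longrightarrow> set fs \<subseteq> X \<Longrightarrow>
      p (A fs) \<le> \<tau> * \<nu> * \<mu> ^ (length fs - 1) * prod_list (map p fs)"
    and A_diff: "set us \<subseteq> X \<Longrightarrow> set vs \<subseteq> X \<Longrightarrow> f \<in> X \<Longrightarrow> g \<in> X \<Longrightarrow>
      p (A (us @ (f - g) # vs) - (A (us @ f # vs) - A (us @ g # vs))) = 0"
    and \<tau>: "0 \<le> \<tau>" and \<mu>: "0 \<le> \<mu>" and \<nu>: "0 \<le> \<nu>" and small: "(\<mu> + \<nu>) * \<tau> < 1"
begin

abbreviation "\<kappa> \<equiv> \<mu> + \<nu>"
abbreviation "Q \<equiv> inv_tensor A"

definition R :: "nat \<Rightarrow> real" where
  "R j = (if j \<le> 1 then 1 else \<kappa> ^ j * (\<tau> * (\<Prod>m\<in>{2..j - 1}. 1 + (\<kappa> * \<tau>) ^ m)))"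

definition C :: real where "C = \<tau> * exp (1 / (1 - \<kappa> * \<tau>))"

lemma R_nonneg: "0 \<le> R j"
  using \<tau> \<mu> \<nu> by (auto simp: R_def intro!: mult_nonneg_nonneg prod_nonneg add_nonneg_nonneg)

text \<open>
  The recursion for \<open>Q\<close> bounds \<open>R j\<close> by a sum over all smaller orders; the definition of \<open>R\<close> is the
  closed form for which these sums telescope.
\<close>

lemma sum_R: "1 \<le> j \<Longrightarrow> (\<Sum>m=1..j. R m * \<tau> ^ m) = \<tau> * (\<Prod>m\<in>{2..j}. 1 + (\<kappa> * \<tau>) ^ m)"
proof (induction j rule: nat_induct_at_least)
  case base
  then show ?case by (simp add: R_def)
next
  case (Suc j)
  have "{2..Suc j} = insert (Suc j) {2..j}" using Suc by auto
  then have "(\<Prod>m\<in>{2..Suc j}. 1 + (\<kappa> * \<tau>) ^ m) = (1 + (\<kappa> * \<tau>) ^ Suc j) * (\<Prod>m\<in>{2..j}. 1 + (\<kappa> * \<tau>) ^ m)"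
    by simp
  moreover have "R (Suc j) * \<tau> ^ Suc j = (\<kappa> * \<tau>) ^ Suc j * (\<tau> * (\<Prod>m\<in>{2..j}. 1 + (\<kappa> * \<tau>) ^ m))"
    using Suc by (simp add: R_def power_mult_distrib)
  ultimately show ?case using Suc by (simp add: algebra_simps)
qed

text \<open>
  \<open>1 + x \<le> exp x\<close> turns the product into the exponential of a geometric series.
\<close>

lemma prod_le_C: "\<tau> * (\<Prod>m\<in>{2..j}. 1 + (\<kappa> * \<tau>) ^ m) \<le> C"
proof -
  have nn: "0 \<le> \<kappa> * \<tau>" using \<tau> \<mu> \<nu> by simp
  have "(\<Prod>m\<in>{2..j}. 1 + (\<kappa> * \<tau>) ^ m) \<le> (\<Prod>m\<in>{2..j}. exp ((\<kappa> * \<tau>) ^ m))"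
    using nn by (intro prod_mono) (auto simp: exp_ge_add_one_self intro!: add_nonneg_nonneg)
  also have "\<dots> = exp (\<Sum>m\<in>{2..j}. (\<kappa> * \<tau>) ^ m)" by (simp add: exp_sum)
  also have "\<dots> \<le> exp (1 / (1 - \<kappa> * \<tau>))"
  proof -
    have "(\<Sum>m\<in>{2..j}. (\<kappa> * \<tau>) ^ m) \<le> (\<Sum>m. (\<kappa> * \<tau>) ^ m)"
      using nn small by (intro sum_le_suminf) (auto intro!: summable_geometric)
    also have "\<dots> = 1 / (1 - \<kappa> * \<tau>)" using nn small by (simp add: suminf_geometric)
    finally show ?thesis by simp
  qed
  finally show ?thesis unfolding C_def using \<tau> by (rule mult_left_mono)
qed

lemma C_nonneg: "0 \<le> C" unfolding C_def using \<tau> by simp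

lemma R_le: "2 \<le> j \<Longrightarrow> R j \<le> C * \<kappa> ^ j"
  using mult_right_mono[OF prod_le_C[of "j - 1"], of "\<kappa> ^ j"] \<mu> \<nu> by (simp add: R_def mult_ac)

lemma R_\<tau>_le:
  assumes "1 \<le> m" shows "R m * \<tau> ^ m \<le> C"
proof -
  have "R m * \<tau> ^ m \<le> (\<Sum>m=1..m. R m * \<tau> ^ m)"
    using assms R_nonneg \<tau> by (intro member_le_sum) auto
  then show ?thesis using sum_R[OF assms] prod_le_C[of m] by simp
qed

lemma Q_simps:
  "Q (Suc 0) fs = hd fs"
  "2 \<le> j \<Longrightarrow> Q j fs = - (\<Sum>m=1..j - 1. \<Sum>ns\<in>compositions j m. Q m (map A (blocks ns fs)))"
  by (auto simp: inv_tensor.simps[of A])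

lemma sum_wt_le:
  assumes "1 \<le> m" "m \<le> j" shows "(\<Sum>ns\<in>compositions j m. wt \<mu> \<nu> ns) \<le> \<kappa> ^ j"
proof -
  obtain i where i: "j = Suc i" using assms by (cases j) auto
  have "(\<Sum>ns\<in>compositions j m. wt \<mu> \<nu> ns) \<le> (\<Sum>ns | sum_list ns = j \<and> (\<forall>i\<in>set ns. 1 \<le> i). wt \<mu> \<nu> ns)"
    by (rule sum_mono2[OF finite_comps]) (auto simp: compositions_def wt_nonneg \<mu> \<nu>)
  also have "\<dots> = \<nu> * \<kappa> ^ i" unfolding i by (rule sum_wt)
  also have "\<dots> \<le> \<kappa> ^ j" using \<mu> \<nu> by (auto simp: i intro!: mult_right_mono)
  finally show ?thesis .
qed

lemma blocks_A_in:
  assumes "ns \<in> compositions j m" "length fs = j" "set fs \<subseteq> X" "b \<in> set (blocks ns fs)"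
  shows "b \<noteq> [] \<and> set b \<subseteq> X \<and> A b \<in> X"
  using assms blocks_nonempty[of ns fs b] blocks_subset[of b ns fs]
  by (auto simp: compositions_def intro!: A_in)

lemma prod_A_blocks:
  assumes "sum_list ns = length fs" "\<forall>i\<in>set ns. 1 \<le> i" "set fs \<subseteq> X"
  shows "prod_list (map p (map A (blocks ns fs))) \<le> \<tau> ^ length ns * wt \<mu> \<nu> ns * prod_list (map p fs)"
  using assms
proof (induction ns arbitrary: fs)
  case Nil
  then show ?case by (simp add: wt_def)
next
  case (Cons i ns)
  have sub: "set (take i fs) \<subseteq> X" "set (drop i fs) \<subseteq> X"
    using Cons.prems(3) by (meson order_trans set_take_subset set_drop_subset)+
  have ne: "take i fs \<noteq> []" "length (take i fs) = i" using Cons.prems by auto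
  have "p (A (take i fs)) \<le> \<tau> * \<nu> * \<mu> ^ (i - 1) * prod_list (map p (take i fs))"
    using A_bound[OF ne(1) sub(1)] ne(2) by simp
  moreover have "prod_list (map p (map A (blocks ns (drop i fs)))) \<le>
      \<tau> ^ length ns * wt \<mu> \<nu> ns * prod_list (map p (drop i fs))"
    by (rule Cons.IH) (use Cons.prems sub in auto)
  moreover have "0 \<le> prod_list (map p gs)" for gs by (induction gs) (auto simp: p_nonneg)
  ultimately have "p (A (take i fs)) * prod_list (map p (map A (blocks ns (drop i fs)))) \<le>
     (\<tau> * \<nu> * \<mu> ^ (i - 1) * prod_list (map p (take i fs))) *
     (\<tau> ^ length ns * wt \<mu> \<nu> ns * prod_list (map p (drop i fs)))"
    using \<tau> \<mu> \<nu> by (intro mult_mono mult_nonneg_nonneg) (auto simp: p_nonneg wt_nonneg simp del: map_map)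
  also have "\<dots> = \<tau> ^ length (i # ns) * wt \<mu> \<nu> (i # ns) * (prod_list (map p (take i fs)) * prod_list (map p (drop i fs)))"
    by (simp add: wt_def algebra_simps)
  also have "prod_list (map p (take i fs)) * prod_list (map p (drop i fs)) = prod_list (map p fs)"
    by (metis append_take_drop_id map_append prod_list.append)
  finally show ?case by simp
qed

lemma prod_p_nonneg: "0 \<le> prod_list (map p fs)"
  by (induction fs) (auto simp: p_nonneg)

text \<open>
  Every block of a composition contributes \<open>\<tau>\<close> times its weight, so that the compositions with \<open>m\<close> parts
  contribute at most \<open>R m \<tau>\<^bsup>m\<^esup> \<kappa>\<^bsup>j\<^esup>\<close>, and the sum over \<open>m\<close> is evaluated by \<open>sum_R\<close>.
\<close>

lemma Q_in_bound:
  assumes "1 \<le> j" "length fs = j" "set fs \<subseteq> X"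
  shows "Q j fs \<in> X \<and> p (Q j fs) \<le> R j * prod_list (map p fs)"
  using assms
proof (induction j arbitrary: fs rule: less_induct)
  case (less j)
  show ?case
  proof (cases "j = 1")
    case True
    then obtain f where "fs = [f]" using less by (metis One_nat_def length_0_conv length_Suc_conv)
    then show ?thesis using True less by (simp add: Q_simps R_def)
  next
    case False
    then have j: "2 \<le> j" using less by simp
    have IH: "Q m (map A (blocks ns fs)) \<in> X \<and>
        p (Q m (map A (blocks ns fs))) \<le> R m * (\<tau> ^ m * wt \<mu> \<nu> ns * prod_list (map p fs))"
      if "m \<in> {1..j - 1}" "ns \<in> compositions j m" for m ns
    proof -
      have "Q m (map A (blocks ns fs)) \<in> X \<and>
          p (Q m (map A (blocks ns fs))) \<le> R m * prod_list (map p (map A (blocks ns fs)))"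
        using that less.prems blocks_A_in[OF that(2) less.prems(2,3)]
        by (intro less.IH) (auto simp: compositions_def)
      moreover have "prod_list (map p (map A (blocks ns fs))) \<le> \<tau> ^ m * wt \<mu> \<nu> ns * prod_list (map p fs)"
        using prod_A_blocks[of ns fs] that less.prems by (auto simp: compositions_def)
      ultimately show ?thesis using R_nonneg[of m] by (meson mult_left_mono order_trans)
    qed
    define s where "s = (\<Sum>m=1..j - 1. \<Sum>ns\<in>compositions j m. Q m (map A (blocks ns fs)))"
    have s: "s \<in> X" unfolding s_def using IH by (intro sum_in) blast
    have "p s \<le> (\<Sum>m=1..j - 1. p (\<Sum>ns\<in>compositions j m. Q m (map A (blocks ns fs))))"
      unfolding s_def using IH by (intro p_sum sum_in) blast
    also have "\<dots> \<le> (\<Sum>m=1..j - 1. \<Sum>ns\<in>compositions j m. p (Q m (map A (blocks ns fs))))"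
      using IH by (intro sum_mono p_sum) blast
    also have "\<dots> \<le> (\<Sum>m=1..j - 1. \<Sum>ns\<in>compositions j m. R m * (\<tau> ^ m * wt \<mu> \<nu> ns * prod_list (map p fs)))"
      using IH by (intro sum_mono) blast
    also have "\<dots> = (\<Sum>m=1..j - 1. R m * \<tau> ^ m * prod_list (map p fs) * (\<Sum>ns\<in>compositions j m. wt \<mu> \<nu> ns))"
      by (simp add: sum_distrib_left mult_ac)
    also have "\<dots> \<le> (\<Sum>m=1..j - 1. R m * \<tau> ^ m * prod_list (map p fs) * \<kappa> ^ j)"
      using R_nonneg \<tau> prod_p_nonneg[of fs] by (intro sum_mono mult_left_mono sum_wt_le) auto
    also have "\<dots> = (\<Sum>m=1..j - 1. R m * \<tau> ^ m) * prod_list (map p fs) * \<kappa> ^ j"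
      by (simp add: sum_distrib_right)
    also have "\<dots> = R j * prod_list (map p fs)"
      using j by (subst sum_R) (auto simp: R_def)
    finally show ?thesis using j s by (simp add: Q_simps s_def uminus_in p_uminus)
  qed
qed

lemmas Q_in = Q_in_bound[THEN conjunct1] and Q_bound = Q_in_bound[THEN conjunct2]

lemma Q_diff:
  assumes "set us \<subseteq> X" "set vs \<subseteq> X" "f \<in> X" "g \<in> X" "length us + length vs + 1 = j"
  shows "p (Q j (us @ (f - g) # vs) - (Q j (us @ f # vs) - Q j (us @ g # vs))) = 0"
  using assms
proof (induction j arbitrary: us vs f g rule: less_induct)
  case (less j)
  show ?case
  proof (cases "j = 1")
    case True
    then show ?thesis using less by (simp add: Q_simps p_zero)
  next
    case False
    then have j: "2 \<le> j" using less by simp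
    define q where "q m ns z = Q m (map A (blocks ns (us @ z # vs)))" for m ns z
    have q_in: "q m ns z \<in> X" if "m \<in> {1..j - 1}" "ns \<in> compositions j m" "z \<in> X" for m ns z
      unfolding q_def
    proof (rule Q_in)
      show "set (map A (blocks ns (us @ z # vs))) \<subseteq> X"
        using blocks_A_in[OF that(2), of "us @ z # vs"] less.prems that(3) by auto
    qed (use that in \<open>auto simp: compositions_def\<close>)
    have "p (q m ns (f - g) - (q m ns f - q m ns g)) = 0"
      if m: "m \<in> {1..j - 1}" and ns: "ns \<in> compositions j m" for m ns
    proof -
      from ns less.prems have "sum_list ns = Suc (length us + length vs)" by (simp add: compositions_def)
      from blocks_split[OF this] obtain bs u v cs
        where bl: "\<And>z. blocks ns (us @ z # vs) = bs @ (u @ z # v) # cs" by blast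
      have in_X: "b \<noteq> [] \<and> set b \<subseteq> X \<and> A b \<in> X" if "b \<in> set (bs @ (u @ z # v) # cs)" "z \<in> X" for b z
        using blocks_A_in[OF ns, of "us @ z # vs" b] less.prems that by (auto simp: bl)
      have uv: "set u \<subseteq> X" "set v \<subseteq> X" using in_X[of "u @ f # v" f] less.prems by auto
      have bc: "set (map A bs) \<subseteq> X" "set (map A cs) \<subseteq> X" using in_X[of _ f] less.prems by auto
      have len: "length (map A bs) + length (map A cs) + 1 = m"
        using arg_cong[OF bl[of f], of length] ns by (simp add: compositions_def)
      define a where "a z = A (u @ z # v)" for z
      have a: "a z \<in> X" if "z \<in> X" for z using in_X[of "u @ z # v" z] that by (simp add: a_def)
      define Qa where "Qa z = Q m (map A bs @ z # map A cs)" for z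
      have Qa: "Qa z \<in> X" if "z \<in> X" for z
        unfolding Qa_def using that bc len m by (intro Q_in) auto
      have D: "p (Qa (y - z) - (Qa y - Qa z)) = 0" if "y \<in> X" "z \<in> X" for y z
        unfolding Qa_def using that bc len m by (intro less.IH) auto
      have Z: "p (Qa z) = 0" if "z \<in> X" "p z = 0" for z
        unfolding Qa_def using Q_bound[of m "map A bs @ z # map A cs"] that bc len m
          p_nonneg[of "Q m (map A bs @ z # map A cs)"] by auto
      have fg: "f - g \<in> X" "f \<in> X" "g \<in> X" using less.prems by (auto intro: diff_in)
      have "p (a (f - g) - (a f - a g)) = 0"
        unfolding a_def using less.prems uv by (intro A_diff) auto
      then have 0: "p (Qa (a (f - g) - (a f - a g))) = 0" by (intro Z diff_in a fg)
      have "p (Qa (a (f - g) - (a f - a g)) - (Qa (a (f - g)) - Qa (a f - a g))) = 0"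
        by (intro D diff_in a fg)
      with 0 have "p (Qa (a (f - g)) - Qa (a f - a g)) = 0"
        using p_eq0_cong[of "Qa (a (f - g) - (a f - a g))" "Qa (a (f - g)) - Qa (a f - a g)"]
        by (simp add: Qa a fg diff_in)
      moreover have "p (Qa (a f - a g) - (Qa (a f) - Qa (a g))) = 0"
        by (intro D a fg)
      ultimately have "p (Qa (a (f - g)) - (Qa (a f) - Qa (a g))) = 0"
        by (rule p_eq0_trans[rotated 3]) (intro diff_in Qa a fg)+
      then show ?thesis by (simp add: q_def Qa_def a_def bl)
    qed
    then have "p ((\<Sum>m=1..j - 1. \<Sum>ns\<in>compositions j m. q m ns (f - g)) -
        (\<Sum>m=1..j - 1. \<Sum>ns\<in>compositions j m. q m ns f - q m ns g)) = 0"
      using q_in diff_in[OF less.prems(3,4)] less.prems by (intro p_eq0_sum sum_in diff_in) auto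
    moreover have "(\<Sum>m=1..j - 1. \<Sum>ns\<in>compositions j m. q m ns (f - g)) \<in> X"
      "(\<Sum>m=1..j - 1. \<Sum>ns\<in>compositions j m. q m ns f - q m ns g) \<in> X"
      using q_in diff_in[OF less.prems(3,4)] less.prems by (auto intro!: sum_in diff_in[of "q _ _ _"])
    ultimately have "p (- (\<Sum>m=1..j - 1. \<Sum>ns\<in>compositions j m. q m ns (f - g)) -
        - (\<Sum>m=1..j - 1. \<Sum>ns\<in>compositions j m. q m ns f - q m ns g)) = 0"
      using p_commute by (simp add: algebra_simps)
    then show ?thesis using j by (simp add: Q_simps q_def sum_subtractf)
  qed
qed

lemma Q_in_append:
  assumes "set us \<subseteq> X" "set vs \<subseteq> X" "f \<in> X" "length us + length vs + 1 = m"
  shows "Q m (us @ f # vs) \<in> X"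
  by (rule Q_in) (use assms in auto)

lemma Q_sum:
  assumes "finite I" "\<And>i. i \<in> I \<Longrightarrow> a i \<in> X" "set us \<subseteq> X" "set vs \<subseteq> X" "length us + length vs + 1 = m"
  shows "p (Q m (us @ sum a I # vs) - (\<Sum>i\<in>I. Q m (us @ a i # vs))) = 0"
  using assms(1,2)
proof (induction I rule: finite_induct)
  case empty
  show ?case using Q_bound[of m "us @ 0 # vs"] p_nonneg[of "Q m (us @ 0 # vs)"] assms zero_in
    by (auto simp: p_zero)
next
  case (insert i I)
  let ?q = "\<lambda>z. Q m (us @ z # vs)"
  have q: "?q z \<in> X" if "z \<in> X" for z using Q_in_append[OF assms(3,4) that assms(5)] .
  have X: "a i \<in> X" "sum a I \<in> X" using insert.prems by (auto intro: sum_in)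
  have "p (?q ((a i + sum a I) - sum a I) - (?q (a i + sum a I) - ?q (sum a I))) = 0"
    using assms X by (intro Q_diff) (auto intro: add_in)
  then have 1: "p (?q (a i + sum a I) - (?q (a i) + ?q (sum a I))) = 0"
    using p_commute[of "?q (a i)" "?q (a i + sum a I) - ?q (sum a I)"] X q
    by (simp add: diff_in add_in algebra_simps)
  have "p (?q (sum a I) - (\<Sum>i\<in>I. ?q (a i))) = 0" using insert by simp
  then have 2: "p ((?q (a i) + ?q (sum a I)) - (?q (a i) + (\<Sum>i\<in>I. ?q (a i)))) = 0" by simp
  have "p (?q (a i + sum a I) - (?q (a i) + (\<Sum>i\<in>I. ?q (a i)))) = 0"
    using insert.prems X by (intro p_eq0_trans[OF _ _ _ 1 2] q add_in sum_in) auto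
  then show ?case using insert by simp
qed

text \<open>The multinomial expansion.\<close>

lemma Q_expand:
  assumes "finite I" "\<And>i. i \<in> I \<Longrightarrow> a i \<in> X" "set us \<subseteq> X" "length us + k = m" "1 \<le> m"
  shows "p (Q m (us @ replicate k (sum a I)) - (\<Sum>is | set is \<subseteq> I \<and> length is = k. Q m (us @ map a is))) = 0"
  using assms(3,4)
proof (induction k arbitrary: us)
  case 0
  have "{is. set is \<subseteq> I \<and> is = []} = {[]}" by auto
  then show ?case by (simp add: p_zero)
next
  case (Suc k)
  define S where "S k = {is. set is \<subseteq> I \<and> length is = k}" for k
  have S: "finite (S k)" "\<And>is. is \<in> S k \<Longrightarrow> set (map a is) \<subseteq> X \<and> length is = k" for k
    using finite_lists_length_eq[OF assms(1)] assms(2) by (auto simp: S_def)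
  have aI: "sum a I \<in> X" using assms by (intro sum_in)
  have rep: "set (replicate k (sum a I)) \<subseteq> X" using aI by auto
  have 1: "p (Q m (us @ sum a I # replicate k (sum a I)) - (\<Sum>i\<in>I. Q m (us @ a i # replicate k (sum a I)))) = 0"
    using assms Suc.prems rep by (intro Q_sum) auto
  have 2: "p ((\<Sum>i\<in>I. Q m (us @ a i # replicate k (sum a I))) - (\<Sum>i\<in>I. \<Sum>is\<in>S k. Q m (us @ a i # map a is))) = 0"
  proof (rule p_eq0_sum)
    fix i assume i: "i \<in> I"
    show "Q m (us @ a i # replicate k (sum a I)) \<in> X"
      using rep i assms(2) Suc.prems by (intro Q_in_append) auto
    show "(\<Sum>is\<in>S k. Q m (us @ a i # map a is)) \<in> X"
      using i assms(2) Suc.prems S by (intro sum_in Q_in_append) auto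
    show "p (Q m (us @ a i # replicate k (sum a I)) - (\<Sum>is\<in>S k. Q m (us @ a i # map a is))) = 0"
      using Suc.IH[of "us @ [a i]"] i assms(2) Suc.prems by (simp add: S_def)
  qed
  have 3: "p (Q m (us @ sum a I # replicate k (sum a I)) - (\<Sum>i\<in>I. \<Sum>is\<in>S k. Q m (us @ a i # map a is))) = 0"
    using S assms(2) Suc.prems rep aI
    by (intro p_eq0_trans[OF _ _ _ 1 2] sum_in Q_in_append) auto
  have "S (Suc k) = (\<lambda>(i, is). i # is) ` (I \<times> S k)"
    by (auto simp: S_def length_Suc_conv image_iff)
  then have "S (Suc k) = (\<lambda>(i, is). i # is) ` (I \<times> S k)" .
  moreover have "inj_on (\<lambda>(i, is). i # is) (I \<times> S k)" by (auto simp: inj_on_def)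
  ultimately have "(\<Sum>is\<in>S (Suc k). Q m (us @ map a is)) = (\<Sum>(i, is)\<in>I \<times> S k. Q m (us @ a i # map a is))"
    by (simp only: sum.reindex o_def) (simp add: case_prod_beta)
  also have "\<dots> = (\<Sum>i\<in>I. \<Sum>is\<in>S k. Q m (us @ a i # map a is))"
    by (rule sum.cartesian_product[symmetric])
  finally show ?case using 3 by (simp add: S_def)
qed

text \<open>
  Replace \<open>f\<close> by \<open>g\<close> in one argument after the other. The list \<open>us\<close> holds the arguments that have already been
  treated.
\<close>

lemma Q_telescope:
  assumes "f \<in> X" "g \<in> X" "p f \<le> M" "p g \<le> M" "1 \<le> m"
    and "set us \<subseteq> X" "\<And>u. u \<in> set us \<Longrightarrow> p u \<le> M" "length us + k = m"
  shows "p (Q m (us @ replicate k f) - Q m (us @ replicate k g)) \<le> R m * k * M ^ (m - 1) * p (f - g)"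
  using assms(6-8)
proof (induction k arbitrary: us)
  case 0
  then show ?case by (simp add: p_zero)
next
  case (Suc k)
  have pl: "prod_list (map p xs) \<le> M ^ length xs" if "\<And>u. u \<in> set xs \<Longrightarrow> p u \<le> M" for xs
    using that
  proof (induction xs)
    case (Cons x xs)
    have "p x * prod_list (map p xs) \<le> M * M ^ length xs"
      using Cons prod_p_nonneg[of xs] p_nonneg[of x] order_trans[OF p_nonneg, of x M]
      by (intro mult_mono) auto
    then show ?case by simp
  qed simp
  let ?q = "\<lambda>z w. Q m (us @ z # replicate k w)"
  have X: "?q z w \<in> X" if "z \<in> X" "w \<in> X" for z w
    by (rule Q_in_append) (use that Suc.prems in auto)
  have "p (?q f f - ?q f g) \<le> R m * k * M ^ (m - 1) * p (f - g)"
    using Suc.IH[of "us @ [f]"] Suc.prems assms by auto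
  moreover have "p (?q f g - ?q g g) \<le> R m * M ^ (m - 1) * p (f - g)"
  proof -
    have "p (?q (f - g) g - (?q f g - ?q g g)) = 0"
      using Suc.prems assms by (intro Q_diff) auto
    then have "p (?q f g - ?q g g) = p (?q (f - g) g)"
      using p_eq0_cong[of "?q (f - g) g" "?q f g - ?q g g"] X assms by (simp add: diff_in)
    also have "\<dots> \<le> R m * prod_list (map p (us @ (f - g) # replicate k g))"
      using Suc.prems assms by (intro Q_bound) (auto intro: diff_in)
    also have "\<dots> = R m * (prod_list (map p (us @ replicate k g)) * p (f - g))" by simp
    also have "\<dots> \<le> R m * (M ^ (m - 1) * p (f - g))"
    proof (intro mult_left_mono mult_right_mono R_nonneg p_nonneg)
      have "p u \<le> M" if "u \<in> set (us @ replicate k g)" for u using that Suc.prems assms by auto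
      then have "prod_list (map p (us @ replicate k g)) \<le> M ^ length (us @ replicate k g)" by (rule pl)
      also have "length (us @ replicate k g) = m - 1" using Suc.prems by simp
      finally show "prod_list (map p (us @ replicate k g)) \<le> M ^ (m - 1)" .
    qed
    finally show ?thesis by (simp add: mult_ac)
  qed
  moreover have "p (?q f f - ?q g g) \<le> p (?q f f - ?q f g) + p (?q f g - ?q g g)"
    using X assms by (intro p_triangle) auto
  ultimately show ?case by (simp add: algebra_simps)
qed


lemma geometric_tail: "0 \<le> x \<Longrightarrow> x < 1 \<Longrightarrow> (\<Sum>j=m..K. x ^ j) \<le> x ^ m / (1 - x)" for x :: real
  by (auto simp: sum_gp divide_right_mono)

text \<open>
  For the truncated forward series the coefficients of equal degree in \<open>\<eta>\<close> are collected. By the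
  recursion defining \<open>Q j\<close>, the terms of degree \<open>j\<close> add up to \<open>Q j \<zeta>\<^sup>j - Q j \<eta>\<^sup>j\<close> with
  \<open>\<zeta> = A [\<eta>]\<close>, and what remains has degree above \<open>N\<close>.
\<close>

text \<open>
  The core of the estimate, with \<open>T \<phi>\<close> replaced by a partial sum of the forward series. Expand
  \<open>Q m\<close> at the sum multilinearly into terms indexed by lists of orders, and split them into total order at most \<open>N\<close> and the
  rest. In the first part the lists of total order \<open>j\<close> are all compositions of \<open>j\<close>, and the recursion of \<open>Q\<close> leaves
  \<open>Q j (\<zeta>, \<dots>, \<zeta>) - Q j (\<eta>, \<dots>, \<eta>)\<close>. The second part is bounded by a geometric tail.
\<close>

lemma resummation:
  assumes \<eta>: "\<eta> \<in> X" and M: "p \<eta> \<le> M" "p (A [\<eta>]) \<le> M" "\<kappa> * M < 1" and \<kappa>: "0 < \<kappa>" and L: "1 \<le> N" "N \<le> L"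
  shows "p (\<eta> - (\<Sum>m=1..N. Q m (replicate m (\<Sum>i=1..L. A (replicate i \<eta>))))) \<le>
    max (1 / \<kappa>) C * \<kappa> / (1 - \<kappa> * M)\<^sup>2 * p (\<eta> - A [\<eta>]) + C * (\<kappa> * M) ^ (N + 1) / (1 - \<kappa> * M)"
proof -
  define a where "a i = A (replicate i \<eta>)" for i
  define \<zeta> where "\<zeta> = A [\<eta>]"
  define S where "S m = {is. set is \<subseteq> {1..L} \<and> length is = m}" for m
  have M0: "0 \<le> M" using M p_nonneg[of \<eta>] by linarith
  have a: "a i \<in> X" if "1 \<le> i" for i unfolding a_def using \<eta> that by (intro A_in) auto
  have \<zeta>: "\<zeta> \<in> X" "\<zeta> = a 1" using a[of 1] by (auto simp: \<zeta>_def a_def)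
  have S: "finite (S m)" "\<And>is. is \<in> S m \<Longrightarrow> set (map a is) \<subseteq> X \<and> length is = m" for m
    using finite_lists_length_eq[of "{1..L}"] a by (auto simp: S_def)
  have q: "Q m (map a is) \<in> X" if "is \<in> S m" "1 \<le> m" for m "is"
    using S(2)[OF that(1)] that(2) by (intro Q_in) auto
  have pa: "p (a i) \<le> \<tau> * (\<nu> * \<mu> ^ (i - 1)) * M ^ i" if "1 \<le> i" for i
  proof -
    have "p (a i) \<le> \<tau> * \<nu> * \<mu> ^ (i - 1) * p \<eta> ^ i"
      using A_bound[of "replicate i \<eta>"] that \<eta> by (auto simp: a_def prod_list_replicate)
    also have "\<dots> \<le> \<tau> * \<nu> * \<mu> ^ (i - 1) * M ^ i"
      using \<tau> \<mu> \<nu> M p_nonneg by (intro mult_left_mono power_mono) auto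
    finally show ?thesis by (simp add: mult_ac)
  qed
  have pq: "p (Q m (map a is)) \<le> C * (wt \<mu> \<nu> is * M ^ sum_list is)" if "is \<in> S m" "1 \<le> m" for m "is"
  proof -
    have "prod_list (map p (map a is)) \<le> \<tau> ^ length is * wt \<mu> \<nu> is * M ^ sum_list is" if "\<forall>i\<in>set is. 1 \<le> i" for "is"
      using that
    proof (induction "is")
      case (Cons i "is")
      have "p (a i) * prod_list (map p (map a is)) \<le>
          (\<tau> * (\<nu> * \<mu> ^ (i - 1)) * M ^ i) * (\<tau> ^ length is * wt \<mu> \<nu> is * M ^ sum_list is)"
        using Cons pa[of i] prod_p_nonneg[of "map a is"] order_trans[OF p_nonneg pa[of i]]
        by (intro mult_mono) auto
      then show ?case by (simp add: wt_def power_add mult_ac)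
    qed (simp add: wt_def)
    moreover have "\<forall>i\<in>set is. 1 \<le> i" "length is = m" using that by (auto simp: S_def)
    ultimately have "prod_list (map p (map a is)) \<le> \<tau> ^ m * wt \<mu> \<nu> is * M ^ sum_list is"
      by blast
    then have "p (Q m (map a is)) \<le> R m * (\<tau> ^ m * wt \<mu> \<nu> is * M ^ sum_list is)"
      using Q_bound[of m "map a is"] S(2)[OF that(1)] that(2) R_nonneg[of m]
      by (meson length_map mult_left_mono order_trans)
    also have "\<dots> = (R m * \<tau> ^ m) * (wt \<mu> \<nu> is * M ^ sum_list is)" by simp
    also have "\<dots> \<le> C * (wt \<mu> \<nu> is * M ^ sum_list is)"
      using R_\<tau>_le[OF that(2)] wt_nonneg[OF \<mu> \<nu>] M0 by (intro mult_right_mono) auto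
    finally show ?thesis .
  qed
  define low where "low = (\<Sum>m=1..N. \<Sum>is\<in>{is \<in> S m. sum_list is \<le> N}. Q m (map a is))"
  define high where "high = (\<Sum>m=1..N. \<Sum>is\<in>{is \<in> S m. N < sum_list is}. Q m (map a is))"
  define E where "E = (\<Sum>m=1..N. Q m (replicate m (\<Sum>i=1..L. a i)))"
  have fL: "(\<Sum>i=1..L. a i) \<in> X" using a by (intro sum_in) auto
  have EX: "E \<in> X" unfolding E_def using fL by (intro sum_in Q_in) auto
  have lowX: "low \<in> X" unfolding low_def by (intro sum_in q) auto
  have highX: "high \<in> X" unfolding high_def by (intro sum_in q) auto
  have "p (E - (\<Sum>m=1..N. \<Sum>is\<in>S m. Q m (map a is))) = 0"
    unfolding E_def
  proof (rule p_eq0_sum)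
    fix m assume m: "m \<in> {1..N}"
    show "p (Q m (replicate m (\<Sum>i=1..L. a i)) - (\<Sum>is\<in>S m. Q m (map a is))) = 0"
      using Q_expand[of "{1..L}" a "[]" m m] a m by (simp add: S_def)
    show "Q m (replicate m (\<Sum>i=1..L. a i)) \<in> X" using fL m by (intro Q_in) auto
    show "(\<Sum>is\<in>S m. Q m (map a is)) \<in> X" using m by (intro sum_in q) auto
  qed
  moreover have "(\<Sum>m=1..N. \<Sum>is\<in>S m. Q m (map a is)) = low + high"
    unfolding low_def high_def sum.distrib[symmetric]
  proof (rule sum.cong[OF refl])
    fix m
    have "{is \<in> S m. sum_list is \<le> N} \<union> {is \<in> S m. N < sum_list is} = S m" by auto
    then show "(\<Sum>is\<in>S m. Q m (map a is)) = (\<Sum>is\<in>{is \<in> S m. sum_list is \<le> N}. Q m (map a is)) +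
        (\<Sum>is\<in>{is \<in> S m. N < sum_list is}. Q m (map a is))"
      by (subst sum.union_disjoint[symmetric]) (use S(1)[of m] in auto)
  qed
  ultimately have E: "p (E - (low + high)) = 0" by simp
  have low: "low = (\<Sum>j=1..N. \<Sum>m=1..j. \<Sum>ns\<in>compositions j m. Q m (map a ns))"
  proof -
    have "low = (\<Sum>m=1..N. \<Sum>j=1..N. \<Sum>ns\<in>compositions j m. Q m (map a ns))"
      unfolding low_def
    proof (rule sum.cong[OF refl])
      fix m assume m: "m \<in> {1..N}"
      have "{is \<in> S m. sum_list is \<le> N} = (\<Union>j\<in>{1..N}. compositions j m)"
      proof (intro equalityI subsetI)
        fix ns assume ns: "ns \<in> {is \<in> S m. sum_list is \<le> N}"
        then have "ns \<in> compositions (sum_list ns) m" by (auto simp: S_def compositions_def)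
        moreover have "sum_list ns \<in> {1..N}" using compositions_le[OF calculation] ns m by auto
        ultimately show "ns \<in> (\<Union>j\<in>{1..N}. compositions j m)" by blast
      next
        fix ns assume "ns \<in> (\<Union>j\<in>{1..N}. compositions j m)"
        then obtain j where j: "j \<in> {1..N}" "ns \<in> compositions j m" by blast
        then have "i \<in> {1..L}" if "i \<in> set ns" for i
          using L that member_le_sum_list[OF that] by (auto simp: compositions_def)
        then show "ns \<in> {is \<in> S m. sum_list is \<le> N}"
          using j by (auto simp: S_def compositions_def)
      qed
      then show "(\<Sum>is\<in>{is \<in> S m. sum_list is \<le> N}. Q m (map a is)) =
          (\<Sum>j=1..N. \<Sum>ns\<in>compositions j m. Q m (map a ns))"
        by (simp only:) (rule sum.UNION_disjoint, simp, simp, auto simp: compositions_def)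
    qed
    also have "\<dots> = (\<Sum>j=1..N. \<Sum>m=1..N. \<Sum>ns\<in>compositions j m. Q m (map a ns))"
      by (rule sum.swap)
    also have "\<dots> = (\<Sum>j=1..N. \<Sum>m=1..j. \<Sum>ns\<in>compositions j m. Q m (map a ns))"
    proof (rule sum.cong[OF refl])
      fix j assume "j \<in> {1..N}"
      then show "(\<Sum>m=1..N. \<Sum>ns\<in>compositions j m. Q m (map a ns)) =
          (\<Sum>m=1..j. \<Sum>ns\<in>compositions j m. Q m (map a ns))"
        by (intro sum.mono_neutral_right) (auto dest: compositions_le intro!: sum.neutral)
    qed
    finally show ?thesis .
  qed
  \<comment> \<open>The part \<open>m < j\<close> is the recursion for \<open>- Q j (\<eta>, \<dots>, \<eta>)\<close>; the part \<open>m = j\<close> is \<open>Q j (\<zeta>, \<dots>, \<zeta>)\<close>.\<close>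
  have coeff: "(\<Sum>m=1..j. \<Sum>ns\<in>compositions j m. Q m (map a ns)) =
      (if j = 1 then \<eta> else 0) - (Q j (replicate j \<eta>) - Q j (replicate j \<zeta>))" if "1 \<le> j" for j
  proof (cases "j = 1")
    case True
    then show ?thesis using \<zeta> by (simp add: compositions_full[of 1, simplified] Q_simps)
  next
    case False
    then have j: "2 \<le> j" using that by simp
    then have "{1..j} = insert j {1..j - 1}" by auto
    then have "(\<Sum>m=1..j. \<Sum>ns\<in>compositions j m. Q m (map a ns)) =
        Q j (replicate j \<zeta>) + (\<Sum>m=1..j - 1. \<Sum>ns\<in>compositions j m. Q m (map a ns))"
      using j \<zeta> by (simp add: compositions_full)
    also have "(\<Sum>m=1..j - 1. \<Sum>ns\<in>compositions j m. Q m (map a ns)) =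
        (\<Sum>m=1..j - 1. \<Sum>ns\<in>compositions j m. Q m (map A (blocks ns (replicate j \<eta>))))"
      by (intro sum.cong refl) (auto simp: compositions_def map_blocks_replicate a_def[abs_def])
    also have "\<dots> = - Q j (replicate j \<eta>)" using j by (simp add: Q_simps)
    finally show ?thesis using False by simp
  qed
  have "low = (\<Sum>j=1..N. if j = 1 then \<eta> else 0) - (\<Sum>j=1..N. Q j (replicate j \<eta>) - Q j (replicate j \<zeta>))"
    unfolding low sum_subtractf[symmetric] by (intro sum.cong refl) (use coeff in \<open>simp add: sum_subtractf\<close>)
  also have "(\<Sum>j=1..N. if j = 1 then \<eta> else 0) = \<eta>" using L by (simp add: sum.delta)
  finally have low': "\<eta> - low = (\<Sum>j=1..N. Q j (replicate j \<eta>) - Q j (replicate j \<zeta>))" by simp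
  have x: "0 \<le> \<kappa> * M" using M0 \<kappa> by simp
  have plow: "p (\<eta> - low) \<le> max (1 / \<kappa>) C * \<kappa> / (1 - \<kappa> * M)\<^sup>2 * p (\<eta> - \<zeta>)"
  proof -
    have "p (\<eta> - low) \<le> (\<Sum>j=1..N. p (Q j (replicate j \<eta>) - Q j (replicate j \<zeta>)))"
      unfolding low' using \<eta> \<zeta> by (intro p_sum diff_in Q_in) auto
    also have "\<dots> \<le> (\<Sum>j=1..N. R j * j * M ^ (j - 1) * p (\<eta> - \<zeta>))"
    proof (rule sum_mono)
      fix j assume "j \<in> {1..N}"
      then show "p (Q j (replicate j \<eta>) - Q j (replicate j \<zeta>)) \<le> R j * j * M ^ (j - 1) * p (\<eta> - \<zeta>)"
        using Q_telescope[of \<eta> \<zeta> M j "[]" j] \<eta> \<zeta>(1) M by (simp add: \<zeta>_def)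
    qed
    also have "\<dots> \<le> (\<Sum>j=1..N. max (1 / \<kappa>) C * \<kappa> * (j * (\<kappa> * M) ^ (j - 1)) * p (\<eta> - \<zeta>))"
    proof (intro sum_mono mult_right_mono p_nonneg)
      fix j assume j: "j \<in> {1..N}"
      have "R j \<le> max (1 / \<kappa>) C * \<kappa> ^ j"
      proof (cases "j = 1")
        case True
        have "1 / \<kappa> * \<kappa> \<le> max (1 / \<kappa>) C * \<kappa>" using \<kappa> by (intro mult_right_mono) auto
        then show ?thesis using True \<kappa> by (simp add: R_def)
      next
        case False
        then have "R j \<le> C * \<kappa> ^ j" using j by (intro R_le) auto
        also have "\<dots> \<le> max (1 / \<kappa>) C * \<kappa> ^ j" using \<kappa> by (intro mult_right_mono) auto
        finally show ?thesis .
      qed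
      then have "R j * (j * M ^ (j - 1)) \<le> max (1 / \<kappa>) C * \<kappa> ^ j * (j * M ^ (j - 1))"
        using M0 by (intro mult_right_mono) auto
      also have "\<kappa> ^ j = \<kappa> * \<kappa> ^ (j - 1)" using j by (cases j) auto
      finally show "R j * j * M ^ (j - 1) \<le> max (1 / \<kappa>) C * \<kappa> * (j * (\<kappa> * M) ^ (j - 1))"
        by (simp add: power_mult_distrib mult_ac)
    qed
    also have "\<dots> = max (1 / \<kappa>) C * \<kappa> * (\<Sum>j=1..N. j * (\<kappa> * M) ^ (j - 1)) * p (\<eta> - \<zeta>)"
      by (simp add: sum_distrib_left sum_distrib_right)
    also have "(\<Sum>j=1..N. j * (\<kappa> * M) ^ (j - 1)) = (\<Sum>j<N. of_nat (Suc j) * (\<kappa> * M) ^ j)"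
      by (rule sum.reindex_bij_witness[of _ Suc "\<lambda>j. j - 1"]) auto
    also have "max (1 / \<kappa>) C * \<kappa> * (\<Sum>j<N. of_nat (Suc j) * (\<kappa> * M) ^ j) * p (\<eta> - \<zeta>) \<le>
        max (1 / \<kappa>) C * \<kappa> * (1 / (1 - \<kappa> * M)\<^sup>2) * p (\<eta> - \<zeta>)"
    proof (intro mult_right_mono mult_left_mono p_nonneg)
      have s: "(\<lambda>j. of_nat (Suc j) * (\<kappa> * M) ^ j) sums (1 / (1 - \<kappa> * M)\<^sup>2)"
        using geometric_deriv_sums[of "\<kappa> * M"] x M by simp
      show "(\<Sum>j<N. of_nat (Suc j) * (\<kappa> * M) ^ j) \<le> 1 / (1 - \<kappa> * M)\<^sup>2"
        unfolding sums_unique[OF s] using x by (intro sum_le_suminf sums_summable[OF s]) auto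
    qed (use \<kappa> C_nonneg in auto)
    finally show ?thesis by simp
  qed
  have phigh: "p high \<le> C * (\<kappa> * M) ^ (N + 1) / (1 - \<kappa> * M)"
  proof -
    define g where "g is = wt \<mu> \<nu> is * M ^ sum_list is" for "is"
    have g: "0 \<le> g is" for "is" using wt_nonneg[OF \<mu> \<nu>] M0 by (simp add: g_def)
    define J where "J = {N + 1..N * L}"
    define V where "V = (\<Union>j\<in>J. {ns. sum_list ns = j \<and> (\<forall>i\<in>set ns. 1 \<le> i)})"
    define W where "W = (\<Union>m\<in>{1..N}. {is \<in> S m. N < sum_list is})"
    have "p high \<le> (\<Sum>m=1..N. p (\<Sum>is\<in>{is \<in> S m. N < sum_list is}. Q m (map a is)))"
      unfolding high_def by (intro p_sum sum_in q) auto
    also have "\<dots> \<le> (\<Sum>m=1..N. \<Sum>is\<in>{is \<in> S m. N < sum_list is}. p (Q m (map a is)))"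
      by (intro sum_mono p_sum q) auto
    also have "\<dots> \<le> (\<Sum>m=1..N. \<Sum>is\<in>{is \<in> S m. N < sum_list is}. C * g is)"
      unfolding g_def by (intro sum_mono pq) auto
    also have "\<dots> = (\<Sum>is\<in>W. C * g is)"
      unfolding W_def
    proof (rule sum.UNION_disjoint[symmetric])
      show "\<forall>m\<in>{1..N}. finite {is \<in> S m. N < sum_list is}" using S(1) by (blast intro: finite_subset)
      have "length is = m" if "is \<in> S m" for m "is" using S(2)[OF that] by blast
      then show "\<forall>m\<in>{1..N}. \<forall>m'\<in>{1..N}. m \<noteq> m' \<longrightarrow> {is \<in> S m. N < sum_list is} \<inter> {is \<in> S m'. N < sum_list is} = {}"
        by blast
    qed simp
    also have "\<dots> \<le> (\<Sum>is\<in>V. C * g is)"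
    proof (rule sum_mono2)
      show "finite V" unfolding V_def J_def using finite_comps by blast
      have "sum_list is \<le> length is * L" if "set is \<subseteq> {1..L}" for "is"
        using that by (induction "is") auto
      then have "sum_list is \<le> N * L" if "set is \<subseteq> {1..L}" "length is \<le> N" for "is"
        using that by (meson mult_le_mono1 order_trans)
      then show "W \<subseteq> V" unfolding W_def V_def J_def S_def by (auto simp: subset_eq)
    qed (use g C_nonneg in auto)
    also have "\<dots> = (\<Sum>j\<in>J. \<Sum>ns | sum_list ns = j \<and> (\<forall>i\<in>set ns. 1 \<le> i). C * g ns)"
      unfolding V_def by (rule sum.UNION_disjoint) (use finite_comps in \<open>auto simp: J_def\<close>)
    also have "\<dots> \<le> (\<Sum>j\<in>J. C * (\<kappa> * M) ^ j)"
    proof (rule sum_mono)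
      fix j assume j: "j \<in> J"
      then obtain i where i: "j = Suc i" by (cases j) (auto simp: J_def)
      have "(\<Sum>ns | sum_list ns = j \<and> (\<forall>i\<in>set ns. 1 \<le> i). C * g ns) =
          C * M ^ j * (\<Sum>ns | sum_list ns = j \<and> (\<forall>i\<in>set ns. 1 \<le> i). wt \<mu> \<nu> ns)"
        unfolding sum_distrib_left by (intro sum.cong) (auto simp: g_def)
      also have "\<dots> = C * M ^ j * (\<nu> * \<kappa> ^ i)" unfolding i by (simp only: sum_wt)
      also have "\<dots> \<le> C * M ^ j * (\<kappa> * \<kappa> ^ i)"
        using C_nonneg M0 \<mu> \<nu> by (intro mult_left_mono mult_right_mono) auto
      finally show "(\<Sum>ns | sum_list ns = j \<and> (\<forall>i\<in>set ns. 1 \<le> i). C * g ns) \<le> C * (\<kappa> * M) ^ j"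
        by (simp add: i power_mult_distrib mult_ac)
    qed
    also have "\<dots> = C * (\<Sum>j\<in>J. (\<kappa> * M) ^ j)" by (simp add: sum_distrib_left)
    also have "\<dots> \<le> C * ((\<kappa> * M) ^ (N + 1) / (1 - \<kappa> * M))"
      unfolding J_def using x M C_nonneg by (intro mult_left_mono geometric_tail) auto
    finally show ?thesis by simp
  qed
  have "p (\<eta> - E) \<le> p (\<eta> - (low + high)) + p ((low + high) - E)"
    using \<eta> lowX highX EX by (intro p_triangle add_in)
  also have "p ((low + high) - E) = 0" using E EX lowX highX p_commute[of "low + high" E] by (simp add: add_in)
  also have "p (\<eta> - (low + high)) \<le> p (\<eta> - low) + p high"
    using p_diff[of "\<eta> - low" high] \<eta> lowX highX by (simp add: diff_in algebra_simps)
  finally show ?thesis using plow phigh by (simp add: E_def a_def \<zeta>_def)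
qed

text \<open>
  The partial sums of the forward series may be replaced by their limit, since each of the finitely many \<open>Q m\<close> with
  \<open>m \<le> N\<close> is continuous.
\<close>

lemma inverse_series_close:
  assumes \<eta>: "\<eta> \<in> X" and M: "p \<eta> \<le> M" "p (A [\<eta>]) \<le> M" "\<kappa> * M < 1" and \<kappa>: "0 < \<kappa>" and N: "1 \<le> N"
    and f: "f \<in> X" and lim: "(\<lambda>L. p (f - (\<Sum>i=1..L. A (replicate i \<eta>)))) \<longlonglongrightarrow> 0"
  shows "p (\<eta> - (\<Sum>m=1..N. Q m (replicate m f))) \<le>
    max (1 / \<kappa>) C * \<kappa> / (1 - \<kappa> * M)\<^sup>2 * p (\<eta> - A [\<eta>]) + C * (\<kappa> * M) ^ (N + 1) / (1 - \<kappa> * M)"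
    (is "?l \<le> ?r")
proof -
  define g where "g L = (\<Sum>i=1..L. A (replicate i \<eta>))" for L
  define c where "c = (\<Sum>m=1..N. R m * m * (p f + 1) ^ (m - 1))"
  have A: "A (replicate i \<eta>) \<in> X" if "1 \<le> i" for i using \<eta> that by (intro A_in) auto
  have gX: "g L \<in> X" for L unfolding g_def by (intro sum_in A) auto
  have "\<forall>\<^sub>F L in sequentially. p (f - g L) < 1"
    unfolding g_def by (rule order_tendstoD(2)[OF lim]) simp
  then have ev: "\<forall>\<^sub>F L in sequentially. ?l \<le> ?r + c * p (f - g L)"
    using eventually_ge_at_top[of N]
  proof eventually_elim
    case (elim L)
    have pg: "p (g L) \<le> p f + 1"
      using p_add[of "g L - f" f] p_commute[of "g L" f] gX[of L] f elim by (simp add: diff_in)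
    have "p ((\<Sum>m=1..N. Q m (replicate m (g L))) - (\<Sum>m=1..N. Q m (replicate m f))) \<le>
        (\<Sum>m=1..N. p (Q m (replicate m (g L)) - Q m (replicate m f)))"
      unfolding sum_subtractf[symmetric] using gX[of L] f by (intro p_sum diff_in Q_in) auto
    also have "\<dots> \<le> (\<Sum>m=1..N. R m * m * (p f + 1) ^ (m - 1) * p (g L - f))"
    proof (rule sum_mono)
      fix m assume "m \<in> {1..N}"
      then show "p (Q m (replicate m (g L)) - Q m (replicate m f)) \<le> R m * m * (p f + 1) ^ (m - 1) * p (g L - f)"
        using Q_telescope[of "g L" f "p f + 1" m "[]" m] gX[of L] f pg by simp
    qed
    also have "\<dots> = c * p (f - g L)"
      using p_commute[OF f gX[of L]] by (simp add: c_def sum_distrib_right)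
    finally have 1: "p ((\<Sum>m=1..N. Q m (replicate m (g L))) - (\<Sum>m=1..N. Q m (replicate m f))) \<le> c * p (f - g L)" .
    have 2: "p (\<eta> - (\<Sum>m=1..N. Q m (replicate m (g L)))) \<le> ?r"
      unfolding g_def using resummation[OF \<eta> M \<kappa> N] elim by simp
    have "?l \<le> p (\<eta> - (\<Sum>m=1..N. Q m (replicate m (g L)))) +
        p ((\<Sum>m=1..N. Q m (replicate m (g L))) - (\<Sum>m=1..N. Q m (replicate m f)))"
      using \<eta> gX[of L] f by (intro p_triangle sum_in Q_in) auto
    then show ?case using 1 2 by linarith
  qed
  have "(\<lambda>L. ?r + c * p (f - g L)) \<longlonglongrightarrow> ?r + c * 0"
    using lim unfolding g_def by (intro tendsto_intros)
  then show ?thesis using tendsto_lowerbound[OF _ ev] by simp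
qed

text \<open>
  The previous bound with \<open>K \<ge> N\<close> in place of \<open>N\<close> has an error term that vanishes as \<open>K\<close> tends to infinity. The terms
  of the inverse series between \<open>N\<close> and \<open>K\<close> are estimated directly by \<open>C (\<kappa> p f)\<^bsup>m\<^esup>\<close>.
\<close>

theorem inverse_series_error:
  assumes \<eta>: "\<eta> \<in> X" and M: "p \<eta> \<le> M" "p (A [\<eta>]) \<le> M" "\<kappa> * M < 1" and \<kappa>: "0 < \<kappa>" and N: "1 \<le> N"
    and f: "f \<in> X" "\<kappa> * p f < 1" and lim: "(\<lambda>L. p (f - (\<Sum>i=1..L. A (replicate i \<eta>)))) \<longlonglongrightarrow> 0"
  shows "p (\<eta> - (\<Sum>m=1..N. Q m (replicate m f))) \<le>
    max (1 / \<kappa>) C * \<kappa> / (1 - \<kappa> * M)\<^sup>2 * p (\<eta> - A [\<eta>]) + C * (\<kappa> * p f) ^ (N + 1) / (1 - \<kappa> * p f)"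
proof -
  define u where "u = max (1 / \<kappa>) C * \<kappa> / (1 - \<kappa> * M)\<^sup>2 * p (\<eta> - A [\<eta>])"
  define v where "v = C * (\<kappa> * p f) ^ (N + 1) / (1 - \<kappa> * p f)"
  have q: "Q m (replicate m f) \<in> X" if "1 \<le> m" for m using f that by (intro Q_in) auto
  have le: "p (\<eta> - (\<Sum>m=1..N. Q m (replicate m f))) \<le> u + v + C * (\<kappa> * M) ^ (K + 1) / (1 - \<kappa> * M)" if K: "N \<le> K" for K
  proof -
    have split: "(\<Sum>m=1..K. Q m (replicate m f)) = (\<Sum>m=1..N. Q m (replicate m f)) + (\<Sum>m=N+1..K. Q m (replicate m f))"
      using K N sum.ub_add_nat[of 1 N "\<lambda>m. Q m (replicate m f)" "K - N"] by simp
    have "p (\<Sum>m=N+1..K. Q m (replicate m f)) \<le> (\<Sum>m=N+1..K. p (Q m (replicate m f)))"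
      by (intro p_sum q) auto
    also have "\<dots> \<le> (\<Sum>m=N+1..K. C * (\<kappa> * p f) ^ m)"
    proof (rule sum_mono)
      fix m assume m: "m \<in> {N+1..K}"
      then have "p (Q m (replicate m f)) \<le> R m * p f ^ m"
        using Q_bound[of m "replicate m f"] f N by (auto simp: prod_list_replicate)
      also have "\<dots> \<le> C * \<kappa> ^ m * p f ^ m" using m N R_le[of m] p_nonneg by (intro mult_right_mono) auto
      finally show "p (Q m (replicate m f)) \<le> C * (\<kappa> * p f) ^ m" by (simp add: power_mult_distrib mult_ac)
    qed
    also have "\<dots> = C * (\<Sum>m=N+1..K. (\<kappa> * p f) ^ m)" by (simp add: sum_distrib_left)
    also have "\<dots> \<le> C * ((\<kappa> * p f) ^ (N + 1) / (1 - \<kappa> * p f))"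
      using f p_nonneg[of f] \<kappa> C_nonneg by (intro mult_left_mono geometric_tail) auto
    finally have 1: "p (\<Sum>m=N+1..K. Q m (replicate m f)) \<le> v" by (simp add: v_def)
    have 2: "p (\<eta> - (\<Sum>m=1..K. Q m (replicate m f))) \<le> u + C * (\<kappa> * M) ^ (K + 1) / (1 - \<kappa> * M)"
      unfolding u_def using K N by (intro inverse_series_close[OF \<eta> M \<kappa> _ f(1) lim]) auto
    have "p ((\<eta> - (\<Sum>m=1..K. Q m (replicate m f))) + (\<Sum>m=N+1..K. Q m (replicate m f))) \<le>
        p (\<eta> - (\<Sum>m=1..K. Q m (replicate m f))) + p (\<Sum>m=N+1..K. Q m (replicate m f))"
      by (intro p_add diff_in \<eta> sum_in q) auto
    then show ?thesis using 1 2 unfolding split by (simp add: algebra_simps)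
  qed
  have "0 \<le> \<kappa> * M" using order_trans[OF p_nonneg M(1)] \<kappa> by simp
  then have "(\<lambda>K. (\<kappa> * M) ^ (K + 1)) \<longlonglongrightarrow> 0"
    using M LIMSEQ_ignore_initial_segment[OF LIMSEQ_realpow_zero, of "\<kappa> * M" 1] by simp
  then have "(\<lambda>K. u + v + C * (\<kappa> * M) ^ (K + 1) / (1 - \<kappa> * M)) \<longlonglongrightarrow> u + v + C * 0 / (1 - \<kappa> * M)"
    using M by (intro tendsto_intros) auto
  then show ?thesis unfolding u_def[symmetric] v_def[symmetric]
    using LIMSEQ_le_const[of _ "u + v"] le by (force intro: exI[of _ N])
qed

end

section \<open>Square integrable functions\<close>

lemma esqrt_power2 [simp]: "(esqrt x)\<^sup>2 = x"
  by (cases x) (auto simp: esqrt_def ennreal_power)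

lemma esqrt_mono: "x \<le> y \<Longrightarrow> esqrt x \<le> esqrt y"
  by (auto simp: esqrt_def top_unique less_top enn2real_mono intro!: ennreal_leI)

lemma esqrt_square [simp]: "esqrt (x\<^sup>2) = x"
  by (cases x) (auto simp: esqrt_def ennreal_power top_power_ennreal)

lemma esqrt_ennreal: "0 \<le> x \<Longrightarrow> esqrt (ennreal x) = ennreal (sqrt x)"
  by (simp add: esqrt_def)

lemma esqrt_less_top [simp]: "esqrt x < top \<longleftrightarrow> x < top"
  by (auto simp: esqrt_def less_top)

lemma esqrt_0 [simp]: "esqrt 0 = 0" by (simp add: esqrt_def)

lemma esqrt_eq_0 [simp]: "esqrt x = 0 \<longleftrightarrow> x = 0"
  by (metis esqrt_0 esqrt_power2 power_zero_numeral)

definition sqint :: "'a measure \<Rightarrow> ('a \<Rightarrow> complex) set" where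
  "sqint M = {f \<in> borel_measurable M. (\<integral>\<^sup>+ x. ennreal ((cmod (f x))\<^sup>2) \<partial>M) < \<infinity>}"

definition nrm :: "'a measure \<Rightarrow> ('a \<Rightarrow> complex) \<Rightarrow> real" where
  "nrm M f = sqrt (\<integral>x. (cmod (f x))\<^sup>2 \<partial>M)"

lemma sqint_measurable [measurable_dest]: "f \<in> sqint M \<Longrightarrow> f \<in> borel_measurable M"
  by (simp add: sqint_def)

lemma sqint_integrable: "f \<in> sqint M \<Longrightarrow> integrable M (\<lambda>x. (cmod (f x))\<^sup>2)"
  by (auto simp: sqint_def integrable_iff_bounded)

lemma sqint_iff: "f \<in> sqint M \<longleftrightarrow> f \<in> borel_measurable M \<and> integrable M (\<lambda>x. (cmod (f x))\<^sup>2)"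
  by (auto simp: sqint_def integrable_iff_bounded)

lemma nrm_nonneg [simp]: "0 \<le> nrm M f" by (simp add: nrm_def)

lemma nrm_power2: "(nrm M f)\<^sup>2 = (\<integral>x. (cmod (f x))\<^sup>2 \<partial>M)" by (simp add: nrm_def)

lemma sqint_nn: "f \<in> sqint M \<Longrightarrow> (\<integral>\<^sup>+ x. ennreal ((cmod (f x))\<^sup>2) \<partial>M) = ennreal ((nrm M f)\<^sup>2)"
  unfolding nrm_power2 by (rule nn_integral_eq_integral) (auto simp: sqint_integrable)

lemma sqint_0 [simp]: "(\<lambda>x. 0) \<in> sqint M" by (simp add: sqint_def)

lemma nrm_0 [simp]: "nrm M (\<lambda>x. 0) = 0" by (simp add: nrm_def)

lemma nrm_cnj [simp]: "nrm M (\<lambda>x. cnj (f x)) = nrm M f" by (simp add: nrm_def)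

lemma measurable_cnj [measurable]: "cnj \<in> borel_measurable borel"
  by (intro borel_measurable_continuous_onI continuous_intros)

lemma sqint_cnj: "f \<in> sqint M \<Longrightarrow> (\<lambda>x. cnj (f x)) \<in> sqint M"
  by (simp add: sqint_def measurable_compose[OF _ measurable_cnj])

lemma sqint_cmult: "f \<in> sqint M \<Longrightarrow> (\<lambda>x. c * f x) \<in> sqint M"
  by (auto simp: sqint_iff norm_mult power_mult_distrib)

lemma nrm_cmult: "nrm M (\<lambda>x. c * f x) = cmod c * nrm M f"
  by (simp add: nrm_def norm_mult power_mult_distrib real_sqrt_mult)

lemma sqint_add:
  assumes f: "f \<in> sqint M" and g: "g \<in> sqint M"
  shows "(\<lambda>x. f x + g x) \<in> sqint M"
  unfolding sqint_iff
proof
  show "integrable M (\<lambda>x. (cmod (f x + g x))\<^sup>2)"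
  proof (rule Bochner_Integration.integrable_bound)
    show "integrable M (\<lambda>x. 2 * (cmod (f x))\<^sup>2 + 2 * (cmod (g x))\<^sup>2)"
      using f g by (auto simp: sqint_iff)
    have "(cmod (f x + g x))\<^sup>2 \<le> 2 * (cmod (f x))\<^sup>2 + 2 * (cmod (g x))\<^sup>2" for x
    proof -
      have "(cmod (f x + g x))\<^sup>2 \<le> (cmod (f x) + cmod (g x))\<^sup>2"
        by (intro power_mono norm_triangle_ineq) auto
      also have "\<dots> \<le> 2 * (cmod (f x))\<^sup>2 + 2 * (cmod (g x))\<^sup>2"
        using zero_le_power2[of "cmod (f x) - cmod (g x)"] by (simp add: power2_eq_square algebra_simps)
      finally show ?thesis .
    qed
    then show "AE x in M. norm ((cmod (f x + g x))\<^sup>2) \<le> norm (2 * (cmod (f x))\<^sup>2 + 2 * (cmod (g x))\<^sup>2)"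
      by simp
  qed (use f g in measurable)
qed (use f g in measurable)

lemma sqint_uminus: "f \<in> sqint M \<Longrightarrow> (\<lambda>x. - f x) \<in> sqint M"
  using sqint_cmult[of f M "-1"] by simp

lemma sqint_diff: "f \<in> sqint M \<Longrightarrow> g \<in> sqint M \<Longrightarrow> (\<lambda>x. f x - g x) \<in> sqint M"
  using sqint_add[OF _ sqint_uminus] by fastforce

lemma sqint_mult:
  assumes f: "f \<in> sqint M" and g: "g \<in> sqint M"
  shows "integrable M (\<lambda>x. f x * g x)" (is ?I)
    and "(\<integral>x. cmod (f x) * cmod (g x) \<partial>M) \<le> nrm M f * nrm M g"
    and "cmod (\<integral>x. f x * g x \<partial>M) \<le> nrm M f * nrm M g"
proof -
  have [measurable]: "f \<in> borel_measurable M" "g \<in> borel_measurable M" using f g by measurable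
  have "(\<integral>\<^sup>+x. ennreal (cmod (f x)) * ennreal (cmod (g x)) \<partial>M)\<^sup>2 \<le>
      (\<integral>\<^sup>+x. (ennreal (cmod (f x)))\<^sup>2 \<partial>M) * (\<integral>\<^sup>+x. (ennreal (cmod (g x)))\<^sup>2 \<partial>M)"
    by (rule Cauchy_Schwarz_nn_integral) measurable
  also have "\<dots> = ennreal ((nrm M f * nrm M g)\<^sup>2)"
    using f g by (simp add: ennreal_power sqint_nn power_mult_distrib ennreal_mult)
  finally have "(\<integral>\<^sup>+x. ennreal (cmod (f x) * cmod (g x)) \<partial>M)\<^sup>2 \<le> (ennreal (nrm M f * nrm M g))\<^sup>2"
    by (subst ennreal_power, simp, simp only: ennreal_mult[OF norm_ge_zero norm_ge_zero])
  then have le: "(\<integral>\<^sup>+x. ennreal (cmod (f x) * cmod (g x)) \<partial>M) \<le> ennreal (nrm M f * nrm M g)"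
    using esqrt_mono by fastforce
  then show I: ?I
    by (intro integrableI_bounded) (auto simp: norm_mult less_top[symmetric] top_unique intro: le_less_trans)
  have "ennreal (\<integral>x. cmod (f x) * cmod (g x) \<partial>M) \<le> ennreal (nrm M f * nrm M g)"
    using integrable_norm[OF I] le by (subst nn_integral_eq_integral[symmetric]) (auto simp: norm_mult)
  then show *: "(\<integral>x. cmod (f x) * cmod (g x) \<partial>M) \<le> nrm M f * nrm M g"
    by (subst (asm) ennreal_le_iff) auto
  have "cmod (\<integral>x. f x * g x \<partial>M) \<le> (\<integral>x. cmod (f x * g x) \<partial>M)"
    by (rule integral_norm_bound)
  then show "cmod (\<integral>x. f x * g x \<partial>M) \<le> nrm M f * nrm M g" using * by (simp add: norm_mult)
qed

lemma nrm_expand: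
  assumes f: "f \<in> sqint M" and g: "g \<in> sqint M"
  shows "(nrm M (\<lambda>x. f x + g x))\<^sup>2 = (nrm M f)\<^sup>2 + 2 * Re (\<integral>x. f x * cnj (g x) \<partial>M) + (nrm M g)\<^sup>2"
proof -
  have I: "integrable M (\<lambda>x. f x * cnj (g x))" by (rule sqint_mult[OF f sqint_cnj[OF g]])
  have "(cmod (f x + g x))\<^sup>2 = (cmod (f x))\<^sup>2 + 2 * Re (f x * cnj (g x)) + (cmod (g x))\<^sup>2" for x
    by (simp add: cmod_power2) (simp add: power2_eq_square algebra_simps)
  then have "(\<integral>x. (cmod (f x + g x))\<^sup>2 \<partial>M) =
      (\<integral>x. (cmod (f x))\<^sup>2 + 2 * Re (f x * cnj (g x)) + (cmod (g x))\<^sup>2 \<partial>M)" by presburger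
  also have "\<dots> = (\<integral>x. (cmod (f x))\<^sup>2 \<partial>M) + 2 * (\<integral>x. Re (f x * cnj (g x)) \<partial>M) + (\<integral>x. (cmod (g x))\<^sup>2 \<partial>M)"
    using sqint_integrable[OF f] sqint_integrable[OF g] integrable_Re[OF I]
    by (simp del: times_complex.sel)
  finally show ?thesis unfolding nrm_power2 integral_Re[OF I] .
qed

lemma nrm_triangle:
  assumes f: "f \<in> sqint M" and g: "g \<in> sqint M"
  shows "nrm M (\<lambda>x. f x + g x) \<le> nrm M f + nrm M g"
proof (rule power2_le_imp_le)
  have "Re (\<integral>x. f x * cnj (g x) \<partial>M) \<le> nrm M f * nrm M g"
    using sqint_mult(3)[OF f sqint_cnj[OF g]] complex_Re_le_cmod order_trans by fastforce
  then show "(nrm M (\<lambda>x. f x + g x))\<^sup>2 \<le> (nrm M f + nrm M g)\<^sup>2"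
    unfolding nrm_expand[OF f g] by (simp add: power2_sum)
qed simp

lemma nrm_uminus: "nrm M (\<lambda>x. - f x) = nrm M f" by (simp add: nrm_def)

lemma nrm_triangle_diff:
  assumes f: "f \<in> sqint M" and g: "g \<in> sqint M"
  shows "nrm M (\<lambda>x. f x - g x) \<le> nrm M f + nrm M g"
  using nrm_triangle[OF f sqint_uminus[OF g]] by (simp add: nrm_uminus)

lemma nrm_eq_0:
  assumes "f \<in> sqint M"
  shows "nrm M f = 0 \<longleftrightarrow> (AE x in M. f x = 0)"
  using integral_nonneg_eq_0_iff_AE[OF sqint_integrable[OF assms]] by (simp add: nrm_def)

lemma nrm_cong_AE:
  assumes "f \<in> borel_measurable M" "g \<in> borel_measurable M" "AE x in M. f x = g x"
  shows "nrm M f = nrm M g"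
  unfolding nrm_def using assms by (intro arg_cong[of _ _ sqrt] integral_cong_AE) auto

lemma sqint_cong_AE:
  assumes "f \<in> sqint M" "g \<in> borel_measurable M" "AE x in M. f x = g x"
  shows "g \<in> sqint M"
proof -
  have "(\<integral>\<^sup>+x. ennreal ((cmod (f x))\<^sup>2) \<partial>M) = (\<integral>\<^sup>+x. ennreal ((cmod (g x))\<^sup>2) \<partial>M)"
    by (rule nn_integral_cong_AE) (use assms(3) in eventually_elim, simp)
  then show ?thesis using assms by (auto simp: sqint_def)
qed

text \<open>Completeness.\<close>

text \<open>
  A subsequence that converges fast in norm has absolutely summable increments almost everywhere; its pointwise limit is the
  limit in norm by Fatou's lemma.
\<close>

lemma sqint_complete:
  assumes fin: "finite_measure M" and f: "\<And>n. f n \<in> sqint M"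
    and Cauchy: "\<And>e. 0 < e \<Longrightarrow> \<exists>K. \<forall>m\<ge>K. \<forall>n\<ge>K. nrm M (\<lambda>x. f m x - f n x) < e"
  obtains g where "g \<in> sqint M" "(\<lambda>n. nrm M (\<lambda>x. f n x - g x)) \<longlonglongrightarrow> 0"
proof -
  interpret finite_measure M by fact
  have f' [measurable]: "f n \<in> borel_measurable M" for n using f by measurable
  have "\<exists>K. \<forall>m\<ge>K. \<forall>n\<ge>K. nrm M (\<lambda>x. f m x - f n x) < (1/2) ^ k" for k :: nat
    using Cauchy[of "(1/2) ^ k"] by simp
  then obtain K where K: "\<And>k m n. K k \<le> m \<Longrightarrow> K k \<le> n \<Longrightarrow> nrm M (\<lambda>x. f m x - f n x) < (1/2) ^ k"
    by metis
  \<comment> \<open>Monotone, and above every \<open>K k\<close>: the indices of the fast subsequence.\<close>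
  define r where "r k = (\<Sum>i\<le>k. K i) + k" for k
  have r: "K k \<le> r k" "r k \<le> r (Suc k)" "k \<le> r k" for k
    using member_le_sum[of k "{..k}" K] by (auto simp: r_def)
  have one: "(\<lambda>x. 1) \<in> sqint M" by (auto simp: sqint_def less_top[symmetric])
  define D where "D k x = cmod (f (r (Suc k)) x - f (r k) x)" for k x
  have [measurable]: "D k \<in> borel_measurable M" for k unfolding D_def by measurable
  have D: "(\<integral>\<^sup>+x. ennreal (D k x) \<partial>M) \<le> ennreal (nrm M (\<lambda>x. 1) * (1/2) ^ k)" for k
  proof -
    have s: "(\<lambda>x. f (r (Suc k)) x - f (r k) x) \<in> sqint M" by (intro sqint_diff f)
    have "(\<integral>\<^sup>+x. ennreal (D k x) \<partial>M) = ennreal (\<integral>x. D k x \<partial>M)"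
      using integrable_norm[OF sqint_mult(1)[OF s one]]
      by (intro nn_integral_eq_integral) (auto simp: D_def)
    also have "(\<integral>x. D k x \<partial>M) \<le> nrm M (\<lambda>x. f (r (Suc k)) x - f (r k) x) * nrm M (\<lambda>x. 1)"
      using sqint_mult(2)[OF s one] by (simp add: D_def)
    also have "\<dots> \<le> (1/2) ^ k * nrm M (\<lambda>x. 1)"
      using K[of k "r (Suc k)" "r k"] r[of k] by (intro mult_right_mono) (auto intro: order_trans less_imp_le)
    finally show ?thesis by (simp add: mult.commute ennreal_leI)
  qed
  have "(\<integral>\<^sup>+x. (\<Sum>k. ennreal (D k x)) \<partial>M) = (\<Sum>k. \<integral>\<^sup>+x. ennreal (D k x) \<partial>M)"
    by (rule nn_integral_suminf) measurable
  also have "\<dots> \<le> (\<Sum>k. ennreal (nrm M (\<lambda>x. 1) * (1/2) ^ k))" by (intro suminf_le D) auto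
  also have "\<dots> = ennreal (\<Sum>k. nrm M (\<lambda>x. 1) * (1/2) ^ k)"
    by (intro suminf_ennreal2) (auto intro!: summable_mult summable_geometric)
  finally have "(\<integral>\<^sup>+x. (\<Sum>k. ennreal (D k x)) \<partial>M) \<noteq> \<infinity>" by (auto simp: top_unique)
  then have "AE x in M. (\<Sum>k. ennreal (D k x)) \<noteq> \<infinity>"
    by (intro nn_integral_PInf_AE) measurable
  then have conv: "AE x in M. convergent (\<lambda>k. f (r k) x)"
  proof eventually_elim
    case (elim x)
    then have "summable (\<lambda>k. D k x)" by (intro summable_suminf_not_top) (auto simp: D_def)
    then have "summable (\<lambda>k. f (r (Suc k)) x - f (r k) x)"
      unfolding D_def by (rule summable_norm_cancel)
    then have "convergent (\<lambda>n. \<Sum>k<n. f (r (Suc k)) x - f (r k) x)" by (simp add: summable_iff_convergent)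
    then have "convergent (\<lambda>n. f (r n) x - f (r 0) x)" using sum_lessThan_telescope[of "\<lambda>k. f (r k) x"] by simp
    from convergent_add[OF this convergent_const[of "f (r 0) x"]] show ?case by simp
  qed
  define g where "g x = lim (\<lambda>k. f (r k) x)" for x
  have [measurable]: "g \<in> borel_measurable M" unfolding g_def by measurable
  have le: "(\<integral>\<^sup>+x. ennreal ((cmod (f n x - g x))\<^sup>2) \<partial>M) \<le> ennreal (e\<^sup>2)"
    if e: "0 < e" and n: "\<And>m. K' \<le> m \<Longrightarrow> nrm M (\<lambda>x. f n x - f m x) < e" for n K' e
  proof -
    have "AE x in M. ennreal ((cmod (f n x - g x))\<^sup>2) = liminf (\<lambda>k. ennreal ((cmod (f n x - f (r k) x))\<^sup>2))"
      using conv
    proof eventually_elim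
      case (elim x)
      then have "(\<lambda>k. f (r k) x) \<longlonglongrightarrow> g x" by (simp add: g_def convergent_LIMSEQ_iff)
      then have "(\<lambda>k. ennreal ((cmod (f n x - f (r k) x))\<^sup>2)) \<longlonglongrightarrow> ennreal ((cmod (f n x - g x))\<^sup>2)"
        by (intro tendsto_intros)
      from lim_imp_Liminf[OF sequentially_bot this] show ?case by simp
    qed
    then have "(\<integral>\<^sup>+x. ennreal ((cmod (f n x - g x))\<^sup>2) \<partial>M) =
        (\<integral>\<^sup>+x. liminf (\<lambda>k. ennreal ((cmod (f n x - f (r k) x))\<^sup>2)) \<partial>M)"
      by (rule nn_integral_cong_AE)
    also have "\<dots> \<le> liminf (\<lambda>k. \<integral>\<^sup>+x. ennreal ((cmod (f n x - f (r k) x))\<^sup>2) \<partial>M)"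
      by (rule nn_integral_liminf) measurable
    also have "\<dots> \<le> limsup (\<lambda>k. \<integral>\<^sup>+x. ennreal ((cmod (f n x - f (r k) x))\<^sup>2) \<partial>M)"
      by (rule Liminf_le_Limsup) simp
    also have "\<dots> \<le> ennreal (e\<^sup>2)"
    proof (rule Limsup_bounded)
      show "\<forall>\<^sub>F k in sequentially. (\<integral>\<^sup>+x. ennreal ((cmod (f n x - f (r k) x))\<^sup>2) \<partial>M) \<le> ennreal (e\<^sup>2)"
        using eventually_ge_at_top[of K']
      proof eventually_elim
        case (elim k)
        then have "nrm M (\<lambda>x. f n x - f (r k) x) < e" using n r(3)[of k] by (meson order_trans)
        then show ?case using e by (subst sqint_nn[OF sqint_diff[OF f f]]) (auto intro!: ennreal_leI power_mono)
      qed
    qed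
    finally show ?thesis .
  qed
  obtain n0 where "\<And>m n. n0 \<le> m \<Longrightarrow> n0 \<le> n \<Longrightarrow> nrm M (\<lambda>x. f m x - f n x) < 1"
    using Cauchy[of 1] by auto
  then have "(\<integral>\<^sup>+x. ennreal ((cmod (f n0 x - g x))\<^sup>2) \<partial>M) \<le> ennreal (1\<^sup>2)"
    by (intro le[of 1 n0]) simp_all
  then have "(\<lambda>x. f n0 x - g x) \<in> sqint M" by (auto simp: sqint_def top_unique less_top[symmetric])
  then have g: "g \<in> sqint M" using sqint_diff[OF f[of n0]] by fastforce
  moreover have "(\<lambda>n. nrm M (\<lambda>x. f n x - g x)) \<longlonglongrightarrow> 0"
  proof (rule LIMSEQ_I)
    fix e :: real assume e: "0 < e"
    then obtain K' where K': "\<And>m n. K' \<le> m \<Longrightarrow> K' \<le> n \<Longrightarrow> nrm M (\<lambda>x. f m x - f n x) < e / 2"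
      using Cauchy[of "e / 2"] by auto
    have "nrm M (\<lambda>x. f n x - g x) < e" if "K' \<le> n" for n
    proof -
      have "ennreal ((nrm M (\<lambda>x. f n x - g x))\<^sup>2) \<le> ennreal ((e / 2)\<^sup>2)"
        unfolding sqint_nn[OF sqint_diff[OF f g], symmetric]
        by (rule le[of _ K']) (use e K'[OF that] in auto)
      then have "(nrm M (\<lambda>x. f n x - g x))\<^sup>2 \<le> (e / 2)\<^sup>2" by (subst (asm) ennreal_le_iff) auto
      then have "nrm M (\<lambda>x. f n x - g x) \<le> e / 2" by (rule power2_le_imp_le) (use e in simp)
      then show ?thesis using e by simp
    qed
    then show "\<exists>no. \<forall>n\<ge>no. norm (nrm M (\<lambda>x. f n x - g x) - 0) < e" by auto
  qed
  ultimately show ?thesis by (rule that)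
qed

lemma nrm_tendsto:
  assumes "\<And>n. f n \<in> sqint M" "g \<in> sqint M" "(\<lambda>n. nrm M (\<lambda>x. f n x - g x)) \<longlonglongrightarrow> 0"
  shows "(\<lambda>n. nrm M (f n)) \<longlonglongrightarrow> nrm M g"
proof (rule LIM_zero_cancel, rule Lim_null_comparison[OF _ assms(3)], rule always_eventually, rule allI)
  fix n
  have "nrm M (f n) \<le> nrm M (\<lambda>x. f n x - g x) + nrm M g"
    using nrm_triangle[OF sqint_diff[OF assms(1,2)] assms(2), of n] by simp
  moreover have "nrm M g \<le> nrm M (f n) + nrm M (\<lambda>x. f n x - g x)"
    using nrm_triangle_diff[OF assms(1) sqint_diff[OF assms(1,2)], of n n] by simp
  ultimately show "norm (nrm M (f n) - nrm M g) \<le> nrm M (\<lambda>x. f n x - g x)" by auto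
qed

lemma sqint_mult_tendsto:
  assumes "\<And>n. f n \<in> sqint M" "g \<in> sqint M" "(\<lambda>n. nrm M (\<lambda>x. f n x - g x)) \<longlonglongrightarrow> 0" "h \<in> sqint M"
  shows "(\<lambda>n. \<integral>x. f n x * h x \<partial>M) \<longlonglongrightarrow> (\<integral>x. g x * h x \<partial>M)"
proof (rule LIM_zero_cancel, rule Lim_null_comparison)
  show "(\<lambda>n. nrm M (\<lambda>x. f n x - g x) * nrm M h) \<longlonglongrightarrow> 0" using tendsto_mult_left_zero[OF assms(3)] .
  show "\<forall>\<^sub>F n in sequentially. norm ((\<integral>x. f n x * h x \<partial>M) - (\<integral>x. g x * h x \<partial>M)) \<le> nrm M (\<lambda>x. f n x - g x) * nrm M h"
  proof (rule always_eventually, rule allI)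
    fix n
    have "(\<integral>x. f n x * h x \<partial>M) - (\<integral>x. g x * h x \<partial>M) = (\<integral>x. (f n x - g x) * h x \<partial>M)"
      using sqint_mult(1)[OF assms(1,4)] sqint_mult(1)[OF assms(2,4)] by (simp add: left_diff_distrib)
    then show "norm ((\<integral>x. f n x * h x \<partial>M) - (\<integral>x. g x * h x \<partial>M)) \<le> nrm M (\<lambda>x. f n x - g x) * nrm M h"
      using sqint_mult(3)[OF sqint_diff[OF assms(1,2)] assms(4), of n] by simp
  qed
qed

text \<open>
  The Riesz representation theorem on a subspace \<open>V\<close>: a minimizing sequence of
  \<open>\<parallel>v\<parallel>\<^sup>2 - 2 Re (L v)\<close> on \<open>V\<close> is a Cauchy sequence by the parallelogram law, and its limit
  represents \<open>L\<close>.
\<close>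

text \<open>
  A minimizing sequence in \<open>V\<close> of \<open>|v|\<^sup>2 - 2 Re (L v)\<close> is Cauchy by the parallelogram identity,
  and its limit represents \<open>L\<close>. The norm of the representing function is bounded by that of \<open>L\<close>, also when \<open>V\<close> is not dense;
  this is what makes norm bounds by duality sharp.
\<close>

theorem riesz_representation:
  fixes L :: "('a \<Rightarrow> complex) \<Rightarrow> complex"
  assumes fin: "finite_measure M" and V: "V \<subseteq> sqint M"
    and V0: "(\<lambda>x. 0) \<in> V" and Vadd: "\<And>u v. u \<in> V \<Longrightarrow> v \<in> V \<Longrightarrow> (\<lambda>x. u x + v x) \<in> V"
    and Vmul: "\<And>c v. v \<in> V \<Longrightarrow> (\<lambda>x. c * v x) \<in> V"
    and Ladd: "\<And>u v. u \<in> V \<Longrightarrow> v \<in> V \<Longrightarrow> L (\<lambda>x. u x + v x) = L u + L v"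
    and Lmul: "\<And>c v. v \<in> V \<Longrightarrow> L (\<lambda>x. c * v x) = c * L v"
    and K: "0 \<le> K" "\<And>v. v \<in> V \<Longrightarrow> cmod (L v) \<le> K * nrm M v"
  shows "\<exists>g\<in>sqint M. nrm M g \<le> K \<and> (\<forall>v\<in>V. L v = (\<integral>x. v x * g x \<partial>M))"
proof -
  \<comment> \<open>The functional minimized by the representing function.\<close>
  define J where "J v = (nrm M v)\<^sup>2 - 2 * Re (L v)" for v
  have J_lower: "- K\<^sup>2 \<le> J v" if "v \<in> V" for v
  proof -
    have "Re (L v) \<le> K * nrm M v" using K(2)[OF that] complex_Re_le_cmod order_trans by blast
    then show ?thesis using zero_le_power2[of "nrm M v - K"] by (simp add: J_def power2_diff mult_ac)
  qed
  define m where "m = Inf (J ` V)"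
  have bdd: "bdd_below (J ` V)" using J_lower by (auto intro!: bdd_belowI2)
  have m: "m \<le> J v" if "v \<in> V" for v unfolding m_def by (rule cINF_lower[OF bdd that])
  have "\<exists>v\<in>V. J v < m + 1 / Suc n" for n
  proof -
    have "Inf (J ` V) < m + 1 / Suc n" unfolding m_def by simp
    then show ?thesis using cInf_lessD[of "J ` V"] V0 by blast
  qed
  then obtain v where v: "\<And>n. v n \<in> V" "\<And>n. J (v n) < m + 1 / Suc n" by metis
  have vs: "v n \<in> sqint M" for n using v V by auto
  have par: "(nrm M (\<lambda>x. v i x - v j x))\<^sup>2 \<le> 2 / Suc i + 2 / Suc j" for i j
  proof -
    define w where "w = (\<lambda>x. (1 / 2) * (v i x + v j x))"
    have w: "w \<in> V" unfolding w_def by (intro Vmul Vadd v)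
    have "L w = (1 / 2) * (L (v i) + L (v j))"
      unfolding w_def Lmul[OF Vadd[OF v(1) v(1)]] Ladd[OF v(1) v(1)] ..
    moreover have "nrm M (\<lambda>x. v i x + v j x) = 2 * nrm M w"
      unfolding w_def nrm_cmult by simp
    moreover have "(nrm M (\<lambda>x. v i x - v j x))\<^sup>2 + (nrm M (\<lambda>x. v i x + v j x))\<^sup>2 = 2 * (nrm M (v i))\<^sup>2 + 2 * (nrm M (v j))\<^sup>2"
      using nrm_expand[OF vs vs, of i j] nrm_expand[OF vs sqint_uminus[OF vs], of i j]
      by (simp add: nrm_uminus)
    moreover have "Re (L w) * 2 = Re (L (v i)) + Re (L (v j))" 
      using arg_cong[OF calculation(1), of Re] by (simp add: algebra_simps)
    ultimately have "(nrm M (\<lambda>x. v i x - v j x))\<^sup>2 = 2 * J (v i) + 2 * J (v j) - 4 * J w"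
      by (simp add: J_def power_mult_distrib)
    then show ?thesis using v(2)[of i] v(2)[of j] m[OF w] by simp
  qed
  have inv: "(\<lambda>n. 1 / real (Suc n)) \<longlonglongrightarrow> 0" by (rule LIMSEQ_Suc[OF lim_1_over_n])
  obtain g where g: "g \<in> sqint M" "(\<lambda>n. nrm M (\<lambda>x. v n x - g x)) \<longlonglongrightarrow> 0"
  proof (rule sqint_complete[OF fin vs])
    fix e :: real assume e: "0 < e"
    then obtain k where k: "1 / real (Suc k) < e\<^sup>2 / 4" using nat_approx_posE[of "e\<^sup>2 / 4"] by auto
    have "nrm M (\<lambda>x. v i x - v j x) < e" if "k \<le> i" "k \<le> j" for i j
    proof (rule power2_less_imp_less)
      have "2 / real (Suc i) \<le> 2 / real (Suc k)" "2 / real (Suc j) \<le> 2 / real (Suc k)"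
        using that by (auto intro!: divide_left_mono)
      moreover have "2 / real (Suc k) = 2 * (1 / real (Suc k))" by simp
      ultimately show "(nrm M (\<lambda>x. v i x - v j x))\<^sup>2 < e\<^sup>2" using par[of i j] k by linarith
    qed (use e in auto)
    then show "\<exists>K. \<forall>m\<ge>K. \<forall>n\<ge>K. nrm M (\<lambda>x. v m x - v n x) < e" by blast
  qed
  have Jm: "(\<lambda>n. J (v n)) \<longlonglongrightarrow> m"
  proof (rule tendsto_sandwich[OF _ _ tendsto_const])
    have "(\<lambda>n. m + 1 / real (Suc n)) \<longlonglongrightarrow> m + 0" by (intro tendsto_intros inv)
    then show "(\<lambda>n. m + 1 / real (Suc n)) \<longlonglongrightarrow> m" by simp
  qed (use v m in \<open>auto intro!: always_eventually less_imp_le\<close>)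
  have quad: "b = 0" if c: "0 \<le> c" and q: "\<And>t::real. 0 \<le> 2 * t * b + t\<^sup>2 * c" for b c :: real
  proof (rule ccontr)
    assume "b \<noteq> 0"
    define t where "t = - b / (c + 1)"
    have "2 * t * b + t\<^sup>2 * c = - (b\<^sup>2 * (c + 2)) / (c + 1)\<^sup>2"
      using c by (simp add: t_def power2_eq_square divide_simps) (simp add: algebra_simps)
    moreover have "0 < b\<^sup>2 * (c + 2)" using \<open>b \<noteq> 0\<close> c by simp
    then have "- (b\<^sup>2 * (c + 2)) / (c + 1)\<^sup>2 < 0" using c by (intro divide_neg_pos) auto
    ultimately show False using q[of t] by linarith
  qed
  have re: "Re (L u) = Re (\<integral>x. u x * cnj (g x) \<partial>M)" if u: "u \<in> V" for u
  proof -
    have us: "u \<in> sqint M" using u V by auto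
    have "0 \<le> 2 * t * (Re (\<integral>x. g x * cnj (u x) \<partial>M) - Re (L u)) + t\<^sup>2 * (nrm M u)\<^sup>2" for t :: real
    proof -
      define tu where "tu x = complex_of_real t * u x" for x
      have tu: "tu \<in> V" "tu \<in> sqint M" unfolding tu_def using Vmul[OF u] sqint_cmult[OF us] by auto
      have "J (\<lambda>x. v n x + tu x) = J (v n) + 2 * t * (Re (\<integral>x. v n x * cnj (u x) \<partial>M) - Re (L u)) + t\<^sup>2 * (nrm M u)\<^sup>2" for n
      proof -
        have "(\<integral>x. v n x * cnj (tu x) \<partial>M) = complex_of_real t * (\<integral>x. v n x * cnj (u x) \<partial>M)"
          unfolding integral_mult_right_zero[symmetric] by (simp add: tu_def mult_ac)
        moreover have "L (\<lambda>x. v n x + tu x) = L (v n) + complex_of_real t * L u"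
          using Ladd[OF v(1) tu(1)] Lmul[OF u] by (simp add: tu_def[abs_def])
        moreover have "(nrm M tu)\<^sup>2 = t\<^sup>2 * (nrm M u)\<^sup>2"
          unfolding tu_def nrm_cmult by (simp add: power_mult_distrib)
        ultimately show ?thesis
          unfolding J_def nrm_expand[OF vs tu(2)] by (simp add: algebra_simps)
      qed
      then have ge: "m \<le> J (v n) + 2 * t * (Re (\<integral>x. v n x * cnj (u x) \<partial>M) - Re (L u)) + t\<^sup>2 * (nrm M u)\<^sup>2" for n
        using m[OF Vadd[OF v(1) tu(1)], of n] by simp
      have "(\<lambda>n. J (v n) + 2 * t * (Re (\<integral>x. v n x * cnj (u x) \<partial>M) - Re (L u)) + t\<^sup>2 * (nrm M u)\<^sup>2) \<longlonglongrightarrow>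
          m + 2 * t * (Re (\<integral>x. g x * cnj (u x) \<partial>M) - Re (L u)) + t\<^sup>2 * (nrm M u)\<^sup>2"
        by (intro tendsto_intros Jm sqint_mult_tendsto[OF vs g sqint_cnj[OF us]])
      then show ?thesis using LIMSEQ_le_const[OF _] ge by fastforce
    qed
    then have "Re (\<integral>x. g x * cnj (u x) \<partial>M) - Re (L u) = 0" by (intro quad[of "(nrm M u)\<^sup>2"]) auto
    moreover have "(\<integral>x. u x * cnj (g x) \<partial>M) = cnj (\<integral>x. g x * cnj (u x) \<partial>M)"
      using Bochner_Integration.integral_cnj[of M "\<lambda>x. g x * cnj (u x)"] by (simp add: mult.commute)
    ultimately show ?thesis by simp
  qed
  have rep: "L u = (\<integral>x. u x * cnj (g x) \<partial>M)" if u: "u \<in> V" for u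
  proof (rule complex_eqI)
    show "Re (L u) = Re (\<integral>x. u x * cnj (g x) \<partial>M)" by (rule re[OF u])
    have "(\<integral>x. \<i> * u x * cnj (g x) \<partial>M) = \<i> * (\<integral>x. u x * cnj (g x) \<partial>M)"
      unfolding integral_mult_right_zero[symmetric] by (simp add: mult.assoc)
    then show "Im (L u) = Im (\<integral>x. u x * cnj (g x) \<partial>M)"
      using re[OF Vmul[OF u, of \<i>]] Lmul[OF u, of \<i>] by simp
  qed
  have "nrm M g * nrm M g \<le> K * nrm M g"
  proof (rule LIMSEQ_le)
    show "(\<lambda>n. K * nrm M (v n)) \<longlonglongrightarrow> K * nrm M g" by (intro tendsto_intros nrm_tendsto[OF vs g])
    have gg: "(\<integral>x. g x * cnj (g x) \<partial>M) = complex_of_real (nrm M g * nrm M g)"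
      using nrm_power2[of M g] by (simp add: complex_norm_square[symmetric] power2_eq_square flip: of_real_mult)
    have "(\<lambda>n. Re (\<integral>x. v n x * cnj (g x) \<partial>M)) \<longlonglongrightarrow> Re (\<integral>x. g x * cnj (g x) \<partial>M)"
      by (intro tendsto_intros sqint_mult_tendsto[OF vs g sqint_cnj[OF g(1)]])
    then show "(\<lambda>n. Re (\<integral>x. v n x * cnj (g x) \<partial>M)) \<longlonglongrightarrow> nrm M g * nrm M g" by (simp add: gg)
    show "\<exists>N. \<forall>n\<ge>N. Re (\<integral>x. v n x * cnj (g x) \<partial>M) \<le> K * nrm M (v n)"
      using K(2)[OF v(1)] rep[OF v(1)] complex_Re_le_cmod by (metis order_trans)
  qed
  then have "nrm M g \<le> K" using K(1) by (cases "nrm M g = 0") (auto simp: mult_le_cancel_right)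
  then show ?thesis using rep g(1) by (intro bexI[of _ "\<lambda>x. cnj (g x)"]) (auto intro: sqint_cnj)
qed

text \<open>
  Approximate \<open>cnj f\<close>, at which the pairing equals the square of the norm.
\<close>

lemma dense_dual_bound:
  assumes f: "f \<in> sqint M" and V: "V \<subseteq> sqint M" and c: "0 \<le> c"
    and dense: "\<And>e. 0 < e \<Longrightarrow> \<exists>v\<in>V. nrm M (\<lambda>x. cnj (f x) - v x) < e"
    and le: "\<And>v. v \<in> V \<Longrightarrow> cmod (\<integral>x. f x * v x \<partial>M) \<le> c * nrm M v"
  shows "nrm M f \<le> c"
proof -
  have "nrm M f * nrm M f \<le> c * nrm M f + e" if e: "0 < e" for e
  proof -
    define e' where "e' = e / (nrm M f + c + 1)"
    have pos: "0 < nrm M f + c + 1" using c by (simp add: add_nonneg_pos)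
    then have e': "0 < e'" using e by (simp add: e'_def)
    from dense[OF this] obtain v where v: "v \<in> V" "nrm M (\<lambda>x. cnj (f x) - v x) < e'" by blast
    have vs: "v \<in> sqint M" using v V by auto
    note fc = sqint_cnj[OF f]
    have "complex_of_real (nrm M f * nrm M f) = (\<integral>x. f x * cnj (f x) \<partial>M)"
      using nrm_power2[of M f] by (simp add: complex_norm_square[symmetric] power2_eq_square flip: of_real_mult)
    also have "\<dots> = (\<integral>x. f x * v x \<partial>M) + (\<integral>x. f x * (cnj (f x) - v x) \<partial>M)"
      using sqint_mult(1)[OF f vs] sqint_mult(1)[OF f sqint_diff[OF fc vs]]
      by (subst Bochner_Integration.integral_add[symmetric]) (auto simp: algebra_simps)
    finally have "nrm M f * nrm M f = cmod ((\<integral>x. f x * v x \<partial>M) + (\<integral>x. f x * (cnj (f x) - v x) \<partial>M))"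
      by (metis norm_of_real abs_of_nonneg mult_nonneg_nonneg nrm_nonneg)
    also have "\<dots> \<le> c * nrm M v + nrm M f * nrm M (\<lambda>x. cnj (f x) - v x)"
      using le[OF v(1)] sqint_mult(3)[OF f sqint_diff[OF fc vs]] by (intro order_trans[OF norm_triangle_ineq]) auto
    also have "\<dots> \<le> c * (nrm M f + e') + nrm M f * e'"
    proof (intro add_mono mult_left_mono c)
      have "nrm M v \<le> nrm M (\<lambda>x. cnj (f x)) + nrm M (\<lambda>x. cnj (f x) - v x)"
        using nrm_triangle_diff[OF fc sqint_diff[OF fc vs]] by simp
      then show "nrm M v \<le> nrm M f + e'" using v by simp
    qed (use v in auto)
    also have "\<dots> \<le> c * nrm M f + (nrm M f + c + 1) * e'" using e' by (simp add: algebra_simps)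
    also have "(nrm M f + c + 1) * e' = e" using pos by (simp add: e'_def)
    finally show ?thesis .
  qed
  then have "nrm M f * nrm M f \<le> c * nrm M f" by (rule field_le_epsilon)
  then show ?thesis using c by (cases "nrm M f = 0") (auto simp: mult_le_cancel_right)
qed

lemma L2_sqint: "L2 d U = sqint (leb d U)"
  by (auto simp: L2_def l2norm_def sqint_def)

lemma l2norm_nrm: "f \<in> sqint (leb d U) \<Longrightarrow> l2norm d U f = ennreal (nrm (leb d U) f)"
  by (simp add: l2norm_def sqint_nn esqrt_ennreal)

section \<open>Smooth functions of coordinates\<close>

text \<open>
  The functions \<open>t\<^bsup>-m\<^esup> e\<^bsup>-1/t\<^esup>\<close> for \<open>t > 0\<close>, extended by zero. The family is closed under
  differentiation up to linear combinations, which is all that is needed to build smooth cutoffs.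
\<close>

definition flat :: "nat \<Rightarrow> real \<Rightarrow> real" where
  "flat m t = (if t \<le> 0 then 0 else inverse t ^ m * exp (- inverse t))"

lemma flat_nonneg: "0 \<le> flat m t" by (simp add: flat_def)
lemma flat_pos: "0 < t \<Longrightarrow> 0 < flat m t" by (simp add: flat_def)
lemma flat_zero: "t \<le> 0 \<Longrightarrow> flat m t = 0" by (simp add: flat_def)

lemma flat_tendsto_0: "(flat m \<longlongrightarrow> 0) (at 0)"
proof (rule filterlim_split_at)
  show "(flat m \<longlongrightarrow> 0) (at_left 0)"
    by (rule tendsto_eventually) (auto simp: flat_def eventually_at_filter)
  have "((\<lambda>t. inverse t ^ m / exp (inverse t)) \<longlongrightarrow> (0::real)) (at_right 0)"
    by (rule filterlim_compose[OF tendsto_power_div_exp_0 filterlim_inverse_at_top_right])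
  moreover have "\<forall>\<^sub>F t in at_right 0. inverse t ^ m / exp (inverse t) = flat m t"
    by (auto simp: flat_def eventually_at_filter exp_minus divide_inverse)
  ultimately show "(flat m \<longlongrightarrow> 0) (at_right 0)" by (rule Lim_transform_eventually)
qed

lemma flat_DERIV: "(flat m has_real_derivative flat (m + 2) t - m * flat (m + 1) t) (at t)"
proof -
  consider "t < 0" | "t = 0" | "0 < t" by linarith
  then show ?thesis
  proof cases
    case 1
    have "((\<lambda>t. 0) has_real_derivative flat (m + 2) t - m * flat (m + 1) t) (at t)"
      using 1 by (simp add: flat_def)
    then show ?thesis
      by (rule has_field_derivative_transform_within_open[of _ _ _ "{..<0}"]) (use 1 in \<open>auto simp: flat_def\<close>)
  next
    case 2
    have "((\<lambda>h. (flat m (0 + h) - flat m 0) / h) \<longlongrightarrow> 0) (at 0)"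
    proof (rule Lim_transform_eventually[OF flat_tendsto_0[of "m + 1"]])
      show "\<forall>\<^sub>F h in at 0. flat (m + 1) h = (flat m (0 + h) - flat m 0) / h"
        by (auto simp: eventually_at_filter flat_def divide_inverse)
    qed
    then show ?thesis using 2 by (simp add: DERIV_def flat_def)
  next
    case 3
    have "((\<lambda>t. inverse t ^ m * exp (- inverse t)) has_real_derivative flat (m + 2) t - m * flat (m + 1) t) (at t)"
    proof (cases m)
      case 0
      then show ?thesis using 3
        by (auto intro!: derivative_eq_intros simp: flat_def power2_eq_square field_simps)
    next
      case (Suc k)
      then show ?thesis using 3
        by (cases k) (auto intro!: derivative_eq_intros simp: flat_def power2_eq_square field_simps,
          metis Suc_pred neq0_conv power_Suc)
    qed
    then show ?thesis
      by (rule has_field_derivative_transform_within_open[of _ _ _ "{0<..}"]) (use 3 in \<open>auto simp: flat_def\<close>)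
  qed
qed

text \<open>
  Enough smooth functions of finitely many coordinates, given by expressions. The class is closed under partial
  differentiation by \<open>smr_partial\<close>, so that smoothness needs no induction on the order of the derivative.
\<close>

inductive smr :: "(pt \<Rightarrow> real) \<Rightarrow> bool" where
  const: "smr (\<lambda>x. r)"
| coord: "smr (\<lambda>x. x i)"
| add: "smr f \<Longrightarrow> smr g \<Longrightarrow> smr (\<lambda>x. f x + g x)"
| mult: "smr f \<Longrightarrow> smr g \<Longrightarrow> smr (\<lambda>x. f x * g x)"
| flat: "smr f \<Longrightarrow> smr (\<lambda>x. flat m (f x))"
| inverse: "smr f \<Longrightarrow> (\<And>x. 0 < f x) \<Longrightarrow> smr (\<lambda>x. inverse (f x))"

lemma smr_diff: "smr f \<Longrightarrow> smr g \<Longrightarrow> smr (\<lambda>x. f x - g x)"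
  using smr.add[OF _ smr.mult[OF smr.const[of "-1"]]] by fastforce

lemma smr_sum: "(\<And>i. i \<in> I \<Longrightarrow> smr (f i)) \<Longrightarrow> smr (\<lambda>x. \<Sum>i\<in>I. f i x)"
  by (induction I rule: infinite_finite_induct) (auto intro: smr.intros)

lemma smr_prod: "(\<And>i. i \<in> I \<Longrightarrow> smr (f i)) \<Longrightarrow> smr (\<lambda>x. \<Prod>i\<in>I. f i x)"
  by (induction I rule: infinite_finite_induct) (auto intro: smr.intros)

lemma smr_power: "smr f \<Longrightarrow> smr (\<lambda>x. f x ^ k)"
  by (induction k) (auto intro: smr.intros)

lemma smr_continuous: "smr f \<Longrightarrow> continuous_on UNIV f"
proof (induction rule: smr.induct)
  case (flat f m)
  have "continuous_on UNIV (flat m)"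
    using DERIV_isCont[OF flat_DERIV] by (simp add: continuous_at_imp_continuous_on)
  from continuous_on_compose2[OF this flat.IH] show ?case by simp
next
  case (inverse f)
  then show ?case by (intro continuous_intros) (auto simp: less_imp_neq[THEN not_sym])
qed (auto intro!: continuous_intros)

lemma smr_partial:
  "smr f \<Longrightarrow> \<exists>g. smr g \<and> (\<forall>x t. ((\<lambda>t. f (x(i := t))) has_real_derivative g (x(i := t))) (at t))"
proof (induction rule: smr.induct)
  case (const r)
  then show ?case by (intro exI[of _ "\<lambda>x. 0"]) (auto intro: smr.intros)
next
  case (coord j)
  then show ?case
    by (intro exI[of _ "\<lambda>x. if j = i then 1 else 0"]) (auto intro: smr.intros)
next
  case (add f g)
  then obtain f' g' where "smr f'" "smr g'"
    "\<forall>x t. ((\<lambda>t. f (x(i := t))) has_real_derivative f' (x(i := t))) (at t)"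
    "\<forall>x t. ((\<lambda>t. g (x(i := t))) has_real_derivative g' (x(i := t))) (at t)" by blast
  then show ?case
    by (intro exI[of _ "\<lambda>x. f' x + g' x"] conjI smr.add allI DERIV_add) blast+
next
  case (mult f g)
  then obtain f' g' where "smr f'" "smr g'"
    "\<forall>x t. ((\<lambda>t. f (x(i := t))) has_real_derivative f' (x(i := t))) (at t)"
    "\<forall>x t. ((\<lambda>t. g (x(i := t))) has_real_derivative g' (x(i := t))) (at t)" by blast
  then show ?case using mult
    by (intro exI[of _ "\<lambda>x. f' x * g x + g' x * f x"] conjI smr.add smr.mult allI DERIV_mult) blast+
next
  case (flat f m)
  then obtain f' where f': "smr f'"
    "\<forall>x t. ((\<lambda>t. f (x(i := t))) has_real_derivative f' (x(i := t))) (at t)" by blast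
  show ?case
  proof (intro exI[of _ "\<lambda>x. (flat (m + 2) (f x) - m * flat (m + 1) (f x)) * f' x"] conjI allI)
    show "smr (\<lambda>x. (flat (m + 2) (f x) - m * flat (m + 1) (f x)) * f' x)"
      using flat f' by (intro smr.mult smr_diff smr.flat smr.const) auto
    show "((\<lambda>t. flat m (f (x(i := t)))) has_real_derivative
        (flat (m + 2) (f (x(i := t))) - m * flat (m + 1) (f (x(i := t)))) * f' (x(i := t))) (at t)" for x t
      using f'(2) by (intro DERIV_chain2[OF flat_DERIV]) auto
  qed
next
  case (inverse f)
  then obtain f' where f': "smr f'"
    "\<forall>x t. ((\<lambda>t. f (x(i := t))) has_real_derivative f' (x(i := t))) (at t)" by blast
  show ?case
  proof (intro exI[of _ "\<lambda>x. (-1) * (inverse (f x) * f' x * inverse (f x))"] conjI allI)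
    show "smr (\<lambda>x. (-1) * (inverse (f x) * f' x * inverse (f x)))"
      using inverse f' by (intro smr.mult smr.inverse smr.const) auto
    show "((\<lambda>t. inverse (f (x(i := t)))) has_real_derivative
        (-1) * (inverse (f (x(i := t))) * f' (x(i := t)) * inverse (f (x(i := t))))) (at t)" for x t
      using DERIV_inverse'[of "\<lambda>t. f (x(i := t))" "f' (x(i := t))" t UNIV] f'(2) inverse.hyps(2)[of "x(i := t)"] by auto
  qed
qed

definition smc :: "(pt \<Rightarrow> complex) \<Rightarrow> bool" where
  "smc f \<longleftrightarrow> smr (\<lambda>x. Re (f x)) \<and> smr (\<lambda>x. Im (f x))"

lemma smc_of_real: "smr f \<Longrightarrow> smc (\<lambda>x. complex_of_real (f x))"
  by (simp add: smc_def smr.const)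

lemma smc_mult: "smc f \<Longrightarrow> smc g \<Longrightarrow> smc (\<lambda>x. f x * g x)"
  by (auto simp: smc_def intro!: smr.intros smr_diff)

lemma smc_partial:
  assumes "smc f"
  shows "\<exists>g. smc g \<and> (\<forall>x t. ((\<lambda>t. f (x(i := t))) has_vector_derivative g (x(i := t))) (at t))"
proof -
  obtain u v where "smr u" "smr v"
    "\<forall>x t. ((\<lambda>t. Re (f (x(i := t)))) has_real_derivative u (x(i := t))) (at t)"
    "\<forall>x t. ((\<lambda>t. Im (f (x(i := t)))) has_real_derivative v (x(i := t))) (at t)"
    using assms smr_partial[of "\<lambda>x. Re (f x)" i] smr_partial[of "\<lambda>x. Im (f x)" i] by (auto simp: smc_def)
  then show ?thesis
    by (intro exI[of _ "\<lambda>x. Complex (u x) (v x)"]) (simp add: smc_def has_vector_derivative_complex_iff)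
qed

lemma smc_continuous: "smc f \<Longrightarrow> continuous_on UNIV f"
proof -
  assume "smc f"
  then have "continuous_on UNIV (\<lambda>x. complex_of_real (Re (f x)) + \<i> * complex_of_real (Im (f x)))"
    by (intro continuous_intros smr_continuous) (auto simp: smc_def)
  then show ?thesis by (simp add: complex_eq[symmetric])
qed

section \<open>Derivatives on coordinate space\<close>

lemma Rsp_upd: "x \<in> Rsp d \<Longrightarrow> i < d \<Longrightarrow> x(i := t) \<in> Rsp d"
  by (auto simp: Rsp_def PiE_def extensional_def)

lemma partial_Rsp: "x \<in> Rsp d \<Longrightarrow> i < d \<Longrightarrow> partial (Rsp d) i f x = vector_derivative (\<lambda>t. f (x(i := t))) (at (x i))"
  by (simp add: partial_def Rsp_upd)

lemma partial_eqI:
  assumes "x \<in> Rsp d" "i < d" "((\<lambda>t. f (x(i := t))) has_vector_derivative D) (at (x i))"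
  shows "partial (Rsp d) i f x = D"
  using assms by (simp add: partial_Rsp vector_derivative_at)

lemma partial_cong:
  assumes "\<And>x. x \<in> Rsp d \<Longrightarrow> f x = g x" "x \<in> Rsp d" "i < d"
  shows "partial (Rsp d) i f x = partial (Rsp d) i g x"
  using assms by (simp add: partial_Rsp Rsp_upd)

lemma Cm_cong:
  assumes "\<And>x. x \<in> Rsp d \<Longrightarrow> f x = g x"
  shows "Cm_on d (Rsp d) m f \<longleftrightarrow> Cm_on d (Rsp d) m g"
  using assms
proof (induction m arbitrary: f g)
  case 0
  then show ?case by (simp cong: continuous_on_cong)
next
  case (Suc m)
  have "continuous_on (Rsp d) f \<longleftrightarrow> continuous_on (Rsp d) g"
    by (rule continuous_on_cong) (use Suc.prems in auto)
  moreover have "Cm_on d (Rsp d) m (partial (Rsp d) i f) \<longleftrightarrow> Cm_on d (Rsp d) m (partial (Rsp d) i g)" if "i < d" for i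
    by (rule Suc.IH) (use partial_cong[of d f g] Suc.prems that in blast)
  moreover have "(\<lambda>t. f (x(i := t))) = (\<lambda>t. g (x(i := t)))" if "i < d" "x \<in> Rsp d" for x i
    using Suc.prems[OF Rsp_upd[OF \<open>x \<in> Rsp d\<close> \<open>i < d\<close>]] by presburger
  ultimately show ?case by auto
qed

text \<open>
  Smoothness on the whole coordinate space, as required of test functions.
\<close>

definition Cinf :: "nat \<Rightarrow> (pt \<Rightarrow> complex) \<Rightarrow> bool" where
  "Cinf d f \<longleftrightarrow> (\<forall>m. Cm_on d (Rsp d) m f)"

lemma Cinf_continuous: "Cinf d f \<Longrightarrow> continuous_on (Rsp d) f"
  unfolding Cinf_def by (metis Cm_on.simps(1))

lemma Cinf_partial: "Cinf d f \<Longrightarrow> i < d \<Longrightarrow> Cinf d (partial (Rsp d) i f)"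
  unfolding Cinf_def by (meson Cm_on.simps(2))

lemma Cinf_has_partial:
  assumes "Cinf d f" "i < d" "x \<in> Rsp d"
  shows "((\<lambda>t. f (x(i := t))) has_vector_derivative partial (Rsp d) i f (x(i := s))) (at s)"
proof -
  have x: "x(i := s) \<in> Rsp d" using assms by (simp add: Rsp_upd)
  have "Cm_on d (Rsp d) 1 f" using assms(1) unfolding Cinf_def by blast
  then have "(\<lambda>t. f (x(i := s, i := t))) differentiable (at ((x(i := s)) i) within {t. x(i := s, i := t) \<in> Rsp d})"
    using assms(2) x unfolding One_nat_def Cm_on.simps by blast
  then have "(\<lambda>t. f (x(i := t))) differentiable (at s)"
    using assms by (simp add: Rsp_upd)
  then show ?thesis using x assms by (simp add: partial_Rsp vector_derivative_works)
qed

text \<open>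
  Coinduction: a class of continuous functions closed under partial derivatives consists of smooth functions.
\<close>

lemma CinfI:
  assumes "P f" and "\<And>f. P f \<Longrightarrow> continuous_on (Rsp d) f"
    and "\<And>f i. P f \<Longrightarrow> i < d \<Longrightarrow> \<exists>g. P g \<and> (\<forall>x\<in>Rsp d. ((\<lambda>t. f (x(i := t))) has_vector_derivative g x) (at (x i)))"
  shows "Cinf d f"
proof -
  have "Cm_on d (Rsp d) m f" for m
    using assms(1)
  proof (induction m arbitrary: f)
    case 0
    then show ?case using assms(2) by simp
  next
    case (Suc m)
    have "(\<forall>x\<in>Rsp d. (\<lambda>t. f (x(i := t))) differentiable (at (x i) within {t. x(i := t) \<in> Rsp d}))
          \<and> Cm_on d (Rsp d) m (partial (Rsp d) i f)" if i: "i < d" for i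
    proof -
      obtain g where g: "P g" "\<forall>x\<in>Rsp d. ((\<lambda>t. f (x(i := t))) has_vector_derivative g x) (at (x i))"
        using assms(3)[OF Suc.prems i] by blast
      have "Cm_on d (Rsp d) m (partial (Rsp d) i f) \<longleftrightarrow> Cm_on d (Rsp d) m g"
        by (rule Cm_cong, rule partial_eqI) (use g i in auto)
      then show ?thesis using g Suc.IH i by (auto simp: Rsp_upd intro: differentiableI_vector)
    qed
    then show ?case using assms(2) Suc.prems by simp
  qed
  then show ?thesis by (simp add: Cinf_def)
qed

lemma smc_Cinf: "smc f \<Longrightarrow> Cinf d f"
proof (rule CinfI[of smc])
  fix f i assume "smc f"
  then obtain g where "smc g" "\<forall>x t. ((\<lambda>t. f (x(i := t))) has_vector_derivative g (x(i := t))) (at t)"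
    using smc_partial by blast
  then show "\<exists>g. smc g \<and> (\<forall>x\<in>Rsp d. ((\<lambda>t. f (x(i := t))) has_vector_derivative g x) (at (x i)))"
    by (metis fun_upd_triv)
qed (auto intro: continuous_on_subset[OF smc_continuous])

lemma Cinf_add:
  assumes "Cinf d f" "Cinf d g" shows "Cinf d (\<lambda>x. f x + g x)"
proof (rule CinfI[of "\<lambda>h. \<exists>f g. Cinf d f \<and> Cinf d g \<and> h = (\<lambda>x. f x + g x)"])
  fix h i assume "\<exists>f g. Cinf d f \<and> Cinf d g \<and> h = (\<lambda>x. f x + g x)" and i: "i < d"
  then obtain f g where fg: "Cinf d f" "Cinf d g" "h = (\<lambda>x. f x + g x)" by blast
  have "((\<lambda>t. h (x(i := t))) has_vector_derivative partial (Rsp d) i f x + partial (Rsp d) i g x) (at (x i))"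
    if "x \<in> Rsp d" for x
    using Cinf_has_partial[OF fg(1) i that, of "x i"] Cinf_has_partial[OF fg(2) i that, of "x i"]
    unfolding fg(3) by (intro has_vector_derivative_add) auto
  then show "\<exists>k. (\<exists>f g. Cinf d f \<and> Cinf d g \<and> k = (\<lambda>x. f x + g x)) \<and>
      (\<forall>x\<in>Rsp d. ((\<lambda>t. h (x(i := t))) has_vector_derivative k x) (at (x i)))"
    using Cinf_partial[OF fg(1) i] Cinf_partial[OF fg(2) i]
    by (intro exI[of _ "\<lambda>x. partial (Rsp d) i f x + partial (Rsp d) i g x"]) blast
qed (use assms in blast, fastforce intro: continuous_on_add Cinf_continuous)

lemma Cinf_cmult:
  assumes "Cinf d f" shows "Cinf d (\<lambda>x. c * f x)"
proof (rule CinfI[of "\<lambda>h. \<exists>f. Cinf d f \<and> h = (\<lambda>x. c * f x)"])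
  fix h i assume "\<exists>f. Cinf d f \<and> h = (\<lambda>x. c * f x)" and i: "i < d"
  then obtain f where f: "Cinf d f" "h = (\<lambda>x. c * f x)" by blast
  have "((\<lambda>t. h (x(i := t))) has_vector_derivative c * partial (Rsp d) i f x) (at (x i))"
    if "x \<in> Rsp d" for x
    using Cinf_has_partial[OF f(1) i that, of "x i"] unfolding f(2)
    by (intro has_vector_derivative_mult_right) auto
  then show "\<exists>k. (\<exists>f. Cinf d f \<and> k = (\<lambda>x. c * f x)) \<and>
      (\<forall>x\<in>Rsp d. ((\<lambda>t. h (x(i := t))) has_vector_derivative k x) (at (x i)))"
    using Cinf_partial[OF f(1) i] by (intro exI[of _ "\<lambda>x. c * partial (Rsp d) i f x"]) blast
qed (use assms in blast, fastforce intro: continuous_on_mult_left Cinf_continuous)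

lemma partial_add:
  assumes "Cinf d f" "Cinf d g" "i < d" "x \<in> Rsp d"
  shows "partial (Rsp d) i (\<lambda>x. f x + g x) x = partial (Rsp d) i f x + partial (Rsp d) i g x"
  using Cinf_has_partial[OF assms(1,3,4), of "x i"] Cinf_has_partial[OF assms(2,3,4), of "x i"] assms
  by (intro partial_eqI has_vector_derivative_add) auto

lemma partial_cmult:
  assumes "Cinf d f" "i < d" "x \<in> Rsp d"
  shows "partial (Rsp d) i (\<lambda>x. c * f x) x = c * partial (Rsp d) i f x"
  using Cinf_has_partial[OF assms, of "x i"] assms
  by (intro partial_eqI has_vector_derivative_mult_right) auto

lemma Cinf_funpow: "Cinf d f \<Longrightarrow> i < d \<Longrightarrow> Cinf d ((partial (Rsp d) i ^^ k) f)"
  by (induction k) (auto intro: Cinf_partial)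

lemma Cinf_mderiv: "Cinf d f \<Longrightarrow> k \<le> d \<Longrightarrow> Cinf d (mderiv (Rsp d) \<alpha> k f)"
  by (induction k) (auto intro: Cinf_funpow)

lemma funpow_partial_cong:
  assumes "\<And>x. x \<in> Rsp d \<Longrightarrow> f x = g x" "i < d" "x \<in> Rsp d"
  shows "(partial (Rsp d) i ^^ k) f x = (partial (Rsp d) i ^^ k) g x"
  using assms(3)
proof (induction k arbitrary: x)
  case (Suc k)
  then show ?case using partial_cong[of d _ _ x i] assms(2) by auto
qed (use assms in auto)

lemma mderiv_add:
  assumes f: "Cinf d f" and g: "Cinf d g" and k: "k \<le> d" "x \<in> Rsp d"
  shows "mderiv (Rsp d) \<alpha> k (\<lambda>x. f x + g x) x = mderiv (Rsp d) \<alpha> k f x + mderiv (Rsp d) \<alpha> k g x"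
  using k
proof (induction k arbitrary: x)
  case (Suc k)
  let ?F = "mderiv (Rsp d) \<alpha> k f" and ?G = "mderiv (Rsp d) \<alpha> k g"
  have FG: "Cinf d ?F" "Cinf d ?G" using Suc.prems f g by (auto intro: Cinf_mderiv)
  have k: "k < d" using Suc.prems by simp
  have "mderiv (Rsp d) \<alpha> (Suc k) (\<lambda>x. f x + g x) x = (partial (Rsp d) k ^^ \<alpha> k) (\<lambda>x. ?F x + ?G x) x"
    unfolding mderiv.simps by (rule funpow_partial_cong) (use Suc in auto)
  also have "\<dots> = (partial (Rsp d) k ^^ j) ?F x + (partial (Rsp d) k ^^ j) ?G x" if "j = \<alpha> k" for j
    unfolding that[symmetric] using Suc.prems(2)
  proof (induction j arbitrary: x)
    case (Suc j)
    have "(partial (Rsp d) k ^^ Suc j) (\<lambda>x. ?F x + ?G x) x =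
        partial (Rsp d) k (\<lambda>x. (partial (Rsp d) k ^^ j) ?F x + (partial (Rsp d) k ^^ j) ?G x) x"
      using partial_cong[OF Suc.IH Suc.prems k] by simp
    then show ?case using partial_add[OF Cinf_funpow[OF FG(1) k] Cinf_funpow[OF FG(2) k] k Suc.prems] by simp
  qed simp
  finally show ?case by simp
qed simp

lemma mderiv_cmult:
  assumes f: "Cinf d f" and k: "k \<le> d" "x \<in> Rsp d"
  shows "mderiv (Rsp d) \<alpha> k (\<lambda>x. c * f x) x = c * mderiv (Rsp d) \<alpha> k f x"
  using k
proof (induction k arbitrary: x)
  case (Suc k)
  let ?F = "mderiv (Rsp d) \<alpha> k f"
  have F: "Cinf d ?F" using Suc.prems f by (auto intro: Cinf_mderiv)
  have k: "k < d" using Suc.prems by simp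
  have "mderiv (Rsp d) \<alpha> (Suc k) (\<lambda>x. c * f x) x = (partial (Rsp d) k ^^ \<alpha> k) (\<lambda>x. c * ?F x) x"
    unfolding mderiv.simps by (rule funpow_partial_cong) (use Suc in auto)
  also have "\<dots> = c * (partial (Rsp d) k ^^ j) ?F x" if "j = \<alpha> k" for j
    unfolding that[symmetric] using Suc.prems(2)
  proof (induction j arbitrary: x)
    case (Suc j)
    have "(partial (Rsp d) k ^^ Suc j) (\<lambda>x. c * ?F x) x =
        partial (Rsp d) k (\<lambda>x. c * (partial (Rsp d) k ^^ j) ?F x) x"
      using partial_cong[OF Suc.IH Suc.prems k] by simp
    then show ?case using partial_cmult[OF Cinf_funpow[OF F k] k Suc.prems] by simp
  qed simp
  finally show ?case by simp
qed simp

lemma open_line: "open W \<Longrightarrow> open {t. (x(i := t)) \<in> W}" for W :: "pt set"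
proof -
  assume W: "open W"
  have "continuous_on UNIV (\<lambda>t. x(i := t))"
  proof (rule continuous_on_coordinatewise_then_product)
    fix j show "continuous_on UNIV (\<lambda>t. (x(i := t)) j)" by (cases "j = i") auto
  qed
  from open_vimage[OF W this] show ?thesis by (simp add: vimage_def)
qed

lemma partial_local:
  assumes W: "open W" and eq: "\<And>x. x \<in> W \<Longrightarrow> x \<in> Rsp d \<Longrightarrow> f x = g x"
    and x: "x \<in> W" "x \<in> Rsp d" and i: "i < d"
  shows "partial (Rsp d) i f x = partial (Rsp d) i g x"
proof -
  let ?S = "{t. x(i := t) \<in> W}"
  have "((\<lambda>t. f (x(i := t))) has_vector_derivative D) (at (x i)) \<longleftrightarrow>
      ((\<lambda>t. g (x(i := t))) has_vector_derivative D) (at (x i))" for D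
    using has_vector_derivative_transform_within_open[of _ D "x i" ?S] open_line[OF W, of x i] x eq i
    by (smt (verit) Rsp_upd fun_upd_triv mem_Collect_eq)
  then show ?thesis using x i by (simp add: partial_Rsp vector_derivative_def)
qed

text \<open>
  Derivatives at a point depend only on the values nearby. This shows that multiplying by a cutoff does not change derivatives
  where the cutoff is one.
\<close>

lemma mderiv_local:
  assumes W: "open W" and eq: "\<And>x. x \<in> W \<Longrightarrow> x \<in> Rsp d \<Longrightarrow> f x = g x"
    and x: "x \<in> W" "x \<in> Rsp d" and k: "k \<le> d"
  shows "mderiv (Rsp d) \<alpha> k f x = mderiv (Rsp d) \<alpha> k g x"
  using x k
proof (induction k arbitrary: x)
  case (Suc k)
  have "(partial (Rsp d) k ^^ j) (mderiv (Rsp d) \<alpha> k f) x = (partial (Rsp d) k ^^ j) (mderiv (Rsp d) \<alpha> k g) x" for j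
    using Suc.prems(1,2)
  proof (induction j arbitrary: x)
    case (Suc j)
    then show ?case using partial_local[OF W, of d _ _ x k] \<open>Suc k \<le> d\<close> by auto
  qed (use Suc in auto)
  then show ?case by simp
qed (use eq in auto)

lemma Cinf_bounded:
  assumes "Cinf d f" "compact K" "K \<subseteq> Rsp d" shows "\<exists>C. \<forall>x\<in>K. cmod (f x) \<le> C"
proof -
  have "compact (f ` K)"
    by (rule compact_continuous_image[OF continuous_on_subset[OF Cinf_continuous]]) (use assms in auto)
  then show ?thesis using bounded_norm_le_SUP_norm compact_imp_bounded bounded_iff by (metis imageI)
qed

lemma test_fun_iff: "\<psi> \<in> test_fun d U \<longleftrightarrow>
    Cinf d \<psi> \<and> (\<exists>K. compact K \<and> K \<subseteq> U \<and> (\<forall>x\<in>Rsp d - K. \<psi> x = 0))"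
  by (simp add: test_fun_def Cinf_def)

lemma test_fun_zero: "(\<lambda>x. 0) \<in> test_fun d U"
  using smc_Cinf[OF smc_of_real[OF smr.const[of 0]]] by (auto simp: test_fun_iff intro!: exI[of _ "{}"])

lemma test_fun_add: "f \<in> test_fun d U \<Longrightarrow> g \<in> test_fun d U \<Longrightarrow> (\<lambda>x. f x + g x) \<in> test_fun d U"
  unfolding test_fun_iff
  by (safe intro!: Cinf_add, rule_tac x="K \<union> Ka" in exI) (auto intro: compact_Un)

lemma test_fun_cmult: "f \<in> test_fun d U \<Longrightarrow> (\<lambda>x. c * f x) \<in> test_fun d U"
  unfolding test_fun_iff by (auto intro!: Cinf_cmult)

section \<open>Lebesgue measure on coordinate space\<close>

abbreviation lb :: "nat \<Rightarrow> pt measure" where "lb d \<equiv> \<Pi>\<^sub>M i\<in>{..<d}. lborel"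

interpretation lbs: product_sigma_finite "\<lambda>_::nat. lborel :: real measure"
  by (simp add: product_sigma_finite_def lborel.sigma_finite_measure_axioms)

lemma space_lb: "space (lb d) = Rsp d"
  by (simp add: space_PiM Rsp_def)

lemma space_leb: "U \<subseteq> Rsp d \<Longrightarrow> space (leb d U) = U"
  by (auto simp: leb_def space_restrict_space space_lb)

lemma measurable_pt: "(\<lambda>x. x) \<in> lb d \<rightarrow>\<^sub>M borel"
proof (rule measurable_coordinatewise_then_product)
  fix i
  show "(\<lambda>x. x i) \<in> borel_measurable (lb d)"
  proof (cases "i < d")
    case True
    then have "(\<lambda>x. x i) \<in> lb d \<rightarrow>\<^sub>M lborel" by (intro measurable_component_singleton) auto
    then show ?thesis by simp
  next
    case False
    have "(\<lambda>x. x i) \<in> borel_measurable (lb d) \<longleftrightarrow> (\<lambda>x. undefined::real) \<in> borel_measurable (lb d)"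
      by (rule measurable_cong) (use False in \<open>auto simp: space_PiM PiE_def extensional_def\<close>)
    then show ?thesis by simp
  qed
qed

lemma measurable_restrict_pt: "(\<lambda>x. restrict x {..<d}) \<in> borel \<rightarrow>\<^sub>M lb d"
  by (rule measurable_restrict) simp

lemma leb_continuous:
  assumes "U \<subseteq> Rsp d" "continuous_on U f"
  shows "f \<in> borel_measurable (leb d U)"
proof -
  have "(\<lambda>x. x) \<in> leb d U \<rightarrow>\<^sub>M restrict_space borel U"
    unfolding leb_def by (rule measurable_restrict_space3[OF measurable_pt]) auto
  from measurable_compose[OF this borel_measurable_continuous_on_restrict[OF assms(2)]] show ?thesis .
qed

lemma sets_lb_borel: "W \<in> sets borel \<Longrightarrow> W \<inter> Rsp d \<in> sets (lb d)"
  using measurable_sets[OF measurable_pt, of W d] by (simp add: space_lb)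

lemma sets_lb_closed: "closed K \<Longrightarrow> K \<subseteq> Rsp d \<Longrightarrow> K \<in> sets (lb d)"
  using sets_lb_borel[of K d] by (simp add: Int_absorb2)

lemma sets_leb_borel:
  assumes "U \<subseteq> Rsp d" "A \<in> sets (leb d U)"
  obtains A' where "A' \<in> sets borel" "A = A' \<inter> U"
proof -
  obtain A1 where A1: "A1 \<in> sets (lb d)" "A = A1 \<inter> U"
    using assms(2) by (auto simp: leb_def sets_restrict_space)
  define A' where "A' = (\<lambda>x. restrict x {..<d}) -` A1"
  have "A' \<in> sets borel" using measurable_sets[OF measurable_restrict_pt A1(1)] by (simp add: A'_def)
  moreover have "A = A' \<inter> U"
  proof -
    have "restrict x {..<d} = x" if "x \<in> U" for x
      using that assms(1) by (auto simp: Rsp_def PiE_def extensional_restrict)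
    then show ?thesis using A1 by (auto simp: A'_def)
  qed
  ultimately show ?thesis by (rule that)
qed

lemma continuous_edist: "continuous_on S (edist d c)"
  unfolding edist_def L2_set_def
  by (rule continuous_on_subset[OF _ subset_UNIV]) (intro continuous_intros continuous_on_product_coordinates)

lemma abs_le_edist: "i < d \<Longrightarrow> \<bar>x i - c i\<bar> \<le> edist d c x"
proof -
  assume "i < d"
  then have "\<bar>c i - x i\<bar> \<le> L2_set (\<lambda>i. \<bar>c i - x i\<bar>) {..<d}" by (intro member_le_L2_set) auto
  then show ?thesis by (simp add: edist_def L2_set_def abs_minus_commute)
qed

lemma edist_nonneg [simp]: "0 \<le> edist d x y" by (simp add: edist_def)

lemma edist_commute: "edist d x y = edist d y x"
  unfolding edist_def L2_set_def by (intro arg_cong[of _ _ sqrt] sum.cong refl power2_commute)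

definition pbox :: "nat \<Rightarrow> pt \<Rightarrow> real \<Rightarrow> pt set" where
  "pbox d c \<rho> = {x \<in> Rsp d. \<forall>i<d. \<bar>x i - c i\<bar> \<le> \<rho>}"

lemma box_PiE: "pbox d c \<rho> = (\<Pi>\<^sub>E i\<in>{..<d}. {c i - \<rho>..c i + \<rho>})"
proof -
  have "\<bar>t - s\<bar> \<le> \<rho> \<longleftrightarrow> t \<in> {s - \<rho>..s + \<rho>}" for t s by auto
  then show ?thesis unfolding pbox_def Rsp_def PiE_iff set_eq_iff by (simp add: Ball_def) blast
qed

lemma compact_box: "compact (pbox d c \<rho>)"
proof -
  have "pbox d c \<rho> = PiE UNIV (\<lambda>i. if i < d then {c i - \<rho>..c i + \<rho>} else {undefined})"
  proof (rule set_eqI)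
    fix x :: pt
    have "(\<forall>i. x i \<in> (if P i then S i else {u})) \<longleftrightarrow> (\<forall>i. P i \<longrightarrow> x i \<in> S i) \<and> (\<forall>i. \<not> P i \<longrightarrow> x i = u)" for P S u
      by (metis singleton_iff)
    then show "x \<in> pbox d c \<rho> \<longleftrightarrow> x \<in> PiE UNIV (\<lambda>i. if i < d then {c i - \<rho>..c i + \<rho>} else {undefined})"
      unfolding box_PiE PiE_iff extensional_def by (simp add: Ball_def)
  qed
  moreover have "compactin (product_topology (\<lambda>i::nat. euclidean) UNIV)
      (PiE UNIV (\<lambda>i. if i < d then {c i - \<rho>..c i + \<rho>} else {undefined}))"
    by (simp add: compactin_PiE)
  ultimately show ?thesis by (simp add: euclidean_product_topology)
qed

lemma box_subset: "pbox d c \<rho> \<subseteq> Rsp d" by (auto simp: pbox_def)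

lemma emeasure_box: "emeasure (lb d) (pbox d c \<rho>) = ennreal (max 0 (2 * \<rho>)) ^ d"
proof -
  have "emeasure (lb d) (pbox d c \<rho>) = (\<Prod>i<d. emeasure lborel {c i - \<rho>..c i + \<rho>})"
    unfolding box_PiE by (rule lbs.emeasure_PiM) auto
  also have "\<dots> = (\<Prod>i<d. ennreal (max 0 (2 * \<rho>)))"
    by (intro prod.cong refl) (auto simp: emeasure_lborel_Icc_eq max_def)
  finally show ?thesis by simp
qed

text \<open>Bounded measurable sets.\<close>

text \<open>
  Bounded measurable subsets of the coordinate space.
\<close>

definition bset :: "nat \<Rightarrow> pt set \<Rightarrow> bool" where
  "bset d U \<longleftrightarrow> U \<in> sets (lb d) \<and> (\<exists>c \<rho>. U \<subseteq> pbox d c \<rho>)"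

lemma bset_Rsp: "bset d U \<Longrightarrow> U \<subseteq> Rsp d" by (meson bset_def box_subset order_trans)

lemma emeasure_leb: "bset d U \<Longrightarrow> A \<subseteq> U \<Longrightarrow> emeasure (leb d U) A = emeasure (lb d) A"
  using bset_Rsp[of d U] unfolding leb_def
  by (intro emeasure_restrict_space) (auto simp: bset_def space_lb Int_absorb2)

lemma finite_leb:
  assumes "bset d U" shows "finite_measure (leb d U)"
proof (rule finite_measureI)
  obtain c \<rho> where U: "U \<subseteq> pbox d c \<rho>" using assms by (auto simp: bset_def)
  have "emeasure (leb d U) U \<le> emeasure (lb d) (pbox d c \<rho>)"
    using U by (simp add: emeasure_leb[OF assms] emeasure_mono sets_lb_closed box_subset compact_imp_closed compact_box)
  then show "emeasure (leb d U) (space (leb d U)) \<noteq> \<infinity>"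
    using bset_Rsp[OF assms] by (auto simp: space_leb emeasure_box top_unique power_eq_top_ennreal)
qed

lemma bset_oball: "c \<in> Rsp d \<Longrightarrow> bset d (oball d c a)"
  unfolding bset_def
proof (intro conjI exI)
  have "open {x. edist d c x < a}"
    by (rule open_Collect_less[OF continuous_edist continuous_on_const])
  then show "oball d c a \<in> sets (lb d)"
    using sets_lb_borel[of "{x. edist d c x < a}" d] by (auto simp: oball_def Int_def conj_commute)
  show "oball d c a \<subseteq> pbox d c a"
  proof
    fix x assume x: "x \<in> oball d c a"
    have "\<bar>x i - c i\<bar> \<le> a" if "i < d" for i
      using abs_le_edist[OF that, of x c] x by (simp add: oball_def)
    then show "x \<in> pbox d c a" using x by (simp add: oball_def pbox_def)
  qed
qed

lemma continuous_coord: "continuous_on S (\<lambda>x::pt. x i)"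
  by (rule continuous_on_subset[OF continuous_on_product_coordinates]) simp

lemma bset_cube: "bset d (cube d l)"
  unfolding bset_def
proof (intro conjI exI)
  have "open (\<Inter>i\<in>{..<d}. {x::pt. \<bar>x i\<bar> < l})"
    by (intro open_INT ballI open_Collect_less continuous_intros continuous_coord) auto
  also have "(\<Inter>i\<in>{..<d}. {x::pt. \<bar>x i\<bar> < l}) = {x::pt. \<forall>i\<in>{..<d}. \<bar>x i\<bar> < l}" by auto
  finally have "open {x::pt. \<forall>i\<in>{..<d}. \<bar>x i\<bar> < l}" .
  then have "{x::pt. \<forall>i\<in>{..<d}. \<bar>x i\<bar> < l} \<inter> Rsp d \<in> sets (lb d)" by (intro sets_lb_borel) simp
  also have "{x::pt. \<forall>i\<in>{..<d}. \<bar>x i\<bar> < l} \<inter> Rsp d = cube d l" by (auto simp: cube_def)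
  finally show "cube d l \<in> sets (lb d)" .
  show "cube d l \<subseteq> pbox d (\<lambda>i. 0) l" unfolding cube_def pbox_def by (simp add: Collect_mono less_imp_le)
qed

lemma sqint_bounded:
  assumes "bset d U" "f \<in> borel_measurable (leb d U)" "\<And>x. x \<in> U \<Longrightarrow> cmod (f x) \<le> C"
  shows "f \<in> sqint (leb d U)" "nrm (leb d U) f \<le> \<bar>C\<bar> * sqrt (measure (leb d U) U)"
proof -
  interpret finite_measure "leb d U" using assms by (intro finite_leb)
  have U: "space (leb d U) = U" using assms by (simp add: space_leb bset_Rsp)
  have le: "(cmod (f x))\<^sup>2 \<le> C\<^sup>2" if "x \<in> U" for x using assms(3)[OF that] by (intro power_mono) auto
  have I: "integrable (leb d U) (\<lambda>x. (cmod (f x))\<^sup>2)"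
    by (rule integrable_const_bound[of _ "C\<^sup>2"]) (use le U assms(2) in auto)
  then show "f \<in> sqint (leb d U)" using assms by (simp add: sqint_iff)
  have "(\<integral>x. (cmod (f x))\<^sup>2 \<partial>leb d U) \<le> (\<integral>x. C\<^sup>2 \<partial>leb d U)"
    by (intro integral_mono I) (use le U in auto)
  also have "\<dots> = C\<^sup>2 * measure (leb d U) U" by (simp add: U)
  finally have "nrm (leb d U) f \<le> sqrt (C\<^sup>2 * measure (leb d U) U)" unfolding nrm_def by simp
  then show "nrm (leb d U) f \<le> \<bar>C\<bar> * sqrt (measure (leb d U) U)" by (simp add: real_sqrt_mult)
qed

lemma sqint_integrable1:
  assumes "finite_measure M" "f \<in> sqint M" shows "integrable M f"
proof -
  interpret finite_measure M by fact
  have "(\<lambda>x. 1) \<in> sqint M" by (auto simp: sqint_iff)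
  from sqint_mult(1)[OF assms(2) this] show ?thesis by simp
qed

section \<open>Polynomials are dense\<close>

text \<open>
  Polynomials in the coordinates relative to \<open>c\<close>, so that they have explicit primitives that vanish at \<open>x i = c i\<close>.
\<close>

inductive rpoly :: "nat \<Rightarrow> pt \<Rightarrow> (pt \<Rightarrow> real) \<Rightarrow> bool" for d c where
  mono: "rpoly d c (\<lambda>x. r * (\<Prod>j<d. (x j - c j) ^ \<beta> j))"
| add: "rpoly d c f \<Longrightarrow> rpoly d c g \<Longrightarrow> rpoly d c (\<lambda>x. f x + g x)"

lemma rpoly_const: "rpoly d c (\<lambda>x. r)"
  using rpoly.mono[of d c r "\<lambda>_. 0"] by simp

lemma rpoly_coord: "i < d \<Longrightarrow> rpoly d c (\<lambda>x. x i)"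
proof -
  assume "i < d"
  then have "(\<Prod>j<d. (x j - c j) ^ (if j = i then 1 else 0)) = x i - c i" for x
    by (subst prod.remove[of _ i]) (auto intro!: prod.neutral)
  then have "rpoly d c (\<lambda>x. x i - c i)"
    using rpoly.mono[of d c 1 "\<lambda>j. if j = i then 1 else 0"] by simp
  from rpoly.add[OF this rpoly_const[of d c "c i"]] show ?thesis by simp
qed

lemma rpoly_mult: "rpoly d c f \<Longrightarrow> rpoly d c g \<Longrightarrow> rpoly d c (\<lambda>x. f x * g x)"
proof (induction rule: rpoly.induct)
  case (mono r \<beta>)
  from mono show ?case
  proof (induction rule: rpoly.induct)
    case (mono q \<gamma>)
    have "(\<lambda>x. r * (\<Prod>j<d. (x j - c j) ^ \<beta> j) * (q * (\<Prod>j<d. (x j - c j) ^ \<gamma> j))) =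
        (\<lambda>x. r * q * (\<Prod>j<d. (x j - c j) ^ (\<beta> j + \<gamma> j)))"
      by (simp add: power_add prod.distrib mult_ac)
    then show ?case using rpoly.mono[of d c "r * q" "\<lambda>j. \<beta> j + \<gamma> j"] by simp
  next
    case (add f g)
    then show ?case using rpoly.add by (force simp: distrib_left)
  qed
next
  case (add f g)
  then show ?case using rpoly.add by (force simp: distrib_right)
qed

lemma rpoly_smr: "rpoly d c f \<Longrightarrow> smr f"
  by (induction rule: rpoly.induct) (auto intro!: smr.intros smr_prod smr_power smr_diff)

definition cpoly :: "nat \<Rightarrow> pt \<Rightarrow> (pt \<Rightarrow> complex) \<Rightarrow> bool" where
  "cpoly d c f \<longleftrightarrow> rpoly d c (\<lambda>x. Re (f x)) \<and> rpoly d c (\<lambda>x. Im (f x))"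

lemma cpoly_add: "cpoly d c f \<Longrightarrow> cpoly d c g \<Longrightarrow> cpoly d c (\<lambda>x. f x + g x)"
  by (auto simp: cpoly_def intro: rpoly.add)

lemma cpoly_of_real: "rpoly d c f \<Longrightarrow> cpoly d c (\<lambda>x. complex_of_real (f x))"
  by (simp add: cpoly_def rpoly_const)

lemma rpoly_diff: "rpoly d c f \<Longrightarrow> rpoly d c g \<Longrightarrow> rpoly d c (\<lambda>x. f x - g x)"
  using rpoly.add[OF _ rpoly_mult[OF rpoly_const[of d c "-1"]]] by fastforce

lemma cpoly_cmult: "cpoly d c f \<Longrightarrow> cpoly d c (\<lambda>x. z * f x)"
  by (auto simp: cpoly_def intro!: rpoly.add rpoly_diff rpoly_mult rpoly_const)

lemma cpoly_smc: "cpoly d c f \<Longrightarrow> smc f"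
  by (auto simp: cpoly_def smc_def intro: rpoly_smr)

lemma smc_bounded:
  assumes "smc f" "bset d U" shows "\<exists>C. \<forall>x\<in>U. cmod (f x) \<le> C"
proof -
  obtain c \<rho> where U: "U \<subseteq> pbox d c \<rho>" using assms by (auto simp: bset_def)
  show ?thesis using Cinf_bounded[OF smc_Cinf[OF assms(1)] compact_box box_subset] U by blast
qed

lemma smc_sqint:
  assumes "smc f" "bset d U" shows "f \<in> sqint (leb d U)"
proof -
  obtain C where C: "\<And>x. x \<in> U \<Longrightarrow> cmod (f x) \<le> C" using smc_bounded[OF assms] by blast
  have "f \<in> borel_measurable (leb d U)"
    by (rule leb_continuous[OF bset_Rsp[OF assms(2)] continuous_on_subset[OF smc_continuous[OF assms(1)]]]) simp
  then show ?thesis using sqint_bounded(1)[OF assms(2)] C by blast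
qed

text \<open>
  Stone--Weierstrass, as the coordinates separate the points of the coordinate space.
\<close>

lemma weierstrass_box:
  assumes "continuous_on (pbox d c \<rho>) f" "0 < e"
  shows "\<exists>g. rpoly d c g \<and> (\<forall>x\<in>pbox d c \<rho>. \<bar>f x - g x\<bar> < e)"
proof -
  interpret function_ring_on "{f. rpoly d c f}" "pbox d c \<rho>"
  proof
    show "continuous_on (pbox d c \<rho>) f" if "f \<in> {f. rpoly d c f}" for f
      using that by (auto intro: continuous_on_subset[OF smr_continuous[OF rpoly_smr]])
    show "\<exists>f\<in>{f. rpoly d c f}. f x \<noteq> f y" if "x \<in> pbox d c \<rho>" "y \<in> pbox d c \<rho>" "x \<noteq> y" for x y
    proof -
      from \<open>x \<noteq> y\<close> obtain i where "x i \<noteq> y i" by blast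
      moreover have "i < d" using that(1,2) calculation by (metis box_subset Rsp_def PiE_arb lessThan_iff subsetD)
      ultimately show ?thesis using rpoly_coord[of i d c] by (intro bexI[of _ "\<lambda>x. x i"]) auto
    qed
  qed (auto intro: compact_box rpoly.add rpoly_mult rpoly_const)
  show ?thesis using Stone_Weierstrass_basic[OF assms] by auto
qed

text \<open>
  Dominated convergence for square integrable functions.
\<close>

lemma nrm_dominated:
  assumes f: "f \<in> sqint M" and s: "\<And>i. s i \<in> borel_measurable M"
    and lim: "\<And>x. x \<in> space M \<Longrightarrow> (\<lambda>i. s i x) \<longlonglongrightarrow> f x"
    and w: "integrable M (\<lambda>x. (w x)\<^sup>2)" "\<And>i x. x \<in> space M \<Longrightarrow> cmod (f x - s i x) \<le> w x" and e: "0 < e"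
  shows "\<exists>i :: nat. nrm M (\<lambda>x. f x - s i x) < e"
proof -
  have "(\<lambda>i. \<integral>x. (cmod (f x - s i x))\<^sup>2 \<partial>M) \<longlonglongrightarrow> (\<integral>x. 0 \<partial>M)"
  proof (rule integral_dominated_convergence[OF _ _ w(1)])
    show "AE x in M. (\<lambda>i. (cmod (f x - s i x))\<^sup>2) \<longlonglongrightarrow> 0"
    proof (rule AE_I2)
      fix x assume "x \<in> space M"
      then have "(\<lambda>i. (cmod (f x - s i x))\<^sup>2) \<longlonglongrightarrow> (cmod (f x - f x))\<^sup>2" by (intro tendsto_intros lim)
      then show "(\<lambda>i. (cmod (f x - s i x))\<^sup>2) \<longlonglongrightarrow> 0" by simp
    qed
    show "AE x in M. norm ((cmod (f x - s i x))\<^sup>2) \<le> (w x)\<^sup>2" for i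
      by (rule AE_I2) (simp add: power_mono w(2))
  qed (use sqint_measurable[OF f] s in auto)
  then have "(\<lambda>i. (nrm M (\<lambda>x. f x - s i x))\<^sup>2) \<longlonglongrightarrow> 0" by (simp add: nrm_power2)
  from order_tendstoD(2)[OF this, of "e\<^sup>2"] e
  have "\<forall>\<^sub>F i in sequentially. (nrm M (\<lambda>x. f x - s i x))\<^sup>2 < e\<^sup>2" by simp
  then obtain i where "(nrm M (\<lambda>x. f x - s i x))\<^sup>2 < e\<^sup>2" using eventually_happens'[OF sequentially_bot] by blast
  then have "nrm M (\<lambda>x. f x - s i x) < e" by (rule power2_less_imp_less) (use e in simp)
  then show ?thesis by blast
qed

text \<open>
  From polynomials one reaches continuous functions by uniform approximation on a box, indicators of compact sets by continuous
  functions \<open>max 0 (1 - n infdist x K)\<close>, indicators of measurable sets by inner regularity, and then simple functions and their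
  limits.
\<close>

theorem cpoly_dense:
  assumes U: "bset d U" and f: "f \<in> sqint (leb d U)" and e: "0 < e"
  shows "\<exists>p. cpoly d c p \<and> nrm (leb d U) (\<lambda>x. f x - p x) < e"
proof -
  let ?M = "leb d U"
  interpret finite_measure ?M by (rule finite_leb[OF U])
  have URsp: "U \<subseteq> Rsp d" by (rule bset_Rsp[OF U])
  have sp: "space ?M = U" by (rule space_leb[OF URsp])
  have ps: "p \<in> sqint ?M" if "cpoly d c p" for p by (rule smc_sqint[OF cpoly_smc[OF that] U])
  define appr where "appr f \<longleftrightarrow> f \<in> sqint ?M \<and> (\<forall>e>0. \<exists>p. cpoly d c p \<and> nrm ?M (\<lambda>x. f x - p x) < e)" for f
  have appr_lim: "appr f" if f: "f \<in> sqint ?M" and g: "\<And>e. 0 < e \<Longrightarrow> \<exists>g. appr g \<and> nrm ?M (\<lambda>x. f x - g x) < e" for f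
    unfolding appr_def
  proof (intro conjI f allI impI)
    fix e :: real assume "0 < e"
    then obtain g where g: "appr g" "nrm ?M (\<lambda>x. f x - g x) < e / 2" using g[of "e / 2"] by auto
    then obtain p where p: "cpoly d c p" "nrm ?M (\<lambda>x. g x - p x) < e / 2"
      using \<open>0 < e\<close> unfolding appr_def by (meson half_gt_zero)
    have "nrm ?M (\<lambda>x. f x - p x) \<le> nrm ?M (\<lambda>x. f x - g x) + nrm ?M (\<lambda>x. g x - p x)"
      using nrm_triangle[of "\<lambda>x. f x - g x" ?M "\<lambda>x. g x - p x"] f g ps[OF p(1)]
      by (simp add: appr_def sqint_diff)
    then show "\<exists>p. cpoly d c p \<and> nrm ?M (\<lambda>x. f x - p x) < e" using p g by (intro exI[of _ p]) auto
  qed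
  have appr_poly: "appr p" if "cpoly d c p" for p
    using that ps[OF that] by (auto simp: appr_def intro!: exI[of _ p])
  have appr_add: "appr (\<lambda>x. f x + g x)" if f: "appr f" and g: "appr g" for f g
    unfolding appr_def
  proof (intro conjI allI impI)
    show "(\<lambda>x. f x + g x) \<in> sqint ?M" using f g by (auto simp: appr_def sqint_add)
    fix e :: real assume "0 < e"
    then obtain p q where p: "cpoly d c p" "nrm ?M (\<lambda>x. f x - p x) < e / 2"
      and q: "cpoly d c q" "nrm ?M (\<lambda>x. g x - q x) < e / 2"
      using f g unfolding appr_def by (meson half_gt_zero)
    have "nrm ?M (\<lambda>x. (f x - p x) + (g x - q x)) \<le> nrm ?M (\<lambda>x. f x - p x) + nrm ?M (\<lambda>x. g x - q x)"
      using f g by (intro nrm_triangle sqint_diff ps[OF p(1)] ps[OF q(1)]) (auto simp: appr_def)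
    then have "nrm ?M (\<lambda>x. f x + g x - (p x + q x)) < e" using p q by (simp add: algebra_simps)
    then show "\<exists>p. cpoly d c p \<and> nrm ?M (\<lambda>x. f x + g x - p x) < e"
      using cpoly_add[OF p(1) q(1)] by blast
  qed
  have appr_cmult: "appr (\<lambda>x. z * f x)" if f: "appr f" for z f
    unfolding appr_def
  proof (intro conjI allI impI)
    show "(\<lambda>x. z * f x) \<in> sqint ?M" using f by (auto simp: appr_def sqint_cmult)
    fix e :: real assume e: "0 < e"
    have pos: "0 < cmod z + 1" by (simp add: add_nonneg_pos)
    then have "0 < e / (cmod z + 1)" using e by simp
    then obtain p where p: "cpoly d c p" "nrm ?M (\<lambda>x. f x - p x) < e / (cmod z + 1)"
      using f unfolding appr_def by meson
    have "nrm ?M (\<lambda>x. z * f x - z * p x) = cmod z * nrm ?M (\<lambda>x. f x - p x)"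
      unfolding nrm_cmult[symmetric] by (simp add: right_diff_distrib)
    also have "\<dots> \<le> (cmod z + 1) * nrm ?M (\<lambda>x. f x - p x)" by (intro mult_right_mono) auto
    also have "\<dots> < e" using p(2) pos by (simp add: pos_less_divide_eq mult.commute)
    finally show "\<exists>p. cpoly d c p \<and> nrm ?M (\<lambda>x. z * f x - p x) < e"
      using cpoly_cmult[OF p(1)] by blast
  qed
  have small: "nrm ?M g \<le> e * sqrt (measure ?M U)"
    if "g \<in> borel_measurable ?M" "\<And>x. x \<in> U \<Longrightarrow> cmod (g x) \<le> e" "0 \<le> e" for g e
    using sqint_bounded(2)[OF U that(1,2)] that(3) by simp
  have appr_cont: "appr (\<lambda>x. complex_of_real (g x))" if g: "continuous_on UNIV g" for g :: "pt \<Rightarrow> real"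
  proof (rule appr_lim)
    obtain c' \<rho>' where "U \<subseteq> pbox d c' \<rho>'" using U by (auto simp: bset_def)
    define \<rho> where "\<rho> = \<bar>\<rho>'\<bar> + (\<Sum>i<d. \<bar>c' i - c i\<bar>)"
    have Ub: "U \<subseteq> pbox d c \<rho>"
    proof
      fix x assume "x \<in> U"
      then have x: "x \<in> pbox d c' \<rho>'" using \<open>U \<subseteq> pbox d c' \<rho>'\<close> by auto
      have "\<bar>x i - c i\<bar> \<le> \<rho>" if "i < d" for i
      proof -
        have "\<bar>c' i - c i\<bar> \<le> (\<Sum>i<d. \<bar>c' i - c i\<bar>)" using that by (intro member_le_sum) auto
        moreover have "\<bar>x i - c' i\<bar> \<le> \<rho>'" using x that by (simp add: pbox_def)
        ultimately show ?thesis by (simp add: \<rho>_def)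
      qed
      then show "x \<in> pbox d c \<rho>" using x by (auto simp: pbox_def)
    qed
    obtain C where C: "\<And>x. x \<in> pbox d c \<rho> \<Longrightarrow> \<bar>g x\<bar> \<le> C"
      using compact_continuous_image[OF continuous_on_subset[OF g] compact_box, of d c \<rho>] compact_imp_bounded
      by (metis bounded_real imageI subset_UNIV)
    have gm: "(\<lambda>x. complex_of_real (g x)) \<in> borel_measurable ?M"
      by (intro leb_continuous URsp continuous_intros continuous_on_subset[OF g]) auto
    then show gs: "(\<lambda>x. complex_of_real (g x)) \<in> sqint ?M"
      using C Ub by (intro sqint_bounded(1)[OF U, of _ C]) auto
    fix e :: real assume e: "0 < e"
    define e' where "e' = e / (sqrt (measure ?M U) + 1)"
    have pos: "0 < sqrt (measure ?M U) + 1" by (simp add: add_nonneg_pos)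
    have e': "0 < e'" using e pos by (simp add: e'_def)
    obtain p where p: "rpoly d c p" "\<And>x. x \<in> pbox d c \<rho> \<Longrightarrow> \<bar>g x - p x\<bar> < e'"
      using weierstrass_box[OF continuous_on_subset[OF g] e', of d c \<rho>] by auto
    have cp: "cpoly d c (\<lambda>x. complex_of_real (p x))" by (rule cpoly_of_real[OF p(1)])
    have "nrm ?M (\<lambda>x. complex_of_real (g x) - complex_of_real (p x)) \<le> e' * sqrt (measure ?M U)"
    proof (rule small)
      show "(\<lambda>x. complex_of_real (g x) - complex_of_real (p x)) \<in> borel_measurable ?M"
        using gs ps[OF cp] by measurable
      show "cmod (complex_of_real (g x) - complex_of_real (p x)) \<le> e'" if "x \<in> U" for x
        using p(2)[of x] that Ub by (auto simp flip: of_real_diff intro: less_imp_le)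
    qed (use e' in simp)
    also have "\<dots> < e' * (sqrt (measure ?M U) + 1)" using e' by simp
    also have "\<dots> = e" using pos by (simp add: e'_def)
    finally show "\<exists>h. appr h \<and> nrm ?M (\<lambda>x. complex_of_real (g x) - h x) < e"
      using appr_poly[OF cp] by blast
  qed
  have ind_sq: "(\<lambda>x. complex_of_real (indicator A x)) \<in> sqint ?M" if "A \<in> sets ?M" for A
    using that by (intro sqint_bounded(1)[OF U, of _ 1]) (auto simp: indicator_def)
  have appr_compact: "appr (\<lambda>x. complex_of_real (indicator (K \<inter> U) x))" if K: "compact K" "K \<noteq> {}" for K
  proof (rule appr_lim)
    have KU: "K \<inter> U \<in> sets ?M"
    proof -
      have "K \<inter> Rsp d \<in> sets (lb d)" using K by (intro sets_lb_borel borel_closed compact_imp_closed)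
      then have "U \<inter> (K \<inter> Rsp d) \<in> sets ?M" by (auto simp: leb_def sets_restrict_space)
      moreover have "U \<inter> (K \<inter> Rsp d) = K \<inter> U" using URsp by auto
      ultimately show ?thesis by simp
    qed
    show isq: "(\<lambda>x. complex_of_real (indicator (K \<inter> U) x)) \<in> sqint ?M" by (rule ind_sq[OF KU])
    define g where "g n x = max 0 (1 - real n * infdist x K)" for n and x :: pt
    have g: "continuous_on UNIV (g n)" for n unfolding g_def by (intro continuous_intros)
    have gs: "(\<lambda>x. complex_of_real (g n x)) \<in> sqint ?M" for n using appr_cont[OF g] by (simp add: appr_def)
    have lim: "(\<lambda>n. g n x) \<longlonglongrightarrow> indicator (K \<inter> U) x" if "x \<in> U" for x
    proof (cases "x \<in> K")
      case True
      then show ?thesis using that by (simp add: g_def)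
    next
      case False
      then have pos: "0 < infdist x K"
        using K infdist_pos_not_in_closed[of K x] compact_imp_closed by blast
      obtain k where k: "1 < real k * infdist x K" using reals_Archimedean3[OF pos] by blast
      have "\<forall>\<^sub>F n in sequentially. g n x = 0"
        using eventually_ge_at_top[of k]
      proof eventually_elim
        case (elim n)
        have "real k * infdist x K \<le> real n * infdist x K" using elim pos by (intro mult_right_mono) auto
        then show ?case using k by (simp add: g_def)
      qed
      then show ?thesis using False by (simp add: tendsto_eventually)
    qed
    fix e :: real assume e: "0 < e"
    have "\<exists>n. nrm ?M (\<lambda>x. complex_of_real (indicator (K \<inter> U) x) - complex_of_real (g n x)) < e"
    proof (rule nrm_dominated[OF isq _ _ _ _ e, where w = "\<lambda>x. 1"])
      show "(\<lambda>x. complex_of_real (g i x)) \<in> borel_measurable ?M" for i using gs by measurable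
      fix x assume x: "x \<in> space ?M"
      show "(\<lambda>i. complex_of_real (g i x)) \<longlonglongrightarrow> complex_of_real (indicator (K \<inter> U) x)"
        using lim[of x] x unfolding sp by (intro tendsto_of_real)
      fix i
      have "0 \<le> g i x" "g i x \<le> 1" by (auto simp: g_def infdist_nonneg)
      then have "\<bar>indicator (K \<inter> U) x - g i x\<bar> \<le> 1" by (auto simp: indicator_def)
      then show "cmod (complex_of_real (indicator (K \<inter> U) x) - complex_of_real (g i x)) \<le> 1" by (simp flip: of_real_diff)
    qed simp
    then show "\<exists>h. appr h \<and> nrm ?M (\<lambda>x. complex_of_real (indicator (K \<inter> U) x) - h x) < e"
      using appr_cont[OF g] by blast
  qed
  have appr_zero: "appr (\<lambda>x. 0)" using appr_poly[OF cpoly_of_real[OF rpoly_const[of d c 0]]] by simp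
  have appr_ind: "appr (\<lambda>x. complex_of_real (indicator A x))" if A: "A \<in> sets ?M" for A
  proof (rule appr_lim[OF ind_sq[OF A]])
    fix e :: real assume e: "0 < e"
    obtain A' where A': "A' \<in> sets borel" "A = A' \<inter> U" using sets_leb_borel[OF URsp A] .
    have idm: "(\<lambda>x. x) \<in> ?M \<rightarrow>\<^sub>M borel" by (rule leb_continuous[OF URsp continuous_on_id])
    define N where "N = distr ?M borel (\<lambda>x. x)"
    interpret N: finite_measure N unfolding N_def by (rule finite_measure_distr[OF idm])
    have N: "emeasure N B = emeasure ?M (B \<inter> U)" if "B \<in> sets borel" for B
      using that idm by (simp add: N_def emeasure_distr sp)
    have SUP: "emeasure N A' = (SUP K \<in> {K. K \<subseteq> A' \<and> compact K}. emeasure N K)"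
      by (rule inner_regular) (use A' in \<open>auto simp: N_def N.emeasure_finite[unfolded N_def]\<close>)
    have "\<exists>K. compact K \<and> K \<subseteq> A' \<and> emeasure N A' < emeasure N K + ennreal (e\<^sup>2)"
    proof (rule ccontr)
      assume "\<not> ?thesis"
      then have "emeasure N K + ennreal (e\<^sup>2) \<le> emeasure N A'" if "compact K" "K \<subseteq> A'" for K
        using that by (meson not_less)
      then have "measure N K + e\<^sup>2 \<le> measure N A'" if "compact K" "K \<subseteq> A'" for K
        using that by (simp add: N.emeasure_eq_measure flip: ennreal_plus)
      then have K: "emeasure N K \<le> ennreal (measure N A' - e\<^sup>2)" if "compact K" "K \<subseteq> A'" for K
        using that by (simp add: N.emeasure_eq_measure ennreal_leI le_diff_eq)
      have "emeasure N A' \<le> ennreal (measure N A' - e\<^sup>2)"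
        unfolding SUP by (rule SUP_least) (use K in auto)
      moreover have "0 \<le> measure N A' - e\<^sup>2"
        using \<open>\<And>K. compact K \<Longrightarrow> K \<subseteq> A' \<Longrightarrow> measure N K + e\<^sup>2 \<le> measure N A'\<close>[of "{}"] by simp
      ultimately show False using e by (simp add: N.emeasure_eq_measure)
    qed
    then obtain K where K: "compact K" "K \<subseteq> A'" "emeasure N A' < emeasure N K + ennreal (e\<^sup>2)" by blast
    have Kb: "K \<in> sets borel" by (intro borel_closed compact_imp_closed K)
    have KU: "K \<inter> U \<in> sets ?M"
    proof -
      have "U \<inter> (K \<inter> Rsp d) \<in> sets ?M" using sets_lb_borel[OF Kb, of d] by (auto simp: leb_def sets_restrict_space)
      moreover have "U \<inter> (K \<inter> Rsp d) = K \<inter> U" using URsp by auto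
      ultimately show ?thesis by simp
    qed
    have "measure ?M A < measure ?M (K \<inter> U) + e\<^sup>2"
      using K(3) A' Kb by (simp add: N emeasure_eq_measure ennreal_less_iff flip: ennreal_plus)
    moreover have "K \<inter> U \<subseteq> A" using K(2) A'(2) by blast
    ultimately have lt: "measure ?M (A - K \<inter> U) < e\<^sup>2"
      using finite_measure_Diff[OF A KU] by linarith
    have "(nrm ?M (\<lambda>x. complex_of_real (indicator A x) - complex_of_real (indicator (K \<inter> U) x)))\<^sup>2 =
        (\<integral>x. indicator (A - K \<inter> U) x \<partial>?M)"
      unfolding nrm_power2 using K(2) A'(2)
      by (intro Bochner_Integration.integral_cong refl) (auto simp: indicator_def)
    also have "\<dots> = measure ?M (A - K \<inter> U)" using A KU by (simp add: sets.Diff)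
    finally have "nrm ?M (\<lambda>x. complex_of_real (indicator A x) - complex_of_real (indicator (K \<inter> U) x)) < e"
      using lt e by (intro power2_less_imp_less[of _ e]) auto
    moreover have "appr (\<lambda>x. complex_of_real (indicator (K \<inter> U) x))"
      using appr_compact[OF K(1)] appr_zero by (cases "K = {}") auto
    ultimately show "\<exists>g. appr g \<and> nrm ?M (\<lambda>x. complex_of_real (indicator A x) - g x) < e" by blast
  qed
  have appr_sum: "appr (\<lambda>x. \<Sum>i\<in>I. h i x)" if "finite I" "\<And>i. i \<in> I \<Longrightarrow> appr (h i)" for I :: "complex set" and h
    using that by (induction I rule: finite_induct) (auto intro: appr_zero appr_add)
  have appr_simple: "appr s" if s: "simple_function ?M s" for s
  proof -
    have fin: "finite (s ` space ?M)" using s by (simp add: simple_function_def)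
    have sx: "(\<Sum>y\<in>s ` space ?M. y * complex_of_real (indicator (s -` {y} \<inter> space ?M) x)) = s x" if "x \<in> space ?M" for x
      using that fin by (subst sum.remove[of _ "s x"]) (auto simp: indicator_def intro!: sum.neutral)
    have a: "appr (\<lambda>x. \<Sum>y\<in>s ` space ?M. y * complex_of_real (indicator (s -` {y} \<inter> space ?M) x))"
      using s by (intro appr_sum fin appr_cmult appr_ind) (auto simp: simple_function_def)
    have sm: "s \<in> borel_measurable ?M" using s by (rule borel_measurable_simple_function)
    show ?thesis
      unfolding appr_def
    proof (intro conjI allI impI)
      show "s \<in> sqint ?M"
        by (rule sqint_cong_AE[OF _ sm]) (use a sx in \<open>auto simp: appr_def\<close>)
      fix e :: real assume "0 < e"
      then obtain p where p: "cpoly d c p" "nrm ?M (\<lambda>x. (\<Sum>y\<in>s ` space ?M. y * complex_of_real (indicator (s -` {y} \<inter> space ?M) x)) - p x) < e"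
        using a unfolding appr_def by blast
      moreover have "nrm ?M (\<lambda>x. (\<Sum>y\<in>s ` space ?M. y * complex_of_real (indicator (s -` {y} \<inter> space ?M) x)) - p x) = nrm ?M (\<lambda>x. s x - p x)"
        unfolding nrm_def by (intro arg_cong[of _ _ sqrt] Bochner_Integration.integral_cong) (simp_all add: sx)
      ultimately show "\<exists>p. cpoly d c p \<and> nrm ?M (\<lambda>x. s x - p x) < e" by auto
    qed
  qed
  have "appr f"
  proof (rule appr_lim[OF f])
    fix e :: real assume e: "0 < e"
    have fm: "f \<in> borel_measurable ?M" using f by measurable
    obtain s where s: "\<And>i. simple_function ?M (s i)" "\<And>x. x \<in> space ?M \<Longrightarrow> (\<lambda>i. s i x) \<longlonglongrightarrow> f x"
      "\<And>i x. x \<in> space ?M \<Longrightarrow> dist (s i x) 0 \<le> 2 * dist (f x) 0"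
      using borel_measurable_implies_sequence_metric[OF fm, of 0] by blast
    have [measurable]: "s i \<in> borel_measurable ?M" for i using s by (intro borel_measurable_simple_function)
    have "\<exists>n. nrm ?M (\<lambda>x. f x - s n x) < e"
    proof (rule nrm_dominated[OF f _ s(2) _ _ e, where w = "\<lambda>x. 3 * cmod (f x)"])
      show "integrable ?M (\<lambda>x. (3 * cmod (f x))\<^sup>2)" using sqint_integrable[OF f] by (simp add: power_mult_distrib)
      show "cmod (f x - s n x) \<le> 3 * cmod (f x)" if "x \<in> space ?M" for n x
        using s(3)[OF that, of n] norm_triangle_ineq4[of "f x" "s n x"] by simp
    qed simp_all
    then show "\<exists>g. appr g \<and> nrm ?M (\<lambda>x. f x - g x) < e" using appr_simple[OF s(1)] by blast
  qed
  then show ?thesis using e by (auto simp: appr_def)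
qed

section \<open>The fundamental lemma of the calculus of variations\<close>

text \<open>
  There are smooth functions with compact support in \<open>U\<close> that have no common zero in \<open>U\<close>.
  For a bounded set this is all that the uniqueness of weak derivatives requires.
\<close>

definition exhausted :: "nat \<Rightarrow> pt set \<Rightarrow> bool" where
  "exhausted d U \<longleftrightarrow> bset d U \<and> (\<exists>\<theta> :: nat \<Rightarrow> pt \<Rightarrow> real. (\<forall>k. smr (\<theta> k)) \<and>
     (\<forall>k. \<exists>K. compact K \<and> K \<subseteq> U \<and> (\<forall>x\<in>Rsp d - K. \<theta> k x = 0)) \<and> (\<forall>x\<in>U. \<exists>k. \<theta> k x \<noteq> 0))"

lemma exhausted_bset: "exhausted d U \<Longrightarrow> bset d U" by (simp add: exhausted_def)

text \<open>
  Multiply \<open>g\<close> by a cutoff \<open>\<theta> k\<close>: the product is orthogonal to all polynomials and hence zero by density,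
  and the cutoffs have no common zero.
\<close>

lemma fundamental_lemma:
  assumes U: "exhausted d U" and g: "g \<in> sqint (leb d U)"
    and 0: "\<And>\<psi>. \<psi> \<in> test_fun d U \<Longrightarrow> (\<integral>x. g x * \<psi> x \<partial>leb d U) = 0"
  shows "AE x in leb d U. g x = 0"
proof -
  let ?M = "leb d U"
  obtain \<theta> :: "nat \<Rightarrow> pt \<Rightarrow> real" where bU: "bset d U" and \<theta>: "\<And>k. smr (\<theta> k)"
    "\<And>k. \<exists>K. compact K \<and> K \<subseteq> U \<and> (\<forall>x\<in>Rsp d - K. \<theta> k x = 0)" "\<And>x. x \<in> U \<Longrightarrow> \<exists>k. \<theta> k x \<noteq> 0"
    using U unfolding exhausted_def by blast
  have sp: "space ?M = U" by (rule space_leb[OF bset_Rsp[OF bU]])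
  have "AE x in ?M. g x * complex_of_real (\<theta> k x) = 0" for k
  proof -
    define h where "h x = g x * complex_of_real (\<theta> k x)" for x
    note c = smc_of_real[OF \<theta>(1)[of k]]
    obtain C where C: "\<And>x. x \<in> U \<Longrightarrow> cmod (complex_of_real (\<theta> k x)) \<le> C" using smc_bounded[OF c bU] by blast
    have cm: "(\<lambda>x. complex_of_real (\<theta> k x)) \<in> borel_measurable ?M" using smc_sqint[OF c bU] by measurable
    have h: "h \<in> sqint ?M"
      unfolding sqint_iff
    proof
      show hm: "h \<in> borel_measurable ?M" unfolding h_def using cm g by measurable
      show "integrable ?M (\<lambda>x. (cmod (h x))\<^sup>2)"
      proof (rule Bochner_Integration.integrable_bound[of _ "\<lambda>x. C\<^sup>2 * (cmod (g x))\<^sup>2"])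
        show "AE x in ?M. norm ((cmod (h x))\<^sup>2) \<le> norm (C\<^sup>2 * (cmod (g x))\<^sup>2)"
        proof (rule AE_I2)
          fix x assume "x \<in> space ?M"
          then have "cmod (h x) \<le> C * cmod (g x)"
            using mult_right_mono[OF C[of x], of "cmod (g x)"] by (simp add: h_def norm_mult sp mult.commute)
          then have "(cmod (h x))\<^sup>2 \<le> (C * cmod (g x))\<^sup>2" by (intro power_mono) auto
          then show "norm ((cmod (h x))\<^sup>2) \<le> norm (C\<^sup>2 * (cmod (g x))\<^sup>2)" by (simp add: power_mult_distrib)
        qed
      qed (use hm sqint_integrable[OF g] in auto)
    qed
    have "nrm ?M h \<le> 0"
    proof (rule dense_dual_bound[OF h])
      show "{p. cpoly d (\<lambda>i. 0) p} \<subseteq> sqint ?M" using smc_sqint[OF cpoly_smc bU] by auto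
      show "\<exists>v\<in>{p. cpoly d (\<lambda>i. 0) p}. nrm ?M (\<lambda>x. cnj (h x) - v x) < e" if "0 < e" for e
        using cpoly_dense[OF bU sqint_cnj[OF h] that] by auto
      fix p assume "p \<in> {p. cpoly d (\<lambda>i. 0) p}"
      then have p: "smc (\<lambda>x. complex_of_real (\<theta> k x) * p x)" using smc_mult[OF c cpoly_smc] by auto
      obtain K where K: "compact K" "K \<subseteq> U" "\<And>x. x \<in> Rsp d - K \<Longrightarrow> \<theta> k x = 0" using \<theta>(2)[of k] by blast
      have "(\<lambda>x. complex_of_real (\<theta> k x) * p x) \<in> test_fun d U"
        unfolding test_fun_iff using smc_Cinf[OF p] K by auto
      from 0[OF this] show "cmod (\<integral>x. h x * p x \<partial>?M) \<le> 0 * nrm ?M p" by (simp add: h_def mult.assoc)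
    qed simp
    then have "nrm ?M h = 0" by (simp add: antisym)
    then show ?thesis using nrm_eq_0[OF h] by (simp add: h_def)
  qed
  then have "AE x in ?M. \<forall>k. g x * complex_of_real (\<theta> k x) = 0" unfolding AE_all_countable by blast
  with AE_space show ?thesis
  proof eventually_elim
    case (elim x)
    then show ?case using \<theta>(3)[of x] by (auto simp: sp)
  qed
qed

lemma edist_power2: "(edist d c x)\<^sup>2 = (\<Sum>i<d. (x i - c i)\<^sup>2)"
  by (simp add: edist_def L2_set_def sum_nonneg power2_commute[of "c _"])

lemma exhausted_oball:
  assumes c: "c \<in> Rsp d" and a: "0 < a" shows "exhausted d (oball d c a)"
  unfolding exhausted_def
proof (intro conjI exI[of _ "\<lambda>k x. flat 0 (a\<^sup>2 - 1 / Suc k - (\<Sum>i<d. (x i - c i)\<^sup>2))"] allI ballI bset_oball c)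
  fix k
  show "smr (\<lambda>x. flat 0 (a\<^sup>2 - 1 / Suc k - (\<Sum>i<d. (x i - c i)\<^sup>2)))"
    by (intro smr.flat smr_diff smr_sum smr_power smr.const smr.coord)
  define K where "K = pbox d c a \<inter> {x. (edist d c x)\<^sup>2 \<le> a\<^sup>2 - 1 / Suc k}"
  have lt: "edist d c x < a" if "(edist d c x)\<^sup>2 \<le> a\<^sup>2 - 1 / Suc k" for x
  proof (rule power2_less_imp_less)
    have "0 < 1 / real (Suc k)" by simp
    then show "(edist d c x)\<^sup>2 < a\<^sup>2" using that by linarith
  qed (use a in simp)
  have "compact K" unfolding K_def
    by (intro compact_Int_closed compact_box closed_Collect_le continuous_intros continuous_edist)
  moreover have "K \<subseteq> oball d c a" using lt by (auto simp: K_def oball_def pbox_def)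
  moreover have "flat 0 (a\<^sup>2 - 1 / Suc k - (\<Sum>i<d. (x i - c i)\<^sup>2)) = 0" if x: "x \<in> Rsp d - K" for x
  proof (rule flat_zero, rule ccontr)
    assume "\<not> a\<^sup>2 - 1 / Suc k - (\<Sum>i<d. (x i - c i)\<^sup>2) \<le> 0"
    then have *: "(edist d c x)\<^sup>2 \<le> a\<^sup>2 - 1 / Suc k" unfolding edist_power2 by linarith
    have "\<bar>x i - c i\<bar> \<le> a" if "i < d" for i using abs_le_edist[OF that, of x c] lt[OF *] by linarith
    then show False using x * by (auto simp: K_def pbox_def)
  qed
  ultimately show "\<exists>K. compact K \<and> K \<subseteq> oball d c a \<and>
      (\<forall>x\<in>Rsp d - K. flat 0 (a\<^sup>2 - 1 / Suc k - (\<Sum>i<d. (x i - c i)\<^sup>2)) = 0)" by blast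
next
  fix x assume "x \<in> oball d c a"
  then have "(edist d c x)\<^sup>2 < a\<^sup>2" unfolding oball_def by (intro power_strict_mono) auto
  then obtain k where "1 / real (Suc k) < a\<^sup>2 - (edist d c x)\<^sup>2" using nat_approx_posE[of "a\<^sup>2 - (edist d c x)\<^sup>2"] by auto
  then have "0 < a\<^sup>2 - 1 / Suc k - (\<Sum>i<d. (x i - c i)\<^sup>2)" unfolding edist_power2 by linarith
  from flat_pos[OF this, of 0] show "\<exists>k. flat 0 (a\<^sup>2 - 1 / Suc k - (\<Sum>i<d. (x i - c i)\<^sup>2)) \<noteq> 0"
    by (metis less_irrefl)
qed

lemma exhausted_cube:
  assumes l: "0 < l" shows "exhausted d (cube d l)"
  unfolding exhausted_def
proof (intro conjI exI[of _ "\<lambda>k x. \<Prod>i<d. flat 0 (l\<^sup>2 - 1 / Suc k - (x i)\<^sup>2)"] allI ballI bset_cube)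
  fix k
  show "smr (\<lambda>x. \<Prod>i<d. flat 0 (l\<^sup>2 - 1 / Suc k - (x i)\<^sup>2))"
    by (intro smr_prod smr.flat smr_diff smr_power smr.const smr.coord)
  define K where "K = pbox d (\<lambda>i. 0) l \<inter> (\<Inter>i\<in>{..<d}. {x::pt. (x i)\<^sup>2 \<le> l\<^sup>2 - 1 / Suc k})"
  have lt: "\<bar>t\<bar> < l" if "t\<^sup>2 \<le> l\<^sup>2 - 1 / Suc k" for t
  proof (rule power2_less_imp_less)
    have "0 < 1 / real (Suc k)" by simp
    then have "t\<^sup>2 < l\<^sup>2" using that by linarith
    then show "\<bar>t\<bar>\<^sup>2 < l\<^sup>2" by simp
  qed (use l in simp)
  have "compact K" unfolding K_def
    by (intro compact_Int_closed compact_box closed_INT ballI closed_Collect_le continuous_intros continuous_coord)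
  moreover have "K \<subseteq> cube d l" using lt by (auto simp: K_def cube_def pbox_def)
  moreover have "(\<Prod>i<d. flat 0 (l\<^sup>2 - 1 / Suc k - (x i)\<^sup>2)) = 0" if x: "x \<in> Rsp d - K" for x
  proof -
    have "\<exists>i<d. \<not> (x i)\<^sup>2 \<le> l\<^sup>2 - 1 / Suc k"
    proof (rule ccontr)
      assume "\<not> ?thesis"
      then have *: "\<And>i. i < d \<Longrightarrow> (x i)\<^sup>2 \<le> l\<^sup>2 - 1 / Suc k" by auto
      then have "\<And>i. i < d \<Longrightarrow> \<bar>x i\<bar> \<le> l" using lt less_imp_le by blast
      with * x show False by (auto simp: K_def pbox_def)
    qed
    then obtain i where i: "i < d" "\<not> (x i)\<^sup>2 \<le> l\<^sup>2 - 1 / Suc k" by blast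
    then have "flat 0 (l\<^sup>2 - 1 / Suc k - (x i)\<^sup>2) = 0" by (intro flat_zero) linarith
    with i(1) show ?thesis by (auto simp: prod_zero_iff)
  qed
  ultimately show "\<exists>K. compact K \<and> K \<subseteq> cube d l \<and>
      (\<forall>x\<in>Rsp d - K. (\<Prod>i<d. flat 0 (l\<^sup>2 - 1 / Suc k - (x i)\<^sup>2)) = 0)" by blast
next
  fix x assume x: "x \<in> cube d l"
  have "\<forall>i\<in>{..<d}. \<forall>\<^sub>F k in sequentially. 1 / real (Suc k) < l\<^sup>2 - (x i)\<^sup>2"
  proof
    fix i assume "i \<in> {..<d}"
    then have "\<bar>x i\<bar>\<^sup>2 < l\<^sup>2" using x unfolding cube_def by (intro power_strict_mono) auto
    then have "0 < l\<^sup>2 - (x i)\<^sup>2" by simp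
    then show "\<forall>\<^sub>F k in sequentially. 1 / real (Suc k) < l\<^sup>2 - (x i)\<^sup>2"
      by (rule order_tendstoD(2)[OF LIMSEQ_Suc[OF lim_1_over_n]])
  qed
  then have "\<forall>\<^sub>F k in sequentially. \<forall>i\<in>{..<d}. 1 / real (Suc k) < l\<^sup>2 - (x i)\<^sup>2"
    by (intro eventually_ball_finite) auto
  then obtain k where k: "\<forall>i\<in>{..<d}. 1 / real (Suc k) < l\<^sup>2 - (x i)\<^sup>2"
    using eventually_happens'[OF sequentially_bot] by blast
  have "0 < (\<Prod>i<d. flat 0 (l\<^sup>2 - 1 / Suc k - (x i)\<^sup>2))"
    by (intro prod_pos flat_pos ballI) (use k in force)
  then show "\<exists>k. (\<Prod>i<d. flat 0 (l\<^sup>2 - 1 / Suc k - (x i)\<^sup>2)) \<noteq> 0" by (metis less_irrefl)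
qed

section \<open>Sobolev norms\<close>

lemma Cinf_sqint:
  assumes "Cinf d \<psi>" "bset d U"
  shows "\<psi> \<in> sqint (leb d U)" "\<exists>C. \<forall>x\<in>U. cmod (\<psi> x) \<le> C"
proof -
  obtain c \<rho> where U: "U \<subseteq> pbox d c \<rho>" using assms by (auto simp: bset_def)
  show bd: "\<exists>C. \<forall>x\<in>U. cmod (\<psi> x) \<le> C"
    using Cinf_bounded[OF assms(1) compact_box box_subset] U by blast
  have "\<psi> \<in> borel_measurable (leb d U)"
    using leb_continuous[OF bset_Rsp[OF assms(2)] continuous_on_subset[OF Cinf_continuous[OF assms(1)] bset_Rsp[OF assms(2)]]] .
  then show "\<psi> \<in> sqint (leb d U)" using sqint_bounded(1)[OF assms(2)] bd by blast
qed

lemma test_fun_Cinf: "\<psi> \<in> test_fun d U \<Longrightarrow> Cinf d \<psi>" by (simp add: test_fun_iff)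

lemma is_weak_deriv_sqint: "is_weak_deriv d U \<alpha> f g \<Longrightarrow> g \<in> sqint (leb d U)"
  by (simp add: is_weak_deriv_def L2_sqint)

lemma test_mderiv:
  assumes "bset d U" "\<psi> \<in> test_fun d U"
  shows "mderiv (Rsp d) \<alpha> d \<psi> \<in> sqint (leb d U)" "\<psi> \<in> sqint (leb d U)"
  using Cinf_sqint(1)[OF Cinf_mderiv[OF test_fun_Cinf[OF assms(2)]] assms(1)]
    Cinf_sqint(1)[OF test_fun_Cinf[OF assms(2)] assms(1)] by auto

lemma is_weak_deriv_lin:
  assumes U: "bset d U" and f: "f \<in> sqint (leb d U)" "f' \<in> sqint (leb d U)"
    and g: "is_weak_deriv d U \<alpha> f g" "is_weak_deriv d U \<alpha> f' g'"
  shows "is_weak_deriv d U \<alpha> (\<lambda>x. z * f x + z' * f' x) (\<lambda>x. z * g x + z' * g' x)"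
  unfolding is_weak_deriv_def L2_sqint
proof (intro conjI ballI)
  note gs = is_weak_deriv_sqint[OF g(1)] is_weak_deriv_sqint[OF g(2)]
  show "(\<lambda>x. z * g x + z' * g' x) \<in> sqint (leb d U)" by (intro sqint_add sqint_cmult gs)
  fix \<psi> assume \<psi>: "\<psi> \<in> test_fun d U"
  let ?D = "mderiv (Rsp d) \<alpha> d \<psi>"
  note I = sqint_mult(1)[OF f(1) test_mderiv(1)[OF U \<psi>, of \<alpha>]] sqint_mult(1)[OF f(2) test_mderiv(1)[OF U \<psi>, of \<alpha>]]
    sqint_mult(1)[OF gs(1) test_mderiv(2)[OF U \<psi>]] sqint_mult(1)[OF gs(2) test_mderiv(2)[OF U \<psi>]]
  have "(\<integral>x. (z * f x + z' * f' x) * ?D x \<partial>leb d U) = (\<integral>x. z * (f x * ?D x) + z' * (f' x * ?D x) \<partial>leb d U)"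
    by (simp add: algebra_simps)
  also have "\<dots> = z * (\<integral>x. f x * ?D x \<partial>leb d U) + z' * (\<integral>x. f' x * ?D x \<partial>leb d U)"
    using I by simp
  also have "\<dots> = (- 1) ^ (\<Sum>i<d. \<alpha> i) * (z * (\<integral>x. g x * \<psi> x \<partial>leb d U) + z' * (\<integral>x. g' x * \<psi> x \<partial>leb d U))"
    using g \<psi> by (simp add: is_weak_deriv_def algebra_simps)
  also have "z * (\<integral>x. g x * \<psi> x \<partial>leb d U) + z' * (\<integral>x. g' x * \<psi> x \<partial>leb d U) =
      (\<integral>x. z * (g x * \<psi> x) + z' * (g' x * \<psi> x) \<partial>leb d U)"
    using I by simp
  also have "\<dots> = (\<integral>x. (z * g x + z' * g' x) * \<psi> x \<partial>leb d U)" by (simp add: algebra_simps)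
  finally show "(\<integral>x. (z * f x + z' * f' x) * ?D x \<partial>leb d U) =
      (- 1) ^ (\<Sum>i<d. \<alpha> i) * (\<integral>x. (z * g x + z' * g' x) * \<psi> x \<partial>leb d U)" .
qed

lemma weak_deriv_unique:
  assumes U: "exhausted d U" and g: "is_weak_deriv d U \<alpha> f g" "is_weak_deriv d U \<alpha> f g'"
  shows "AE x in leb d U. g x = g' x"
proof -
  note gs = is_weak_deriv_sqint[OF g(1)] is_weak_deriv_sqint[OF g(2)]
  note bU = exhausted_bset[OF U]
  have "AE x in leb d U. g x - g' x = 0"
  proof (rule fundamental_lemma[OF U sqint_diff[OF gs]])
    fix \<psi> assume \<psi>: "\<psi> \<in> test_fun d U"
    have "(\<integral>x. (g x - g' x) * \<psi> x \<partial>leb d U) = (\<integral>x. g x * \<psi> x \<partial>leb d U) - (\<integral>x. g' x * \<psi> x \<partial>leb d U)"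
      using sqint_mult(1)[OF gs(1) test_mderiv(2)[OF bU \<psi>]] sqint_mult(1)[OF gs(2) test_mderiv(2)[OF bU \<psi>]]
      by (simp add: left_diff_distrib)
    also have "(\<integral>x. g x * \<psi> x \<partial>leb d U) = (\<integral>x. g' x * \<psi> x \<partial>leb d U)"
    proof -
      have "(- 1) ^ (\<Sum>i<d. \<alpha> i) * (\<integral>x. g x * \<psi> x \<partial>leb d U) = (- 1) ^ (\<Sum>i<d. \<alpha> i) * (\<integral>x. g' x * \<psi> x \<partial>leb d U)"
      proof -
        have "(\<integral>x. f x * mderiv (Rsp d) \<alpha> d \<psi> x \<partial>leb d U) = (- 1) ^ (\<Sum>i<d. \<alpha> i) * (\<integral>x. g x * \<psi> x \<partial>leb d U)"
          "(\<integral>x. f x * mderiv (Rsp d) \<alpha> d \<psi> x \<partial>leb d U) = (- 1) ^ (\<Sum>i<d. \<alpha> i) * (\<integral>x. g' x * \<psi> x \<partial>leb d U)"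
          using g \<psi> unfolding is_weak_deriv_def by blast+
        then show ?thesis by (rule subst)
      qed
      then show ?thesis by simp
    qed
    finally show "(\<integral>x. (g x - g' x) * \<psi> x \<partial>leb d U) = 0" by simp
  qed
  then show ?thesis by simp
qed

lemma weak_deriv_is: "\<exists>g. is_weak_deriv d U \<alpha> f g \<Longrightarrow> is_weak_deriv d U \<alpha> f (weak_deriv d U \<alpha> f)"
  using someI_ex[of "is_weak_deriv d U \<alpha> f"] by (simp add: weak_deriv_def)

lemma nrm_weak_deriv:
  assumes U: "exhausted d U" and g: "is_weak_deriv d U \<alpha> f g"
  shows "nrm (leb d U) (weak_deriv d U \<alpha> f) = nrm (leb d U) g"
proof -
  have w: "is_weak_deriv d U \<alpha> f (weak_deriv d U \<alpha> f)" using weak_deriv_is g by blast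
  show ?thesis
    using is_weak_deriv_sqint[OF w] is_weak_deriv_sqint[OF g] weak_deriv_unique[OF U w g]
    by (intro nrm_cong_AE) auto
qed

lemma finite_multi [simp]: "finite (multi d s)"
proof (rule finite_subset)
  show "multi d s \<subseteq> {..<d} \<rightarrow>\<^sub>E {..s}"
  proof
    fix \<alpha> assume \<alpha>: "\<alpha> \<in> multi d s"
    have "\<alpha> i \<le> s" if "i < d" for i
      using \<alpha> member_le_sum[of i "{..<d}" \<alpha>] that by (auto simp: multi_def)
    then show "\<alpha> \<in> {..<d} \<rightarrow>\<^sub>E {..s}" using \<alpha> by (auto simp: multi_def PiE_iff)
  qed
qed (auto intro: finite_PiE)

text \<open>
  The Sobolev norm as a real number, for elements of the space.
\<close>

definition sn :: "nat \<Rightarrow> pt set \<Rightarrow> nat \<Rightarrow> (pt \<Rightarrow> complex) \<Rightarrow> real" where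
  "sn d U s f = L2_set (\<lambda>\<alpha>. nrm (leb d U) (weak_deriv d U \<alpha> f)) (multi d s)"

lemma sobolev_sqint: "f \<in> sobolev d U s \<Longrightarrow> f \<in> sqint (leb d U)"
  by (simp add: sobolev_def L2_sqint)

lemma sobolev_weak:
  "f \<in> sobolev d U s \<Longrightarrow> \<alpha> \<in> multi d s \<Longrightarrow> is_weak_deriv d U \<alpha> f (weak_deriv d U \<alpha> f)"
  by (intro weak_deriv_is) (auto simp: sobolev_def)

lemma sobolev_norm_sn:
  assumes f: "f \<in> sobolev d U s" shows "sobolev_norm d U s f = ennreal (sn d U s f)"
proof -
  have "(\<Sum>\<alpha>\<in>multi d s. (l2norm d U (weak_deriv d U \<alpha> f))\<^sup>2) =
      (\<Sum>\<alpha>\<in>multi d s. ennreal ((nrm (leb d U) (weak_deriv d U \<alpha> f))\<^sup>2))"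
    by (intro sum.cong refl) (simp add: l2norm_nrm is_weak_deriv_sqint[OF sobolev_weak[OF f]] ennreal_power)
  also have "\<dots> = ennreal (\<Sum>\<alpha>\<in>multi d s. (nrm (leb d U) (weak_deriv d U \<alpha> f))\<^sup>2)"
    by (intro sum_ennreal) auto
  finally show ?thesis using f by (simp add: sobolev_norm_def sn_def L2_set_def esqrt_ennreal sum_nonneg)
qed

lemma sn_nonneg [simp]: "0 \<le> sn d U s f" by (simp add: sn_def)

lemma sobolev_lin:
  assumes U: "bset d U" and f: "f \<in> sobolev d U s" "g \<in> sobolev d U s"
  shows "(\<lambda>x. z * f x + z' * g x) \<in> sobolev d U s"
  unfolding sobolev_def L2_sqint
proof (safe)
  show "(\<lambda>x. z * f x + z' * g x) \<in> sqint (leb d U)"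
    by (intro sqint_add sqint_cmult sobolev_sqint[OF f(1)] sobolev_sqint[OF f(2)])
  fix \<alpha> assume "\<alpha> \<in> multi d s"
  then show "\<exists>h. is_weak_deriv d U \<alpha> (\<lambda>x. z * f x + z' * g x) h"
    using is_weak_deriv_lin[OF U sobolev_sqint[OF f(1)] sobolev_sqint[OF f(2)] sobolev_weak[OF f(1)] sobolev_weak[OF f(2)]]
    by blast
qed

lemma sn_lin:
  assumes U: "exhausted d U" and f: "f \<in> sobolev d U s" "g \<in> sobolev d U s"
  shows "sn d U s (\<lambda>x. z * f x + z' * g x) \<le> cmod z * sn d U s f + cmod z' * sn d U s g"
proof -
  let ?n = "nrm (leb d U)" and ?w = "weak_deriv d U"
  note bU = exhausted_bset[OF U]
  have "sn d U s (\<lambda>x. z * f x + z' * g x) \<le> L2_set (\<lambda>\<alpha>. cmod z * ?n (?w \<alpha> f) + cmod z' * ?n (?w \<alpha> g)) (multi d s)"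
    unfolding sn_def
  proof (rule L2_set_mono)
    fix \<alpha> assume \<alpha>: "\<alpha> \<in> multi d s"
    note w = sobolev_weak[OF f(1) \<alpha>] sobolev_weak[OF f(2) \<alpha>]
    note ws = is_weak_deriv_sqint[OF w(1)] is_weak_deriv_sqint[OF w(2)]
    have "?n (?w \<alpha> (\<lambda>x. z * f x + z' * g x)) = ?n (\<lambda>x. z * ?w \<alpha> f x + z' * ?w \<alpha> g x)"
      by (rule nrm_weak_deriv[OF U is_weak_deriv_lin[OF bU sobolev_sqint[OF f(1)] sobolev_sqint[OF f(2)] w]])
    also have "\<dots> \<le> ?n (\<lambda>x. z * ?w \<alpha> f x) + ?n (\<lambda>x. z' * ?w \<alpha> g x)"
      by (intro nrm_triangle sqint_cmult ws)
    finally show "?n (?w \<alpha> (\<lambda>x. z * f x + z' * g x)) \<le> cmod z * ?n (?w \<alpha> f) + cmod z' * ?n (?w \<alpha> g)"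
      by (simp add: nrm_cmult)
  qed simp
  also have "\<dots> \<le> L2_set (\<lambda>\<alpha>. cmod z * ?n (?w \<alpha> f)) (multi d s) + L2_set (\<lambda>\<alpha>. cmod z' * ?n (?w \<alpha> g)) (multi d s)"
    by (rule L2_set_triangle_ineq)
  finally show ?thesis by (simp add: sn_def L2_set_right_distrib)
qed

lemma is_weak_deriv_cong_AE:
  assumes "f \<in> borel_measurable (leb d U)" "g \<in> borel_measurable (leb d U)" "AE x in leb d U. f x = g x"
    and U: "bset d U"
  shows "is_weak_deriv d U \<alpha> f h \<longleftrightarrow> is_weak_deriv d U \<alpha> g h"
proof -
  have "(\<integral>x. f x * mderiv (Rsp d) \<alpha> d \<psi> x \<partial>leb d U) = (\<integral>x. g x * mderiv (Rsp d) \<alpha> d \<psi> x \<partial>leb d U)"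
    if "\<psi> \<in> test_fun d U" for \<psi>
  proof (rule integral_cong_AE)
    have "mderiv (Rsp d) \<alpha> d \<psi> \<in> borel_measurable (leb d U)" using test_mderiv(1)[OF U that] by measurable
    then show "(\<lambda>x. f x * mderiv (Rsp d) \<alpha> d \<psi> x) \<in> borel_measurable (leb d U)"
      "(\<lambda>x. g x * mderiv (Rsp d) \<alpha> d \<psi> x) \<in> borel_measurable (leb d U)" using assms by measurable
  qed (use assms(3) in eventually_elim, simp)
  then show ?thesis by (simp add: is_weak_deriv_def)
qed

lemma sobolev_cong_AE:
  assumes "f \<in> borel_measurable (leb d U)" "g \<in> borel_measurable (leb d U)" "AE x in leb d U. f x = g x"
    and U: "bset d U"
  shows "f \<in> sobolev d U s \<longleftrightarrow> g \<in> sobolev d U s" "sn d U s f = sn d U s g"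
proof -
  have w: "is_weak_deriv d U \<alpha> f = is_weak_deriv d U \<alpha> g" for \<alpha>
    using is_weak_deriv_cong_AE[OF assms] by blast
  have "AE x in leb d U. g x = f x" using assms(3) by auto
  then have "f \<in> sqint (leb d U) \<longleftrightarrow> g \<in> sqint (leb d U)"
    using sqint_cong_AE[of f "leb d U" g] sqint_cong_AE[of g "leb d U" f] assms by blast
  then show "f \<in> sobolev d U s \<longleftrightarrow> g \<in> sobolev d U s" by (simp add: sobolev_def L2_sqint w)
  show "sn d U s f = sn d U s g" by (simp add: sn_def weak_deriv_def w)
qed

lemma mderiv_zero: "(\<And>i. i < k \<Longrightarrow> \<alpha> i = 0) \<Longrightarrow> mderiv S \<alpha> k f = f"
  by (induction k) auto

lemma is_weak_deriv_zero:
  assumes "f \<in> sqint (leb d U)" "\<And>i. i < d \<Longrightarrow> \<alpha> i = 0"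
  shows "is_weak_deriv d U \<alpha> f f"
  using assms by (simp add: is_weak_deriv_def L2_sqint mderiv_zero)

section \<open>A Poincare inequality\<close>

text \<open>
  Integration in one coordinate, starting from the hyperplane through the centre.
\<close>

lemma rpoly_primitive:
  assumes i: "i < d" and h: "rpoly d c h"
  shows "\<exists>\<psi>. rpoly d c \<psi> \<and> (\<forall>x t. ((\<lambda>t. \<psi> (x(i := t))) has_real_derivative h (x(i := t))) (at t)) \<and>
    (\<forall>x. \<psi> (x(i := c i)) = 0)"
  using h
proof (induction rule: rpoly.induct)
  case (mono r \<beta>)
  define \<gamma> where "\<gamma> = \<beta>(i := Suc (\<beta> i))"
  define R where "R x = (\<Prod>j\<in>{..<d} - {i}. (x j - c j) ^ \<beta> j)" for x
  have R: "R (x(i := t)) = R x" for x t unfolding R_def by (intro prod.cong) auto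
  have "(\<Prod>j\<in>{..<d} - {i}. (x j - c j) ^ \<gamma> j) = R x" for x
    unfolding R_def by (intro prod.cong) (auto simp: \<gamma>_def)
  then have \<gamma>: "(\<Prod>j<d. (x j - c j) ^ \<gamma> j) = (x i - c i) ^ Suc (\<beta> i) * R x" for x
    using i by (subst prod.remove[of _ i]) (auto simp: \<gamma>_def)
  have \<beta>: "(\<Prod>j<d. (x j - c j) ^ \<beta> j) = (x i - c i) ^ \<beta> i * R x" for x
    using i unfolding R_def by (subst prod.remove[of _ i]) auto
  define \<psi> where "\<psi> = (\<lambda>x. r / Suc (\<beta> i) * (\<Prod>j<d. (x j - c j) ^ \<gamma> j))"
  have "rpoly d c \<psi>" unfolding \<psi>_def by (rule rpoly.mono)
  moreover have "((\<lambda>t. \<psi> (x(i := t))) has_real_derivative r * (\<Prod>j<d. ((x(i := t)) j - c j) ^ \<beta> j)) (at t)" for x t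
  proof -
    have "((\<lambda>t. r / Suc (\<beta> i) * ((t - c i) ^ Suc (\<beta> i) * R x)) has_real_derivative
        r / Suc (\<beta> i) * (Suc (\<beta> i) * (t - c i) ^ \<beta> i * R x)) (at t)"
      by (auto intro!: derivative_eq_intros simp del: power_Suc)
    also have "r / Suc (\<beta> i) * (Suc (\<beta> i) * (t - c i) ^ \<beta> i * R x) = r * ((t - c i) ^ \<beta> i * R x)"
      by simp
    finally show ?thesis unfolding \<psi>_def \<gamma> \<beta> R by simp
  qed
  moreover have "\<psi> (x(i := c i)) = 0" for x unfolding \<psi>_def \<gamma> by simp
  ultimately show ?case by blast
next
  case (add f g)
  then obtain F G where FG: "rpoly d c F" "rpoly d c G"
    "\<And>x t. ((\<lambda>t. F (x(i := t))) has_real_derivative f (x(i := t))) (at t)"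
    "\<And>x t. ((\<lambda>t. G (x(i := t))) has_real_derivative g (x(i := t))) (at t)"
    "\<And>x. F (x(i := c i)) = 0" "\<And>x. G (x(i := c i)) = 0" by blast
  show ?case
  proof (intro exI[of _ "\<lambda>x. F x + G x"] conjI allI)
    show "rpoly d c (\<lambda>x. F x + G x)" by (intro rpoly.add FG)
    show "((\<lambda>t. F (x(i := t)) + G (x(i := t))) has_real_derivative f (x(i := t)) + g (x(i := t))) (at t)" for x t
      by (intro DERIV_add FG)
    show "F (x(i := c i)) + G (x(i := c i)) = 0" for x using FG(5,6) by simp
  qed
qed

lemma cpoly_primitive:
  assumes i: "i < d" and h: "cpoly d c h"
  shows "\<exists>\<psi>. cpoly d c \<psi> \<and> (\<forall>x t. ((\<lambda>t. \<psi> (x(i := t))) has_vector_derivative h (x(i := t))) (at t)) \<and>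
    (\<forall>x. \<psi> (x(i := c i)) = 0)"
proof -
  obtain u v where uv: "rpoly d c u" "rpoly d c v"
    "\<And>x t. ((\<lambda>t. u (x(i := t))) has_real_derivative Re (h (x(i := t)))) (at t)"
    "\<And>x t. ((\<lambda>t. v (x(i := t))) has_real_derivative Im (h (x(i := t)))) (at t)"
    "\<And>x. u (x(i := c i)) = 0" "\<And>x. v (x(i := c i)) = 0"
    using rpoly_primitive[OF i, of c "\<lambda>x. Re (h x)"] rpoly_primitive[OF i, of c "\<lambda>x. Im (h x)"] h
    unfolding cpoly_def by metis
  show ?thesis
    by (intro exI[of _ "\<lambda>x. Complex (u x) (v x)"])
      (simp add: cpoly_def uv has_vector_derivative_complex_iff complex_eq_iff)
qed

text \<open>
  Cauchy--Schwarz for \<open>F y = \<integral> f\<close> over an interval of length at most \<open>a\<close>.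
\<close>

lemma line_bound:
  fixes F f :: "real \<Rightarrow> complex"
  assumes F: "\<And>t. (F has_vector_derivative f t) (at t)" and f: "continuous_on UNIV f"
    and F0: "F c = 0" and a: "\<bar>y - c\<bar> \<le> a"
    and S: "S \<in> sets borel" "{min c y..max c y} \<subseteq> S"
  shows "ennreal ((cmod (F y))\<^sup>2) \<le> ennreal a * (\<integral>\<^sup>+t. ennreal ((cmod (f t))\<^sup>2) * indicator S t \<partial>lborel)"
proof -
  define I where "I = {min c y..max c y}"
  have FTC: "(\<integral>t. indicator I t *\<^sub>R f t \<partial>lborel) = F (max c y) - F (min c y)"
    unfolding I_def
    by (rule integral_FTC_Icc) (auto intro: has_vector_derivative_at_within[OF F] continuous_on_subset[OF f])
  then have Fy: "cmod (F y) = cmod (\<integral>t. indicator I t *\<^sub>R f t \<partial>lborel)"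
    using F0 by (auto simp: max_def min_def)
  obtain C where C: "\<And>t. t \<in> I \<Longrightarrow> cmod (f t) \<le> C"
  proof -
    have "bounded (f ` I)"
      by (intro compact_imp_bounded compact_continuous_image continuous_on_subset[OF f]) (auto simp: I_def)
    then show ?thesis using that unfolding bounded_iff by blast
  qed
  have fm: "f \<in> borel_measurable borel" using f by (rule borel_measurable_continuous_onI)
  have I [measurable]: "I \<in> sets borel" by (simp add: I_def)
  have emI: "emeasure lborel I = ennreal \<bar>y - c\<bar>" by (auto simp: I_def max_def min_def)
  have oneI: "(\<lambda>t. complex_of_real (indicator I t)) \<in> sqint lborel"
  proof -
    have "(\<integral>\<^sup>+ t. ennreal ((cmod (complex_of_real (indicator I t)))\<^sup>2) \<partial>lborel) = (\<integral>\<^sup>+ t. indicator I t \<partial>lborel)"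
      by (intro nn_integral_cong) (auto simp: indicator_def)
    then show ?thesis by (simp add: sqint_def emI)
  qed
  have n1: "(nrm lborel (\<lambda>t. complex_of_real (indicator I t)))\<^sup>2 = \<bar>y - c\<bar>"
  proof -
    have "(\<integral>t. (cmod (complex_of_real (indicator I t)))\<^sup>2 \<partial>lborel) = (\<integral>t. indicator I t \<partial>lborel)"
      by (intro Bochner_Integration.integral_cong) (auto simp: indicator_def)
    then show ?thesis by (simp add: nrm_power2 measure_def emI)
  qed
  have le: "(\<integral>\<^sup>+ t. ennreal ((cmod (indicator I t *\<^sub>R f t))\<^sup>2) \<partial>lborel) \<le> (\<integral>\<^sup>+t. ennreal ((cmod (f t))\<^sup>2) * indicator S t \<partial>lborel)"
    using S(2) by (intro nn_integral_mono) (auto simp: indicator_def I_def)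
  have fI: "(\<lambda>t. indicator I t *\<^sub>R f t) \<in> sqint lborel"
  proof -
    have "(\<integral>\<^sup>+ t. ennreal ((cmod (indicator I t *\<^sub>R f t))\<^sup>2) \<partial>lborel) \<le> (\<integral>\<^sup>+ t. ennreal (C\<^sup>2) * indicator I t \<partial>lborel)"
      by (intro nn_integral_mono) (auto simp: indicator_def intro!: ennreal_leI power_mono C)
    also have "\<dots> < \<infinity>" by (simp add: nn_integral_cmult_indicator emI ennreal_mult_less_top)
    finally show ?thesis using fm by (simp add: sqint_def)
  qed
  have "cmod (\<integral>t. (indicator I t *\<^sub>R f t) * complex_of_real (indicator I t) \<partial>lborel) \<le>
      nrm lborel (\<lambda>t. indicator I t *\<^sub>R f t) * nrm lborel (\<lambda>t. complex_of_real (indicator I t))"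
    by (rule sqint_mult(3)[OF fI oneI])
  moreover have "(\<integral>t. (indicator I t *\<^sub>R f t) * complex_of_real (indicator I t) \<partial>lborel) = (\<integral>t. indicator I t *\<^sub>R f t \<partial>lborel)"
    by (intro Bochner_Integration.integral_cong) (auto simp: indicator_def)
  ultimately have "(cmod (F y))\<^sup>2 \<le> (nrm lborel (\<lambda>t. indicator I t *\<^sub>R f t) * nrm lborel (\<lambda>t. complex_of_real (indicator I t)))\<^sup>2"
    unfolding Fy by (intro power_mono) auto
  also have "\<dots> = \<bar>y - c\<bar> * (nrm lborel (\<lambda>t. indicator I t *\<^sub>R f t))\<^sup>2"
    using n1 by (simp add: power_mult_distrib)
  also have "\<dots> \<le> a * (nrm lborel (\<lambda>t. indicator I t *\<^sub>R f t))\<^sup>2"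
    using a by (intro mult_right_mono) auto
  finally have "ennreal ((cmod (F y))\<^sup>2) \<le> ennreal (a * (nrm lborel (\<lambda>t. indicator I t *\<^sub>R f t))\<^sup>2)"
    by (rule ennreal_leI)
  also have "\<dots> = ennreal a * (\<integral>\<^sup>+ t. ennreal ((cmod (indicator I t *\<^sub>R f t))\<^sup>2) \<partial>lborel)"
    using a sqint_nn[OF fI] by (simp add: ennreal_mult)
  also have "\<dots> \<le> ennreal a * (\<integral>\<^sup>+t. ennreal ((cmod (f t))\<^sup>2) * indicator S t \<partial>lborel)"
    by (rule mult_left_mono[OF le]) simp
  finally show ?thesis .
qed

text \<open>
  A line in direction \<open>i\<close> meets the ball in an interval that is symmetric about \<open>c i\<close>, of half-length at most \<open>a\<close>. On each half
  the primitive is bounded by \<open>line_bound\<close>, and integrating this over the interval costs another factor \<open>2 a\<close>.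
\<close>

lemma primitive_bound:
  assumes i: "i < d" and c: "c \<in> Rsp d" and a: "0 < a" and h: "cpoly d c h" and \<psi>: "cpoly d c \<psi>"
    and D: "\<And>x t. ((\<lambda>t. \<psi> (x(i := t))) has_vector_derivative h (x(i := t))) (at t)"
    and \<psi>0: "\<And>x. \<psi> (x(i := c i)) = 0"
  shows "nrm (leb d (oball d c a)) \<psi> \<le> sqrt 2 * a * nrm (leb d (oball d c a)) h"
proof -
  define U where "U = oball d c a"
  have U: "bset d U" unfolding U_def by (rule bset_oball[OF c])
  have Us: "U \<in> sets (lb d)" using U by (simp add: bset_def)
  define I where "I = {..<d} - {i}"
  have I: "finite I" "i \<notin> I" "insert i I = {..<d}" using i by (auto simp: I_def)
  have hs: "h \<in> sqint (leb d U)" "\<psi> \<in> sqint (leb d U)" using h \<psi> by (auto intro: smc_sqint[OF cpoly_smc U])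
  have restr: "(\<integral>\<^sup>+x. f x \<partial>leb d U) = (\<integral>\<^sup>+x. f x * indicator U x \<partial>lb d)" for f
    unfolding leb_def by (rule nn_integral_restrict_space) (use Us sets.sets_into_space[OF Us] in \<open>auto simp: Int_absorb2\<close>)
  have meas: "(\<lambda>x. ennreal ((cmod (f x))\<^sup>2) * indicator U x) \<in> borel_measurable (lb d)" if "smc f" for f
  proof -
    have "f \<in> borel_measurable (lb d)"
      using measurable_compose[OF measurable_pt borel_measurable_continuous_onI[OF smc_continuous[OF that]]] .
    then show ?thesis using Us by measurable
  qed
  have m1: "(\<lambda>x. ennreal ((cmod (\<psi> x))\<^sup>2) * indicator U x) \<in> borel_measurable (Pi\<^sub>M (insert i I) (\<lambda>_. lborel))"
    unfolding I(3) by (rule meas[OF cpoly_smc[OF \<psi>]])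
  have m2: "(\<lambda>x. ennreal (2 * a\<^sup>2) * (ennreal ((cmod (h x))\<^sup>2) * indicator U x)) \<in> borel_measurable (Pi\<^sub>M (insert i I) (\<lambda>_. lborel))"
    unfolding I(3) using meas[OF cpoly_smc[OF h]] by measurable
  have "(\<integral>\<^sup>+x. ennreal ((cmod (\<psi> x))\<^sup>2) * indicator U x \<partial>lb d) =
      (\<integral>\<^sup>+x. \<integral>\<^sup>+y. ennreal ((cmod (\<psi> (x(i := y))))\<^sup>2) * indicator U (x(i := y)) \<partial>lborel \<partial>Pi\<^sub>M I (\<lambda>_. lborel))"
    using lbs.product_nn_integral_insert[OF I(1,2) m1] unfolding I(3) .
  also have "\<dots> \<le> (\<integral>\<^sup>+x. \<integral>\<^sup>+y. ennreal (2 * a\<^sup>2) * (ennreal ((cmod (h (x(i := y))))\<^sup>2) * indicator U (x(i := y))) \<partial>lborel \<partial>Pi\<^sub>M I (\<lambda>_. lborel))"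
  proof (rule nn_integral_mono)
    fix x assume x: "x \<in> space (Pi\<^sub>M I (\<lambda>_. lborel :: real measure))"
    have xR: "x(i := y) \<in> Rsp d" for y
      using x I(3) by (auto simp: space_PiM Rsp_def PiE_iff extensional_def I_def)
    define S where "S = {y. x(i := y) \<in> U}"
    define \<rho> where "\<rho> = (\<Sum>j\<in>I. (x j - c j)\<^sup>2)"
    have S_iff: "y \<in> S \<longleftrightarrow> (y - c i)\<^sup>2 + \<rho> < a\<^sup>2" for y
    proof -
      have "(edist d c (x(i := y)))\<^sup>2 = (y - c i)\<^sup>2 + \<rho>"
        unfolding edist_power2 I(3)[symmetric] \<rho>_def using I(1,2)
        by (simp) (intro sum.cong, auto)
      moreover have "edist d c (x(i := y)) < a \<longleftrightarrow> (edist d c (x(i := y)))\<^sup>2 < a\<^sup>2"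
        using a power2_less_imp_less[of "edist d c (x(i := y))" a] power_strict_mono[of "edist d c (x(i := y))" a 2] by auto
      ultimately show ?thesis using xR by (simp add: S_def U_def oball_def)
    qed
    have \<rho>: "0 \<le> \<rho>" by (simp add: \<rho>_def sum_nonneg)
    have Sa: "\<bar>y - c i\<bar> \<le> a" if "y \<in> S" for y
    proof -
      have "\<bar>y - c i\<bar>\<^sup>2 \<le> a\<^sup>2" using that \<rho> unfolding S_iff power2_abs by linarith
      then show ?thesis by (rule power2_le_imp_le) (use a in simp)
    qed
    have Sseg: "{min (c i) y..max (c i) y} \<subseteq> S" if "y \<in> S" for y
    proof
      fix t assume "t \<in> {min (c i) y..max (c i) y}"
      then have "\<bar>t - c i\<bar> \<le> \<bar>y - c i\<bar>" by auto
      then have "\<bar>t - c i\<bar>\<^sup>2 \<le> \<bar>y - c i\<bar>\<^sup>2" by (intro power_mono) auto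
      then show "t \<in> S" using that unfolding S_iff power2_abs by linarith
    qed
    have "S = {y. (y - c i)\<^sup>2 + \<rho> < a\<^sup>2}" using S_iff by blast
    moreover have "open {y. (y - c i)\<^sup>2 + \<rho> < a\<^sup>2}" by (intro open_Collect_less continuous_intros)
    ultimately have "open S" by simp
    then have Sb: "S \<in> sets borel" by simp
    define H where "H = (\<integral>\<^sup>+y. ennreal ((cmod (h (x(i := y))))\<^sup>2) * indicator S y \<partial>lborel)"
    have hc: "continuous_on UNIV (\<lambda>t. h (x(i := t)))"
    proof -
      have "continuous_on UNIV (\<lambda>t. x(i := t))"
      proof (rule continuous_on_coordinatewise_then_product)
        fix j show "continuous_on UNIV (\<lambda>t. (x(i := t)) j)" by (cases "j = i") auto
      qed
      from continuous_on_compose2[OF smc_continuous[OF cpoly_smc[OF h]] this] show ?thesis by simp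
    qed
    have hm: "(\<lambda>y. ennreal ((cmod (h (x(i := y))))\<^sup>2) * indicator S y) \<in> borel_measurable lborel"
      using borel_measurable_continuous_onI[OF hc] Sb by measurable
    have "(\<integral>\<^sup>+y. ennreal ((cmod (\<psi> (x(i := y))))\<^sup>2) * indicator U (x(i := y)) \<partial>lborel) \<le> (\<integral>\<^sup>+y. ennreal a * H * indicator {c i - a..c i + a} y \<partial>lborel)"
    proof (rule nn_integral_mono)
      fix y
      show "ennreal ((cmod (\<psi> (x(i := y))))\<^sup>2) * indicator U (x(i := y)) \<le> ennreal a * H * indicator {c i - a..c i + a} y"
      proof (cases "y \<in> S")
        case True
        have "ennreal ((cmod (\<psi> (x(i := y))))\<^sup>2) \<le> ennreal a * H"
          unfolding H_def by (rule line_bound[OF D hc \<psi>0 Sa[OF True] Sb Sseg[OF True]])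
        moreover have "y \<in> {c i - a..c i + a}" using Sa[OF True] by auto
        ultimately show ?thesis using True by (simp add: S_def)
      next
        case False
        then show ?thesis by (simp add: S_def)
      qed
    qed
    also have "\<dots> = ennreal a * H * ennreal (2 * a)"
      using a by (simp add: nn_integral_cmult_indicator)
    also have "\<dots> = ennreal (2 * a\<^sup>2) * H"
      using a by (simp add: power2_eq_square ennreal_mult mult_ac)
    also have "\<dots> = (\<integral>\<^sup>+y. ennreal (2 * a\<^sup>2) * (ennreal ((cmod (h (x(i := y))))\<^sup>2) * indicator S y) \<partial>lborel)"
      unfolding H_def using hm by (rule nn_integral_cmult[symmetric])
    also have "\<dots> = (\<integral>\<^sup>+y. ennreal (2 * a\<^sup>2) * (ennreal ((cmod (h (x(i := y))))\<^sup>2) * indicator U (x(i := y))) \<partial>lborel)"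
      by (simp add: S_def indicator_def)
    finally show "(\<integral>\<^sup>+y. ennreal ((cmod (\<psi> (x(i := y))))\<^sup>2) * indicator U (x(i := y)) \<partial>lborel) \<le>
        (\<integral>\<^sup>+y. ennreal (2 * a\<^sup>2) * (ennreal ((cmod (h (x(i := y))))\<^sup>2) * indicator U (x(i := y))) \<partial>lborel)" .
  qed
  also have "\<dots> = (\<integral>\<^sup>+x. ennreal (2 * a\<^sup>2) * (ennreal ((cmod (h x))\<^sup>2) * indicator U x) \<partial>lb d)"
    using lbs.product_nn_integral_insert[OF I(1,2) m2, symmetric] unfolding I(3) .
  also have "\<dots> = ennreal (2 * a\<^sup>2) * (\<integral>\<^sup>+x. ennreal ((cmod (h x))\<^sup>2) * indicator U x \<partial>lb d)"
    by (rule nn_integral_cmult[OF meas[OF cpoly_smc[OF h]]])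
  finally have "ennreal ((nrm (leb d U) \<psi>)\<^sup>2) \<le> ennreal (2 * a\<^sup>2) * ennreal ((nrm (leb d U) h)\<^sup>2)"
    unfolding restr[symmetric] sqint_nn[OF hs(1)] sqint_nn[OF hs(2)] .
  also have "\<dots> = ennreal ((sqrt 2 * a * nrm (leb d U) h)\<^sup>2)"
    by (simp add: power_mult_distrib ennreal_mult)
  finally have "(nrm (leb d U) \<psi>)\<^sup>2 \<le> (sqrt 2 * a * nrm (leb d U) h)\<^sup>2" by (subst (asm) ennreal_le_iff) auto
  then show ?thesis unfolding U_def by (rule power2_le_imp_le) (use a in simp)
qed

text \<open>
  Integrate \<open>\<alpha> i\<close> times in every coordinate. Each integration costs a factor \<open>sqrt 2 * a\<close>, which is the base of the powers in
  the constant \<open>P\<close>.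
\<close>

lemma mderiv_primitive:
  assumes c: "c \<in> Rsp d" and a: "0 < a" and h: "cpoly d c h" and k: "k \<le> d"
  shows "\<exists>\<psi>. cpoly d c \<psi> \<and> (\<forall>x\<in>Rsp d. mderiv (Rsp d) \<alpha> k \<psi> x = h x) \<and>
    nrm (leb d (oball d c a)) \<psi> \<le> (sqrt 2 * a) ^ (\<Sum>i<k. \<alpha> i) * nrm (leb d (oball d c a)) h"
  using h k
proof (induction k arbitrary: h)
  case 0
  then show ?case by auto
next
  case (Suc k)
  let ?n = "nrm (leb d (oball d c a))"
  have k: "k < d" using Suc.prems by simp
  have "\<exists>h1. cpoly d c h1 \<and> (\<forall>x\<in>Rsp d. (partial (Rsp d) k ^^ j) h1 x = h x) \<and> ?n h1 \<le> (sqrt 2 * a) ^ j * ?n h" for j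
    using Suc.prems(1)
  proof (induction j arbitrary: h)
    case 0
    then show ?case by auto
  next
    case (Suc j)
    obtain h' where h': "cpoly d c h'" "\<And>x t. ((\<lambda>t. h' (x(k := t))) has_vector_derivative h (x(k := t))) (at t)"
      "\<And>x. h' (x(k := c k)) = 0"
      using cpoly_primitive[OF k Suc.prems] by blast
    have n': "?n h' \<le> sqrt 2 * a * ?n h" by (rule primitive_bound[OF k c a Suc.prems h'])
    obtain h1 where h1: "cpoly d c h1" "\<And>x. x \<in> Rsp d \<Longrightarrow> (partial (Rsp d) k ^^ j) h1 x = h' x" "?n h1 \<le> (sqrt 2 * a) ^ j * ?n h'"
      using Suc.IH[OF h'(1)] by blast
    have "(partial (Rsp d) k ^^ Suc j) h1 x = h x" if x: "x \<in> Rsp d" for x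
    proof -
      have "partial (Rsp d) k ((partial (Rsp d) k ^^ j) h1) x = partial (Rsp d) k h' x"
        by (rule partial_cong[OF h1(2) x k])
      also have "\<dots> = h x" using partial_eqI[OF x k] h'(2)[of x "x k"] by simp
      finally show ?thesis by simp
    qed
    moreover have "?n h1 \<le> (sqrt 2 * a) ^ Suc j * ?n h"
    proof -
      have "(sqrt 2 * a) ^ j * ?n h' \<le> (sqrt 2 * a) ^ j * (sqrt 2 * a * ?n h)"
        using a n' by (intro mult_left_mono) auto
      then show ?thesis using h1(3) by (simp add: mult_ac)
    qed
    ultimately show ?case using h1(1) by blast
  qed
  then obtain h1 where h1: "cpoly d c h1" "\<And>x. x \<in> Rsp d \<Longrightarrow> (partial (Rsp d) k ^^ \<alpha> k) h1 x = h x"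
    "?n h1 \<le> (sqrt 2 * a) ^ \<alpha> k * ?n h" by blast
  obtain \<psi> where \<psi>: "cpoly d c \<psi>" "\<And>x. x \<in> Rsp d \<Longrightarrow> mderiv (Rsp d) \<alpha> k \<psi> x = h1 x"
    "?n \<psi> \<le> (sqrt 2 * a) ^ (\<Sum>i<k. \<alpha> i) * ?n h1"
    using Suc.IH[OF h1(1)] k by auto
  have "mderiv (Rsp d) \<alpha> (Suc k) \<psi> x = h x" if x: "x \<in> Rsp d" for x
    using funpow_partial_cong[OF \<psi>(2) k x, where k = "\<alpha> k"] h1(2)[OF x] by simp
  moreover have "?n \<psi> \<le> (sqrt 2 * a) ^ (\<Sum>i<Suc k. \<alpha> i) * ?n h"
  proof -
    have "(sqrt 2 * a) ^ (\<Sum>i<k. \<alpha> i) * ?n h1 \<le> (sqrt 2 * a) ^ (\<Sum>i<k. \<alpha> i) * ((sqrt 2 * a) ^ \<alpha> k * ?n h)"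
      using a h1(3) by (intro mult_left_mono) auto
    then show ?thesis using \<psi>(3) by (simp add: power_add mult_ac)
  qed
  ultimately show ?case using \<psi>(1) by blast
qed

text \<open>
  A smooth cutoff that is one near \<open>K\<close>, used to turn polynomials into test functions.
\<close>

lemma plateau:
  assumes K: "compact K" "K \<subseteq> oball d c a" and a: "0 < a"
  obtains \<theta> W K' where "smr \<theta>" "\<And>x. 0 \<le> \<theta> x" "\<And>x. \<theta> x \<le> 1" "open W" "K \<subseteq> W" "\<And>x. x \<in> W \<Longrightarrow> \<theta> x = 1"
    "compact K'" "K' \<subseteq> oball d c a" "\<And>x. x \<in> Rsp d - K' \<Longrightarrow> \<theta> x = 0"
proof -
  define \<rho> where "\<rho> x = (\<Sum>i<d. (x i - c i)\<^sup>2)" for x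
  have \<rho>: "\<rho> x = (edist d c x)\<^sup>2" for x by (simp add: \<rho>_def edist_power2)
  have \<rho>c: "continuous_on S \<rho>" for S unfolding \<rho>[abs_def] by (intro continuous_intros continuous_edist)
  have "\<exists>b0. b0 < a\<^sup>2 \<and> 0 \<le> b0 \<and> (\<forall>x\<in>K. \<rho> x \<le> b0)"
  proof (cases "K = {}")
    case True
    then show ?thesis using a by (intro exI[of _ 0]) auto
  next
    case False
    obtain z where z: "z \<in> K" "\<forall>x\<in>K. \<rho> x \<le> \<rho> z" using continuous_attains_sup[OF K(1) False \<rho>c] by blast
    have "\<rho> z < a\<^sup>2" unfolding \<rho> using z K(2) by (intro power_strict_mono) (auto simp: oball_def)
    then show ?thesis using z by (intro exI[of _ "\<rho> z"]) (auto simp: \<rho>)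
  qed
  then obtain b0 where b0: "b0 < a\<^sup>2" "0 \<le> b0" "\<And>x. x \<in> K \<Longrightarrow> \<rho> x \<le> b0" by blast
  define b1 where "b1 = (2 * b0 + a\<^sup>2) / 3"
  define b2 where "b2 = (b0 + 2 * a\<^sup>2) / 3"
  have b: "b0 < b1" "b1 < b2" "b2 < a\<^sup>2" using b0 by (auto simp: b1_def b2_def)
  define D where "D x = flat 0 (b2 - \<rho> x) + flat 0 (\<rho> x - b1)" for x
  have D: "0 < D x" for x
  proof (cases "\<rho> x < b2")
    case True
    then show ?thesis unfolding D_def by (intro add_pos_nonneg flat_pos flat_nonneg) simp
  next
    case False
    then show ?thesis using b unfolding D_def by (intro add_nonneg_pos flat_pos flat_nonneg) simp
  qed
  define \<theta> where "\<theta> x = flat 0 (b2 - \<rho> x) * inverse (D x)" for x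
  have \<rho>s: "smr \<rho>" unfolding \<rho>_def[abs_def] by (intro smr_sum smr_power smr_diff smr.coord smr.const)
  have Ds: "smr D" unfolding D_def[abs_def] by (intro smr.add smr.flat smr_diff smr.const \<rho>s)
  define K' where "K' = pbox d c a \<inter> {x. \<rho> x \<le> b2}"
  show ?thesis
  proof (rule that[of \<theta> "{x. \<rho> x < b1}" K'])
    show "smr \<theta>" unfolding \<theta>_def[abs_def] by (intro smr.mult smr.inverse smr.flat smr_diff smr.const \<rho>s Ds D)
    show "0 \<le> \<theta> x" for x using D[of x] by (simp add: \<theta>_def flat_nonneg)
    show "\<theta> x \<le> 1" for x
    proof -
      have "flat 0 (b2 - \<rho> x) \<le> D x" by (simp add: D_def flat_nonneg)
      then show ?thesis using D[of x] by (simp add: \<theta>_def divide_inverse[symmetric])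
    qed
    show "open {x. \<rho> x < b1}" by (intro open_Collect_less \<rho>c continuous_intros)
    show "K \<subseteq> {x. \<rho> x < b1}" using b0(3) b(1) by force
    show "\<theta> x = 1" if "x \<in> {x. \<rho> x < b1}" for x
      using that D[of x] by (simp add: \<theta>_def D_def flat_zero[of "\<rho> x - b1"])
    show "compact K'" unfolding K'_def
      by (intro compact_Int_closed compact_box closed_Collect_le \<rho>c continuous_intros)
    have lt: "edist d c x < a" if "\<rho> x \<le> b2" for x
      by (rule power2_less_imp_less) (use that b(3) a in \<open>auto simp: \<rho>\<close>)
    show "K' \<subseteq> oball d c a" using lt by (auto simp: K'_def oball_def pbox_def)
    show "\<theta> x = 0" if x: "x \<in> Rsp d - K'" for x
    proof -
      have "b2 \<le> \<rho> x"
      proof (rule ccontr)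
        assume n: "\<not> b2 \<le> \<rho> x"
        have "\<bar>x i - c i\<bar> \<le> a" if "i < d" for i using abs_le_edist[OF that, of x c] lt[of x] n by simp
        then show False using x n by (auto simp: K'_def pbox_def)
      qed
      then show ?thesis by (simp add: \<theta>_def flat_zero)
    qed
  qed
qed

text \<open>
  By duality: to bound \<open>\<integral> f h\<close> for a polynomial \<open>h\<close>, write \<open>h\<close> as the derivative \<open>D\<^sup>\<alpha> \<psi>\<close> of a polynomial with
  \<open>\<parallel>\<psi>\<parallel> \<le> (sqrt 2 a)\<^bsup>|\<alpha>|\<^esup> \<parallel>h\<parallel>\<close>. Since \<open>f\<close> vanishes away from a compact set, \<open>\<psi>\<close> may be cut off to become a
  test function, and the derivative moves to \<open>f\<close>.
\<close>

lemma poincare_weak: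
  assumes c: "c \<in> Rsp d" and a: "0 < a" and f: "f \<in> sobolev0 d (oball d c a) s" and \<alpha>: "\<alpha> \<in> multi d s"
  shows "nrm (leb d (oball d c a)) f \<le>
    (sqrt 2 * a) ^ (\<Sum>i<d. \<alpha> i) * nrm (leb d (oball d c a)) (weak_deriv d (oball d c a) \<alpha> f)"
proof -
  define U where "U = oball d c a"
  have bU: "bset d U" unfolding U_def by (rule bset_oball[OF c])
  let ?n = "nrm (leb d U)" and ?g = "weak_deriv d U \<alpha> f"
  define q where "q = (sqrt 2 * a) ^ (\<Sum>i<d. \<alpha> i)"
  have fS: "f \<in> sobolev d U s" using f by (simp add: sobolev0_def U_def)
  note fs = sobolev_sqint[OF fS] and w = sobolev_weak[OF fS \<alpha>]
  note gs = is_weak_deriv_sqint[OF w]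
  obtain K where K: "compact K" "K \<subseteq> U" "AE x in leb d U. x \<notin> K \<longrightarrow> f x = 0"
    using f unfolding sobolev0_def U_def by blast
  have "?n f \<le> q * ?n ?g"
  proof (rule dense_dual_bound[OF fs])
    show "{p. cpoly d c p} \<subseteq> sqint (leb d U)" using smc_sqint[OF cpoly_smc bU] by auto
    show "0 \<le> q * ?n ?g" using a by (simp add: q_def)
    show "\<exists>v\<in>{p. cpoly d c p}. ?n (\<lambda>x. cnj (f x) - v x) < e" if "0 < e" for e
      using cpoly_dense[OF bU sqint_cnj[OF fs] that] by auto
    fix h assume "h \<in> {p. cpoly d c p}"
    then have h: "cpoly d c h" by simp
    obtain \<psi> where \<psi>: "cpoly d c \<psi>" "\<And>x. x \<in> Rsp d \<Longrightarrow> mderiv (Rsp d) \<alpha> d \<psi> x = h x" "?n \<psi> \<le> q * ?n h"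
      using mderiv_primitive[OF c a h order_refl, of \<alpha>] unfolding U_def q_def by blast
    obtain \<theta> W K' where \<theta>: "smr \<theta>" "\<And>x. 0 \<le> \<theta> x" "\<And>x. \<theta> x \<le> 1" "open W" "K \<subseteq> W" "\<And>x. x \<in> W \<Longrightarrow> \<theta> x = 1"
      "compact K'" "K' \<subseteq> U" "\<And>x. x \<in> Rsp d - K' \<Longrightarrow> \<theta> x = 0"
      using plateau[OF K(1) K(2)[unfolded U_def] a] unfolding U_def by metis
    define \<zeta> where "\<zeta> x = complex_of_real (\<theta> x) * \<psi> x" for x
    have \<zeta>smc: "smc \<zeta>" unfolding \<zeta>_def[abs_def] by (intro smc_mult smc_of_real \<theta>(1) cpoly_smc[OF \<psi>(1)])
    have \<zeta>: "\<zeta> \<in> test_fun d U"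
      unfolding test_fun_iff using smc_Cinf[OF \<zeta>smc] \<theta>(7,8,9) by (auto simp: \<zeta>_def)
    have \<psi>s: "\<psi> \<in> sqint (leb d U)" by (rule smc_sqint[OF cpoly_smc[OF \<psi>(1)] bU])
    have "(\<integral>x. f x * h x \<partial>leb d U) = (\<integral>x. f x * mderiv (Rsp d) \<alpha> d \<zeta> x \<partial>leb d U)"
    proof (rule integral_cong_AE)
      have "mderiv (Rsp d) \<alpha> d \<zeta> \<in> borel_measurable (leb d U)" using test_mderiv(1)[OF bU \<zeta>] by measurable
      then show "(\<lambda>x. f x * mderiv (Rsp d) \<alpha> d \<zeta> x) \<in> borel_measurable (leb d U)" using fs by measurable
      have "h \<in> borel_measurable (leb d U)" using smc_sqint[OF cpoly_smc[OF h] bU] by measurable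
      then show "(\<lambda>x. f x * h x) \<in> borel_measurable (leb d U)" using fs by measurable
      show "AE x in leb d U. f x * h x = f x * mderiv (Rsp d) \<alpha> d \<zeta> x"
        using K(3) AE_space
      proof eventually_elim
        case (elim x)
        then have x: "x \<in> Rsp d" using bset_Rsp[OF bU] space_leb[OF bset_Rsp[OF bU]] by auto
        show ?case
        proof (cases "x \<in> K")
          case True
          then have "mderiv (Rsp d) \<alpha> d \<zeta> x = mderiv (Rsp d) \<alpha> d \<psi> x"
            using \<theta>(5,6) x by (intro mderiv_local[OF \<theta>(4)]) (auto simp: \<zeta>_def)
          then show ?thesis using \<psi>(2)[OF x] by simp
        qed (use elim in simp)
      qed
    qed
    also have "\<dots> = (- 1) ^ (\<Sum>i<d. \<alpha> i) * (\<integral>x. ?g x * \<zeta> x \<partial>leb d U)"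
      using w \<zeta> by (simp add: is_weak_deriv_def)
    finally have "cmod (\<integral>x. f x * h x \<partial>leb d U) = cmod (\<integral>x. ?g x * \<zeta> x \<partial>leb d U)"
      by (simp add: norm_mult norm_power)
    also have "\<dots> \<le> ?n ?g * ?n \<zeta>" by (rule sqint_mult(3)[OF gs test_mderiv(2)[OF bU \<zeta>]])
    also have "\<dots> \<le> ?n ?g * ?n \<psi>"
      unfolding nrm_def[of _ \<zeta>] nrm_def[of _ \<psi>]
    proof (intro mult_left_mono real_sqrt_le_mono integral_mono)
      show "integrable (leb d U) (\<lambda>x. (cmod (\<zeta> x))\<^sup>2)" by (rule sqint_integrable[OF test_mderiv(2)[OF bU \<zeta>]])
      show "integrable (leb d U) (\<lambda>x. (cmod (\<psi> x))\<^sup>2)" by (rule sqint_integrable[OF \<psi>s])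
      show "(cmod (\<zeta> x))\<^sup>2 \<le> (cmod (\<psi> x))\<^sup>2" for x
        using \<theta>(2,3)[of x] by (intro power_mono) (auto simp: \<zeta>_def norm_mult mult_left_le_one_le)
    qed simp
    also have "\<dots> \<le> ?n ?g * (q * ?n h)" by (rule mult_left_mono[OF \<psi>(3)]) simp
    finally show "cmod (\<integral>x. f x * h x \<partial>leb d U) \<le> q * ?n ?g * ?n h"
      by (simp add: mult_ac)
  qed
  then show ?thesis by (simp add: q_def U_def)
qed

text \<open>
  Multi-indices of order \<open>j\<close> are compositions of \<open>j\<close> into \<open>d\<close> natural numbers.
\<close>

lemma card_multi_eq:
  assumes "1 \<le> d" shows "card {\<alpha> \<in> {..<d} \<rightarrow>\<^sub>E UNIV. (\<Sum>i<d. \<alpha> i) = (j::nat)} = (d + j - 1) choose (d - 1)"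
proof -
  have "bij_betw (\<lambda>\<alpha>. map \<alpha> [0..<d]) {\<alpha> \<in> {..<d} \<rightarrow>\<^sub>E UNIV. (\<Sum>i<d. \<alpha> i) = j} {l. length l = d \<and> sum_list l = j}"
  proof (rule bij_betw_byWitness[of _ "\<lambda>l. restrict ((!) l) {..<d}"])
    show "\<forall>\<alpha>\<in>{\<alpha> \<in> {..<d} \<rightarrow>\<^sub>E UNIV. (\<Sum>i<d. \<alpha> i) = j}. restrict ((!) (map \<alpha> [0..<d])) {..<d} = \<alpha>"
    proof (intro ballI ext)
      fix \<alpha> i assume "\<alpha> \<in> {\<alpha> \<in> {..<d} \<rightarrow>\<^sub>E UNIV. (\<Sum>i<d. \<alpha> i) = j}"
      then show "restrict ((!) (map \<alpha> [0..<d])) {..<d} i = \<alpha> i"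
        by (cases "i < d") (simp_all add: PiE_iff extensional_def)
    qed
    show "\<forall>l\<in>{l. length l = d \<and> sum_list l = j}. map (restrict ((!) l) {..<d}) [0..<d] = l"
    proof
      fix l assume "l \<in> {l. length l = d \<and> sum_list l = j}"
      then show "map (restrict ((!) l) {..<d}) [0..<d] = l" by (intro nth_equalityI) simp_all
    qed
    show "(\<lambda>\<alpha>. map \<alpha> [0..<d]) ` {\<alpha> \<in> {..<d} \<rightarrow>\<^sub>E UNIV. (\<Sum>i<d. \<alpha> i) = j} \<subseteq> {l. length l = d \<and> sum_list l = j}"
    proof (intro image_subsetI CollectI conjI)
      fix \<alpha> assume "\<alpha> \<in> {\<alpha> \<in> {..<d} \<rightarrow>\<^sub>E UNIV. (\<Sum>i<d. \<alpha> i) = j}"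
      then show "sum_list (map \<alpha> [0..<d]) = j"
        by (simp add: interv_sum_list_conv_sum_set_nat atLeast0LessThan)
    qed simp
    show "(\<lambda>l. restrict ((!) l) {..<d}) ` {l. length l = d \<and> sum_list l = j} \<subseteq> {\<alpha> \<in> {..<d} \<rightarrow>\<^sub>E UNIV. (\<Sum>i<d. \<alpha> i) = j}"
    proof (intro image_subsetI CollectI conjI)
      fix l assume l: "l \<in> {l. length l = d \<and> sum_list l = j}"
      show "restrict ((!) l) {..<d} \<in> {..<d} \<rightarrow>\<^sub>E UNIV" by simp
      have len: "length l = d" using l by simp
      have "(\<Sum>i<d. restrict ((!) l) {..<d} i) = (\<Sum>i<d. l ! i)" by (intro sum.cong) auto
      also have "\<dots> = sum_list l" unfolding sum_list_sum_nth len atLeast0LessThan ..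
      also have "\<dots> = j" using l by simp
      finally show "(\<Sum>i<d. restrict ((!) l) {..<d} i) = j" .
    qed
  qed
  from bij_betw_same_card[OF this]
  have "card {\<alpha> \<in> {..<d} \<rightarrow>\<^sub>E UNIV. (\<Sum>i<d. \<alpha> i) = j} = (j + d - 1) choose j"
    unfolding card_length_sum_list .
  also have "\<dots> = (d + j - 1) choose (d - 1)"
    using assms binomial_symmetric[of j "j + d - 1"] by (simp add: add.commute)
  finally show ?thesis .
qed

lemma sum_multi:
  assumes d: "1 \<le> d"
  shows "(\<Sum>\<alpha>\<in>multi d s. g (\<Sum>i<d. \<alpha> i)) = (\<Sum>j\<le>s. real ((d + j - 1) choose (d - 1)) * g j)"
proof -
  define E where "E j = {\<alpha> \<in> {..<d} \<rightarrow>\<^sub>E UNIV. (\<Sum>i<d. \<alpha> i) = (j::nat)}" for j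
  have U: "multi d s = (\<Union>j\<le>s. E j)" by (auto simp: multi_def E_def)
  have fin: "finite (E j)" if "j \<le> s" for j
    by (rule finite_subset[OF _ finite_multi[of d s]]) (use that U in auto)
  have "(\<Sum>\<alpha>\<in>multi d s. g (\<Sum>i<d. \<alpha> i)) = (\<Sum>j\<le>s. \<Sum>\<alpha>\<in>E j. g (\<Sum>i<d. \<alpha> i))"
    unfolding U by (rule sum.UNION_disjoint) (use fin in \<open>auto simp: E_def\<close>)
  also have "\<dots> = (\<Sum>j\<le>s. \<Sum>\<alpha>\<in>E j. g j)" by (intro sum.cong refl) (auto simp: E_def)
  also have "\<dots> = (\<Sum>j\<le>s. real ((d + j - 1) choose (d - 1)) * g j)"
    by (simp add: card_multi_eq[OF d] E_def)
  finally show ?thesis .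
qed

definition Psum :: "nat \<Rightarrow> real \<Rightarrow> nat \<Rightarrow> real" where
  "Psum s a n = (\<Sum>j\<le>s. real ((n + j - 1) choose (n - 1)) * inverse ((2 * a\<^sup>2) ^ j))"

lemma Psum_pos:
  assumes "0 < a" shows "0 < Psum s a n"
proof -
  have "0 < real ((n + 0 - 1) choose (n - 1)) * inverse ((2 * a\<^sup>2) ^ 0)" by simp
  also have "\<dots> \<le> Psum s a n"
    unfolding Psum_def using assms
    by (intro member_le_sum[of 0 _ "\<lambda>j. real ((n + j - 1) choose (n - 1)) * inverse ((2 * a\<^sup>2) ^ j)"]) auto
  finally show ?thesis .
qed

lemma Pconst_pos: "0 < a \<Longrightarrow> 0 < Pconst s a n"
  using Psum_pos[of a s n] by (simp add: Pconst_def Psum_def)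

text \<open>
  Divide \<open>poincare_weak\<close> by the power of \<open>sqrt 2 * a\<close>, square, and sum over all multi-indices; the number of multi-indices of
  order \<open>j\<close> is the binomial coefficient in \<open>P\<close>.
\<close>

theorem poincare:
  assumes c: "c \<in> Rsp n" and a: "0 < a" and n: "1 \<le> n" and f: "f \<in> sobolev0 n (oball n c a) s"
  shows "nrm (leb n (oball n c a)) f \<le> Pconst s a n * sn n (oball n c a) s f"
proof -
  define U where "U = oball n c a"
  let ?n = "nrm (leb n U)"
  have "(?n f)\<^sup>2 * Psum s a n = (\<Sum>\<alpha>\<in>multi n s. (?n f)\<^sup>2 * inverse ((2 * a\<^sup>2) ^ (\<Sum>i<n. \<alpha> i)))"
    unfolding Psum_def sum_multi[OF n, symmetric] sum_distrib_left ..
  also have "\<dots> \<le> (\<Sum>\<alpha>\<in>multi n s. (?n (weak_deriv n U \<alpha> f))\<^sup>2)"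
  proof (rule sum_mono)
    fix \<alpha> assume \<alpha>: "\<alpha> \<in> multi n s"
    let ?k = "\<Sum>i<n. \<alpha> i"
    have "(?n f)\<^sup>2 \<le> ((sqrt 2 * a) ^ ?k * ?n (weak_deriv n U \<alpha> f))\<^sup>2"
      using poincare_weak[OF c a f \<alpha>] by (intro power_mono) (auto simp: U_def)
    also have "\<dots> = (2 * a\<^sup>2) ^ ?k * (?n (weak_deriv n U \<alpha> f))\<^sup>2"
      by (simp add: power_mult_distrib power_even_eq[symmetric] flip: power_mult)
        (simp add: power_mult mult.commute[of _ 2])
    finally show "(?n f)\<^sup>2 * inverse ((2 * a\<^sup>2) ^ ?k) \<le> (?n (weak_deriv n U \<alpha> f))\<^sup>2"
      using a by (simp add: divide_simps mult.commute)
  qed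
  also have "\<dots> = (sn n U s f)\<^sup>2" by (simp add: sn_def L2_set_def sum_nonneg)
  finally have le: "(?n f)\<^sup>2 * Psum s a n \<le> (sn n U s f)\<^sup>2" .
  have pos: "0 < Psum s a n" by (rule Psum_pos[OF a])
  have P2: "(Pconst s a n)\<^sup>2 * Psum s a n = 1"
  proof -
    have "(Pconst s a n)\<^sup>2 = Psum s a n powr (- 1 / 2) * Psum s a n powr (- 1 / 2)"
      by (simp add: Pconst_def Psum_def power2_eq_square)
    also have "\<dots> = Psum s a n powr (- 1)" by (subst powr_add[symmetric]) simp
    also have "\<dots> = inverse (Psum s a n)" using pos by (simp add: powr_minus)
    finally show ?thesis using pos by simp
  qed
  have "(?n f)\<^sup>2 = (Pconst s a n)\<^sup>2 * ((?n f)\<^sup>2 * Psum s a n)" using P2 by (simp add: mult_ac)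
  also have "\<dots> \<le> (Pconst s a n)\<^sup>2 * (sn n U s f)\<^sup>2" by (intro mult_left_mono le) simp
  finally have "(?n f)\<^sup>2 \<le> (Pconst s a n * sn n U s f)\<^sup>2" by (simp add: power_mult_distrib)
  then show ?thesis unfolding U_def
    by (rule power2_le_imp_le) (use Pconst_pos[OF a] in \<open>simp add: less_imp_le\<close>)
qed

section \<open>Bessel functions of order zero\<close>

text \<open>
  \<open>fI\<close> and \<open>fS\<close> below are the two power series in terms of which \<open>J\<^sub>0, Y\<^sub>0, I\<^sub>0, K\<^sub>0\<close> are written, as functions of
  \<open>x = r\<^sup>2 / 4\<close>; negative \<open>x\<close> belongs to the functions \<open>J\<^sub>0\<close> and \<open>Y\<^sub>0\<close>.
\<close>

definition bI :: "nat \<Rightarrow> real" where "bI m = 1 / (fact m)\<^sup>2"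
definition bS :: "nat \<Rightarrow> real" where "bS m = harm m / (fact m)\<^sup>2"

lemma harm_le: "harm m \<le> (fact m :: real)"
proof -
  have "harm m \<le> real m"
  proof (induction m)
    case (Suc m)
    have "inverse (real (Suc m)) \<le> 1" by (simp add: field_simps)
    with Suc show ?case by (simp add: harm_Suc)
  qed (simp add: harm_def)
  also have "\<dots> \<le> real (fact m)" using fact_ge_self[of m] by (simp only: of_nat_le_iff)
  finally show ?thesis by simp
qed

lemma exp_dominated:
  assumes "\<And>m. \<bar>c m\<bar> \<le> 1 / fact m" shows "summable (\<lambda>m. c m * (x::real) ^ m)"
proof (rule summable_comparison_test[OF exI[of _ 0]])
  show "\<forall>m\<ge>0. norm (c m * x ^ m) \<le> inverse (fact m) * \<bar>x\<bar> ^ m"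
  proof (intro allI impI)
    fix m
    have "\<bar>c m\<bar> * \<bar>x\<bar> ^ m \<le> 1 / fact m * \<bar>x\<bar> ^ m" by (intro mult_right_mono assms) simp
    then show "norm (c m * x ^ m) \<le> inverse (fact m) * \<bar>x\<bar> ^ m"
      by (simp add: abs_mult power_abs divide_inverse)
  qed
  show "summable (\<lambda>m. inverse (fact m) * \<bar>x\<bar> ^ m)" by (rule summable_exp)
qed

lemma bI_summable: "summable (\<lambda>m. bI m * x ^ m)"
proof (rule exp_dominated)
  fix m :: nat
  have "(1::real) * fact m \<le> fact m * fact m" by (intro mult_right_mono fact_ge_1) simp
  then show "\<bar>bI m\<bar> \<le> 1 / fact m" by (simp add: bI_def power2_eq_square divide_simps)
qed

lemma bS_summable: "summable (\<lambda>m. bS m * x ^ m)"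
proof (rule exp_dominated)
  fix m :: nat
  have "\<bar>bS m\<bar> = harm m / (fact m * fact m)" using harm_nonneg[of m] by (simp add: bS_def power2_eq_square)
  also have "\<dots> \<le> fact m / (fact m * fact m)" by (intro divide_right_mono harm_le) simp
  finally show "\<bar>bS m\<bar> \<le> 1 / fact m" by simp
qed

definition fI :: "real \<Rightarrow> real" where "fI x = (\<Sum>m. bI m * x ^ m)"
definition fS :: "real \<Rightarrow> real" where "fS x = (\<Sum>m. bS m * x ^ m)"
definition fI1 :: "real \<Rightarrow> real" where "fI1 x = (\<Sum>m. diffs bI m * x ^ m)"
definition fS1 :: "real \<Rightarrow> real" where "fS1 x = (\<Sum>m. diffs bS m * x ^ m)"
definition fI2 :: "real \<Rightarrow> real" where "fI2 x = (\<Sum>m. diffs (diffs bI) m * x ^ m)"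
definition fS2 :: "real \<Rightarrow> real" where "fS2 x = (\<Sum>m. diffs (diffs bS) m * x ^ m)"

lemmas bI1_summable = termdiff_converges_all[OF bI_summable]
lemmas bS1_summable = termdiff_converges_all[OF bS_summable]

lemma fI_DERIV: "(fI has_real_derivative fI1 x) (at x)"
  unfolding fI_def[abs_def] fI1_def by (rule termdiffs_strong_converges_everywhere[OF bI_summable])
lemma fS_DERIV: "(fS has_real_derivative fS1 x) (at x)"
  unfolding fS_def[abs_def] fS1_def by (rule termdiffs_strong_converges_everywhere[OF bS_summable])
lemma fI1_DERIV: "(fI1 has_real_derivative fI2 x) (at x)"
  unfolding fI1_def[abs_def] fI2_def by (rule termdiffs_strong_converges_everywhere[OF bI1_summable])
lemma fS1_DERIV: "(fS1 has_real_derivative fS2 x) (at x)"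
  unfolding fS1_def[abs_def] fS2_def by (rule termdiffs_strong_converges_everywhere[OF bS1_summable])

lemma x_diffs:
  fixes c :: "nat \<Rightarrow> real"
  assumes "\<And>x. summable (\<lambda>n. c n * x ^ n)"
  shows "(\<lambda>n. (real n + 1) * c n * x ^ n) sums (x * (\<Sum>n. diffs c n * x ^ n) + (\<Sum>n. c n * x ^ n))"
proof -
  have "(\<lambda>n. x * (real n * c n * x ^ (n - Suc 0))) sums (x * (\<Sum>n. diffs c n * x ^ n))"
    using diffs_equiv[OF termdiff_converges_all[OF assms], of x] by (intro sums_mult) simp
  from sums_add[OF this summable_sums[OF assms]]
  have "(\<lambda>n. x * (real n * c n * x ^ (n - Suc 0)) + c n * x ^ n) sums (x * (\<Sum>n. diffs c n * x ^ n) + (\<Sum>n. c n * x ^ n))" .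
  moreover have "x * (real n * c n * x ^ (n - Suc 0)) + c n * x ^ n = (real n + 1) * c n * x ^ n" for n
    by (cases n) (auto simp: algebra_simps)
  ultimately show ?thesis by simp
qed

lemma diffs_bI: "diffs bI m = 1 / ((real m + 1) * (fact m)\<^sup>2)"
proof -
  have "diffs bI m = (real m + 1) / ((real m + 1) * fact m)\<^sup>2" by (simp add: diffs_def bI_def add.commute)
  also have "\<dots> = 1 / ((real m + 1) * (fact m)\<^sup>2)" by (simp add: power2_eq_square divide_simps)
  finally show ?thesis .
qed

text \<open>
  Bessel's equation in the variable \<open>x\<close>.
\<close>

lemma ode_I: "x * fI2 x + fI1 x = fI x"
proof -
  have "(real n + 1) * diffs bI n = bI n" for n
    by (simp add: diffs_bI bI_def)
  then have "(\<lambda>n. bI n * x ^ n) sums (x * fI2 x + fI1 x)"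
    using x_diffs[OF bI1_summable, of x] by (simp add: fI1_def fI2_def)
  then show ?thesis unfolding fI_def by (rule sums_unique)
qed

lemma ode_S: "x * fS2 x + fS1 x = fS x + fI1 x"
proof -
  have "(real n + 1) * diffs bS n = bS n + diffs bI n" for n
  proof -
    have "(real n + 1) * diffs bS n = (real n + 1)\<^sup>2 * harm (Suc n) / ((real n + 1) * fact n)\<^sup>2"
      by (simp add: diffs_def bS_def power2_eq_square add.commute)
    also have "\<dots> = harm (Suc n) / (fact n)\<^sup>2" by (simp add: power_mult_distrib)
    also have "\<dots> = bS n + diffs bI n"
      by (simp add: harm_Suc bS_def diffs_bI add_divide_distrib inverse_eq_divide add.commute)
    finally show ?thesis .
  qed
  then have "(\<lambda>n. bS n * x ^ n + diffs bI n * x ^ n) sums (x * fS2 x + fS1 x)"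
    using x_diffs[OF bS1_summable, of x] by (simp add: fS1_def fS2_def distrib_right)
  moreover have "(\<lambda>n. bS n * x ^ n + diffs bI n * x ^ n) sums (fS x + fI1 x)"
    unfolding fS_def fI1_def by (intro sums_add summable_sums bS_summable bI1_summable)
  ultimately show ?thesis by (rule sums_unique2)
qed

lemma fI_0: "fI 0 = 1"
  unfolding fI_def using powser_zero[of bI] by (simp add: bI_def)

text \<open>
  The difference of both sides has derivative zero by the two differential equations, and vanishes at zero. For a common zero of
  \<open>fI\<close> and \<open>fS\<close> it would say \<open>0 = - 1 / 2\<close>, so \<open>J\<^sub>0\<close> and \<open>Y\<^sub>0\<close> have no common zero.
\<close>

lemma wronskian: "x * (fS1 x * fI x - fS x * fI1 x) = ((fI x)\<^sup>2 - 1) / 2"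
proof -
  define W where "W x = x * (fS1 x * fI x - fS x * fI1 x) - ((fI x)\<^sup>2 - 1) / 2" for x
  have "(W has_real_derivative 0) (at x)" for x
  proof -
    have "(W has_real_derivative
        (fS1 x * fI x - fS x * fI1 x) + x * ((fS2 x * fI x + fS1 x * fI1 x) - (fS1 x * fI1 x + fS x * fI2 x)) - fI x * fI1 x) (at x)"
      unfolding W_def[abs_def]
      by (auto intro!: derivative_eq_intros fI_DERIV fS_DERIV fI1_DERIV fS1_DERIV simp: algebra_simps)
    also have "(fS1 x * fI x - fS x * fI1 x) + x * ((fS2 x * fI x + fS1 x * fI1 x) - (fS1 x * fI1 x + fS x * fI2 x)) - fI x * fI1 x =
        fI x * (x * fS2 x + fS1 x) - fS x * (x * fI2 x + fI1 x) - fI x * fI1 x"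
      by (simp add: algebra_simps)
    also have "\<dots> = 0" unfolding ode_I ode_S by (simp add: algebra_simps)
    finally show ?thesis .
  qed
  then have "W x = W 0" by (intro DERIV_isconst_all) auto
  then show ?thesis by (simp add: W_def fI_0)
qed

lemma fI_ge_1: "0 \<le> x \<Longrightarrow> 1 \<le> fI x"
proof -
  assume x: "0 \<le> x"
  have "(\<Sum>m\<in>{0}. bI m * x ^ m) \<le> fI x"
    unfolding fI_def by (rule sum_le_suminf[OF bI_summable]) (use x in \<open>auto simp: bI_def\<close>)
  then show ?thesis by (simp add: bI_def)
qed

lemma fI1_le:
  assumes "0 < x" shows "fI1 x / fI x \<le> 1 / sqrt x"
proof -
  define V where "V x = (fI x)\<^sup>2 - x * (fI1 x)\<^sup>2" for x
  have D: "(V has_real_derivative (fI1 y)\<^sup>2) (at y)" for y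
  proof -
    have "(V has_real_derivative 2 * fI y * fI1 y - ((fI1 y)\<^sup>2 + y * (2 * fI1 y * fI2 y))) (at y)"
      unfolding V_def[abs_def] by (auto intro!: derivative_eq_intros fI_DERIV fI1_DERIV simp: algebra_simps)
    also have "2 * fI y * fI1 y - ((fI1 y)\<^sup>2 + y * (2 * fI1 y * fI2 y)) =
        2 * (y * fI2 y + fI1 y) * fI1 y - ((fI1 y)\<^sup>2 + y * (2 * fI1 y * fI2 y))" by (simp add: ode_I)
    also have "\<dots> = (fI1 y)\<^sup>2" by (simp add: algebra_simps power2_eq_square)
    finally show ?thesis .
  qed
  have "V 0 \<le> V x"
  proof (rule DERIV_nonneg_imp_nondecreasing[of 0 x V])
    show "0 \<le> x" using assms by simp
    show "\<exists>D. (V has_real_derivative D) (at y) \<and> 0 \<le> D" for y using D[of y] zero_le_power2 by blast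
  qed
  then have "x * (fI1 x)\<^sup>2 \<le> (fI x)\<^sup>2" by (simp add: V_def fI_0)
  then have "(sqrt x * fI1 x)\<^sup>2 \<le> (fI x)\<^sup>2" using assms by (simp add: power_mult_distrib)
  then have "sqrt x * fI1 x \<le> fI x" by (rule power2_le_imp_le) (use fI_ge_1[of x] assms in simp)
  then show ?thesis using assms fI_ge_1[of x] by (simp add: divide_simps mult.commute)
qed

lemma harm_ge: "euler_mascheroni + ln (real m + 1) \<le> harm m + 1 / (real m + 1)"
proof -
  have "(\<lambda>n. harm (Suc n) - ln (real (Suc n))) \<longlonglongrightarrow> (euler_mascheroni::real)"
    using LIMSEQ_Suc[OF euler_mascheroni_LIMSEQ] by simp
  from decseq_ge[OF decseq_harm_diff_ln this, of m] show ?thesis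
    by (simp add: harm_Suc divide_inverse add.commute)
qed

text \<open>
  Termwise: combine \<open>harm m \<ge> euler_mascheroni + ln (m + 1) - 1 / (m + 1)\<close> with
  \<open>ln t \<le> t - 1\<close> for \<open>t = x / (m + 1)\<^sup>2\<close>. On summing against \<open>x\<^sup>m / (m!)\<^sup>2\<close> the factor
  \<open>x / (m + 1)\<^sup>2\<close> shifts the index by one, so the two contributions of order \<open>fI x / 2\<close> cancel.
\<close>

lemma fS_lower:
  assumes x: "0 < x"
  shows "- (1 / sqrt x) \<le> fS x / fI x - ln x / 2 - euler_mascheroni"
proof -
  let ?\<gamma> = "euler_mascheroni :: real"
  have le: "bI m * x ^ m / 2 - bI (Suc m) * x ^ Suc m / 2 - diffs bI m * x ^ m \<le> bS m * x ^ m - (ln x / 2 + ?\<gamma>) * (bI m * x ^ m)" for m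
  proof -
    let ?s = "real m + 1"
    have s: "0 < ?s" by simp
    have "ln (x / ?s\<^sup>2) \<le> x / ?s\<^sup>2 - 1" using x s by (intro ln_le_minus_one) auto
    then have "ln x - 2 * ln ?s \<le> x / ?s\<^sup>2 - 1"
      using x s by (simp add: ln_div ln_realpow)
    moreover have "1 / 2 - A / 2 - B \<le> H - (L / 2 + g)" if "L - 2 * l \<le> A - 1" "g + l \<le> H + B" for A B H L l g :: real
      using that by (simp add: field_simps)
    ultimately have "1 / 2 - x / ?s\<^sup>2 / 2 - 1 / ?s \<le> harm m - (ln x / 2 + ?\<gamma>)"
      using harm_ge[of m] by blast
    then have "(1 / 2 - x / ?s\<^sup>2 / 2 - 1 / ?s) * (bI m * x ^ m) \<le> (harm m - (ln x / 2 + ?\<gamma>)) * (bI m * x ^ m)"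
      using x by (intro mult_right_mono) (auto simp: bI_def)
    moreover have "x / ?s\<^sup>2 * (bI m * x ^ m) = bI (Suc m) * x ^ Suc m"
      by (simp add: bI_def power_mult_distrib add.commute)
    moreover have "1 / ?s * (bI m * x ^ m) = diffs bI m * x ^ m" by (simp add: bI_def diffs_bI)
    moreover have "harm m * (bI m * x ^ m) = bS m * x ^ m" by (simp add: bI_def bS_def)
    ultimately show ?thesis by (simp add: left_diff_distrib)
  qed
  have I1: "(\<lambda>m. bI (Suc m) * x ^ Suc m) sums (fI x - 1)"
    using summable_sums[OF bI_summable[of x]] by (subst sums_Suc_iff) (simp add: fI_def bI_def)
  have l: "(\<lambda>m. bI m * x ^ m / 2 - bI (Suc m) * x ^ Suc m / 2 - diffs bI m * x ^ m) sums (fI x / 2 - (fI x - 1) / 2 - fI1 x)"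
    by (intro sums_diff sums_divide I1) (auto simp: fI_def fI1_def intro: summable_sums bI_summable bI1_summable)
  have r: "(\<lambda>m. bS m * x ^ m - (ln x / 2 + ?\<gamma>) * (bI m * x ^ m)) sums (fS x - (ln x / 2 + ?\<gamma>) * fI x)"
    by (intro sums_diff sums_mult) (auto simp: fI_def fS_def intro: summable_sums bI_summable bS_summable)
  have "fI x / 2 - (fI x - 1) / 2 - fI1 x \<le> fS x - (ln x / 2 + ?\<gamma>) * fI x" by (rule sums_le[OF le l r])
  then have "- fI1 x \<le> fS x - (ln x / 2 + ?\<gamma>) * fI x" by (simp add: field_simps)
  then have "- fI1 x / fI x \<le> (fS x - (ln x / 2 + ?\<gamma>) * fI x) / fI x"
    using fI_ge_1[of x] x by (intro divide_right_mono) auto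
  also have "\<dots> = fS x / fI x - ln x / 2 - ?\<gamma>" using fI_ge_1[of x] x by (simp add: field_simps)
  finally show ?thesis using fI1_le[OF x] by simp
qed

text \<open>
  By the Wronskian \<open>fS / fI - ln x / 2 - euler_mascheroni\<close> is strictly decreasing, and by \<open>fS_lower\<close> its limit at infinity is not negative.
  In other words \<open>K\<^sub>0 / I\<^sub>0\<close> decreases and does not become negative at infinity.
\<close>

lemma fS_gt:
  assumes x: "0 < x" shows "(ln x / 2 + euler_mascheroni) * fI x < fS x"
proof -
  define q where "q x = fS x / fI x - ln x / 2 - euler_mascheroni" for x
  have pos: "0 < fI y" if "0 < y" for y using fI_ge_1[of y] that by simp
  have D: "(q has_real_derivative - 1 / (2 * y * (fI y)\<^sup>2)) (at y)" if y: "0 < y" for y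
  proof -
    have "(q has_real_derivative (fS1 y * fI y - fS y * fI1 y) / (fI y * fI y) - 1 / y / 2) (at y)"
      unfolding q_def[abs_def] using pos[OF y] y
      by (auto intro!: derivative_eq_intros fI_DERIV fS_DERIV simp: field_simps)
    also have "(fS1 y * fI y - fS y * fI1 y) / (fI y * fI y) = (((fI y)\<^sup>2 - 1) / 2 / y) / (fI y * fI y)"
      using y by (simp add: wronskian[symmetric])
    also have "((fI y)\<^sup>2 - 1) / 2 / y / (fI y * fI y) - 1 / y / 2 = - 1 / (2 * y * (fI y)\<^sup>2)"
      using y pos[OF y] by (simp add: field_simps power2_eq_square)
    finally show ?thesis .
  qed
  have dec: "q z < q y" if "0 < y" "y < z" for y z
  proof (rule DERIV_neg_imp_decreasing[OF that(2)])
    fix w assume "y \<le> w" "w \<le> z"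
    then have "0 < w" using that by simp
    then show "\<exists>D. (q has_real_derivative D) (at w) \<and> D < 0"
      using D[of w] pos[of w] by (intro exI[of _ "- 1 / (2 * w * (fI w)\<^sup>2)"]) (auto intro!: divide_neg_pos)
  qed
  have "0 < q x"
  proof (rule ccontr)
    assume "\<not> 0 < q x"
    then have neg: "q (x + 1) < 0" using dec[of x "x + 1"] x by simp
    define e where "e = - q (x + 1)"
    have e: "0 < e" using neg by (simp add: e_def)
    \<comment> \<open>So far out that the lower bound \<open>- 1 / sqrt z\<close> exceeds \<open>q (x + 1) = - e\<close>.\<close>
    define z where "z = max (x + 2) ((1 / e)\<^sup>2)"
    have z: "x + 1 < z" "0 < z" "(1 / e)\<^sup>2 \<le> z" using x by (auto simp: z_def)
    have "1 / e \<le> sqrt z" using z(3) by (rule real_le_rsqrt)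
    then have "1 / sqrt z \<le> e" using e z(2) by (simp add: divide_simps mult.commute)
    moreover have "- (1 / sqrt z) \<le> q z" unfolding q_def by (rule fS_lower[OF z(2)])
    moreover have "q z < q (x + 1)" using dec z x by simp
    ultimately show False by (simp add: e_def)
  qed
  then have "0 < q x * fI x" using pos[OF x] by simp
  also have "q x * fI x = fS x - (ln x / 2 + euler_mascheroni) * fI x"
    using pos[OF x] by (simp add: q_def field_simps)
  finally show ?thesis by simp
qed

lemma bessel_simps:
  "bessel_J0 r = fI (- (r\<^sup>2 / 4))"
  "bessel_Y0 r = 2 / pi * (ln (r / 2) + euler_mascheroni) * fI (- (r\<^sup>2 / 4)) - 2 / pi * fS (- (r\<^sup>2 / 4))"
  "bessel_K0 r = - (ln (r / 2) + euler_mascheroni) * fI (r\<^sup>2 / 4) + fS (r\<^sup>2 / 4)"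
proof -
  have m: "(- 1) ^ m * z ^ m = (- z) ^ m" for m and z :: real
    by (simp flip: power_mult_distrib)
  show J: "bessel_J0 r = fI (- (r\<^sup>2 / 4))"
    unfolding bessel_J0_def fI_def bI_def m by simp
  have "(- 1) ^ m * harm m * (r\<^sup>2 / 4) ^ m / (fact m)\<^sup>2 = bS m * (- (r\<^sup>2 / 4)) ^ m" for m
  proof -
    have "(- 1) ^ m * harm m * (r\<^sup>2 / 4) ^ m / (fact m)\<^sup>2 = bS m * ((- 1) ^ m * (r\<^sup>2 / 4) ^ m)" by (simp add: bS_def)
    then show ?thesis by (simp only: m)
  qed
  then show "bessel_Y0 r = 2 / pi * (ln (r / 2) + euler_mascheroni) * fI (- (r\<^sup>2 / 4)) - 2 / pi * fS (- (r\<^sup>2 / 4))"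
    unfolding bessel_Y0_def J fS_def by presburger
  show "bessel_K0 r = - (ln (r / 2) + euler_mascheroni) * fI (r\<^sup>2 / 4) + fS (r\<^sup>2 / 4)"
    by (simp add: bessel_K0_def bessel_I0_def fI_def fS_def bI_def bS_def)
qed

lemma hankel_nonzero: "0 < r \<Longrightarrow> hankel_H0 r \<noteq> 0"
proof
  assume r: "0 < r" and 0: "hankel_H0 r = 0"
  define z where "z = - (r\<^sup>2 / 4)"
  have J: "fI z = 0" and Y: "bessel_Y0 r = 0"
    using 0 by (auto simp: hankel_H0_def complex_eq_iff bessel_simps(1) z_def)
  then have "fS z = 0" by (simp add: bessel_simps(2) z_def)
  with J wronskian[of z] show False by simp
qed

lemma K0_pos: "0 < r \<Longrightarrow> 0 < bessel_K0 r"
proof -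
  assume r: "0 < r"
  have "ln (r\<^sup>2 / 4) = 2 * ln (r / 2)"
    using r ln_realpow[of "r / 2" 2] by (simp add: power_divide)
  then show ?thesis using fS_gt[of "r\<^sup>2 / 4"] r by (simp add: bessel_simps(3) algebra_simps)
qed

section \<open>The Green's function as a radial function\<close>

text \<open>
  The Green's function in terms of the distance.
\<close>

definition gr :: "wave \<Rightarrow> nat \<Rightarrow> real \<Rightarrow> real \<Rightarrow> complex" where
  "gr w n k r = (case w of
       Helmholtz \<Rightarrow>
         if n = 1 then \<i> / (2 * of_real k) * exp (\<i> * of_real (k * r))
         else if n = 2 then \<i> / 4 * hankel_H0 (k * r)
         else exp (\<i> * of_real (k * r)) / of_real (4 * pi * r)
     | Diffuse \<Rightarrow>
         if n = 1 then of_real (1 / (2 * k) * exp (- k * r))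
         else if n = 2 then of_real (1 / (2 * pi) * bessel_K0 (k * r))
         else of_real (exp (- k * r) / (4 * pi * r)))"

lemma green_gr: "green w n k x y = gr w n k (edist n x y)"
  by (simp add: green_def gr_def Let_def)

lemma green_commute: "green w n k x y = green w n k y x"
  by (simp add: green_gr edist_commute)

lemma gr_nonzero: "0 < k \<Longrightarrow> 0 < r \<Longrightarrow> gr w n k r \<noteq> 0"
  using hankel_nonzero[of "k * r"] K0_pos[of "k * r"] by (auto simp: gr_def split: wave.split)

lemma gr_continuous: "0 < k \<Longrightarrow> continuous_on {0<..} (gr w n k)"
proof -
  assume k: "0 < k"
  have fI: "continuous_on A fI" for A
    using DERIV_isCont[OF fI_DERIV] by (intro continuous_at_imp_continuous_on) auto
  have fS: "continuous_on A fS" for A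
    using DERIV_isCont[OF fS_DERIV] by (intro continuous_at_imp_continuous_on) auto
  have J: "continuous_on {0<..} (\<lambda>r. bessel_J0 (k * r))"
    unfolding bessel_simps by (intro continuous_on_compose2[OF fI[of UNIV]] continuous_intros) auto
  have Y: "continuous_on {0<..} (\<lambda>r. bessel_Y0 (k * r))"
    unfolding bessel_simps using k
    by (intro continuous_on_compose2[OF fI[of UNIV]] continuous_on_compose2[OF fS[of UNIV]] continuous_intros) auto
  have K: "continuous_on {0<..} (\<lambda>r. bessel_K0 (k * r))"
    unfolding bessel_simps using k
    by (intro continuous_on_compose2[OF fI[of UNIV]] continuous_on_compose2[OF fS[of UNIV]] continuous_intros) auto
  have H: "continuous_on {0<..} (\<lambda>r. hankel_H0 (k * r))"
  proof -
    have "hankel_H0 (k * r) = of_real (bessel_J0 (k * r)) + \<i> * of_real (bessel_Y0 (k * r))" for r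
      by (simp add: hankel_H0_def complex_eq_iff)
    then show ?thesis using J Y by (simp add: continuous_intros)
  qed
  show ?thesis
    unfolding gr_def[abs_def] using k
    by (cases w; cases "n = 1"; cases "n = 2") (auto intro!: continuous_intros H K)
qed

lemma gr_measurable: "0 < k \<Longrightarrow> (\<lambda>r. if r \<in> {0<..} then gr w n k r else c) \<in> borel_measurable borel"
  using borel_measurable_continuous_on_restrict[OF gr_continuous[of k w n]]
  by (subst measurable_restrict_space_iff[symmetric]) auto

section \<open>The geometry of the boundary\<close>

lemma ccube_pbox: "ccube d l = pbox d (\<lambda>i. 0) l" by (simp add: ccube_def pbox_def)

lemma cube_subset_ccube: "cube d l \<subseteq> ccube d l" by (auto simp: cube_def ccube_def less_imp_le)

lemma green_measurable:
  assumes "0 < k" shows "(\<lambda>p. green w n k (fst p) (snd p)) \<in> borel_measurable (borel \<Otimes>\<^sub>M borel)"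
proof -
  have c: "continuous_on UNIV (\<lambda>p::pt \<times> pt. edist n (fst p) (snd p))"
    unfolding edist_def L2_set_def
    by (intro continuous_intros continuous_on_compose2[OF continuous_on_product_coordinates continuous_on_fst]
        continuous_on_compose2[OF continuous_on_product_coordinates continuous_on_snd]) auto
  have m: "(\<lambda>p::pt \<times> pt. edist n (fst p) (snd p)) \<in> borel_measurable (borel \<Otimes>\<^sub>M borel)"
    unfolding borel_prod by (rule borel_measurable_continuous_onI[OF c])
  have "green w n k (fst p) (snd p) = (\<lambda>r. if r \<in> {0<..} then gr w n k r else gr w n k 0) (edist n (fst p) (snd p))" for p
  proof (cases "0 < edist n (fst p) (snd p)")
    case False
    then have "edist n (fst p) (snd p) = 0" using edist_nonneg[of n "fst p" "snd p"] by linarith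
    then show ?thesis by (simp add: green_gr)
  qed (simp add: green_gr)
  then show ?thesis using measurable_compose[OF m gr_measurable[OF assms, of w n "gr w n k 0"]] by simp
qed

text \<open>
  The geometry: the ball, the boundary and its charts.
\<close>

locale scat =
  fixes w :: wave and n :: nat and k a :: real and c :: pt and \<Omega> :: "pt set" and A :: atlas and bb :: int
  assumes n: "n \<in> {1, 2, 3}" and k: "0 < k" and a: "0 < a" and c: "c \<in> Rsp n"
    and gap: "0 < (INF (x, y) \<in> bdry n \<Omega> \<times> oball n c a. edist n x y)"
    and atlas: "boundary_atlas n \<Omega> A bb"
begin

abbreviation "B \<equiv> oball n c a"
abbreviation "d \<equiv> n - 1"
abbreviation "l \<equiv> halfwidth A"
abbreviation "\<Delta> \<equiv> Delta n A"
abbreviation "ch \<equiv> chart n A"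
abbreviation "G \<equiv> green w n k"

text \<open>
  The part of the boundary covered by the closed charts. All boundary norms depend only on the values there, and \<open>Z\<close> is compact.
\<close>

definition Z :: "pt set" where "Z = (\<Union>r<charts A. ch r ` ccube d l)"

lemma n1: "1 \<le> n" using n by auto
lemma l_pos: "0 < l" using atlas by (simp add: boundary_atlas_def)
lemma B_bset: "bset n B" by (rule bset_oball[OF c])
lemma B_exh: "exhausted n B" by (rule exhausted_oball[OF c a])
lemma D_bset: "bset d \<Delta>" by (rule bset_cube)
lemma D_exh: "exhausted d \<Delta>" by (rule exhausted_cube[OF l_pos])
lemma B_space: "space (leb n B) = B" by (rule space_leb[OF bset_Rsp[OF B_bset]])
lemma D_space: "space (leb d \<Delta>) = \<Delta>" by (rule space_leb[OF bset_Rsp[OF D_bset]])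
lemma B_fin: "finite_measure (leb n B)" by (rule finite_leb[OF B_bset])
lemma D_fin: "finite_measure (leb d \<Delta>)" by (rule finite_leb[OF D_bset])

lemma lift_Rsp: "x' \<in> Rsp d \<Longrightarrow> x'(d := t) \<in> Rsp n"
proof -
  assume x: "x' \<in> Rsp d"
  have "(x'(d := t)) i = undefined" if "i \<notin> {..<n}" for i
    using x that n1 by (auto simp: Rsp_def PiE_def extensional_def)
  then show ?thesis by (auto simp: Rsp_def PiE_def extensional_def)
qed

lemma coord_Rsp: "r < charts A \<Longrightarrow> x \<in> Rsp n \<Longrightarrow> coord A r x \<in> Rsp n"
  using atlas by (auto simp: boundary_atlas_def)

lemma coord_continuous:
  assumes r: "r < charts A" and f: "continuous_on S f" "\<And>x. x \<in> S \<Longrightarrow> f x \<in> Rsp n"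
  shows "continuous_on S (\<lambda>x. coord A r (f x))"
proof (rule continuous_on_coordinatewise_then_product)
  fix i
  show "continuous_on S (\<lambda>x. coord A r (f x) i)"
  proof (cases "i < n")
    case True
    show ?thesis unfolding continuous_on_def
    proof
      fix x assume x: "x \<in> S"
      have "continuous_on S (\<lambda>y. edist n (f x) (f y))"
        by (rule continuous_on_compose2[OF continuous_edist[of UNIV] f(1)]) simp
      then have "((\<lambda>y. edist n (f x) (f y)) \<longlongrightarrow> edist n (f x) (f x)) (at x within S)"
        using x by (simp add: continuous_on_def)
      then have 0: "((\<lambda>y. edist n (f x) (f y)) \<longlongrightarrow> 0) (at x within S)" by (simp add: edist_def L2_set_def)
      have "norm (coord A r (f y) i - coord A r (f x) i) \<le> edist n (f x) (f y)" if "y \<in> S" for y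
        using abs_le_edist[OF True, of "coord A r (f y)" "coord A r (f x)"] atlas r f(2)[OF x] f(2)[OF that]
        by (simp add: boundary_atlas_def)
      then have "((\<lambda>y. coord A r (f y) i - coord A r (f x) i) \<longlongrightarrow> 0) (at x within S)"
        by (intro Lim_null_comparison[OF _ 0]) (simp add: eventually_at_filter)
      then show "((\<lambda>y. coord A r (f y) i) \<longlongrightarrow> coord A r (f x) i) (at x within S)" by (rule LIM_zero_cancel)
    qed
  next
    case False
    have "coord A r (f x) i = undefined" if "x \<in> S" for x
      using coord_Rsp[OF r f(2)[OF that]] False by (auto simp: Rsp_def PiE_def extensional_def)
    then show ?thesis by (intro continuous_on_eq[OF continuous_on_const]) simp
  qed
qed

lemma upd_continuous:
  fixes g :: "'b::topological_space \<Rightarrow> pt"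
  assumes "continuous_on S g" "continuous_on S h" shows "continuous_on S (\<lambda>x. (g x)(d := h x))"
proof (rule continuous_on_coordinatewise_then_product)
  fix j show "continuous_on S (\<lambda>x. ((g x)(d := h x)) j)"
    using assms continuous_on_product_then_coordinatewise[OF assms(1)] by (cases "j = d") auto
qed

lemma graph_continuous: "r < charts A \<Longrightarrow> continuous_on (ccube d l) (graph A r)"
  using atlas by (auto simp: boundary_atlas_def)

lemma ch_continuous: "r < charts A \<Longrightarrow> continuous_on (ccube d l) (ch r)"
  unfolding chart_def
  by (intro coord_continuous upd_continuous continuous_on_id graph_continuous lift_Rsp) (auto simp: ccube_def)

lemma Z_compact: "compact Z"
  unfolding Z_def
  by (intro compact_UN finite_lessThan compact_continuous_image ch_continuous)
    (auto simp: ccube_pbox compact_box)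

lemma ch_Z: "r < charts A \<Longrightarrow> x' \<in> \<Delta> \<Longrightarrow> ch r x' \<in> Z"
  unfolding Z_def using cube_subset_ccube by blast

text \<open>
  Points slightly above the graph lie in \<open>\<Omega>\<close> and points slightly below it do not.
\<close>

lemma Z_bdry: "Z \<subseteq> bdry n \<Omega>"
proof
  fix z assume "z \<in> Z"
  then obtain r x' where r: "r < charts A" and x': "x' \<in> ccube d l" and z: "z = ch r x'"
    unfolding Z_def by blast
  define h where "h = graph A r x'"
  define p where "p t = coord A r (x'(d := t))" for t
  have zp: "z = p h" by (simp add: z chart_def p_def h_def)
  have H: "0 < height A" using atlas by (simp add: boundary_atlas_def)
  have up: "p t \<in> \<Omega>" if "h < t" "t < h + height A" for t
    using atlas r x' that unfolding boundary_atlas_def h_def p_def by blast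
  have down: "p t \<notin> closure \<Omega>" if "h - height A < t" "t < h" for t
    using atlas r x' that unfolding boundary_atlas_def h_def p_def by blast
  have xR: "x' \<in> Rsp d" using x' by (simp add: ccube_def)
  have pR: "p t \<in> Rsp n" for t unfolding p_def by (rule coord_Rsp[OF r lift_Rsp[OF xR]])
  have pc: "continuous_on UNIV p" unfolding p_def[abs_def]
    by (intro coord_continuous[OF r] upd_continuous continuous_on_const continuous_on_id lift_Rsp xR)
  have near: "\<exists>e>0. e < height A \<and> p (h + e) \<in> T \<and> p (h - e) \<in> T" if T: "openin (top_of_set (Rsp n)) T" "z \<in> T" for T
  proof -
    obtain W where W: "open W" "T = Rsp n \<inter> W" using T(1) by (auto simp: openin_open)
    have "open (p -` W)" by (rule open_vimage[OF W(1) pc])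
    moreover have "h \<in> p -` W" using T W zp by simp
    ultimately obtain e where e: "0 < e" "\<And>t. dist t h < e \<Longrightarrow> p t \<in> W" by (auto simp: open_dist)
    define e' where "e' = min (e / 2) (height A / 2)"
    have "0 < e'" "e' < e" "e' < height A" using e H by (auto simp: e'_def)
    moreover have "p (h + e') \<in> W" "p (h - e') \<in> W" using calculation by (auto intro!: e(2) simp: dist_real_def)
    ultimately show ?thesis using W pR by blast
  qed
  have "z \<in> top_of_set (Rsp n) closure_of \<Omega>"
    unfolding in_closure_of
  proof (intro conjI allI impI)
    show "z \<in> topspace (top_of_set (Rsp n))" using zp pR by simp
    fix T assume "z \<in> T \<and> openin (top_of_set (Rsp n)) T"
    then obtain e where "0 < e" "e < height A" "p (h + e) \<in> T" using near by blast
    then show "\<exists>y. y \<in> \<Omega> \<and> y \<in> T" using up[of "h + e"] by auto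
  qed
  moreover have "z \<notin> top_of_set (Rsp n) interior_of \<Omega>"
  proof
    assume "z \<in> top_of_set (Rsp n) interior_of \<Omega>"
    then obtain T where T: "openin (top_of_set (Rsp n)) T" "z \<in> T" "T \<subseteq> \<Omega>" by (auto simp: interior_of_def)
    then obtain e where "0 < e" "e < height A" "p (h - e) \<in> T" using near by blast
    then show False using down[of "h - e"] T(3) closure_subset by auto
  qed
  ultimately show "z \<in> bdry n \<Omega>" by (simp add: bdry_def frontier_of_def)
qed

text \<open>
  \<open>Z\<close> is a compact part of the boundary, which has positive distance from the ball.
\<close>

lemma distance_bounds: "\<exists>\<delta> R. 0 < \<delta> \<and> (\<forall>z\<in>Z. \<forall>y\<in>B. \<delta> \<le> edist n z y \<and> edist n z y \<le> R)"
proof -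
  define \<delta> where "\<delta> = (INF (x, y) \<in> bdry n \<Omega> \<times> B. edist n x y)"
  have "\<delta> \<le> edist n z y" if "z \<in> Z" "y \<in> B" for z y
  proof -
    have "\<delta> \<le> (\<lambda>(x, y). edist n x y) (z, y)"
      unfolding \<delta>_def by (rule cINF_lower) (use that Z_bdry in \<open>auto intro!: bdd_belowI2[of _ 0]\<close>)
    then show ?thesis by simp
  qed
  moreover have "\<exists>R. \<forall>z\<in>Z. \<forall>y\<in>B. edist n z y \<le> R"
  proof -
    have "continuous_on (Z \<times> pbox n c a) (\<lambda>p. edist n (fst p) (snd p))"
      unfolding edist_def L2_set_def
      by (intro continuous_intros continuous_on_compose2[OF continuous_on_product_coordinates continuous_on_fst]
        continuous_on_compose2[OF continuous_on_product_coordinates continuous_on_snd]) auto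
    from compact_continuous_image[OF this compact_Times[OF Z_compact compact_box]]
    have "bounded ((\<lambda>p. edist n (fst p) (snd p)) ` (Z \<times> pbox n c a))" by (rule compact_imp_bounded)
    then obtain R where R: "\<And>p. p \<in> Z \<times> pbox n c a \<Longrightarrow> \<bar>edist n (fst p) (snd p)\<bar> \<le> R"
      unfolding bounded_iff real_norm_def by blast
    have "y \<in> pbox n c a" if "y \<in> B" for y
    proof -
      have "\<bar>y i - c i\<bar> \<le> a" if "i < n" for i
        using abs_le_edist[OF that, of y c] \<open>y \<in> B\<close> by (simp add: oball_def)
      then show ?thesis using \<open>y \<in> B\<close> by (simp add: oball_def pbox_def)
    qed
    then have "edist n z y \<le> R" if "z \<in> Z" "y \<in> B" for z y using R[of "(z, y)"] that by simp
    then show ?thesis by blast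
  qed
  ultimately show ?thesis using gap unfolding \<delta>_def by blast
qed

lemma green_bounded: "\<exists>C. \<forall>z\<in>Z. \<forall>y\<in>B. cmod (G z y) \<le> C"
proof -
  obtain \<delta> R where \<delta>: "0 < \<delta>" "\<And>z y. z \<in> Z \<Longrightarrow> y \<in> B \<Longrightarrow> \<delta> \<le> edist n z y \<and> edist n z y \<le> R"
    using distance_bounds by blast
  have "compact (gr w n k ` {\<delta>..R})"
    by (intro compact_continuous_image continuous_on_subset[OF gr_continuous[OF k]]) (use \<delta> in auto)
  then obtain C where C: "\<And>r. r \<in> {\<delta>..R} \<Longrightarrow> cmod (gr w n k r) \<le> C"
    using compact_imp_bounded[of "gr w n k ` {\<delta>..R}"] unfolding bounded_iff by blast
  show ?thesis using C \<delta>(2) by (intro exI[of _ C]) (auto simp: green_gr)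
qed

lemma ch_measurable: "r < charts A \<Longrightarrow> ch r \<in> leb d \<Delta> \<rightarrow>\<^sub>M borel"
  by (rule leb_continuous[OF bset_Rsp[OF D_bset] continuous_on_subset[OF ch_continuous cube_subset_ccube]])

lemma B_measurable: "(\<lambda>y. y) \<in> leb n B \<rightarrow>\<^sub>M borel"
  by (rule leb_continuous[OF bset_Rsp[OF B_bset] continuous_on_id])

lemma G_measurable2:
  assumes f: "f \<in> M \<rightarrow>\<^sub>M borel" and g: "g \<in> M \<rightarrow>\<^sub>M borel"
  shows "(\<lambda>x. G (f x) (g x)) \<in> borel_measurable M"
  using measurable_compose[OF measurable_Pair[OF f g] green_measurable[OF k, of w n]] by simp

end

section \<open>Finite sums of measure spaces\<close>

text \<open>
  The product of a counting measure with \<open>N\<close> is a disjoint union of copies of \<open>N\<close>. It holds all derivatives on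
  all charts at once, so that a Sobolev norm on the boundary becomes a single \<open>L\<^sup>2\<close> norm.
\<close>

lemma sum_measure_measurable:
  assumes "finite I"
  shows "f \<in> borel_measurable (count_space I \<Otimes>\<^sub>M N) \<longleftrightarrow> (\<forall>i\<in>I. (\<lambda>x. f (i, x)) \<in> borel_measurable N)"
proof
  assume f: "f \<in> borel_measurable (count_space I \<Otimes>\<^sub>M N)"
  show "\<forall>i\<in>I. (\<lambda>x. f (i, x)) \<in> borel_measurable N"
  proof
    fix i assume "i \<in> I"
    then have "(\<lambda>x. (i, x)) \<in> N \<rightarrow>\<^sub>M count_space I \<Otimes>\<^sub>M N" by (intro measurable_Pair1') simp
    from measurable_compose[OF this f] show "(\<lambda>x. f (i, x)) \<in> borel_measurable N" .
  qed
qed (use assms in \<open>auto intro!: measurable_pair_measure_countable1 countable_finite\<close>)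

lemma sum_measure_nn:
  assumes I: "finite I" and N: "finite_measure N" and f: "f \<in> borel_measurable (count_space I \<Otimes>\<^sub>M N)"
  shows "(\<integral>\<^sup>+p. f p \<partial>(count_space I \<Otimes>\<^sub>M N)) = (\<Sum>i\<in>I. \<integral>\<^sup>+x. f (i, x) \<partial>N)"
proof -
  interpret N: finite_measure N by fact
  show ?thesis
    using N.nn_integral_fst[OF f] I by (simp add: nn_integral_count_space_finite)
qed

lemma sum_measure_sqint:
  assumes I: "finite I" and N: "finite_measure N"
  shows "f \<in> sqint (count_space I \<Otimes>\<^sub>M N) \<longleftrightarrow> (\<forall>i\<in>I. (\<lambda>x. f (i, x)) \<in> sqint N)"
    and "f \<in> sqint (count_space I \<Otimes>\<^sub>M N) \<Longrightarrow> (nrm (count_space I \<Otimes>\<^sub>M N) f)\<^sup>2 = (\<Sum>i\<in>I. (nrm N (\<lambda>x. f (i, x)))\<^sup>2)"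
proof -
  have nn: "(\<integral>\<^sup>+p. ennreal ((cmod (f p))\<^sup>2) \<partial>(count_space I \<Otimes>\<^sub>M N)) = (\<Sum>i\<in>I. \<integral>\<^sup>+x. ennreal ((cmod (f (i, x)))\<^sup>2) \<partial>N)"
    if "f \<in> borel_measurable (count_space I \<Otimes>\<^sub>M N)"
    using that by (intro sum_measure_nn I N) measurable
  show iff: "f \<in> sqint (count_space I \<Otimes>\<^sub>M N) \<longleftrightarrow> (\<forall>i\<in>I. (\<lambda>x. f (i, x)) \<in> sqint N)"
    unfolding sqint_def mem_Collect_eq using nn sum_measure_measurable[OF I, of f N] I
    by (auto simp: less_top)
  assume f: "f \<in> sqint (count_space I \<Otimes>\<^sub>M N)"
  then have fi: "\<And>i. i \<in> I \<Longrightarrow> (\<lambda>x. f (i, x)) \<in> sqint N" using iff by blast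
  have "ennreal ((nrm (count_space I \<Otimes>\<^sub>M N) f)\<^sup>2) = (\<Sum>i\<in>I. ennreal ((nrm N (\<lambda>x. f (i, x)))\<^sup>2))"
    using nn[OF sqint_measurable[OF f]] sqint_nn[OF f] by (simp add: sqint_nn[OF fi])
  also have "\<dots> = ennreal (\<Sum>i\<in>I. (nrm N (\<lambda>x. f (i, x)))\<^sup>2)" by (intro sum_ennreal) simp
  finally show "(nrm (count_space I \<Otimes>\<^sub>M N) f)\<^sup>2 = (\<Sum>i\<in>I. (nrm N (\<lambda>x. f (i, x)))\<^sup>2)"
    by (simp add: sum_nonneg)
qed

lemma sum_measure_finite:
  assumes I: "finite I" and N: "finite_measure N" shows "finite_measure (count_space I \<Otimes>\<^sub>M N)"
proof (rule finite_measureI)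
  interpret N: finite_measure N by fact
  have "emeasure (count_space I \<Otimes>\<^sub>M N) (space (count_space I \<Otimes>\<^sub>M N)) = (\<integral>\<^sup>+p. 1 \<partial>(count_space I \<Otimes>\<^sub>M N))" by simp
  also have "\<dots> = (\<Sum>i\<in>I. \<integral>\<^sup>+x. 1 \<partial>N)" by (rule sum_measure_nn[OF I N]) simp
  also have "\<dots> < \<infinity>"
  proof -
    have "emeasure N (space N) < top" using N.emeasure_finite less_top by blast
    then show ?thesis by (simp add: ennreal_mult_less_top of_nat_less_top)
  qed
  finally show "emeasure (count_space I \<Otimes>\<^sub>M N) (space (count_space I \<Otimes>\<^sub>M N)) \<noteq> \<infinity>" by simp
qed

lemma sum_measure_integral:
  fixes f :: "'i \<times> 'a \<Rightarrow> complex"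
  assumes I: "finite I" and N: "finite_measure N" and f: "integrable (count_space I \<Otimes>\<^sub>M N) f"
  shows "(\<integral>p. f p \<partial>(count_space I \<Otimes>\<^sub>M N)) = (\<Sum>i\<in>I. \<integral>x. f (i, x) \<partial>N)"
proof -
  interpret N: finite_measure N by fact
  interpret C: sigma_finite_measure "count_space I" using I by (rule sigma_finite_measure_count_space_finite)
  interpret P: pair_sigma_finite "count_space I" N ..
  show ?thesis using P.integral_fst'[OF f] I by (simp add: lebesgue_integral_count_space_finite)
qed

(* With d = n - 1 as a dimension, the numeral 1 must not be rewritten. *)
declare One_nat_def [simp del]

section \<open>Norms of potentials\<close>

lemma sobolev_norm_cong:
  assumes U: "U \<subseteq> Rsp d" and eq: "\<And>x. x \<in> U \<Longrightarrow> f x = g x"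
  shows "sobolev_norm d U s f = sobolev_norm d U s g" "f \<in> sobolev d U s \<longleftrightarrow> g \<in> sobolev d U s"
proof -
  have sp: "space (leb d U) = U" by (rule space_leb[OF U])
  have "(\<integral>x. f x * h x \<partial>leb d U) = (\<integral>x. g x * h x \<partial>leb d U)" for h
    by (rule Bochner_Integration.integral_cong) (simp_all add: sp eq)
  then have w: "is_weak_deriv d U \<alpha> f = is_weak_deriv d U \<alpha> g" for \<alpha>
    by (simp add: is_weak_deriv_def[abs_def])
  have "f \<in> borel_measurable (leb d U) \<longleftrightarrow> g \<in> borel_measurable (leb d U)"
    by (rule measurable_cong) (simp add: sp eq)
  moreover have "l2norm d U f = l2norm d U g"
    unfolding l2norm_def by (intro arg_cong[of _ _ esqrt] nn_integral_cong) (simp add: sp eq)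
  ultimately show s: "f \<in> sobolev d U s \<longleftrightarrow> g \<in> sobolev d U s" by (simp add: sobolev_def L2_def w)
  show "sobolev_norm d U s f = sobolev_norm d U s g" unfolding sobolev_norm_def s weak_deriv_def w ..
qed

context scat
begin

text \<open>
  Boundary norms see a function only through the charts.
\<close>

lemma bd_norm_cong:
  assumes eq: "\<And>r x'. r < charts A \<Longrightarrow> x' \<in> \<Delta> \<Longrightarrow> f (ch r x') = g (ch r x')"
  shows "bd_norm n A b f = bd_norm n A b g"
proof -
  have "bd_norm_pos n A s f = bd_norm_pos n A s g" for s
    unfolding bd_norm_pos_def
    by (intro arg_cong[of _ _ esqrt] sum.cong refl arg_cong[of _ _ "\<lambda>x. x\<^sup>2"] sobolev_norm_cong(1)[OF bset_Rsp[OF D_bset]])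
      (auto intro: eq)
  moreover have "bd_norm_neg n A s f = bd_norm_neg n A s g" for s
  proof -
    have "((\<lambda>x'. f (ch r x')) \<in> borel_measurable (leb d \<Delta>)) = ((\<lambda>x'. g (ch r x')) \<in> borel_measurable (leb d \<Delta>))"
      if "r < charts A" for r
      by (rule measurable_cong) (use that in \<open>simp add: D_space eq\<close>)
    moreover have "bd_pairable n A f h = bd_pairable n A g h" for h
      unfolding bd_pairable_def
    proof (intro all_cong1 imp_cong refl)
      fix r assume r: "r < charts A"
      show "integrable (leb d \<Delta>) (\<lambda>x'. f (ch r x') * cnj (h (ch r x'))) =
          integrable (leb d \<Delta>) (\<lambda>x'. g (ch r x') * cnj (h (ch r x')))"
        by (rule Bochner_Integration.integrable_cong) (use r in \<open>simp_all add: D_space eq\<close>)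
    qed
    moreover have "bd_pairing n A f h = bd_pairing n A g h" for h
      unfolding bd_pairing_def
    proof (rule sum.cong[OF refl])
      fix r assume r: "r \<in> {..<charts A}"
      show "(\<integral>x'. f (ch r x') * cnj (h (ch r x')) \<partial>leb d \<Delta>) = (\<integral>x'. g (ch r x') * cnj (h (ch r x')) \<partial>leb d \<Delta>)"
        by (rule Bochner_Integration.integral_cong) (use r in \<open>simp_all add: D_space eq\<close>)
    qed
    ultimately have e: "bd_pairable n A f = bd_pairable n A g" "bd_pairing n A f = bd_pairing n A g"
      "(\<forall>r<charts A. (\<lambda>x'. f (ch r x')) \<in> borel_measurable (leb d \<Delta>)) = (\<forall>r<charts A. (\<lambda>x'. g (ch r x')) \<in> borel_measurable (leb d \<Delta>))"
      by auto
    show ?thesis unfolding bd_norm_neg_def e ..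
  qed
  ultimately show ?thesis by (simp add: bd_norm_def)
qed

lemma bd_norm_pos_real:
  assumes "\<And>r. r < charts A \<Longrightarrow> (\<lambda>x'. f (ch r x')) \<in> sobolev d \<Delta> s"
  shows "bd_norm_pos n A s f = ennreal (sqrt (\<Sum>r<charts A. (sn d \<Delta> s (\<lambda>x'. f (ch r x')))\<^sup>2))"
proof -
  have "(\<Sum>r<charts A. (sobolev_norm d \<Delta> s (\<lambda>x'. f (ch r x')))\<^sup>2) = (\<Sum>r<charts A. ennreal ((sn d \<Delta> s (\<lambda>x'. f (ch r x')))\<^sup>2))"
    by (intro sum.cong refl) (simp add: sobolev_norm_sn[OF assms] ennreal_power)
  also have "\<dots> = ennreal (\<Sum>r<charts A. (sn d \<Delta> s (\<lambda>x'. f (ch r x')))\<^sup>2)" by (intro sum_ennreal) simp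
  finally show ?thesis by (simp add: bd_norm_pos_def esqrt_ennreal sum_nonneg)
qed

lemma bd_norm_pos_sobolev:
  assumes "bd_norm_pos n A s f < \<infinity>" "r < charts A"
  shows "(\<lambda>x'. f (ch r x')) \<in> sobolev d \<Delta> s"
proof (rule ccontr)
  assume "(\<lambda>x'. f (ch r x')) \<notin> sobolev d \<Delta> s"
  then have "(sobolev_norm d \<Delta> s (\<lambda>x'. f (ch r x')))\<^sup>2 = \<infinity>" by (simp add: sobolev_norm_def top_power_ennreal)
  then have "(\<Sum>r<charts A. (sobolev_norm d \<Delta> s (\<lambda>x'. f (ch r x')))\<^sup>2) = \<infinity>"
    using assms(2) by (subst sum.remove[of _ r]) auto
  then show False using assms(1) by (simp only: bd_norm_pos_def) (simp add: esqrt_def)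
qed

lemma bd_norm_zero: "bd_norm n A b (\<lambda>x. 0) = 0"
proof -
  have z: "(\<lambda>x. 0) \<in> sobolev d \<Delta> s" for s
    unfolding sobolev_def L2_sqint by (auto simp: is_weak_deriv_def L2_sqint intro!: exI[of _ "\<lambda>x. 0"])
  have "sn d \<Delta> s (\<lambda>x. 0) = 0" for s
    using sn_lin[OF D_exh z[of s] z[of s], where z = 0 and z' = 0] antisym[OF _ sn_nonneg[of d \<Delta> s]] by simp
  then have "bd_norm_pos n A s (\<lambda>x. 0) = 0" for s using bd_norm_pos_real[of "\<lambda>x. 0" s] z by simp
  moreover have "bd_norm_neg n A s (\<lambda>x. 0) = 0" for s
    by (auto simp: bd_norm_neg_def bd_pairable_def bd_pairing_def intro!: antisym SUP_least)
  ultimately show ?thesis by (simp add: bd_norm_def)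
qed

text \<open>
  The potential with density \<open>\<rho>\<close> on the ball.
\<close>

definition pot :: "(pt \<Rightarrow> complex) \<Rightarrow> pt \<Rightarrow> complex" where
  "pot \<rho> x = (\<integral>y. G x y * \<rho> y \<partial>leb n B)"

lemma G_pair_measurable:
  "r < charts A \<Longrightarrow> (\<lambda>p. G (ch r (fst p)) (snd p)) \<in> borel_measurable (leb d \<Delta> \<Otimes>\<^sub>M leb n B)"
  by (intro G_measurable2 measurable_compose[OF measurable_fst ch_measurable] measurable_compose[OF measurable_snd B_measurable])

lemma G_left_measurable: "(\<lambda>y. G x y) \<in> borel_measurable (leb n B)"
  by (intro G_measurable2 B_measurable) simp

lemma pot_measurable:
  assumes "\<rho> \<in> borel_measurable (leb n B)" "r < charts A"
  shows "(\<lambda>x'. pot \<rho> (ch r x')) \<in> borel_measurable (leb d \<Delta>)"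
proof -
  interpret Bf: finite_measure "leb n B" by (rule B_fin)
  have "(\<lambda>p. G (ch r (fst p)) (snd p) * \<rho> (snd p)) \<in> borel_measurable (leb d \<Delta> \<Otimes>\<^sub>M leb n B)"
    using G_pair_measurable[OF assms(2)] assms(1) by measurable
  then show ?thesis unfolding pot_def
    by (intro Bf.borel_measurable_lebesgue_integral) (simp add: case_prod_beta')
qed

definition Gmax :: real where "Gmax = (SOME C. 0 \<le> C \<and> (\<forall>z\<in>Z. \<forall>y\<in>B. cmod (G z y) \<le> C))"

lemma Gmax: "0 \<le> Gmax" "z \<in> Z \<Longrightarrow> y \<in> B \<Longrightarrow> cmod (G z y) \<le> Gmax"
proof -
  obtain C where C: "\<forall>z\<in>Z. \<forall>y\<in>B. cmod (G z y) \<le> C" using green_bounded by blast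
  then have "0 \<le> \<bar>C\<bar> \<and> (\<forall>z\<in>Z. \<forall>y\<in>B. cmod (G z y) \<le> \<bar>C\<bar>)" by force
  then have "0 \<le> Gmax \<and> (\<forall>z\<in>Z. \<forall>y\<in>B. cmod (G z y) \<le> Gmax)"
    unfolding Gmax_def by (rule someI[of "\<lambda>C. 0 \<le> C \<and> (\<forall>z\<in>Z. \<forall>y\<in>B. cmod (G z y) \<le> C)"])
  then show "0 \<le> Gmax" "z \<in> Z \<Longrightarrow> y \<in> B \<Longrightarrow> cmod (G z y) \<le> Gmax" by auto
qed

lemma G_\<rho>_integrable:
  assumes \<rho>: "integrable (leb n B) \<rho>" and z: "z \<in> Z"
  shows "integrable (leb n B) (\<lambda>y. G z y * \<rho> y)"
proof (rule Bochner_Integration.integrable_bound[of _ "\<lambda>y. Gmax * cmod (\<rho> y)"])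
  show "(\<lambda>y. G z y * \<rho> y) \<in> borel_measurable (leb n B)" using G_left_measurable \<rho> by measurable
  show "AE y in leb n B. norm (G z y * \<rho> y) \<le> norm (Gmax * cmod (\<rho> y))"
    using Gmax z by (intro AE_I2) (auto simp: B_space norm_mult intro!: mult_right_mono)
qed (use \<rho> in auto)

lemma pot_bounded:
  assumes \<rho>: "integrable (leb n B) \<rho>" and z: "z \<in> Z"
  shows "cmod (pot \<rho> z) \<le> Gmax * (\<integral>y. cmod (\<rho> y) \<partial>leb n B)"
proof -
  have "cmod (pot \<rho> z) \<le> (\<integral>y. cmod (G z y * \<rho> y) \<partial>leb n B)" unfolding pot_def by (rule integral_norm_bound)
  also have "\<dots> \<le> (\<integral>y. Gmax * cmod (\<rho> y) \<partial>leb n B)"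
    by (intro integral_mono integrable_norm G_\<rho>_integrable assms)
      (use Gmax z \<rho> in \<open>auto simp: B_space norm_mult intro!: mult_right_mono\<close>)
  finally show ?thesis by simp
qed

lemma pot_sqint:
  assumes \<rho>: "integrable (leb n B) \<rho>" and r: "r < charts A"
  shows "(\<lambda>x'. pot \<rho> (ch r x')) \<in> sqint (leb d \<Delta>)"
  by (rule sqint_bounded(1)[OF D_bset pot_measurable[OF _ r] pot_bounded[OF \<rho> ch_Z[OF r]]]) (use \<rho> in auto)

lemma GD_measurable:
  assumes D: "D \<in> borel_measurable (leb d \<Delta>)" and r: "r < charts A"
  shows "(\<lambda>y. \<integral>x'. G (ch r x') y * D x' \<partial>leb d \<Delta>) \<in> borel_measurable (leb n B)"
proof -
  interpret Df: finite_measure "leb d \<Delta>" by (rule D_fin)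
  have "(\<lambda>p. G (ch r (snd p)) (fst p) * D (snd p)) \<in> borel_measurable (leb n B \<Otimes>\<^sub>M leb d \<Delta>)"
    using measurable_compose[OF measurable_pair_swap' G_pair_measurable[OF r]] D by (simp add: case_prod_beta')
  then show ?thesis by (intro Df.borel_measurable_lebesgue_integral) (simp add: case_prod_beta')
qed

lemma GD_integrable:
  assumes D: "integrable (leb d \<Delta>) D" and r: "r < charts A" and y: "y \<in> B"
  shows "integrable (leb d \<Delta>) (\<lambda>x'. G (ch r x') y * D x')"
proof (rule Bochner_Integration.integrable_bound[of _ "\<lambda>x'. Gmax * cmod (D x')"])
  have "(\<lambda>x'. G (ch r x') y) \<in> borel_measurable (leb d \<Delta>)" by (intro G_measurable2 ch_measurable r) simp
  then show "(\<lambda>x'. G (ch r x') y * D x') \<in> borel_measurable (leb d \<Delta>)" using D by measurable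
  show "AE x' in leb d \<Delta>. norm (G (ch r x') y * D x') \<le> norm (Gmax * cmod (D x'))"
    using Gmax y ch_Z[OF r] by (intro AE_I2) (auto simp: D_space norm_mult intro!: mult_right_mono)
qed (use D in auto)

lemma GD_bounded:
  assumes D: "integrable (leb d \<Delta>) D" and r: "r < charts A" and y: "y \<in> B"
  shows "cmod (\<integral>x'. G (ch r x') y * D x' \<partial>leb d \<Delta>) \<le> Gmax * (\<integral>x'. cmod (D x') \<partial>leb d \<Delta>)"
proof -
  have "cmod (\<integral>x'. G (ch r x') y * D x' \<partial>leb d \<Delta>) \<le> (\<integral>x'. cmod (G (ch r x') y * D x') \<partial>leb d \<Delta>)"
    by (rule integral_norm_bound)
  also have "\<dots> \<le> (\<integral>x'. Gmax * cmod (D x') \<partial>leb d \<Delta>)"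
    by (intro integral_mono integrable_norm GD_integrable assms)
      (use Gmax y D ch_Z[OF r] in \<open>auto simp: D_space norm_mult intro!: mult_right_mono\<close>)
  finally show ?thesis by simp
qed

lemma \<rho>_mult_integrable:
  assumes \<rho>: "integrable (leb n B) \<rho>" and h: "h \<in> borel_measurable (leb n B)" "\<And>y. y \<in> B \<Longrightarrow> cmod (h y) \<le> C"
  shows "integrable (leb n B) (\<lambda>y. \<rho> y * h y)"
proof (rule Bochner_Integration.integrable_bound[of _ "\<lambda>y. \<bar>C\<bar> * cmod (\<rho> y)"])
  show "AE y in leb n B. norm (\<rho> y * h y) \<le> norm (\<bar>C\<bar> * cmod (\<rho> y))"
  proof (rule AE_I2)
    fix y assume "y \<in> space (leb n B)"
    then have "cmod (h y) \<le> \<bar>C\<bar>" using h(2)[of y] by (simp add: B_space)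
    then show "norm (\<rho> y * h y) \<le> norm (\<bar>C\<bar> * cmod (\<rho> y))"
      using mult_left_mono[of "cmod (h y)" "\<bar>C\<bar>" "cmod (\<rho> y)"] by (simp add: norm_mult abs_mult mult.commute)
  qed
qed (use \<rho> h in \<open>auto intro: borel_measurable_times\<close>)

text \<open>
  Pairing a potential with a function on the boundary is integrating the pairing of the Green's function against the density.
\<close>

lemma pot_fubini:
  assumes \<rho>: "integrable (leb n B) \<rho>" and D: "integrable (leb d \<Delta>) D" and r: "r < charts A"
  shows "(\<integral>x'. pot \<rho> (ch r x') * D x' \<partial>leb d \<Delta>) = (\<integral>y. \<rho> y * (\<integral>x'. G (ch r x') y * D x' \<partial>leb d \<Delta>) \<partial>leb n B)"
proof -
  interpret Bf: finite_measure "leb n B" by (rule B_fin)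
  interpret Df: finite_measure "leb d \<Delta>" by (rule D_fin)
  interpret P: pair_sigma_finite "leb d \<Delta>" "leb n B" ..
  let ?f = "\<lambda>x' y. G (ch r x') y * \<rho> y * D x'"
  have \<rho>m: "\<rho> \<in> borel_measurable (leb n B)" and Dm: "D \<in> borel_measurable (leb d \<Delta>)" using \<rho> D by auto
  have m: "(\<lambda>p. ?f (fst p) (snd p)) \<in> borel_measurable (leb d \<Delta> \<Otimes>\<^sub>M leb n B)"
    using G_pair_measurable[OF r] \<rho>m Dm by measurable
  have I: "integrable (leb d \<Delta> \<Otimes>\<^sub>M leb n B) (\<lambda>p. ?f (fst p) (snd p))"
  proof (rule integrableI_bounded[OF m])
    have "(\<integral>\<^sup>+p. ennreal (cmod (?f (fst p) (snd p))) \<partial>(leb d \<Delta> \<Otimes>\<^sub>M leb n B)) =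
        (\<integral>\<^sup>+x'. \<integral>\<^sup>+y. ennreal (cmod (?f x' y)) \<partial>leb n B \<partial>leb d \<Delta>)"
      using m by (subst Bf.nn_integral_fst[symmetric]) auto
    also have "\<dots> \<le> (\<integral>\<^sup>+x'. \<integral>\<^sup>+y. ennreal (Gmax * cmod (D x')) * ennreal (cmod (\<rho> y)) \<partial>leb n B \<partial>leb d \<Delta>)"
    proof (intro nn_integral_mono)
      fix x' y assume "x' \<in> space (leb d \<Delta>)" "y \<in> space (leb n B)"
      then have "cmod (?f x' y) \<le> Gmax * cmod (\<rho> y) * cmod (D x')"
        using Gmax(2)[OF ch_Z[OF r], of x' y]
        by (auto simp: norm_mult D_space B_space intro!: mult_right_mono)
      then show "ennreal (cmod (?f x' y)) \<le> ennreal (Gmax * cmod (D x')) * ennreal (cmod (\<rho> y))"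
        using Gmax(1) by (subst ennreal_mult[symmetric]) (auto intro!: ennreal_leI simp: mult_ac)
    qed
    also have "\<dots> = (\<integral>\<^sup>+x'. ennreal (Gmax * cmod (D x')) * (\<integral>\<^sup>+y. ennreal (cmod (\<rho> y)) \<partial>leb n B) \<partial>leb d \<Delta>)"
      using \<rho>m by (simp add: nn_integral_cmult)
    also have "\<dots> = (\<integral>\<^sup>+x'. ennreal (Gmax * cmod (D x')) \<partial>leb d \<Delta>) * (\<integral>\<^sup>+y. ennreal (cmod (\<rho> y)) \<partial>leb n B)"
      using Dm by (simp add: nn_integral_multc)
    also have "(\<integral>\<^sup>+x'. ennreal (Gmax * cmod (D x')) \<partial>leb d \<Delta>) = ennreal (\<integral>x'. Gmax * cmod (D x') \<partial>leb d \<Delta>)"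
      using D Gmax(1) by (intro nn_integral_eq_integral) auto
    also have "(\<integral>\<^sup>+y. ennreal (cmod (\<rho> y)) \<partial>leb n B) = ennreal (\<integral>y. cmod (\<rho> y) \<partial>leb n B)"
      using \<rho> by (intro nn_integral_eq_integral) auto
    finally show "(\<integral>\<^sup>+p. ennreal (norm (?f (fst p) (snd p))) \<partial>(leb d \<Delta> \<Otimes>\<^sub>M leb n B)) < \<infinity>"
      by (auto intro: le_less_trans simp: ennreal_mult_less_top)
  qed
  have "(\<integral>x'. pot \<rho> (ch r x') * D x' \<partial>leb d \<Delta>) = (\<integral>x'. \<integral>y. ?f x' y \<partial>leb n B \<partial>leb d \<Delta>)"
    unfolding pot_def by (intro Bochner_Integration.integral_cong refl integral_mult_left_zero[symmetric])
  also have "\<dots> = (\<integral>y. \<integral>x'. ?f x' y \<partial>leb d \<Delta> \<partial>leb n B)"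
    using I by (intro P.Fubini_integral[symmetric]) (simp add: case_prod_beta')
  also have "\<dots> = (\<integral>y. \<rho> y * (\<integral>x'. G (ch r x') y * D x' \<partial>leb d \<Delta>) \<partial>leb n B)"
  proof (rule Bochner_Integration.integral_cong[OF refl])
    fix y
    have "(\<integral>x'. ?f x' y \<partial>leb d \<Delta>) = (\<integral>x'. \<rho> y * (G (ch r x') y * D x') \<partial>leb d \<Delta>)"
      by (intro Bochner_Integration.integral_cong refl) (simp only: mult_ac)
    also have "\<dots> = \<rho> y * (\<integral>x'. G (ch r x') y * D x' \<partial>leb d \<Delta>)" by (rule integral_mult_right_zero)
    finally show "(\<integral>x'. ?f x' y \<partial>leb d \<Delta>) = \<rho> y * (\<integral>x'. G (ch r x') y * D x' \<partial>leb d \<Delta>)" .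
  qed
  finally show ?thesis .
qed

text \<open>
  Minkowski's integral inequality for the norm of \<open>H\<^sup>s(\<partial>\<Omega>)\<close>. The weak derivatives of the potential
  are produced by the Riesz representation theorem, which also bounds them.
\<close>

text \<open>
  Consider tuples \<open>v\<close> of test functions, indexed by charts and multi-indices, and the functional
  \<open>L v = \<Sum> (-1)\<^bsup>|\<alpha>|\<^esup> \<integral> pot \<rho> D\<^sup>\<alpha> v\<close>. By Fubini it is the integral of \<open>\<rho> y\<close> times the same functional for
  \<open>G y\<close>, and that is at most \<open>Wr \<parallel>v\<parallel>\<close> since \<open>G y\<close> has weak derivatives. Hence \<open>L\<close> is represented by a function of norm at most
  \<open>Wr \<integral> |\<rho>|\<close>; its components are the weak derivatives of the potential, which therefore exist and obey the bound.
\<close>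

lemma bd_norm_pos_pot:
  assumes Wr: "0 \<le> Wr" and bd: "\<And>y. y \<in> B \<Longrightarrow> bd_norm_pos n A s (\<lambda>x. G y x) \<le> ennreal Wr"
    and \<rho>: "integrable (leb n B) \<rho>"
  shows "bd_norm_pos n A s (pot \<rho>) \<le> ennreal (Wr * (\<integral>y. cmod (\<rho> y) \<partial>leb n B))"
proof -
  let ?N = "leb d \<Delta>"
  let ?J = "\<lambda>i \<psi> y. \<integral>x. G (ch (fst i) x) y * mderiv (Rsp d) (snd i) d \<psi> x \<partial>leb d \<Delta>"
  define I where "I = {..<charts A} \<times> multi d s"
  have I: "finite I" by (simp add: I_def)
  let ?M = "count_space I \<Otimes>\<^sub>M ?N"
  note bD = D_bset and fN = D_fin
  define sg :: "(nat \<Rightarrow> nat) \<Rightarrow> complex" where "sg \<alpha> = (- 1) ^ (\<Sum>i<d. \<alpha> i)" for \<alpha>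
  have sg: "sg \<alpha> * sg \<alpha> = 1" for \<alpha> by (simp add: sg_def flip: power_add mult_2)
  define V where "V = {v :: (nat \<times> (nat \<Rightarrow> nat)) \<times> pt \<Rightarrow> complex. \<forall>i\<in>I. (\<lambda>x. v (i, x)) \<in> test_fun d \<Delta>}"
  define E where "E v y = (\<Sum>i\<in>I. sg (snd i) * ?J i (\<lambda>x. v (i, x)) y)" for v y
  define L where "L v = (\<integral>y. \<rho> y * E v y \<partial>leb n B)" for v
  have Dv: "integrable ?N (mderiv (Rsp d) (snd i) d (\<lambda>x. v (i, x)))" if "v \<in> V" "i \<in> I" for v i
    using that test_mderiv(1)[OF bD, of "\<lambda>x. v (i, x)" "snd i"] sqint_integrable1[OF fN] by (auto simp: V_def)
  have ch: "fst i < charts A" "snd i \<in> multi d s" if "i \<in> I" for i using that by (auto simp: I_def)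
  have Vs: "V \<subseteq> sqint ?M"
    using test_mderiv(2)[OF bD] by (auto simp: V_def sum_measure_sqint(1)[OF I fN])
  have Em: "E v \<in> borel_measurable (leb n B)" if "v \<in> V" for v
    unfolding E_def using Dv[OF that] ch
    by (intro borel_measurable_sum borel_measurable_times borel_measurable_const GD_measurable) auto
  have nG: "sqrt (\<Sum>i\<in>I. (nrm ?N (weak_deriv d \<Delta> (snd i) (\<lambda>x. G y (ch (fst i) x))))\<^sup>2) \<le> Wr"
    "\<And>r. r < charts A \<Longrightarrow> (\<lambda>x. G y (ch r x)) \<in> sobolev d \<Delta> s" if y: "y \<in> B" for y
  proof -
    have fin: "bd_norm_pos n A s (\<lambda>x. G y x) < \<infinity>" using bd[OF y] by (auto intro: le_less_trans)
    then show S: "\<And>r. r < charts A \<Longrightarrow> (\<lambda>x. G y (ch r x)) \<in> sobolev d \<Delta> s" by (rule bd_norm_pos_sobolev)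
    have "ennreal (sqrt (\<Sum>r<charts A. (sn d \<Delta> s (\<lambda>x. G y (ch r x)))\<^sup>2)) \<le> ennreal Wr"
      using bd[OF y] bd_norm_pos_real[OF S] by simp
    then have le: "sqrt (\<Sum>r<charts A. (sn d \<Delta> s (\<lambda>x. G y (ch r x)))\<^sup>2) \<le> Wr" using Wr by simp
    have "(\<Sum>r<charts A. (sn d \<Delta> s (\<lambda>x. G y (ch r x)))\<^sup>2) =
        (\<Sum>r<charts A. \<Sum>\<alpha>\<in>multi d s. (nrm ?N (weak_deriv d \<Delta> \<alpha> (\<lambda>x. G y (ch r x))))\<^sup>2)"
      by (simp add: sn_def L2_set_def sum_nonneg)
    also have "\<dots> = (\<Sum>i\<in>I. (nrm ?N (weak_deriv d \<Delta> (snd i) (\<lambda>x. G y (ch (fst i) x))))\<^sup>2)"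
      unfolding I_def by (simp add: sum.cartesian_product case_prod_beta')
    finally show "sqrt (\<Sum>i\<in>I. (nrm ?N (weak_deriv d \<Delta> (snd i) (\<lambda>x. G y (ch (fst i) x))))\<^sup>2) \<le> Wr"
      using le by presburger
  qed
  have Eb: "cmod (E v y) \<le> Wr * nrm ?M v" if v: "v \<in> V" and y: "y \<in> B" for v y
  proof -
    let ?g = "\<lambda>i. weak_deriv d \<Delta> (snd i) (\<lambda>x. G y (ch (fst i) x))"
    have w: "is_weak_deriv d \<Delta> (snd i) (\<lambda>x. G y (ch (fst i) x)) (?g i)" if "i \<in> I" for i
      by (rule sobolev_weak[OF nG(2)[OF y]]) (use ch[OF that] in auto)
    have vi: "(\<lambda>x. v (i, x)) \<in> test_fun d \<Delta>" if "i \<in> I" for i using v that by (simp add: V_def)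
    have Ee: "E v y = (\<Sum>i\<in>I. \<integral>x. ?g i x * v (i, x) \<partial>?N)"
      unfolding E_def
    proof (rule sum.cong[OF refl])
      fix i assume i: "i \<in> I"
      have "?J i (\<lambda>x. v (i, x)) y = sg (snd i) * (\<integral>x. ?g i x * v (i, x) \<partial>?N)"
        using w[OF i] vi[OF i] unfolding is_weak_deriv_def sg_def by (simp add: green_commute)
      then show "sg (snd i) * ?J i (\<lambda>x. v (i, x)) y = (\<integral>x. ?g i x * v (i, x) \<partial>?N)"
        using sg[of "snd i"] by (simp add: mult.assoc[symmetric])
    qed
    have nv: "L2_set (\<lambda>i. nrm ?N (\<lambda>x. v (i, x))) I = nrm ?M v"
    proof -
      have vs: "v \<in> sqint ?M" using Vs v by blast
      show ?thesis unfolding L2_set_def sum_measure_sqint(2)[OF I fN vs, symmetric] by simp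
    qed
    have "cmod (E v y) \<le> (\<Sum>i\<in>I. cmod (\<integral>x. ?g i x * v (i, x) \<partial>?N))" unfolding Ee by (rule norm_sum)
    also have "\<dots> \<le> (\<Sum>i\<in>I. \<bar>nrm ?N (?g i)\<bar> * \<bar>nrm ?N (\<lambda>x. v (i, x))\<bar>)"
      using sqint_mult(3)[OF is_weak_deriv_sqint[OF w] test_mderiv(2)[OF bD vi]] by (intro sum_mono) simp
    also have "\<dots> \<le> L2_set (\<lambda>i. nrm ?N (?g i)) I * L2_set (\<lambda>i. nrm ?N (\<lambda>x. v (i, x))) I"
      by (rule L2_set_mult_ineq)
    also have "\<dots> \<le> Wr * nrm ?M v"
      unfolding nv using nG(1)[OF y] by (intro mult_right_mono) (auto simp: L2_set_def)
    finally show ?thesis .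
  qed
  have \<rho>E: "integrable (leb n B) (\<lambda>y. \<rho> y * E v y)" if "v \<in> V" for v
    by (rule \<rho>_mult_integrable[OF \<rho> Em[OF that] Eb[OF that]])
  have Vadd: "(\<lambda>x. u x + v x) \<in> V" if "u \<in> V" "v \<in> V" for u v
    using that by (auto simp: V_def intro: test_fun_add)
  have Vmul: "(\<lambda>x. z * v x) \<in> V" if "v \<in> V" for z v
    using that by (auto simp: V_def intro: test_fun_cmult)
  have DR: "x \<in> Rsp d" if "x \<in> space ?N" for x using that bset_Rsp[OF bD] by (auto simp: D_space)
  have Eadd: "E (\<lambda>x. u x + v x) y = E u y + E v y" if uv: "u \<in> V" "v \<in> V" and y: "y \<in> B" for u v y
    unfolding E_def sum.distrib[symmetric] distrib_left[symmetric]
  proof (rule sum.cong[OF refl], rule arg_cong[of _ _ "(*) _"])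
    fix i assume i: "i \<in> I"
    have C: "Cinf d (\<lambda>x. u (i, x))" "Cinf d (\<lambda>x. v (i, x))" using uv i test_fun_Cinf by (auto simp: V_def)
    have "?J i (\<lambda>x. u (i, x) + v (i, x)) y =
        (\<integral>x. G (ch (fst i) x) y * mderiv (Rsp d) (snd i) d (\<lambda>x. u (i, x)) x + G (ch (fst i) x) y * mderiv (Rsp d) (snd i) d (\<lambda>x. v (i, x)) x \<partial>?N)"
      by (intro Bochner_Integration.integral_cong refl) (simp add: mderiv_add[OF C order_refl DR] distrib_left)
    then show "?J i (\<lambda>x. u (i, x) + v (i, x)) y =
        ?J i (\<lambda>x. u (i, x)) y +
        ?J i (\<lambda>x. v (i, x)) y"
      using GD_integrable[OF Dv[OF uv(1) i] ch(1)[OF i] y] GD_integrable[OF Dv[OF uv(2) i] ch(1)[OF i] y] by simp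
  qed
  have Emul: "E (\<lambda>x. z * v x) y = z * E v y" if v: "v \<in> V" for z v y
    unfolding E_def sum_distrib_left
  proof (rule sum.cong[OF refl])
    fix i assume i: "i \<in> I"
    have C: "Cinf d (\<lambda>x. v (i, x))" using v i test_fun_Cinf by (auto simp: V_def)
    have "?J i (\<lambda>x. z * v (i, x)) y =
        (\<integral>x. z * (G (ch (fst i) x) y * mderiv (Rsp d) (snd i) d (\<lambda>x. v (i, x)) x) \<partial>?N)"
      by (intro Bochner_Integration.integral_cong refl) (simp add: mderiv_cmult[OF C order_refl DR])
    then show "sg (snd i) * ?J i (\<lambda>x. z * v (i, x)) y =
        z * (sg (snd i) * ?J i (\<lambda>x. v (i, x)) y)"
      by simp
  qed
  define K where "K = Wr * (\<integral>y. cmod (\<rho> y) \<partial>leb n B)"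
  have K: "0 \<le> K" unfolding K_def using Wr by simp
  have "\<exists>g\<in>sqint ?M. nrm ?M g \<le> K \<and> (\<forall>v\<in>V. L v = (\<integral>x. v x * g x \<partial>?M))"
  proof (rule riesz_representation[OF sum_measure_finite[OF I fN] Vs _ Vadd Vmul _ _ K])
    show "(\<lambda>x. 0) \<in> V" using test_fun_zero by (simp add: V_def)
    show "L (\<lambda>x. u x + v x) = L u + L v" if uv: "u \<in> V" "v \<in> V" for u v
    proof -
      have "L (\<lambda>x. u x + v x) = (\<integral>y. \<rho> y * E u y + \<rho> y * E v y \<partial>leb n B)"
        unfolding L_def by (intro Bochner_Integration.integral_cong refl) (simp add: Eadd[OF uv] B_space distrib_left)
      then show ?thesis using \<rho>E[OF uv(1)] \<rho>E[OF uv(2)] by (simp add: L_def)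
    qed
    show "L (\<lambda>x. z * v x) = z * L v" if "v \<in> V" for z v
    proof -
      have "L (\<lambda>x. z * v x) = (\<integral>y. z * (\<rho> y * E v y) \<partial>leb n B)"
        unfolding L_def by (intro Bochner_Integration.integral_cong refl) (simp add: Emul[OF that])
      then show ?thesis by (simp add: L_def)
    qed
    show "cmod (L v) \<le> K * nrm ?M v" if v: "v \<in> V" for v
    proof -
      have "cmod (L v) \<le> (\<integral>y. cmod (\<rho> y * E v y) \<partial>leb n B)" unfolding L_def by (rule integral_norm_bound)
      also have "\<dots> \<le> (\<integral>y. cmod (\<rho> y) * (Wr * nrm ?M v) \<partial>leb n B)"
        by (intro integral_mono integrable_norm \<rho>E[OF v])
          (use \<rho> Eb[OF v] in \<open>auto simp: B_space norm_mult intro!: mult_left_mono\<close>)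
      also have "\<dots> = K * nrm ?M v" by (simp add: K_def mult_ac)
      finally show ?thesis .
    qed
  qed auto
  then obtain g where g: "g \<in> sqint ?M" "nrm ?M g \<le> K" "\<And>v. v \<in> V \<Longrightarrow> L v = (\<integral>x. v x * g x \<partial>?M)" by blast
  have gi: "(\<lambda>x. g (i, x)) \<in> sqint ?N" if "i \<in> I" for i using g(1) that sum_measure_sqint(1)[OF I fN] by blast
  have wp: "is_weak_deriv d \<Delta> (snd i) (\<lambda>x'. pot \<rho> (ch (fst i) x')) (\<lambda>x. g (i, x))" if i: "i \<in> I" for i
    unfolding is_weak_deriv_def L2_sqint
  proof (intro conjI gi[OF i] ballI)
    fix \<psi> assume \<psi>: "\<psi> \<in> test_fun d \<Delta>"
    define v where "v = (\<lambda>(j, x). if j = i then \<psi> x else 0)"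
    have vj: "(\<lambda>x. v (j, x)) = (if j = i then \<psi> else (\<lambda>x. 0))" for j by (auto simp: v_def)
    have v: "v \<in> V" unfolding V_def mem_Collect_eq vj using \<psi> test_fun_zero by auto
    have z: "mderiv (Rsp d) \<alpha> d (\<lambda>x. 0 :: complex) x = 0" if "x \<in> space ?N" for \<alpha> and x
      using mderiv_cmult[OF test_fun_Cinf[OF \<psi>] order_refl DR[OF that], of \<alpha> 0] by simp
    have "E v y = sg (snd i) * ?J i \<psi> y" for y
    proof -
      have "?J j (\<lambda>x. v (j, x)) y = 0" if "j \<noteq> i" for j
      proof -
        have "?J j (\<lambda>x. v (j, x)) y = (\<integral>x. 0 \<partial>?N)"
          unfolding vj using that by (intro Bochner_Integration.integral_cong refl) (simp add: z)
        then show ?thesis by simp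
      qed
      then show ?thesis unfolding E_def using I i by (subst sum.remove[of _ i]) (auto simp: vj)
    qed
    then have "L v = sg (snd i) * (\<integral>y. \<rho> y * ?J i \<psi> y \<partial>leb n B)"
    proof -
      assume E: "\<And>y. E v y = sg (snd i) * ?J i \<psi> y"
      have "L v = (\<integral>y. sg (snd i) * (\<rho> y * ?J i \<psi> y) \<partial>leb n B)"
        unfolding L_def by (rule Bochner_Integration.integral_cong[OF refl]) (simp only: E mult.left_commute)
      also have "\<dots> = sg (snd i) * (\<integral>y. \<rho> y * ?J i \<psi> y \<partial>leb n B)"
        by (rule integral_mult_right_zero)
      finally show ?thesis .
    qed
    also have "\<dots> = sg (snd i) * (\<integral>x'. pot \<rho> (ch (fst i) x') * mderiv (Rsp d) (snd i) d \<psi> x' \<partial>?N)"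
      by (subst pot_fubini[OF \<rho> sqint_integrable1[OF fN test_mderiv(1)[OF bD \<psi>]] ch(1)[OF i]]) simp
    finally have 1: "L v = sg (snd i) * (\<integral>x'. pot \<rho> (ch (fst i) x') * mderiv (Rsp d) (snd i) d \<psi> x' \<partial>?N)" .
    have vs: "v \<in> sqint ?M" using v Vs by blast
    have "(\<integral>x. v x * g x \<partial>?M) = (\<Sum>j\<in>I. \<integral>x. v (j, x) * g (j, x) \<partial>?N)"
      by (rule sum_measure_integral[OF I fN sqint_mult(1)[OF vs g(1)]])
    also have "\<dots> = (\<integral>x. \<psi> x * g (i, x) \<partial>?N)"
      using I i by (subst sum.remove[of _ i]) (auto simp: v_def intro!: sum.neutral)
    finally have "L v = (\<integral>x. g (i, x) * \<psi> x \<partial>?N)" using g(3)[OF v] by (simp add: mult.commute)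
    then have "sg (snd i) * (\<integral>x. g (i, x) * \<psi> x \<partial>?N) = sg (snd i) * sg (snd i) * (\<integral>x'. pot \<rho> (ch (fst i) x') * mderiv (Rsp d) (snd i) d \<psi> x' \<partial>?N)"
      using 1 by simp
    then show "(\<integral>x. pot \<rho> (ch (fst i) x) * mderiv (Rsp d) (snd i) d \<psi> x \<partial>?N) = (- 1) ^ (\<Sum>j<d. snd i j) * (\<integral>x. g (i, x) * \<psi> x \<partial>?N)"
      using sg[of "snd i"] by (simp add: sg_def)
  qed
  have S: "(\<lambda>x'. pot \<rho> (ch r x')) \<in> sobolev d \<Delta> s" if r: "r < charts A" for r
    unfolding sobolev_def L2_sqint
  proof (intro CollectI conjI pot_sqint[OF \<rho> r] ballI)
    fix \<alpha> assume "\<alpha> \<in> multi d s"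
    then show "\<exists>h. is_weak_deriv d \<Delta> \<alpha> (\<lambda>x'. pot \<rho> (ch r x')) h" using wp[of "(r, \<alpha>)"] r by (auto simp: I_def)
  qed
  have "(\<Sum>r<charts A. (sn d \<Delta> s (\<lambda>x'. pot \<rho> (ch r x')))\<^sup>2) =
      (\<Sum>r<charts A. \<Sum>\<alpha>\<in>multi d s. (nrm ?N (weak_deriv d \<Delta> \<alpha> (\<lambda>x'. pot \<rho> (ch r x'))))\<^sup>2)"
    by (simp add: sn_def L2_set_def sum_nonneg)
  also have "\<dots> = (\<Sum>i\<in>I. (nrm ?N (weak_deriv d \<Delta> (snd i) (\<lambda>x'. pot \<rho> (ch (fst i) x'))))\<^sup>2)"
    unfolding I_def by (simp add: sum.cartesian_product case_prod_beta')
  also have "\<dots> = (\<Sum>i\<in>I. (nrm ?N (\<lambda>x. g (i, x)))\<^sup>2)"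
    by (intro sum.cong refl) (simp add: nrm_weak_deriv[OF D_exh wp])
  also have "\<dots> = (nrm ?M g)\<^sup>2" by (rule sum_measure_sqint(2)[OF I fN g(1), symmetric])
  finally have "bd_norm_pos n A s (pot \<rho>) = ennreal (nrm ?M g)" by (simp add: bd_norm_pos_real[OF S])
  also have "\<dots> \<le> ennreal K" using g(2) by (rule ennreal_leI)
  finally show ?thesis by (simp add: K_def)
qed

lemma bd_sobolev_norm_finite: "g \<in> bd_sobolev n A s \<Longrightarrow> bd_norm_pos n A s g = ennreal (sqrt (\<Sum>r<charts A. (sn d \<Delta> s (\<lambda>x'. g (ch r x')))\<^sup>2))"
  by (rule bd_norm_pos_real) (simp add: bd_sobolev_def)

lemma bd_sobolev_sqint: "g \<in> bd_sobolev n A s \<Longrightarrow> r < charts A \<Longrightarrow> (\<lambda>x'. g (ch r x')) \<in> sqint (leb d \<Delta>)"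
  by (rule sobolev_sqint[of _ _ _ s]) (simp add: bd_sobolev_def)

text \<open>
  A negative norm is a supremum of pairings, and each of them is linear in the function.
\<close>

lemma bd_norm_neg_pot:
  assumes Wr: "0 \<le> Wr" and bd: "\<And>y. y \<in> B \<Longrightarrow> bd_norm_neg n A s (\<lambda>x. G y x) \<le> ennreal Wr"
    and \<rho>: "integrable (leb n B) \<rho>"
  shows "bd_norm_neg n A s (pot \<rho>) \<le> ennreal (Wr * (\<integral>y. cmod (\<rho> y) \<partial>leb n B))"
proof -
  let ?N = "leb d \<Delta>" and ?K = "Wr * (\<integral>y. cmod (\<rho> y) \<partial>leb n B)"
  have K: "0 \<le> ?K" using Wr by simp
  have gc: "integrable ?N (\<lambda>x'. cnj (g (ch r x')))" if "g \<in> bd_sobolev n A s" "r < charts A" for g r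
    by (rule sqint_integrable1[OF D_fin sqint_cnj[OF bd_sobolev_sqint[OF that]]])
  have le: "ennreal (cmod (bd_pairing n A (pot \<rho>) g)) / bd_norm_pos n A s g \<le> ennreal ?K"
    if g: "g \<in> bd_sobolev n A s" for g
  proof -
    define Ng where "Ng = sqrt (\<Sum>r<charts A. (sn d \<Delta> s (\<lambda>x'. g (ch r x')))\<^sup>2)"
    have Ng: "0 \<le> Ng" "bd_norm_pos n A s g = ennreal Ng"
      using bd_sobolev_norm_finite[OF g] by (auto simp: Ng_def sum_nonneg)
    have pG: "cmod (bd_pairing n A (\<lambda>x. G y x) g) \<le> Wr * Ng" if y: "y \<in> B" for y
    proof -
      have "bd_norm_neg n A s (\<lambda>x. G y x) \<noteq> \<infinity>" using bd[OF y] by (auto simp: top_unique)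
      then have "bd_norm_neg n A s (\<lambda>x. G y x) =
          (SUP g\<in>bd_sobolev n A s. ennreal (cmod (bd_pairing n A (\<lambda>x. G y x) g)) / bd_norm_pos n A s g)"
        unfolding bd_norm_neg_def by (meson)
      then have "ennreal (cmod (bd_pairing n A (\<lambda>x. G y x) g)) / bd_norm_pos n A s g \<le> ennreal Wr"
        using bd[OF y] g by (metis (no_types, lifting) SUP_upper order_trans)
      then have *: "ennreal (cmod (bd_pairing n A (\<lambda>x. G y x) g)) / ennreal Ng \<le> ennreal Wr" by (simp add: Ng)
      show ?thesis
      proof (cases "Ng = 0")
        case True
        then show ?thesis using * by (cases "bd_pairing n A (\<lambda>x. G y x) g = 0") (auto simp: top_unique divide_ennreal_def ennreal_mult_eq_top_iff ennreal_mult_top)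
      next
        case False
        then have "ennreal (cmod (bd_pairing n A (\<lambda>x. G y x) g) / Ng) \<le> ennreal Wr"
          using * Ng(1) by (simp add: divide_ennreal)
        then show ?thesis using False Ng(1) Wr by (simp add: divide_simps)
      qed
    qed
    have "bd_pairing n A (pot \<rho>) g = (\<Sum>r<charts A. \<integral>y. \<rho> y * (\<integral>x'. G (ch r x') y * cnj (g (ch r x')) \<partial>?N) \<partial>leb n B)"
      unfolding bd_pairing_def by (intro sum.cong refl pot_fubini[OF \<rho> gc[OF g]]) auto
    also have "\<dots> = (\<integral>y. (\<Sum>r<charts A. \<rho> y * (\<integral>x'. G (ch r x') y * cnj (g (ch r x')) \<partial>?N)) \<partial>leb n B)"
      by (intro Bochner_Integration.integral_sum[symmetric] \<rho>_mult_integrable[OF \<rho> GD_measurable GD_bounded[OF gc[OF g]]])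
        (use gc[OF g] in auto)
    also have "\<dots> = (\<integral>y. \<rho> y * bd_pairing n A (\<lambda>x. G y x) g \<partial>leb n B)"
      unfolding bd_pairing_def sum_distrib_left by (simp add: green_commute)
    finally have "cmod (bd_pairing n A (pot \<rho>) g) \<le> (\<integral>y. cmod (\<rho> y * bd_pairing n A (\<lambda>x. G y x) g) \<partial>leb n B)"
      by (simp only: integral_norm_bound)
    also have "\<dots> \<le> (\<integral>y. cmod (\<rho> y) * (Wr * Ng) \<partial>leb n B)"
    proof (rule integral_mono)
      have m: "(\<lambda>y. bd_pairing n A (\<lambda>x. G y x) g) \<in> borel_measurable (leb n B)"
        unfolding bd_pairing_def
      proof (rule borel_measurable_sum)
        fix r assume r: "r \<in> {..<charts A}"
        then have "(\<lambda>x'. cnj (g (ch r x'))) \<in> borel_measurable ?N" using gc[OF g] by auto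
        from GD_measurable[OF this] r
        show "(\<lambda>y. \<integral>x'. G y (ch r x') * cnj (g (ch r x')) \<partial>?N) \<in> borel_measurable (leb n B)"
          by (simp add: green_commute[of _ _ _ _ "ch r _"])
      qed
      show "integrable (leb n B) (\<lambda>y. cmod (\<rho> y * bd_pairing n A (\<lambda>x. G y x) g))"
        by (intro integrable_norm \<rho>_mult_integrable[OF \<rho> m pG])
      show "cmod (\<rho> y * bd_pairing n A (\<lambda>x. G y x) g) \<le> cmod (\<rho> y) * (Wr * Ng)" if "y \<in> space (leb n B)" for y
        using pG[of y] that by (simp add: norm_mult B_space mult_left_mono)
    qed (use \<rho> in auto)
    finally have le: "cmod (bd_pairing n A (pot \<rho>) g) \<le> ?K * Ng" by (simp add: mult_ac)
    show ?thesis
    proof (cases "Ng = 0")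
      case True
      then have "bd_pairing n A (pot \<rho>) g = 0" using le by simp
      then show ?thesis by simp
    next
      case False
      then have "cmod (bd_pairing n A (pot \<rho>) g) / Ng \<le> ?K" using le Ng(1) by (simp add: divide_simps)
      then show ?thesis unfolding Ng(2) using False Ng(1) by (subst divide_ennreal) (auto intro!: ennreal_leI)
    qed
  qed
  have "bd_pairable n A (pot \<rho>) g" if g: "g \<in> bd_sobolev n A s" for g
    unfolding bd_pairable_def
    using sqint_mult(1)[OF pot_sqint[OF \<rho>] sqint_cnj[OF bd_sobolev_sqint[OF g]]] by auto
  moreover have "\<forall>r<charts A. (\<lambda>x'. pot \<rho> (ch r x')) \<in> borel_measurable ?N"
    using pot_measurable \<rho> by auto
  ultimately have "bd_norm_neg n A s (pot \<rho>) =
      (SUP g\<in>bd_sobolev n A s. ennreal (cmod (bd_pairing n A (pot \<rho>) g)) / bd_norm_pos n A s g)"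
    unfolding bd_norm_neg_def by simp
  also have "\<dots> \<le> ennreal ?K" by (rule SUP_least[OF le])
  finally show ?thesis .
qed

definition W :: ennreal where "W = (SUP y\<in>B. bd_norm n A bb (\<lambda>x. G y x))"

text \<open>
  If \<open>W = \<infinity>\<close> the right side is infinite except for \<open>\<rho> = 0\<close> almost everywhere.
\<close>

theorem bd_norm_pot:
  assumes \<rho>: "integrable (leb n B) \<rho>"
  shows "bd_norm n A bb (pot \<rho>) \<le> W * ennreal (\<integral>y. cmod (\<rho> y) \<partial>leb n B)"
proof (cases "(\<integral>y. cmod (\<rho> y) \<partial>leb n B) = 0")
  case True
  then have "AE y in leb n B. \<rho> y = 0"
    using \<rho> by (subst (asm) integral_nonneg_eq_0_iff_AE) auto
  then have "AE y in leb n B. G x y * \<rho> y = 0" for x by auto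
  then have "pot \<rho> x = 0" for x
    unfolding pot_def by (rule integral_eq_zero_AE)
  then have "pot \<rho> = (\<lambda>x. 0)" by auto
  then show ?thesis by (simp add: bd_norm_zero)
next
  case False
  then have pos: "0 < (\<integral>y. cmod (\<rho> y) \<partial>leb n B)" by (simp add: less_le)
  show ?thesis
  proof (cases "W = \<infinity>")
    case True
    then show ?thesis using pos by (simp add: ennreal_top_mult)
  next
    case False
    define Wr where "Wr = enn2real W"
    have Wr: "0 \<le> Wr" "W = ennreal Wr" using False by (auto simp: Wr_def ennreal_enn2real less_top)
    have bd: "bd_norm n A bb (\<lambda>x. G y x) \<le> ennreal Wr" if "y \<in> B" for y
      unfolding Wr(2)[symmetric] W_def by (rule SUP_upper[OF that])
    have "bd_norm n A bb (pot \<rho>) \<le> ennreal (Wr * (\<integral>y. cmod (\<rho> y) \<partial>leb n B))"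
      using bd_norm_pos_pot[OF Wr(1) _ \<rho>, of "nat bb"] bd_norm_neg_pot[OF Wr(1) _ \<rho>, of "nat (- bb)"] bd
      by (auto simp: bd_norm_def split: if_splits)
    then show ?thesis using Wr pos by (simp add: ennreal_mult)
  qed
qed

end

section \<open>Multiple scattering as iterated potentials\<close>

context scat
begin

lemma c_B: "c \<in> B" using c a by (simp add: oball_def edist_def L2_set_def)

text \<open>
  Distances between the ball and \<open>Z\<close> stay in a compact interval, on which the Green's function is continuous without zeros.
\<close>

lemma green_lower: "\<exists>m>0. \<forall>z\<in>Z. \<forall>y\<in>B. m \<le> cmod (G z y)"
proof -
  obtain \<delta> R where \<delta>: "0 < \<delta>" "\<And>z y. z \<in> Z \<Longrightarrow> y \<in> B \<Longrightarrow> \<delta> \<le> edist n z y \<and> edist n z y \<le> R"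
    using distance_bounds by blast
  show ?thesis
  proof (cases "{\<delta>..R} = {}")
    case False
    have "continuous_on {\<delta>..R} (\<lambda>r. cmod (gr w n k r))"
      by (intro continuous_on_norm continuous_on_subset[OF gr_continuous[OF k]]) (use \<delta> in auto)
    from continuous_attains_inf[OF compact_Icc False this]
    obtain r where r: "r \<in> {\<delta>..R}" "\<And>r'. r' \<in> {\<delta>..R} \<Longrightarrow> cmod (gr w n k r) \<le> cmod (gr w n k r')" by blast
    have "0 < cmod (gr w n k r)" using gr_nonzero[OF k, of r w n] r(1) \<delta>(1) by simp
    then show ?thesis using r(2) \<delta>(2) by (intro exI[of _ "cmod (gr w n k r)"]) (auto simp: green_gr)
  next
    case True
    then have "z \<notin> Z \<or> y \<notin> B" for z y using \<delta>(2)[of z y] by force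
    then show ?thesis by (intro exI[of _ 1]) auto
  qed
qed

text \<open>
  \<open>D\<close> agrees on the boundary with the potential of a density of \<open>L\<^sup>1\<close> norm at most \<open>r\<close>.
\<close>

definition pot_by :: "real \<Rightarrow> (pt \<Rightarrow> complex) \<Rightarrow> bool" where
  "pot_by r D \<longleftrightarrow> (\<exists>\<rho>. integrable (leb n B) \<rho> \<and> (\<forall>z\<in>Z. D z = pot \<rho> z) \<and> (\<integral>y. cmod (\<rho> y) \<partial>leb n B) \<le> r)"

lemma pot_byI:
  "integrable (leb n B) \<rho> \<Longrightarrow> (\<And>z. z \<in> Z \<Longrightarrow> D z = pot \<rho> z) \<Longrightarrow> (\<integral>y. cmod (\<rho> y) \<partial>leb n B) \<le> r \<Longrightarrow> pot_by r D"
  unfolding pot_by_def by blast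

lemma pot_byE:
  assumes "pot_by r D"
  obtains \<rho> where "integrable (leb n B) \<rho>" "\<And>z. z \<in> Z \<Longrightarrow> D z = pot \<rho> z" "(\<integral>y. cmod (\<rho> y) \<partial>leb n B) \<le> r"
  using assms unfolding pot_by_def by blast

lemma pot_by_zero: "(\<And>z. z \<in> Z \<Longrightarrow> D z = 0) \<Longrightarrow> pot_by 0 D"
  by (rule pot_byI[of "\<lambda>y. 0"]) (simp_all add: pot_def)

lemma pot_by_cong: "(\<And>z. z \<in> Z \<Longrightarrow> D z = E z) \<Longrightarrow> pot_by r E \<Longrightarrow> pot_by r D"
  unfolding pot_by_def by simp

lemma pot_by_diff:
  assumes "pot_by r D" "pot_by r' E" shows "pot_by (r + r') (\<lambda>z. D z - E z)"
proof -
  obtain \<rho> where \<rho>: "integrable (leb n B) \<rho>" "\<And>z. z \<in> Z \<Longrightarrow> D z = pot \<rho> z" "(\<integral>y. cmod (\<rho> y) \<partial>leb n B) \<le> r"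
    using assms(1) by (rule pot_byE) blast
  obtain \<theta> where \<theta>: "integrable (leb n B) \<theta>" "\<And>z. z \<in> Z \<Longrightarrow> E z = pot \<theta> z" "(\<integral>y. cmod (\<theta> y) \<partial>leb n B) \<le> r'"
    using assms(2) by (rule pot_byE) blast
  show ?thesis
  proof (rule pot_byI)
    show "integrable (leb n B) (\<lambda>y. \<rho> y - \<theta> y)" using \<rho>(1) \<theta>(1) by simp
    show "D z - E z = pot (\<lambda>y. \<rho> y - \<theta> y) z" if z: "z \<in> Z" for z
      unfolding \<rho>(2)[OF z] \<theta>(2)[OF z] pot_def right_diff_distrib
      by (rule Bochner_Integration.integral_diff[OF G_\<rho>_integrable[OF \<rho>(1) z] G_\<rho>_integrable[OF \<theta>(1) z], symmetric])
    have "(\<integral>y. cmod (\<rho> y - \<theta> y) \<partial>leb n B) \<le> (\<integral>y. cmod (\<rho> y) + cmod (\<theta> y) \<partial>leb n B)"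
      using \<rho>(1) \<theta>(1) by (intro integral_mono norm_triangle_ineq4) auto
    also have "\<dots> = (\<integral>y. cmod (\<rho> y) \<partial>leb n B) + (\<integral>y. cmod (\<theta> y) \<partial>leb n B)" using \<rho>(1) \<theta>(1) by simp
    finally show "(\<integral>y. cmod (\<rho> y - \<theta> y) \<partial>leb n B) \<le> r + r'" using \<rho>(3) \<theta>(3) by simp
  qed
qed

lemma pot_by_norm: "pot_by r D \<Longrightarrow> bd_norm n A bb D \<le> W * ennreal r"
proof (erule pot_byE)
  fix \<rho> assume \<rho>: "integrable (leb n B) \<rho>" "\<And>z. z \<in> Z \<Longrightarrow> D z = pot \<rho> z" "(\<integral>y. cmod (\<rho> y) \<partial>leb n B) \<le> r"
  have "bd_norm n A bb D = bd_norm n A bb (pot \<rho>)" by (rule bd_norm_cong) (rule \<rho>(2)[OF ch_Z])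
  also have "\<dots> \<le> W * ennreal (\<integral>y. cmod (\<rho> y) \<partial>leb n B)" by (rule bd_norm_pot[OF \<rho>(1)])
  also have "\<dots> \<le> W * ennreal r" by (intro mult_left_mono ennreal_leI \<rho>(3)) simp
  finally show ?thesis .
qed

abbreviation is_pot :: "(pt \<Rightarrow> complex) \<Rightarrow> bool" where "is_pot D \<equiv> \<exists>r. pot_by r D"

lemma is_pot_diff: "is_pot D \<Longrightarrow> is_pot E \<Longrightarrow> is_pot (\<lambda>z. D z - E z)"
  using pot_by_diff by blast

lemma is_pot_sum: "(\<And>i. i \<in> I \<Longrightarrow> is_pot (D i)) \<Longrightarrow> is_pot (\<lambda>z. \<Sum>i\<in>I. D i z)"
proof (induction I rule: infinite_finite_induct)
  case (insert i I)
  have "is_pot (\<lambda>z. 0)" using pot_by_zero[of "\<lambda>z. 0"] by blast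
  with insert have "is_pot (\<lambda>z. D i z - (0 - (\<Sum>i\<in>I. D i z)))" by (intro is_pot_diff) auto
  then show ?case using insert by simp
qed (use pot_by_zero[of "\<lambda>z. 0"] in auto)

end

text \<open>
  Finiteness of \<open>\<mu> + \<nu>\<close> says that the supremum \<open>g\<close> and the product \<open>W * Ca\<close> are finite. The factors
  \<open>W\<close> and \<open>Ca\<close> themselves may be \<open>0\<close> and \<open>\<infinity>\<close>.
\<close>

locale fwd = scat +
  fixes ui :: data
  assumes ui: "\<And>r. r < charts A \<Longrightarrow> (\<lambda>(y, x1'). ui y (ch r x1')) \<in> borel_measurable (leb n B \<Otimes>\<^sub>M leb d \<Delta>)"
    and WCa: "W * Ca n B A ui < \<infinity>"
    and gsup: "(SUP y\<in>B. l2norm n B (\<lambda>x. G y x)) < \<infinity>"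
begin

definition g :: real where "g = enn2real (SUP y\<in>B. l2norm n B (\<lambda>x. G y x))"

lemma G_B: "y \<in> B \<Longrightarrow> (\<lambda>x. G y x) \<in> sqint (leb n B)" "y \<in> B \<Longrightarrow> nrm (leb n B) (\<lambda>x. G y x) \<le> g"
proof -
  assume y: "y \<in> B"
  have le: "l2norm n B (\<lambda>x. G y x) \<le> (SUP y\<in>B. l2norm n B (\<lambda>x. G y x))" by (rule SUP_upper[OF y])
  also have "\<dots> = ennreal g" using gsup by (simp add: g_def ennreal_enn2real)
  finally have le': "l2norm n B (\<lambda>x. G y x) \<le> ennreal g" .
  show 1: "(\<lambda>x. G y x) \<in> sqint (leb n B)"
    unfolding L2_sqint[symmetric] L2_def using G_left_measurable le gsup by (auto intro: le_less_trans)
  show "nrm (leb n B) (\<lambda>x. G y x) \<le> g"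
    using le' unfolding l2norm_nrm[OF 1] by (simp add: g_def)
qed

lemma g_nonneg: "0 \<le> g" by (simp add: g_def)

lemma B_sigma: "sigma_finite_measure (leb n B)"
  by (rule finite_measure.axioms(1)[OF B_fin])

abbreviation "PB j \<equiv> \<Pi>\<^sub>M i\<in>{..<j}. leb n B"

interpretation PB: product_sigma_finite "\<lambda>_ :: nat. leb n B"
  by (rule product_sigma_finite.intro) (rule B_sigma)

lemma PB_component: "i < j \<Longrightarrow> (\<lambda>y. y i) \<in> PB j \<rightarrow>\<^sub>M leb n B"
  by (rule measurable_component_singleton) simp

lemma PB_borel: "i < j \<Longrightarrow> (\<lambda>y. y i) \<in> PB j \<rightarrow>\<^sub>M borel"
  by (rule measurable_compose[OF PB_component B_measurable])

text \<open>
  The product of the Green's functions along a chain of \<open>j\<close> scatterers, the first of which is seen from \<open>x\<close>.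
\<close>

definition kernel :: "nat \<Rightarrow> pt \<Rightarrow> (nat \<Rightarrow> pt) \<Rightarrow> complex" where
  "kernel j x y = G x (y 0) * (\<Prod>l<j - 1. G (y l) (y (Suc l)))"

definition npot :: "(pt \<Rightarrow> ennreal) \<Rightarrow> pt \<Rightarrow> ennreal" where
  "npot h x = (\<integral>\<^sup>+y. ennreal (cmod (G x y)) * h y \<partial>leb n B)"

text \<open>
  The field scattered along a chain of scatterers \<open>f # fs\<close> is radiated by the first one, which in turn is driven by the field that
  the remaining ones radiate; the last one is driven by \<open>v\<close>. \<open>dens\<close> is the density on the first scatterer.
\<close>

fun dens :: "(pt \<Rightarrow> complex) \<Rightarrow> param list \<Rightarrow> pt \<Rightarrow> complex" where
  "dens v [] = v"
| "dens v [f] = (\<lambda>y. of_real (k\<^sup>2) * f y * v y)"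
| "dens v (f # fs) = (\<lambda>y. of_real (k\<^sup>2) * f y * pot (dens v fs) y)"

text \<open>
  The same with absolute values, in \<open>ennreal\<close>, to decide integrability.
\<close>

fun ndens :: "(pt \<Rightarrow> ennreal) \<Rightarrow> param list \<Rightarrow> pt \<Rightarrow> ennreal" where
  "ndens u [] = u"
| "ndens u [f] = (\<lambda>y. ennreal (cmod (of_real (k\<^sup>2) * f y)) * u y)"
| "ndens u (f # fs) = (\<lambda>y. ennreal (cmod (of_real (k\<^sup>2) * f y)) * npot (ndens u fs) y)"

lemma dens_Cons: "fs \<noteq> [] \<Longrightarrow> dens v (f # fs) = (\<lambda>y. of_real (k\<^sup>2) * f y * pot (dens v fs) y)"
  by (cases fs) simp_all

lemma ndens_Cons: "fs \<noteq> [] \<Longrightarrow> ndens u (f # fs) = (\<lambda>y. ennreal (cmod (of_real (k\<^sup>2) * f y)) * npot (ndens u fs) y)"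
  by (cases fs) simp_all

text \<open>
  At the other end, the last scatterer may be absorbed into the incident field. Product integrals over tuples of points are peeled from
  this end.
\<close>

lemma dens_snoc: "fs \<noteq> [] \<Longrightarrow> dens v (fs @ [f]) = dens (pot (dens v [f])) fs"
proof (induction fs)
  case (Cons h fs)
  then show ?case by (cases "fs = []") (simp_all add: dens_Cons)
qed simp

lemma ndens_snoc: "fs \<noteq> [] \<Longrightarrow> ndens u (fs @ [f]) = ndens (npot (ndens u [f])) fs"
proof (induction fs)
  case (Cons h fs)
  then show ?case by (cases "fs = []") (simp_all add: ndens_Cons)
qed simp

lemma npot_mono: "(\<And>y. y \<in> B \<Longrightarrow> h y \<le> h' y) \<Longrightarrow> npot h x \<le> npot h' x"
  unfolding npot_def by (intro nn_integral_mono mult_left_mono) (simp_all add: B_space)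

lemma ndens_mono: "(\<And>y. y \<in> B \<Longrightarrow> u y \<le> u' y) \<Longrightarrow> y \<in> B \<Longrightarrow> ndens u fs y \<le> ndens u' fs y"
proof (induction fs arbitrary: y)
  case (Cons f fs)
  show ?case
  proof (cases "fs = []")
    case True
    then show ?thesis using Cons.prems by (simp add: mult_left_mono)
  next
    case False
    then show ?thesis unfolding ndens_Cons[OF False] by (intro mult_left_mono npot_mono Cons.IH Cons.prems) simp_all
  qed
qed simp

lemma npot_measurable: "h \<in> borel_measurable (leb n B) \<Longrightarrow> npot h \<in> borel_measurable (leb n B)"
proof -
  assume h: "h \<in> borel_measurable (leb n B)"
  have G: "(\<lambda>p. G (fst p) (snd p)) \<in> borel_measurable (leb n B \<Otimes>\<^sub>M leb n B)"
    by (rule G_measurable2) (auto intro: measurable_compose[OF _ B_measurable])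
  have "(\<lambda>p. h (snd p)) \<in> borel_measurable (leb n B \<Otimes>\<^sub>M leb n B)" using h by simp
  with G have "(\<lambda>p. ennreal (cmod (G (fst p) (snd p))) * h (snd p)) \<in> borel_measurable (leb n B \<Otimes>\<^sub>M leb n B)"
    by simp
  from sigma_finite_measure.borel_measurable_nn_integral_fst[OF B_sigma this] show ?thesis unfolding npot_def by simp
qed

lemma pot_measurable_B: "h \<in> borel_measurable (leb n B) \<Longrightarrow> pot h \<in> borel_measurable (leb n B)"
proof -
  assume h: "h \<in> borel_measurable (leb n B)"
  have G: "(\<lambda>p. G (fst p) (snd p)) \<in> borel_measurable (leb n B \<Otimes>\<^sub>M leb n B)"
    by (rule G_measurable2) (auto intro: measurable_compose[OF _ B_measurable])
  have "(\<lambda>p. h (snd p)) \<in> borel_measurable (leb n B \<Otimes>\<^sub>M leb n B)" using h by simp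
  with G have "(\<lambda>(x, y). G x y * h y) \<in> borel_measurable (leb n B \<Otimes>\<^sub>M leb n B)"
    by (simp add: case_prod_beta')
  from sigma_finite_measure.borel_measurable_lebesgue_integral[OF B_sigma this] show ?thesis unfolding pot_def by simp
qed

lemma dens_measurable:
  assumes "v \<in> borel_measurable (leb n B)" "\<And>f. f \<in> set fs \<Longrightarrow> f \<in> borel_measurable (leb n B)"
  shows "dens v fs \<in> borel_measurable (leb n B)"
  using assms(2)
proof (induction fs)
  case (Cons f fs)
  then show ?case using assms(1) by (cases "fs = []") (auto simp: dens_Cons intro!: pot_measurable_B borel_measurable_times)
qed (simp add: assms(1))

lemma ndens_measurable:
  assumes "u \<in> borel_measurable (leb n B)" "\<And>f. f \<in> set fs \<Longrightarrow> f \<in> borel_measurable (leb n B)"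
  shows "ndens u fs \<in> borel_measurable (leb n B)"
  using assms(2)
proof (induction fs)
  case (Cons f fs)
  then have f: "f \<in> borel_measurable (leb n B)" by simp
  show ?case
  proof (cases "fs = []")
    case True
    then show ?thesis using f assms(1) by simp
  next
    case False
    have "npot (ndens u fs) \<in> borel_measurable (leb n B)" using Cons by (intro npot_measurable) simp
    with f show ?thesis unfolding ndens_Cons[OF False] by simp
  qed
qed (simp add: assms(1))

lemma pot_npot: "ennreal (cmod (pot h x)) \<le> npot (\<lambda>y. ennreal (cmod (h y))) x"
proof (cases "integrable (leb n B) (\<lambda>y. G x y * h y)")
  case True
  from integral_norm_bound_ennreal[OF this] show ?thesis
    unfolding pot_def npot_def by (simp add: norm_mult ennreal_mult)
qed (simp add: pot_def not_integrable_integral_eq)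

lemma dens_ndens: "y \<in> B \<Longrightarrow> ennreal (cmod (dens v fs y)) \<le> ndens (\<lambda>y. ennreal (cmod (v y))) fs y"
proof (induction fs arbitrary: y)
  case (Cons f fs)
  show ?case
  proof (cases "fs = []")
    case False
    have "ennreal (cmod (dens v (f # fs) y)) = ennreal (cmod (of_real (k\<^sup>2) * f y)) * ennreal (cmod (pot (dens v fs) y))"
      unfolding dens_Cons[OF False] by (simp only: norm_mult ennreal_mult norm_ge_zero mult_nonneg_nonneg)
    also have "\<dots> \<le> ennreal (cmod (of_real (k\<^sup>2) * f y)) * npot (ndens (\<lambda>y. ennreal (cmod (v y))) fs) y"
      by (intro mult_left_mono order_trans[OF pot_npot] npot_mono Cons.IH) simp_all
    finally show ?thesis unfolding ndens_Cons[OF False] .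
  qed (simp add: norm_mult ennreal_mult[symmetric])
qed simp

text \<open>
  Fubini and Cauchy--Schwarz, with the symmetry of \<open>G\<close>: \<open>\<integral> |f(y)| |G(y,z)| dy \<le> \<parallel>f\<parallel> g\<close> for every \<open>z\<close>.
\<close>

lemma L1_step:
  assumes f: "f \<in> sqint (leb n B)" and h: "h \<in> borel_measurable (leb n B)"
  shows "(\<integral>\<^sup>+y. ennreal (cmod (f y)) * npot h y \<partial>leb n B) \<le> ennreal (nrm (leb n B) f * g) * (\<integral>\<^sup>+z. h z \<partial>leb n B)"
proof -
  interpret pair_sigma_finite "leb n B" "leb n B"
    by (rule pair_sigma_finite.intro) (rule B_sigma)+
  have fm: "f \<in> borel_measurable (leb n B)" using f by auto
  have G: "(\<lambda>p. G (fst p) (snd p)) \<in> borel_measurable (leb n B \<Otimes>\<^sub>M leb n B)"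
    by (rule G_measurable2) (auto intro: measurable_compose[OF _ B_measurable])
  have "(\<lambda>p. h (snd p)) \<in> borel_measurable (leb n B \<Otimes>\<^sub>M leb n B)"
    "(\<lambda>p. f (fst p)) \<in> borel_measurable (leb n B \<Otimes>\<^sub>M leb n B)" using h fm by simp_all
  with G have m: "(\<lambda>(y, z). ennreal (cmod (f y)) * (ennreal (cmod (G y z)) * h z)) \<in> borel_measurable (leb n B \<Otimes>\<^sub>M leb n B)"
    by (simp add: case_prod_beta')
  have "(\<integral>\<^sup>+y. ennreal (cmod (f y)) * npot h y \<partial>leb n B) = (\<integral>\<^sup>+y. \<integral>\<^sup>+z. ennreal (cmod (f y)) * (ennreal (cmod (G y z)) * h z) \<partial>leb n B \<partial>leb n B)"
    unfolding npot_def
    by (intro nn_integral_cong nn_integral_cmult[symmetric]) (use h G_left_measurable in simp)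
  also have "\<dots> = (\<integral>\<^sup>+z. \<integral>\<^sup>+y. ennreal (cmod (f y)) * (ennreal (cmod (G y z)) * h z) \<partial>leb n B \<partial>leb n B)"
    by (rule Fubini'[OF m, symmetric])
  also have "\<dots> \<le> (\<integral>\<^sup>+z. ennreal (nrm (leb n B) f * g) * h z \<partial>leb n B)"
  proof (rule nn_integral_mono)
    fix z assume "z \<in> space (leb n B)"
    then have z: "z \<in> B" by (simp add: B_space)
    have Gz: "(\<lambda>y. G y z) \<in> sqint (leb n B)" "nrm (leb n B) (\<lambda>y. G y z) \<le> g"
      using G_B[OF z] by (simp_all add: green_commute[of _ _ _ _ z])
    have int: "integrable (leb n B) (\<lambda>y. cmod (f y) * cmod (G y z))"
      using integrable_norm[OF sqint_mult(1)[OF f Gz(1)]] by (simp add: norm_mult)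
    have "(\<integral>\<^sup>+y. ennreal (cmod (f y)) * (ennreal (cmod (G y z)) * h z) \<partial>leb n B) =
        (\<integral>\<^sup>+y. ennreal (cmod (f y) * cmod (G y z)) * h z \<partial>leb n B)"
      by (intro nn_integral_cong) (simp add: ennreal_mult mult.assoc)
    also have "\<dots> = (\<integral>\<^sup>+y. ennreal (cmod (f y) * cmod (G y z)) \<partial>leb n B) * h z"
      using int by (intro nn_integral_multc) auto
    also have "(\<integral>\<^sup>+y. ennreal (cmod (f y) * cmod (G y z)) \<partial>leb n B) = ennreal (\<integral>y. cmod (f y) * cmod (G y z) \<partial>leb n B)"
      by (rule nn_integral_eq_integral[OF int]) simp
    also have "\<dots> * h z \<le> ennreal (nrm (leb n B) f * g) * h z"
      using order_trans[OF sqint_mult(2)[OF f Gz(1)] mult_left_mono[OF Gz(2) nrm_nonneg]]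
      by (intro mult_right_mono ennreal_leI) auto
    finally show "(\<integral>\<^sup>+y. ennreal (cmod (f y)) * (ennreal (cmod (G y z)) * h z) \<partial>leb n B) \<le> ennreal (nrm (leb n B) f * g) * h z" .
  qed
  also have "\<dots> = ennreal (nrm (leb n B) f * g) * (\<integral>\<^sup>+z. h z \<partial>leb n B)" by (rule nn_integral_cmult[OF h])
  finally show ?thesis .
qed

definition L1c :: "param list \<Rightarrow> real" where
  "L1c fs = (\<Prod>f\<leftarrow>fs. k\<^sup>2 * nrm (leb n B) f) * g ^ (length fs - 1)"

lemma L1c_nonneg: "0 \<le> L1c fs"
  unfolding L1c_def by (intro mult_nonneg_nonneg prod_list_nonneg zero_le_power g_nonneg) auto

lemma ndens_L1:
  assumes v: "v \<in> sqint (leb n B)"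
  shows "fs \<noteq> [] \<Longrightarrow> set fs \<subseteq> sqint (leb n B) \<Longrightarrow>
    (\<integral>\<^sup>+y. ndens (\<lambda>y. ennreal (cmod (v y))) fs y \<partial>leb n B) \<le> ennreal (L1c fs * nrm (leb n B) v)"
proof (induction fs)
  case (Cons f fs)
  have f: "(\<lambda>y. of_real (k\<^sup>2) * f y) \<in> sqint (leb n B)" using Cons.prems by (intro sqint_cmult) simp
  have nf: "nrm (leb n B) (\<lambda>y. of_real (k\<^sup>2) * f y) = k\<^sup>2 * nrm (leb n B) f" unfolding nrm_cmult norm_of_real by simp
  show ?case
  proof (cases "fs = []")
    case True
    have int: "integrable (leb n B) (\<lambda>y. cmod (of_real (k\<^sup>2) * f y) * cmod (v y))"
      using integrable_norm[OF sqint_mult(1)[OF f v]] by (simp add: norm_mult)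
    have "(\<integral>\<^sup>+y. ndens (\<lambda>y. ennreal (cmod (v y))) [f] y \<partial>leb n B) = (\<integral>\<^sup>+y. ennreal (cmod (of_real (k\<^sup>2) * f y) * cmod (v y)) \<partial>leb n B)"
      by (simp only: ndens.simps ennreal_mult[OF norm_ge_zero norm_ge_zero])
    also have "\<dots> = ennreal (\<integral>y. cmod (of_real (k\<^sup>2) * f y) * cmod (v y) \<partial>leb n B)"
      by (rule nn_integral_eq_integral[OF int]) simp
    also have "\<dots> \<le> ennreal (k\<^sup>2 * nrm (leb n B) f * nrm (leb n B) v)"
      using sqint_mult(2)[OF f v] unfolding nf by (rule ennreal_leI)
    finally show ?thesis unfolding True by (simp add: L1c_def)
  next
    case False
    then obtain m where m: "length fs = Suc m" by (cases fs) auto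
    have fsm: "h \<in> borel_measurable (leb n B)" if "h \<in> set fs" for h using Cons.prems that by auto
    have nm: "ndens (\<lambda>y. ennreal (cmod (v y))) fs \<in> borel_measurable (leb n B)"
      using v by (intro ndens_measurable fsm) auto
    have "(\<integral>\<^sup>+y. ndens (\<lambda>y. ennreal (cmod (v y))) (f # fs) y \<partial>leb n B)
        \<le> ennreal (k\<^sup>2 * nrm (leb n B) f * g) * (\<integral>\<^sup>+z. ndens (\<lambda>y. ennreal (cmod (v y))) fs z \<partial>leb n B)"
      unfolding ndens_Cons[OF False] nf[symmetric] by (rule L1_step[OF f nm])
    also have "\<dots> \<le> ennreal (k\<^sup>2 * nrm (leb n B) f * g) * ennreal (L1c fs * nrm (leb n B) v)"
      using Cons False by (intro mult_left_mono Cons.IH) auto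
    also have "\<dots> = ennreal ((k\<^sup>2 * nrm (leb n B) f * g) * (L1c fs * nrm (leb n B) v))"
      using g_nonneg L1c_nonneg by (intro ennreal_mult[symmetric]) auto
    also have "(k\<^sup>2 * nrm (leb n B) f * g) * (L1c fs * nrm (leb n B) v) = L1c (f # fs) * nrm (leb n B) v"
      by (simp add: L1c_def m)
    finally show ?thesis .
  qed
qed simp

end

context fwd
begin

interpretation PB: product_sigma_finite "\<lambda>_ :: nat. leb n B"
  by (rule product_sigma_finite.intro) (rule B_sigma)

definition strength :: "param list \<Rightarrow> (nat \<Rightarrow> pt) \<Rightarrow> complex" where
  "strength fs y = (\<Prod>l<length fs. of_real (k\<^sup>2) * (fs ! l) (y l))"

definition chain :: "(pt \<Rightarrow> complex) \<Rightarrow> param list \<Rightarrow> pt \<Rightarrow> (nat \<Rightarrow> pt) \<Rightarrow> complex" where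
  "chain v fs x y = kernel (length fs) x y * strength fs y * v (y (length fs - 1))"

definition nchain :: "(pt \<Rightarrow> ennreal) \<Rightarrow> param list \<Rightarrow> pt \<Rightarrow> (nat \<Rightarrow> pt) \<Rightarrow> ennreal" where
  "nchain u fs x y = ennreal (cmod (kernel (length fs) x y * strength fs y)) * u (y (length fs - 1))"

lemma kernel_snoc: "kernel (Suc (Suc j)) x (y(Suc j := z)) = kernel (Suc j) x y * G (y j) z"
proof -
  have "(\<Prod>l<j. G ((y(Suc j := z)) l) ((y(Suc j := z)) (Suc l))) = (\<Prod>l<j. G (y l) (y (Suc l)))"
    by (intro prod.cong) auto
  then show ?thesis by (simp add: kernel_def)
qed

lemma strength_snoc: "strength (fs @ [f]) (y(length fs := z)) = strength fs y * (of_real (k\<^sup>2) * f z)"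
proof -
  have "(\<Prod>l<length fs. of_real (k\<^sup>2) * ((fs @ [f]) ! l) ((y(length fs := z)) l)) = strength fs y"
    unfolding strength_def by (intro prod.cong) (auto simp: nth_append)
  then show ?thesis by (simp add: strength_def[of "fs @ [f]"])
qed

lemma kernel_measurable: "0 < j \<Longrightarrow> kernel j x \<in> borel_measurable (PB j)"
proof -
  assume j: "0 < j"
  have "(\<lambda>y. G x (y 0)) \<in> borel_measurable (PB j)" by (rule G_measurable2[OF _ PB_borel[OF j]]) simp
  moreover have "(\<lambda>y. \<Prod>l<j - 1. G (y l) (y (Suc l))) \<in> borel_measurable (PB j)"
    by (intro borel_measurable_prod G_measurable2 PB_borel) auto
  ultimately show ?thesis unfolding kernel_def[abs_def] by (rule borel_measurable_times)
qed

lemma strength_measurable: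
  assumes "\<And>f. f \<in> set fs \<Longrightarrow> f \<in> borel_measurable (leb n B)"
  shows "strength fs \<in> borel_measurable (PB (length fs))"
proof -
  have "(\<lambda>y. (fs ! l) (y l)) \<in> borel_measurable (PB (length fs))" if "l < length fs" for l
    using measurable_compose[OF PB_component[OF that] assms[OF nth_mem[OF that]]] .
  then show ?thesis unfolding strength_def[abs_def]
    by (intro borel_measurable_prod borel_measurable_times borel_measurable_const) auto
qed

lemma ks_measurable:
  assumes "fs \<noteq> []" "\<And>f. f \<in> set fs \<Longrightarrow> f \<in> borel_measurable (leb n B)"
  shows "(\<lambda>y. kernel (length fs) x y * strength fs y) \<in> borel_measurable (PB (length fs))"
  using assms by (intro borel_measurable_times kernel_measurable strength_measurable) auto

lemma last_measurable: "fs \<noteq> [] \<Longrightarrow> u \<in> leb n B \<rightarrow>\<^sub>M M \<Longrightarrow> (\<lambda>y. u (y (length fs - 1))) \<in> PB (length fs) \<rightarrow>\<^sub>M M"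
  by (rule measurable_compose[OF PB_component]) simp_all

lemma chain_measurable:
  assumes "fs \<noteq> []" "\<And>f. f \<in> set fs \<Longrightarrow> f \<in> borel_measurable (leb n B)" "v \<in> borel_measurable (leb n B)"
  shows "chain v fs x \<in> borel_measurable (PB (length fs))"
  unfolding chain_def[abs_def] by (intro borel_measurable_times[OF ks_measurable last_measurable] assms) auto

lemma nchain_measurable:
  assumes "fs \<noteq> []" "\<And>f. f \<in> set fs \<Longrightarrow> f \<in> borel_measurable (leb n B)" "u \<in> borel_measurable (leb n B)"
  shows "nchain u fs x \<in> borel_measurable (PB (length fs))"
proof -
  have "(\<lambda>y. ennreal (cmod (kernel (length fs) x y * strength fs y))) \<in> borel_measurable (PB (length fs))"
    using ks_measurable[OF assms(1,2)] by (intro measurable_compose[OF _ measurable_ennreal] borel_measurable_norm) auto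
  then show ?thesis unfolding nchain_def[abs_def] using last_measurable[OF assms(1,3)] by (rule borel_measurable_times_ennreal)
qed

lemma not_self: "j \<notin> {..<j}" for j :: nat by simp

lemma PB_one: "PB (length [f]) = Pi\<^sub>M {0} (\<lambda>_. leb n B)" by (simp add: lessThan_Suc)

lemma PB_Suc: "PB (length (fs @ [f])) = Pi\<^sub>M (insert (length fs) {..<length fs}) (\<lambda>_. leb n B)"
  by (simp add: lessThan_Suc)

text \<open>
  Integrate over the last point of the chain; this replaces the incident field \<open>u\<close> by the field radiated by the last scatterer.
\<close>

lemma nchain_integral:
  shows "fs \<noteq> [] \<Longrightarrow> set fs \<subseteq> borel_measurable (leb n B) \<Longrightarrow> u \<in> borel_measurable (leb n B) \<Longrightarrow>
    (\<integral>\<^sup>+y. nchain u fs x y \<partial>PB (length fs)) = npot (ndens u fs) x"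
proof (induction fs arbitrary: u rule: rev_induct)
  case (snoc f fs)
  have f: "f \<in> borel_measurable (leb n B)" and fs: "\<And>f. f \<in> set fs \<Longrightarrow> f \<in> borel_measurable (leb n B)"
    using snoc.prems by auto
  note u = snoc.prems(3)
  have k2f: "(\<lambda>z. ennreal (cmod (of_real (k\<^sup>2) * f z))) \<in> borel_measurable (leb n B)"
    using f by (intro measurable_compose[OF _ measurable_ennreal] borel_measurable_norm borel_measurable_times) auto
  have Gx: "(\<lambda>z. ennreal (cmod (G x z))) \<in> borel_measurable (leb n B)" for x
    by (rule measurable_compose[OF measurable_compose[OF G_left_measurable borel_measurable_norm] measurable_ennreal])
  show ?case
  proof (cases "fs = []")
    case True
    have k1: "nchain u [f] x y = ennreal (cmod (G x (y 0))) * (ennreal (cmod (of_real (k\<^sup>2) * f (y 0))) * u (y 0))" for y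
      by (simp add: nchain_def kernel_def strength_def norm_mult ennreal_mult mult.assoc)
    have "(\<integral>\<^sup>+y. nchain u [f] x y \<partial>PB (length [f])) = npot (ndens u [f]) x"
      unfolding PB_one k1 npot_def ndens.simps
      by (rule PB.product_nn_integral_singleton) (intro borel_measurable_times_ennreal Gx k2f u)
    then show ?thesis using True by simp
  next
    case False
    then obtain m where m: "length fs = Suc m" by (cases fs) auto
    have nm: "nchain u (fs @ [f]) x \<in> borel_measurable (Pi\<^sub>M (insert (length fs) {..<length fs}) (\<lambda>_. leb n B))"
      unfolding PB_Suc[symmetric, of fs f] using snoc.prems by (intro nchain_measurable) auto
    have inner: "(\<integral>\<^sup>+z. nchain u (fs @ [f]) x (y(length fs := z)) \<partial>leb n B) = nchain (npot (ndens u [f])) fs x y" for y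
    proof -
      have "nchain u (fs @ [f]) x (y(length fs := z)) =
          ennreal (cmod (kernel (length fs) x y * strength fs y)) *
          (ennreal (cmod (G (y (length fs - 1)) z)) * (ennreal (cmod (of_real (k\<^sup>2) * f z)) * u z))" for z
      proof -
        have "nchain u (fs @ [f]) x (y(length fs := z)) =
          ennreal (cmod ((kernel (Suc m) x y * G (y m) z) * (strength fs y * (of_real (k\<^sup>2) * f z)))) * u z"
          unfolding nchain_def strength_snoc by (simp add: m kernel_snoc)
        also have "\<dots> = ennreal (cmod (kernel (length fs) x y * strength fs y)) *
          (ennreal (cmod (G (y (length fs - 1)) z)) * (ennreal (cmod (of_real (k\<^sup>2) * f z)) * u z))"
          unfolding norm_mult m by (simp add: ennreal_mult ac_simps)
        finally show ?thesis .
      qed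
      then have "(\<integral>\<^sup>+z. nchain u (fs @ [f]) x (y(length fs := z)) \<partial>leb n B) = ennreal (cmod (kernel (length fs) x y * strength fs y)) *
          (\<integral>\<^sup>+z. ennreal (cmod (G (y (length fs - 1)) z)) * (ennreal (cmod (of_real (k\<^sup>2) * f z)) * u z) \<partial>leb n B)"
        by (simp only:) (rule nn_integral_cmult, intro borel_measurable_times_ennreal Gx k2f u)
      then show ?thesis by (simp add: nchain_def npot_def)
    qed
    have um: "npot (ndens u [f]) \<in> borel_measurable (leb n B)"
      using f u by (intro npot_measurable ndens_measurable) auto
    have "(\<integral>\<^sup>+y. nchain u (fs @ [f]) x y \<partial>PB (length (fs @ [f]))) = (\<integral>\<^sup>+y. nchain (npot (ndens u [f])) fs x y \<partial>PB (length fs))"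
      unfolding PB_Suc PB.product_nn_integral_insert[OF finite_lessThan not_self nm] inner ..
    also have "\<dots> = npot (ndens (npot (ndens u [f])) fs) x"
      using snoc.prems by (intro snoc.IH False um) auto
    finally show ?thesis by (simp only: ndens_snoc[OF False])
  qed
qed simp

lemma chain_integrable:
  assumes fs: "fs \<noteq> []" "set fs \<subseteq> borel_measurable (leb n B)" and v: "v \<in> borel_measurable (leb n B)"
    and fin: "npot (ndens (\<lambda>y. ennreal (cmod (v y))) fs) x < \<infinity>"
  shows "integrable (PB (length fs)) (chain v fs x)"
proof (rule integrableI_bounded)
  show "chain v fs x \<in> borel_measurable (PB (length fs))" using assms by (intro chain_measurable) auto
  have "(\<integral>\<^sup>+y. ennreal (cmod (chain v fs x y)) \<partial>PB (length fs)) = (\<integral>\<^sup>+y. nchain (\<lambda>y. ennreal (cmod (v y))) fs x y \<partial>PB (length fs))"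
    by (intro nn_integral_cong) (simp add: chain_def nchain_def norm_mult ennreal_mult)
  also have "\<dots> < \<infinity>" using nchain_integral[OF fs, of "\<lambda>y. ennreal (cmod (v y))" x] v fin by simp
  finally show "(\<integral>\<^sup>+y. ennreal (cmod (chain v fs x y)) \<partial>PB (length fs)) < \<infinity>" .
qed

text \<open>
  The same induction for the signed integral. The integrability needed for Fubini comes from \<open>nchain_integral\<close>.
\<close>

lemma chain_integral:
  "fs \<noteq> [] \<Longrightarrow> set fs \<subseteq> borel_measurable (leb n B) \<Longrightarrow> v \<in> borel_measurable (leb n B) \<Longrightarrow>
    npot (ndens (\<lambda>y. ennreal (cmod (v y))) fs) x < \<infinity> \<Longrightarrow>
    (\<integral>y. chain v fs x y \<partial>PB (length fs)) = pot (dens v fs) x"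
proof (induction fs arbitrary: v rule: rev_induct)
  case (snoc f fs)
  have f: "f \<in> borel_measurable (leb n B)" using snoc.prems by auto
  note v = snoc.prems(3)
  show ?case
  proof (cases "fs = []")
    case True
    have k1: "chain v [f] x y = G x (y 0) * (of_real (k\<^sup>2) * f (y 0) * v (y 0))" for y
      by (simp add: chain_def kernel_def strength_def mult.assoc)
    have "(\<integral>y. chain v [f] x y \<partial>PB (length [f])) = pot (dens v [f]) x"
      unfolding PB_one k1 pot_def dens.simps
      by (rule PB.product_integral_singleton) (intro borel_measurable_times borel_measurable_const G_left_measurable f v)
    then show ?thesis using True by simp
  next
    case False
    then obtain m where m: "length fs = Suc m" by (cases fs) auto
    have int: "integrable (Pi\<^sub>M (insert (length fs) {..<length fs}) (\<lambda>_. leb n B)) (chain v (fs @ [f]) x)"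
      unfolding PB_Suc[symmetric, of fs f] by (rule chain_integrable[OF snoc.prems])
    have inner: "(\<integral>z. chain v (fs @ [f]) x (y(length fs := z)) \<partial>leb n B) = chain (pot (dens v [f])) fs x y" for y
    proof -
      have "chain v (fs @ [f]) x (y(length fs := z)) =
          kernel (length fs) x y * strength fs y * (G (y (length fs - 1)) z * (of_real (k\<^sup>2) * f z * v z))" for z
        unfolding chain_def strength_snoc by (simp add: m kernel_snoc)
      then have "(\<integral>z. chain v (fs @ [f]) x (y(length fs := z)) \<partial>leb n B) = kernel (length fs) x y * strength fs y *
          (\<integral>z. G (y (length fs - 1)) z * (of_real (k\<^sup>2) * f z * v z) \<partial>leb n B)"
        by (simp only:) (rule integral_mult_right_zero)
      then show ?thesis by (simp add: chain_def pot_def)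
    qed
    have vm: "pot (dens v [f]) \<in> borel_measurable (leb n B)"
      using f v by (intro pot_measurable_B dens_measurable) auto
    have "npot (ndens (\<lambda>y. ennreal (cmod (pot (dens v [f]) y))) fs) x \<le> npot (ndens (npot (ndens (\<lambda>y. ennreal (cmod (v y))) [f])) fs) x"
      by (intro npot_mono ndens_mono order_trans[OF pot_npot] npot_mono dens_ndens)
    also have "\<dots> < \<infinity>" using snoc.prems(4) unfolding ndens_snoc[OF False] .
    finally have fin: "npot (ndens (\<lambda>y. ennreal (cmod (pot (dens v [f]) y))) fs) x < \<infinity>" .
    have "(\<integral>y. chain v (fs @ [f]) x y \<partial>PB (length (fs @ [f]))) = (\<integral>y. chain (pot (dens v [f])) fs x y \<partial>PB (length fs))"
      unfolding PB_Suc PB.product_integral_insert[OF finite_lessThan not_self int] inner ..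
    also have "\<dots> = pot (dens (pot (dens v [f])) fs) x"
      using snoc.prems by (intro snoc.IH False vm fin) auto
    finally show ?thesis by (simp only: dens_snoc[OF False])
  qed
qed simp

abbreviation "F \<equiv> forward_op w n k B ui"

lemma forward_chain: "F (length fs) (tensor fs) x x1 = (\<integral>y. chain (\<lambda>y. ui y x1) fs x y \<partial>PB (length fs))"
proof -
  have "of_real (k ^ (2 * length fs)) * (G x (y 0) * (\<Prod>l<length fs - 1. G (y l) (y (Suc l))) * ui (y (length fs - 1)) x1 * tensor fs y)
      = chain (\<lambda>y. ui y x1) fs x y" for y
  proof -
    have "strength fs y = of_real (k ^ (2 * length fs)) * tensor fs y"
      unfolding strength_def tensor_def prod.distrib by (simp add: power_mult)
    then show ?thesis by (simp add: chain_def kernel_def ac_simps)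
  qed
  then show ?thesis unfolding forward_op_def integral_mult_right_zero[symmetric] by (simp only:)
qed

lemma npot_finite:
  assumes z: "z \<in> Z" and h: "h \<in> borel_measurable (leb n B)" "(\<integral>\<^sup>+y. h y \<partial>leb n B) < \<infinity>"
  shows "npot h z < \<infinity>"
proof -
  have "npot h z \<le> (\<integral>\<^sup>+y. ennreal Gmax * h y \<partial>leb n B)"
    unfolding npot_def using Gmax(2)[OF z] by (intro nn_integral_mono mult_right_mono ennreal_leI) (auto simp: B_space)
  also have "\<dots> = ennreal Gmax * (\<integral>\<^sup>+y. h y \<partial>leb n B)" by (rule nn_integral_cmult[OF h(1)])
  also have "\<dots> < \<infinity>" using h(2) by (simp add: ennreal_mult_less_top)
  finally show ?thesis .
qed

text \<open>
  Since \<open>|G|\<close> is bounded below, the density is integrable as soon as one receiver sees a finite potential.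
\<close>

lemma npot_infinite:
  assumes z: "z \<in> Z" and h: "h \<in> borel_measurable (leb n B)" "npot h z < \<infinity>"
  shows "(\<integral>\<^sup>+y. h y \<partial>leb n B) < \<infinity>"
proof -
  obtain m where m: "0 < m" "\<And>y. y \<in> B \<Longrightarrow> m \<le> cmod (G z y)" using green_lower z by blast
  have "ennreal m * (\<integral>\<^sup>+y. h y \<partial>leb n B) = (\<integral>\<^sup>+y. ennreal m * h y \<partial>leb n B)" by (rule nn_integral_cmult[OF h(1), symmetric])
  also have "\<dots> \<le> npot h z"
    unfolding npot_def using m(2) by (intro nn_integral_mono mult_right_mono ennreal_leI) (auto simp: B_space)
  finally have "ennreal m * (\<integral>\<^sup>+y. h y \<partial>leb n B) < \<infinity>" using h(2) by (rule le_less_trans)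
  then show ?thesis using m(1) by (auto simp: ennreal_mult_less_top ennreal_eq_0_iff)
qed

abbreviation nd :: "pt \<Rightarrow> param list \<Rightarrow> pt \<Rightarrow> ennreal" where
  "nd x1 \<equiv> ndens (\<lambda>y. ennreal (cmod (ui y x1)))"

context
  fixes x1 :: pt and fs :: "param list"
  assumes v: "(\<lambda>y. ui y x1) \<in> borel_measurable (leb n B)" and fs: "fs \<noteq> []" "set fs \<subseteq> sqint (leb n B)"
begin

lemma fs': "set fs \<subseteq> borel_measurable (leb n B)" using fs(2) by auto

lemma nd_measurable: "nd x1 fs \<in> borel_measurable (leb n B)"
  using v fs' by (intro ndens_measurable) auto

lemma forward_fin:
  assumes z: "z \<in> Z" and fin: "(\<integral>\<^sup>+y. nd x1 fs y \<partial>leb n B) < \<infinity>"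
  shows "F (length fs) (tensor fs) z x1 = pot (dens (\<lambda>y. ui y x1) fs) z"
    and "integrable (PB (length fs)) (chain (\<lambda>y. ui y x1) fs z)"
proof -
  have fin': "npot (nd x1 fs) z < \<infinity>" by (rule npot_finite[OF z nd_measurable fin])
  show "F (length fs) (tensor fs) z x1 = pot (dens (\<lambda>y. ui y x1) fs) z"
    unfolding forward_chain by (rule chain_integral[OF fs(1) fs' v fin'])
  show "integrable (PB (length fs)) (chain (\<lambda>y. ui y x1) fs z)"
    by (rule chain_integrable[OF fs(1) fs' v fin'])
qed

lemma dens_L1:
  assumes le: "(\<integral>\<^sup>+y. nd x1 fs y \<partial>leb n B) \<le> ennreal r" and r: "0 \<le> r"
  shows "integrable (leb n B) (dens (\<lambda>y. ui y x1) fs)" "(\<integral>y. cmod (dens (\<lambda>y. ui y x1) fs y) \<partial>leb n B) \<le> r"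
proof -
  have m: "dens (\<lambda>y. ui y x1) fs \<in> borel_measurable (leb n B)" using v fs' by (intro dens_measurable) auto
  have le': "(\<integral>\<^sup>+y. ennreal (cmod (dens (\<lambda>y. ui y x1) fs y)) \<partial>leb n B) \<le> ennreal r"
    by (rule order_trans[OF nn_integral_mono le]) (simp add: dens_ndens B_space)
  show i: "integrable (leb n B) (dens (\<lambda>y. ui y x1) fs)"
    by (rule integrableI_bounded[OF m le_less_trans[OF le']]) simp
  have "ennreal (\<integral>y. cmod (dens (\<lambda>y. ui y x1) fs y) \<partial>leb n B) \<le> ennreal r"
    using le' i by (subst nn_integral_eq_integral[symmetric]) auto
  then show "(\<integral>y. cmod (dens (\<lambda>y. ui y x1) fs y) \<partial>leb n B) \<le> r" using r by (subst (asm) ennreal_le_iff) auto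
qed

lemma forward_pot:
  assumes le: "(\<integral>\<^sup>+y. nd x1 fs y \<partial>leb n B) \<le> ennreal r" and r: "0 \<le> r"
  shows "pot_by r (\<lambda>z. F (length fs) (tensor fs) z x1)"
  by (rule pot_byI[OF dens_L1(1)[OF le r] forward_fin(1) dens_L1(2)[OF le r]]) (use le in \<open>auto intro: le_less_trans\<close>)

text \<open>
  A nonintegrable density gives nonintegrable chains at every receiver, and the value of such an integral is zero by convention.
\<close>

lemma forward_zero:
  assumes inf: "\<not> (\<integral>\<^sup>+y. nd x1 fs y \<partial>leb n B) < \<infinity>" and z: "z \<in> Z"
  shows "F (length fs) (tensor fs) z x1 = 0"
  unfolding forward_chain
proof (rule not_integrable_integral_eq)
  show "\<not> integrable (PB (length fs)) (chain (\<lambda>y. ui y x1) fs z)"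
  proof
    assume "integrable (PB (length fs)) (chain (\<lambda>y. ui y x1) fs z)"
    then have "(\<integral>\<^sup>+y. ennreal (cmod (chain (\<lambda>y. ui y x1) fs z y)) \<partial>PB (length fs)) < \<infinity>"
      by (simp add: integrable_iff_bounded)
    also have "(\<lambda>y. ennreal (cmod (chain (\<lambda>y. ui y x1) fs z y))) = nchain (\<lambda>y. ennreal (cmod (ui y x1))) fs z"
      by (intro ext) (simp add: chain_def nchain_def norm_mult ennreal_mult)
    also have "(\<integral>\<^sup>+y. nchain (\<lambda>y. ennreal (cmod (ui y x1))) fs z y \<partial>PB (length fs)) = npot (nd x1 fs) z"
      using v by (intro nchain_integral fs fs') simp
    finally show False using npot_infinite[OF z nd_measurable] inf by blast
  qed
qed

lemma forward_is_pot: "is_pot (\<lambda>z. F (length fs) (tensor fs) z x1)"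
proof (cases "(\<integral>\<^sup>+y. nd x1 fs y \<partial>leb n B) < \<infinity>")
  case True
  then have "(\<integral>\<^sup>+y. nd x1 fs y \<partial>leb n B) \<le> ennreal (enn2real (\<integral>\<^sup>+y. nd x1 fs y \<partial>leb n B))" by (simp add: ennreal_enn2real)
  from forward_pot[OF this] show ?thesis by auto
next
  case False
  have "pot_by 0 (\<lambda>z. F (length fs) (tensor fs) z x1)" by (rule pot_by_zero) (rule forward_zero[OF False])
  then show ?thesis by blast
qed

end

end

section \<open>Norms of the scattering data\<close>

lemma l2norm_le_sobolev_norm:
  assumes U: "exhausted d U" shows "l2norm d U f \<le> sobolev_norm d U s f"
proof (cases "f \<in> sobolev d U s")
  case True
  let ?z = "restrict (\<lambda>_. 0) {..<d}"
  have f: "f \<in> sqint (leb d U)" by (rule sobolev_sqint[OF True])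
  have eq: "nrm (leb d U) f = nrm (leb d U) (weak_deriv d U ?z f)"
    by (rule nrm_weak_deriv[OF U is_weak_deriv_zero[OF f], symmetric]) simp
  have z: "?z \<in> multi d s" by (simp add: multi_def)
  have "nrm (leb d U) (weak_deriv d U ?z f) \<le> sn d U s f"
    unfolding sn_def by (rule member_le_L2_set[OF finite_multi z])
  then show ?thesis unfolding sobolev_norm_sn[OF True] l2norm_nrm[OF f] eq by (rule ennreal_leI)
qed (simp add: sobolev_norm_def)

context scat
begin

text \<open>
  Densities whose \<open>L\<^sup>1\<close> norms are summable can be summed under the integral.
\<close>

lemma potential_series:
  fixes f :: "nat \<Rightarrow> pt \<Rightarrow> complex"
  assumes int: "\<And>j. integrable (leb n B) (f j)" and le: "\<And>j. (\<integral>y. cmod (f j y) \<partial>leb n B) \<le> b j" and b: "summable b"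
  shows "integrable (leb n B) (\<lambda>y. \<Sum>j. f j y)" and "(\<integral>y. cmod (\<Sum>j. f j y) \<partial>leb n B) \<le> (\<Sum>j. b j)"
    and "\<And>z. z \<in> Z \<Longrightarrow> (\<lambda>j. pot (f j) z) sums pot (\<lambda>y. \<Sum>j. f j y) z"
proof -
  have sI: "summable (\<lambda>j. \<integral>y. cmod (f j y) \<partial>leb n B)"
    by (rule summable_comparison_test'[OF b]) (use le in simp)
  have "(\<integral>\<^sup>+y. (\<Sum>j. ennreal (cmod (f j y))) \<partial>leb n B) = (\<Sum>j. \<integral>\<^sup>+y. ennreal (cmod (f j y)) \<partial>leb n B)"
    using int by (intro nn_integral_suminf) auto
  also have "\<dots> = (\<Sum>j. ennreal (\<integral>y. cmod (f j y) \<partial>leb n B))"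
    using int by (intro suminf_cong nn_integral_eq_integral) auto
  also have "\<dots> = ennreal (\<Sum>j. \<integral>y. cmod (f j y) \<partial>leb n B)"
    by (rule suminf_ennreal2[OF _ sI]) simp
  finally have "(\<integral>\<^sup>+y. (\<Sum>j. ennreal (cmod (f j y))) \<partial>leb n B) \<noteq> \<infinity>" by simp
  then have "AE y in leb n B. (\<Sum>j. ennreal (cmod (f j y))) \<noteq> \<infinity>"
    using int by (intro nn_integral_PInf_AE) auto
  then have AEs: "AE y in leb n B. summable (\<lambda>j. cmod (f j y))"
    by (rule AE_mp) (auto intro!: AE_I2 summable_suminf_not_top)
  show i1: "integrable (leb n B) (\<lambda>y. \<Sum>j. f j y)"
    by (rule integrable_suminf[OF int AEs sI])
  have i2: "integrable (leb n B) (\<lambda>y. \<Sum>j. cmod (f j y))"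
    by (rule integrable_suminf[OF integrable_norm[OF int]]) (use AEs sI in simp_all)
  have "(\<integral>y. cmod (\<Sum>j. f j y) \<partial>leb n B) \<le> (\<integral>y. (\<Sum>j. cmod (f j y)) \<partial>leb n B)"
    by (rule integral_mono_AE[OF integrable_norm[OF i1] i2]) (use AEs in \<open>auto elim!: eventually_mono intro: summable_norm\<close>)
  also have "\<dots> = (\<Sum>j. \<integral>y. cmod (f j y) \<partial>leb n B)"
    by (rule integral_suminf[OF integrable_norm[OF int]]) (use AEs sI in simp_all)
  also have "\<dots> \<le> (\<Sum>j. b j)" by (rule suminf_le[OF le sI b])
  finally show "(\<integral>y. cmod (\<Sum>j. f j y) \<partial>leb n B) \<le> (\<Sum>j. b j)" .
  fix z assume z: "z \<in> Z"
  have iG: "integrable (leb n B) (\<lambda>y. G z y * f j y)" for j by (rule G_\<rho>_integrable[OF int z])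
  have "(\<lambda>j. \<integral>y. G z y * f j y \<partial>leb n B) sums (\<integral>y. (\<Sum>j. G z y * f j y) \<partial>leb n B)"
  proof (rule sums_integral[OF iG])
    show "AE y in leb n B. summable (\<lambda>j. norm (G z y * f j y))"
      using AEs by eventually_elim (simp add: norm_mult summable_mult)
    have "(\<integral>y. norm (G z y * f j y) \<partial>leb n B) \<le> Gmax * b j" for j
    proof -
      have "(\<integral>y. norm (G z y * f j y) \<partial>leb n B) \<le> (\<integral>y. Gmax * cmod (f j y) \<partial>leb n B)"
        using Gmax(2)[OF z] int by (intro integral_mono integrable_norm iG) (auto simp: norm_mult B_space intro: mult_right_mono)
      also have "\<dots> = Gmax * (\<integral>y. cmod (f j y) \<partial>leb n B)" by simp
      also have "\<dots> \<le> Gmax * b j" by (rule mult_left_mono[OF le Gmax(1)])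
      finally show ?thesis .
    qed
    then show "summable (\<lambda>j. \<integral>y. norm (G z y * f j y) \<partial>leb n B)"
      by (intro summable_comparison_test'[OF summable_mult[OF b, of Gmax]]) simp
  qed
  also have "(\<integral>y. (\<Sum>j. G z y * f j y) \<partial>leb n B) = (\<integral>y. G z y * (\<Sum>j. f j y) \<partial>leb n B)"
  proof (rule integral_cong_AE)
    show "AE y in leb n B. (\<Sum>j. G z y * f j y) = G z y * (\<Sum>j. f j y)"
      using AEs by eventually_elim (rule suminf_mult[OF summable_norm_cancel])
    show "(\<lambda>y. \<Sum>j. G z y * f j y) \<in> borel_measurable (leb n B)"
      using iG by (intro borel_measurable_suminf) auto
    show "(\<lambda>y. G z y * (\<Sum>j. f j y)) \<in> borel_measurable (leb n B)"
      using i1 by (intro borel_measurable_times G_left_measurable) auto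
  qed
  finally show "(\<lambda>j. pot (f j) z) sums pot (\<lambda>y. \<Sum>j. f j y) z" by (simp add: pot_def)
qed

end

context fwd
begin

lemma ui_measurable:
  assumes "q < charts A" "x1' \<in> \<Delta>" shows "(\<lambda>y. ui y (ch q x1')) \<in> borel_measurable (leb n B)"
proof -
  have "x1' \<in> space (leb d \<Delta>)" using assms D_space by simp
  from measurable_compose[OF measurable_Pair2'[OF this] ui[OF assms(1)]] show ?thesis by simp
qed

lemma ui_sq_measurable:
  assumes "q < charts A"
  shows "(\<lambda>(y, x1'). ennreal ((cmod (ui y (ch q x1')))\<^sup>2)) \<in> borel_measurable (leb n B \<Otimes>\<^sub>M leb d \<Delta>)"
proof -
  have "(\<lambda>p. ennreal ((cmod (case p of (y, x1') \<Rightarrow> ui y (ch q x1')))\<^sup>2)) \<in> borel_measurable (leb n B \<Otimes>\<^sub>M leb d \<Delta>)"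
    using ui[OF assms] by simp
  then show ?thesis by (simp add: case_prod_beta')
qed

lemma l2_ui_measurable:
  assumes q: "q < charts A"
  shows "(\<lambda>x1'. (l2norm n B (\<lambda>y. ui y (ch q x1')))\<^sup>2) \<in> borel_measurable (leb d \<Delta>)"
proof -
  have "(\<lambda>p. case prod.swap p of (y, x1') \<Rightarrow> ennreal ((cmod (ui y (ch q x1')))\<^sup>2)) \<in> borel_measurable (leb d \<Delta> \<Otimes>\<^sub>M leb n B)"
    by (rule measurable_compose[OF _ ui_sq_measurable[OF q]]) (simp add: prod.swap_def)
  from sigma_finite_measure.borel_measurable_nn_integral_fst[OF B_sigma this] show ?thesis
    by (simp add: l2norm_def)
qed

text \<open>
  Tonelli: the \<open>L\<^sup>2(B)\<close> norms of the incident fields, square integrated over the sources, are the \<open>L\<^sup>2\<close> norms over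
  the sources, square integrated over the ball. This is the origin of \<open>Ca\<close>.
\<close>

lemma incident_square_integral:
  "(\<Sum>q<charts A. \<integral>\<^sup>+x1'. (l2norm n B (\<lambda>y. ui y (ch q x1')))\<^sup>2 \<partial>leb d \<Delta>) \<le> (Ca n B A ui)\<^sup>2"
proof -
  interpret pair_sigma_finite "leb n B" "leb d \<Delta>"
    by (rule pair_sigma_finite.intro) (rule B_sigma finite_measure.axioms(1)[OF D_fin])+
  let ?s = "SUP y\<in>B. bd_norm n A 0 (\<lambda>x1. ui y x1)"
  have le: "(\<Sum>q<charts A. (l2norm d \<Delta> (\<lambda>x1'. ui y (ch q x1')))\<^sup>2) \<le> ?s\<^sup>2" if y: "y \<in> B" for y
  proof -
    have "(\<Sum>q<charts A. (l2norm d \<Delta> (\<lambda>x1'. ui y (ch q x1')))\<^sup>2) \<le> (\<Sum>q<charts A. (sobolev_norm d \<Delta> 0 (\<lambda>x1'. ui y (ch q x1')))\<^sup>2)"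
      by (intro sum_mono power_mono l2norm_le_sobolev_norm[OF D_exh]) simp
    also have "\<dots> = (bd_norm n A 0 (\<lambda>x1. ui y x1))\<^sup>2" by (simp add: bd_norm_def bd_norm_pos_def)
    also have "\<dots> \<le> ?s\<^sup>2" by (intro power_mono SUP_upper[OF y]) simp
    finally show ?thesis .
  qed
  have "(\<Sum>q<charts A. \<integral>\<^sup>+x1'. (l2norm n B (\<lambda>y. ui y (ch q x1')))\<^sup>2 \<partial>leb d \<Delta>)
      = (\<Sum>q<charts A. \<integral>\<^sup>+y. (l2norm d \<Delta> (\<lambda>x1'. ui y (ch q x1')))\<^sup>2 \<partial>leb n B)"
    unfolding l2norm_def esqrt_power2 by (intro sum.cong refl Fubini' ui_sq_measurable) simp
  also have "\<dots> = (\<integral>\<^sup>+y. (\<Sum>q<charts A. (l2norm d \<Delta> (\<lambda>x1'. ui y (ch q x1')))\<^sup>2) \<partial>leb n B)"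
  proof (rule nn_integral_sum[symmetric])
    fix q assume "q \<in> {..<charts A}"
    then have q: "q < charts A" by simp
    from sigma_finite_measure.borel_measurable_nn_integral_fst[OF finite_measure.axioms(1)[OF D_fin] ui_sq_measurable[OF q]]
    show "(\<lambda>y. (l2norm d \<Delta> (\<lambda>x1'. ui y (ch q x1')))\<^sup>2) \<in> borel_measurable (leb n B)" by (simp add: l2norm_def)
  qed
  also have "\<dots> \<le> (\<integral>\<^sup>+y. ?s\<^sup>2 \<partial>leb n B)" by (rule nn_integral_mono) (simp add: le B_space)
  also have "\<dots> = (Ca n B A ui)\<^sup>2" by (simp add: Ca_def B_space power_mult_distrib mult.commute)
  finally show ?thesis .
qed

lemma Ca_finite: "W \<noteq> 0 \<Longrightarrow> Ca n B A ui < \<infinity>"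
  using WCa by (auto simp: ennreal_mult_less_top)

lemma AE_incident:
  assumes q: "q < charts A" and W: "W \<noteq> 0"
  shows "AE x1' in leb d \<Delta>. (\<lambda>y. ui y (ch q x1')) \<in> sqint (leb n B)"
proof -
  have "(\<integral>\<^sup>+x1'. (l2norm n B (\<lambda>y. ui y (ch q x1')))\<^sup>2 \<partial>leb d \<Delta>) \<le> (\<Sum>q<charts A. \<integral>\<^sup>+x1'. (l2norm n B (\<lambda>y. ui y (ch q x1')))\<^sup>2 \<partial>leb d \<Delta>)"
    using q by (intro member_le_sum) auto
  also have "\<dots> \<le> (Ca n B A ui)\<^sup>2" by (rule incident_square_integral)
  also have "\<dots> < \<infinity>" using Ca_finite[OF W] by (simp add: power2_eq_square ennreal_mult_less_top)
  finally have "AE x1' in leb d \<Delta>. (l2norm n B (\<lambda>y. ui y (ch q x1')))\<^sup>2 \<noteq> \<infinity>"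
    by (intro nn_integral_PInf_AE l2_ui_measurable[OF q]) simp
  moreover have "AE x1' in leb d \<Delta>. x1' \<in> \<Delta>" using AE_space[of "leb d \<Delta>"] unfolding D_space .
  ultimately show ?thesis
  proof eventually_elim
    case (elim x1')
    then have "l2norm n B (\<lambda>y. ui y (ch q x1')) < \<infinity>" by (auto simp: less_top power2_eq_square ennreal_mult_eq_top_iff)
    then show ?case unfolding L2_sqint[symmetric] L2_def using ui_measurable[OF q elim(2)] by simp
  qed
qed

text \<open>
  The bound is needed for almost every source only. When \<open>W = 0\<close>, however, there may be many sources whose incident field is not
  square integrable, and then it is used that the field is a potential at all.
\<close>

theorem data_norm_potential:
  assumes e: "0 \<le> e"
    and D: "\<And>q x1'. q < charts A \<Longrightarrow> x1' \<in> \<Delta> \<Longrightarrow> (\<lambda>y. ui y (ch q x1')) \<in> sqint (leb n B) \<Longrightarrow>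
      pot_by (e * nrm (leb n B) (\<lambda>y. ui y (ch q x1'))) (\<lambda>z. D z (ch q x1'))"
    and D': "\<And>q x1'. q < charts A \<Longrightarrow> x1' \<in> \<Delta> \<Longrightarrow> is_pot (\<lambda>z. D z (ch q x1'))"
  shows "data_norm n A bb D \<le> ennreal e * (W * Ca n B A ui)"
proof -
  let ?v = "\<lambda>q x1' y. ui y (ch q x1')"
  let ?b = "\<lambda>q x1'. bd_norm n A bb (\<lambda>x. D x (ch q x1'))"
  have "(\<Sum>q<charts A. \<integral>\<^sup>+x1'. (?b q x1')\<^sup>2 \<partial>leb d \<Delta>)
      \<le> (\<Sum>q<charts A. \<integral>\<^sup>+x1'. (W * ennreal e)\<^sup>2 * (l2norm n B (?v q x1'))\<^sup>2 \<partial>leb d \<Delta>)"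
  proof (intro sum_mono nn_integral_mono_AE)
    fix q assume "q \<in> {..<charts A}"
    then have q: "q < charts A" by simp
    have AED: "AE x1' in leb d \<Delta>. x1' \<in> \<Delta>" using AE_space[of "leb d \<Delta>"] unfolding D_space .
    show "AE x1' in leb d \<Delta>. (?b q x1')\<^sup>2 \<le> (W * ennreal e)\<^sup>2 * (l2norm n B (?v q x1'))\<^sup>2"
    proof (cases "W = 0")
      case True
      from AED show ?thesis
      proof eventually_elim
        case (elim x1')
        obtain r where "pot_by r (\<lambda>x. D x (ch q x1'))" using D'[OF q elim] by blast
        from pot_by_norm[OF this] show ?case by (simp add: True)
      qed
    next
      case False
      from AE_incident[OF q False] AED show ?thesis
      proof eventually_elim
        case (elim x1')
        have "?b q x1' \<le> W * ennreal (e * nrm (leb n B) (?v q x1'))"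
          by (rule pot_by_norm[OF D[OF q elim(2,1)]])
        also have "\<dots> = W * ennreal e * l2norm n B (?v q x1')"
          unfolding l2norm_nrm[OF elim(1)] by (simp add: ennreal_mult e mult.assoc)
        finally show ?case unfolding power_mult_distrib[symmetric] by (rule power_mono) simp
      qed
    qed
  qed
  also have "\<dots> = (W * ennreal e)\<^sup>2 * (\<Sum>q<charts A. \<integral>\<^sup>+x1'. (l2norm n B (?v q x1'))\<^sup>2 \<partial>leb d \<Delta>)"
    unfolding sum_distrib_left by (intro sum.cong refl nn_integral_cmult l2_ui_measurable) simp
  also have "\<dots> \<le> (W * ennreal e)\<^sup>2 * (Ca n B A ui)\<^sup>2" by (intro mult_left_mono incident_square_integral) simp
  also have "\<dots> = (ennreal e * (W * Ca n B A ui))\<^sup>2" by (simp add: power_mult_distrib ac_simps)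
  finally have "(\<Sum>q<charts A. \<integral>\<^sup>+x1'. (?b q x1')\<^sup>2 \<partial>leb d \<Delta>) \<le> (ennreal e * (W * Ca n B A ui))\<^sup>2" .
  from esqrt_mono[OF this] show ?thesis unfolding data_norm_def esqrt_square .
qed

lemma forward_measurable:
  assumes fs: "fs \<noteq> []" "\<And>f. f \<in> set fs \<Longrightarrow> f \<in> borel_measurable (leb n B)" and rq: "r < charts A" "q < charts A"
  shows "(\<lambda>(x', x1'). F (length fs) (tensor fs) (ch r x') (ch q x1')) \<in> borel_measurable (leb d \<Delta> \<Otimes>\<^sub>M leb d \<Delta>)"
proof -
  let ?j = "length fs"
  let ?N = "leb d \<Delta> \<Otimes>\<^sub>M leb d \<Delta>"
  have PBs: "sigma_finite_measure (PB ?j)"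
    by (rule product_sigma_finite.sigma_finite[OF product_sigma_finite.intro finite_lessThan]) (rule B_sigma)
  have x: "(\<lambda>p. ch r (fst (fst p))) \<in> ?N \<Otimes>\<^sub>M PB ?j \<rightarrow>\<^sub>M borel"
    by (rule measurable_compose[OF _ ch_measurable[OF rq(1)]]) simp
  have y: "(\<lambda>p. snd p i) \<in> ?N \<Otimes>\<^sub>M PB ?j \<rightarrow>\<^sub>M leb n B" if "i < ?j" for i
    by (rule measurable_compose[OF measurable_snd PB_component[OF that]])
  have y': "(\<lambda>p. snd p i) \<in> ?N \<Otimes>\<^sub>M PB ?j \<rightarrow>\<^sub>M borel" if "i < ?j" for i
    by (rule measurable_compose[OF y[OF that] B_measurable])
  have j: "0 < ?j" using fs(1) by simp
  have K: "(\<lambda>p. kernel ?j (ch r (fst (fst p))) (snd p)) \<in> borel_measurable (?N \<Otimes>\<^sub>M PB ?j)"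
    unfolding kernel_def by (intro borel_measurable_times borel_measurable_prod G_measurable2 x y') (use j in auto)
  have S: "(\<lambda>p. strength fs (snd p)) \<in> borel_measurable (?N \<Otimes>\<^sub>M PB ?j)"
    by (rule measurable_compose[OF measurable_snd strength_measurable[OF fs(2)]])
  have "(\<lambda>p. (snd p (?j - 1), snd (fst p))) \<in> ?N \<Otimes>\<^sub>M PB ?j \<rightarrow>\<^sub>M leb n B \<Otimes>\<^sub>M leb d \<Delta>"
    using j by (intro measurable_Pair y) auto
  from measurable_compose[OF this ui[OF rq(2)]]
  have U: "(\<lambda>p. ui (snd p (?j - 1)) (ch q (snd (fst p)))) \<in> borel_measurable (?N \<Otimes>\<^sub>M PB ?j)" by simp
  have "(\<lambda>(p, y). chain (\<lambda>y. ui y (ch q (snd p))) fs (ch r (fst p)) y) \<in> borel_measurable (?N \<Otimes>\<^sub>M PB ?j)"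
    unfolding chain_def case_prod_beta' by (intro borel_measurable_times K S U)
  from sigma_finite_measure.borel_measurable_lebesgue_integral[OF PBs this]
  show ?thesis unfolding forward_chain by (simp add: case_prod_beta')
qed

lemma forward_L1:
  assumes v: "(\<lambda>y. ui y x1) \<in> sqint (leb n B)" and fs: "fs \<noteq> []" "set fs \<subseteq> sqint (leb n B)"
  shows "pot_by (L1c fs * nrm (leb n B) (\<lambda>y. ui y x1)) (\<lambda>z. F (length fs) (tensor fs) z x1)"
  by (rule forward_pot[OF sqint_measurable[OF v] fs ndens_L1[OF v fs]]) (simp add: L1c_nonneg)

lemma forward_norm:
  assumes fs: "fs \<noteq> []" "set fs \<subseteq> sqint (leb n B)"
  shows "data_norm n A bb (F (length fs) (tensor fs)) \<le> ennreal (L1c fs) * (W * Ca n B A ui)"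
  by (rule data_norm_potential[OF L1c_nonneg forward_L1[OF _ fs] forward_is_pot[OF ui_measurable fs]])

lemma forward_data_space:
  assumes fs: "fs \<noteq> []" "set fs \<subseteq> sqint (leb n B)"
  shows "F (length fs) (tensor fs) \<in> data_space n A bb"
proof -
  have "data_norm n A bb (F (length fs) (tensor fs)) < \<infinity>"
    using forward_norm[OF fs] WCa by (auto intro: le_less_trans simp: ennreal_mult_less_top)
  moreover have "f \<in> borel_measurable (leb n B)" if "f \<in> set fs" for f using fs(2) that by auto
  ultimately show ?thesis unfolding data_space_def using forward_measurable[OF fs(1)] by blast
qed

lemma tensor_slot:
  "tensor (us @ f # vs) y = f (y (length us)) * (\<Prod>i\<in>{..<length us + Suc (length vs)} - {length us}. ((us @ 0 # vs) ! i) (y i))"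
proof -
  have "tensor (us @ f # vs) y = ((us @ f # vs) ! length us) (y (length us)) *
      (\<Prod>i\<in>{..<length us + Suc (length vs)} - {length us}. ((us @ f # vs) ! i) (y i))"
    unfolding tensor_def by (subst prod.remove[of _ "length us"]) auto
  moreover have "((us @ f # vs) ! i) (y i) = ((us @ 0 # vs) ! i) (y i)" if "i \<noteq> length us" for i
    using that by (simp add: nth_append nth_Cons split: nat.split)
  ultimately show ?thesis by simp
qed

lemma forward_slot_diff:
  assumes fs: "set us \<subseteq> sqint (leb n B)" "f \<in> sqint (leb n B)" "h \<in> sqint (leb n B)" "set vs \<subseteq> sqint (leb n B)"
    and z: "z \<in> Z" and v: "(\<lambda>y. ui y x1) \<in> sqint (leb n B)"
  defines "j \<equiv> length us + Suc (length vs)"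
  shows "F j (tensor (us @ (f - h) # vs)) z x1 = F j (tensor (us @ f # vs)) z x1 - F j (tensor (us @ h # vs)) z x1"
proof -
  let ?c = "\<lambda>f. chain (\<lambda>y. ui y x1) (us @ f # vs) z"
  have F: "F j (tensor (us @ f # vs)) z x1 = (\<integral>y. ?c f y \<partial>PB j)" for f
    using forward_chain[of "us @ f # vs" z x1] by (simp add: j_def)
  have int: "integrable (PB j) (?c f)" if "f \<in> sqint (leb n B)" for f
  proof -
    have ne: "us @ f # vs \<noteq> []" "set (us @ f # vs) \<subseteq> sqint (leb n B)" using that fs(1,4) by auto
    have "(\<integral>\<^sup>+y. nd x1 (us @ f # vs) y \<partial>leb n B) < \<infinity>" by (rule le_less_trans[OF ndens_L1[OF v ne]]) simp
    from forward_fin(2)[OF sqint_measurable[OF v] ne z this] show ?thesis by (simp add: j_def)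
  qed
  have ten: "strength (us @ f # vs) y = of_real (k\<^sup>2) ^ j * tensor (us @ f # vs) y" for f y
    unfolding strength_def tensor_def prod.distrib by (simp add: j_def)
  have lin: "?c (f - h) y = ?c f y - ?c h y" for y
    unfolding chain_def ten tensor_slot by (simp add: algebra_simps)
  have "(\<integral>y. ?c (f - h) y \<partial>PB j) = (\<integral>y. ?c f y \<partial>PB j) - (\<integral>y. ?c h y \<partial>PB j)"
    unfolding lin by (rule Bochner_Integration.integral_diff[OF int[OF fs(2)] int[OF fs(3)]])
  then show ?thesis unfolding F .
qed

lemma data_space_diff_measurable:
  assumes "\<And>r q. r < charts A \<Longrightarrow> q < charts A \<Longrightarrow> (\<lambda>(x', x1'). D (ch r x') (ch q x1')) \<in> borel_measurable (leb d \<Delta> \<Otimes>\<^sub>M leb d \<Delta>)"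
    "\<And>r q. r < charts A \<Longrightarrow> q < charts A \<Longrightarrow> (\<lambda>(x', x1'). E (ch r x') (ch q x1')) \<in> borel_measurable (leb d \<Delta> \<Otimes>\<^sub>M leb d \<Delta>)"
    and "data_norm n A bb (\<lambda>x x1. D x x1 - E x x1) < \<infinity>"
  shows "(\<lambda>x x1. D x x1 - E x x1) \<in> data_space n A bb"
  unfolding data_space_def mem_Collect_eq
proof (intro conjI allI impI assms(3))
  fix r q assume "r < charts A" "q < charts A"
  from borel_measurable_diff[OF assms(1)[OF this] assms(2)[OF this]]
  show "(\<lambda>(x', x1'). D (ch r x') (ch q x1') - E (ch r x') (ch q x1')) \<in> borel_measurable (leb d \<Delta> \<Otimes>\<^sub>M leb d \<Delta>)"
    by (simp add: case_prod_beta')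
qed

lemma data_space_measurable: "D \<in> data_space n A bb \<Longrightarrow> r < charts A \<Longrightarrow> q < charts A \<Longrightarrow>
    (\<lambda>(x', x1'). D (ch r x') (ch q x1')) \<in> borel_measurable (leb d \<Delta> \<Otimes>\<^sub>M leb d \<Delta>)"
  by (simp add: data_space_def)

text \<open>
  Multilinearity holds for the sources with square integrable incident field, and for all data norms that is enough.
\<close>

lemma forward_diff:
  assumes fs: "set us \<subseteq> sqint (leb n B)" "f \<in> sqint (leb n B)" "h \<in> sqint (leb n B)" "set vs \<subseteq> sqint (leb n B)"
  defines "K \<equiv> \<lambda>f. F (length us + Suc (length vs)) (tensor (us @ f # vs))"
  shows "(\<lambda>x x1. K f x x1 - K h x x1) \<in> data_space n A bb"
    and "(\<lambda>x x1. K (f - h) x x1 - (K f x x1 - K h x x1)) \<in> data_space n A bb"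
    and "data_norm n A bb (\<lambda>x x1. K (f - h) x x1 - (K f x x1 - K h x x1)) = 0"
proof -
  have fh: "f - h \<in> sqint (leb n B)" using sqint_diff[OF fs(2,3)] by (simp add: fun_diff_def)
  have K: "K f \<in> data_space n A bb" if "f \<in> sqint (leb n B)" for f
    using forward_data_space[of "us @ f # vs"] that fs(1,4) by (auto simp: K_def)
  have eq: "K (f - h) z (ch q x1') = K f z (ch q x1') - K h z (ch q x1')"
    if "z \<in> Z" "(\<lambda>y. ui y (ch q x1')) \<in> sqint (leb n B)" for z q x1'
    unfolding K_def by (rule forward_slot_diff[OF fs that])
  have pot: "is_pot (\<lambda>z. K f z (ch q x1'))" if "f \<in> sqint (leb n B)" "q < charts A" "x1' \<in> \<Delta>" for f q x1'
    using forward_is_pot[OF ui_measurable[OF that(2,3)], of "us @ f # vs"] that(1) fs(1,4) by (auto simp: K_def)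
  have "data_norm n A bb (\<lambda>x x1. K f x x1 - K h x x1) \<le> ennreal (L1c (us @ (f - h) # vs)) * (W * Ca n B A ui)"
  proof (rule data_norm_potential[OF L1c_nonneg])
    show "is_pot (\<lambda>z. K f z (ch q x1') - K h z (ch q x1'))" if "q < charts A" "x1' \<in> \<Delta>" for q x1'
      using that by (intro is_pot_diff pot fs)
    fix q x1' assume v: "(\<lambda>y. ui y (ch q x1')) \<in> sqint (leb n B)"
    have "us @ (f - h) # vs \<noteq> []" "set (us @ (f - h) # vs) \<subseteq> sqint (leb n B)" using fs(1,4) fh by auto
    from forward_L1[OF v this]
    have "pot_by (L1c (us @ (f - h) # vs) * nrm (leb n B) (\<lambda>y. ui y (ch q x1'))) (\<lambda>z. K (f - h) z (ch q x1'))"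
      by (simp add: K_def)
    then show "pot_by (L1c (us @ (f - h) # vs) * nrm (leb n B) (\<lambda>y. ui y (ch q x1'))) (\<lambda>z. K f z (ch q x1') - K h z (ch q x1'))"
      by (rule pot_by_cong[rotated]) (rule eq[OF _ v, symmetric])
  qed
  also have "\<dots> < \<infinity>" using WCa by (simp add: ennreal_mult_less_top)
  finally show 1: "(\<lambda>x x1. K f x x1 - K h x x1) \<in> data_space n A bb"
    by (intro data_space_diff_measurable data_space_measurable K fs)
  have "data_norm n A bb (\<lambda>x x1. K (f - h) x x1 - (K f x x1 - K h x x1)) \<le> ennreal 0 * (W * Ca n B A ui)"
  proof (rule data_norm_potential[OF order_refl])
    show "is_pot (\<lambda>z. K (f - h) z (ch q x1') - (K f z (ch q x1') - K h z (ch q x1')))" if "q < charts A" "x1' \<in> \<Delta>" for q x1'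
      using that by (intro is_pot_diff pot fs fh)
    fix q x1' assume v: "(\<lambda>y. ui y (ch q x1')) \<in> sqint (leb n B)"
    show "pot_by (0 * nrm (leb n B) (\<lambda>y. ui y (ch q x1'))) (\<lambda>z. K (f - h) z (ch q x1') - (K f z (ch q x1') - K h z (ch q x1')))"
      unfolding mult_zero_left by (rule pot_by_zero) (simp add: eq[OF _ v])
  qed
  then show 0: "data_norm n A bb (\<lambda>x x1. K (f - h) x x1 - (K f x x1 - K h x x1)) = 0" by simp
  show "(\<lambda>x x1. K (f - h) x x1 - (K f x x1 - K h x x1)) \<in> data_space n A bb"
    by (intro data_space_diff_measurable data_space_measurable[OF K[OF fh]] data_space_measurable[OF 1]) (simp_all add: 0)
qed

section \<open>The forward series\<close>

text \<open>
  The remainder of the forward series after \<open>L\<close> terms is a single potential, the density of which is the remainder of the series of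
  densities.
\<close>

lemma scattered_tail:
  assumes \<eta>: "\<eta> \<in> sqint (leb n B)" and v: "(\<lambda>y. ui y x1) \<in> borel_measurable (leb n B)"
    and le: "\<And>j. (\<integral>\<^sup>+y. nd x1 (replicate (Suc (j + L)) \<eta>) y \<partial>leb n B) \<le> ennreal (b j)"
    and b: "summable b" "\<And>j. 0 \<le> b j"
  shows "pot_by (\<Sum>j. b j) (\<lambda>z. scattered F \<eta> z x1 - (\<Sum>i=1..L. F i (tensor (replicate i \<eta>)) z x1))"
proof -
  have r: "replicate (Suc j) \<eta> \<noteq> []" "set (replicate (Suc j) \<eta>) \<subseteq> sqint (leb n B)" for j using \<eta> by auto
  let ?\<rho> = "\<lambda>j. dens (\<lambda>y. ui y x1) (replicate (Suc (j + L)) \<eta>)"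
  note S = potential_series[where f = ?\<rho> and b = b, OF dens_L1[OF v r le b(2)] b(1)]
  show ?thesis
  proof (rule pot_byI[OF S(1) _ S(2)])
    fix z assume z: "z \<in> Z"
    let ?F = "\<lambda>j. F (Suc j) (tensor (replicate (Suc j) \<eta>)) z x1"
    have F: "?F (j + L) = pot (?\<rho> j) z" for j
      using forward_fin(1)[OF v r z le_less_trans[OF le]] by simp
    have s: "(\<lambda>j. ?F (j + L)) sums pot (\<lambda>y. \<Sum>j. ?\<rho> j y) z" unfolding F by (rule S(3)[OF z])
    then have "summable ?F" using sums_summable summable_iff_shift[of ?F L] by blast
    then have "(\<Sum>j. ?F j) = (\<Sum>j. ?F (j + L)) + (\<Sum>j<L. ?F j)" by (rule suminf_split_initial_segment)
    moreover have "(\<Sum>i=1..L. F i (tensor (replicate i \<eta>)) z x1) = (\<Sum>j<L. ?F j)"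
      unfolding One_nat_def sum.atLeast1_atMost_eq ..
    ultimately show "scattered F \<eta> z x1 - (\<Sum>i=1..L. F i (tensor (replicate i \<eta>)) z x1) = pot (\<lambda>y. \<Sum>j. ?\<rho> j y) z"
      unfolding scattered_def sums_unique[OF s] by simp
  qed
qed

text \<open>
  Prepending a scatterer multiplies the \<open>L\<^sup>1\<close> bound by a fixed factor. Hence the series of densities is dominated by a
  geometric one from the first order on at which the density is integrable.
\<close>

lemma nd_geometric:
  assumes \<eta>: "\<eta> \<in> sqint (leb n B)" and v: "(\<lambda>y. ui y x1) \<in> borel_measurable (leb n B)"
  shows "(\<integral>\<^sup>+y. nd x1 (replicate (Suc (j + L)) \<eta>) y \<partial>leb n B) \<le>
    ennreal ((k\<^sup>2 * nrm (leb n B) \<eta> * g) ^ j) * (\<integral>\<^sup>+y. nd x1 (replicate (Suc L) \<eta>) y \<partial>leb n B)"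
proof (induction j)
  case (Suc j)
  let ?q = "k\<^sup>2 * nrm (leb n B) \<eta> * g"
  have "nrm (leb n B) (\<lambda>y. of_real (k\<^sup>2) * \<eta> y) = k\<^sup>2 * nrm (leb n B) \<eta>" unfolding nrm_cmult norm_of_real by simp
  note nq = this
  have ne: "replicate (Suc (j + L)) \<eta> \<noteq> []" "set (replicate (Suc (j + L)) \<eta>) \<subseteq> sqint (leb n B)" using \<eta> by auto
  have "(\<integral>\<^sup>+y. nd x1 (\<eta> # replicate (Suc (j + L)) \<eta>) y \<partial>leb n B) \<le> ennreal ?q * (\<integral>\<^sup>+y. nd x1 (replicate (Suc (j + L)) \<eta>) y \<partial>leb n B)"
    unfolding ndens_Cons[OF ne(1)] nq[symmetric] by (rule L1_step[OF sqint_cmult[OF \<eta>] nd_measurable[OF v ne]])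
  also have "\<dots> \<le> ennreal ?q * (ennreal (?q ^ j) * (\<integral>\<^sup>+y. nd x1 (replicate (Suc L) \<eta>) y \<partial>leb n B))"
    by (rule mult_left_mono[OF Suc]) simp
  also have "\<dots> = ennreal (?q ^ Suc j) * (\<integral>\<^sup>+y. nd x1 (replicate (Suc L) \<eta>) y \<partial>leb n B)"
    using g_nonneg by (simp add: ennreal_mult mult.assoc)
  finally show ?case by simp
qed simp

text \<open>
  Either no order has an integrable density and all terms vanish, or the orders from some \<open>L\<close> on form a convergent series of
  potentials, and the finitely many others are potentials as well.
\<close>

lemma scattered_is_pot:
  assumes \<eta>: "\<eta> \<in> sqint (leb n B)" and sm: "k\<^sup>2 * nrm (leb n B) \<eta> * g < 1" and v: "(\<lambda>y. ui y x1) \<in> borel_measurable (leb n B)"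
  shows "is_pot (\<lambda>z. scattered F \<eta> z x1 - (\<Sum>i=1..L. F i (tensor (replicate i \<eta>)) z x1))"
proof -
  let ?q = "k\<^sup>2 * nrm (leb n B) \<eta> * g"
  have q0: "0 \<le> ?q" using g_nonneg by simp
  have r: "replicate (Suc j) \<eta> \<noteq> []" "set (replicate (Suc j) \<eta>) \<subseteq> sqint (leb n B)" for j using \<eta> by auto
  have Fi: "is_pot (\<lambda>z. \<Sum>i=1..L. F i (tensor (replicate i \<eta>)) z x1)" for L
  proof (rule is_pot_sum)
    fix i assume "i \<in> {1..L}"
    then obtain j where "i = Suc j" by (cases i) auto
    then show "is_pot (\<lambda>z. F i (tensor (replicate i \<eta>)) z x1)" using forward_is_pot[OF v r, of j] by simp
  qed
  have "is_pot (\<lambda>z. scattered F \<eta> z x1)"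
  proof (cases "\<exists>L. (\<integral>\<^sup>+y. nd x1 (replicate (Suc L) \<eta>) y \<partial>leb n B) < \<infinity>")
    case True
    then obtain L h where h: "(\<integral>\<^sup>+y. nd x1 (replicate (Suc L) \<eta>) y \<partial>leb n B) = ennreal h" "0 \<le> h"
      by (metis ennreal_enn2real enn2real_nonneg infinity_ennreal_def)
    have le: "(\<integral>\<^sup>+y. nd x1 (replicate (Suc (j + L)) \<eta>) y \<partial>leb n B) \<le> ennreal (?q ^ j * h)" for j
      using nd_geometric[OF \<eta> v, of j L] q0 h(2) unfolding h(1) by (simp add: ennreal_mult)
    have "summable (\<lambda>j. ?q ^ j * h)" using sm q0 by (intro summable_mult2 summable_geometric) simp
    from scattered_tail[OF \<eta> v le this] q0 h(2)
    have tail: "is_pot (\<lambda>z. scattered F \<eta> z x1 - (\<Sum>i=1..L. F i (tensor (replicate i \<eta>)) z x1))" by (meson mult_nonneg_nonneg zero_le_power)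
    have "is_pot (\<lambda>z. 0 - (\<Sum>i=1..L. F i (tensor (replicate i \<eta>)) z x1))"
      by (rule is_pot_diff[OF _ Fi]) (use pot_by_zero[of "\<lambda>z. 0"] in blast)
    from is_pot_diff[OF tail this] show ?thesis by simp
  next
    case False
    have "scattered F \<eta> z x1 = 0" if z: "z \<in> Z" for z
    proof -
      have "F (Suc j) (tensor (replicate (Suc j) \<eta>)) z x1 = 0" for j
        using forward_zero[OF v r _ z] False by (simp only: length_replicate) blast
      then show ?thesis by (simp add: scattered_def)
    qed
    then have "pot_by 0 (\<lambda>z. scattered F \<eta> z x1)" by (rule pot_by_zero)
    then show ?thesis by blast
  qed
  from is_pot_diff[OF this Fi] show ?thesis .
qed

lemma scattered_partial_sum:
  assumes \<eta>: "\<eta> \<in> sqint (leb n B)" and sm: "k\<^sup>2 * nrm (leb n B) \<eta> * g < 1"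
  defines "b \<equiv> \<lambda>j. L1c (replicate (Suc j) \<eta>)"
  shows "data_norm n A bb (\<lambda>x x1. scattered F \<eta> x x1 - (\<Sum>i=1..L. F i (tensor (replicate i \<eta>)) x x1))
    \<le> ennreal (\<Sum>j. b (j + L)) * (W * Ca n B A ui)"
    and "summable b"
proof -
  have bj: "b j = k\<^sup>2 * nrm (leb n B) \<eta> * (k\<^sup>2 * nrm (leb n B) \<eta> * g) ^ j" for j
    by (simp add: b_def L1c_def power_mult_distrib map_replicate prod_list_replicate)
  have q0: "0 \<le> k\<^sup>2 * nrm (leb n B) \<eta> * g" using g_nonneg by simp
  show b: "summable b"
    unfolding bj[abs_def] using sm q0 by (intro summable_mult summable_geometric) simp
  have bL: "summable (\<lambda>j. b (j + L))" using b by (simp add: summable_iff_shift)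
  have b0: "0 \<le> b j" for j unfolding b_def by (rule L1c_nonneg)
  have r: "replicate (Suc j) \<eta> \<noteq> []" "set (replicate (Suc j) \<eta>) \<subseteq> sqint (leb n B)" for j using \<eta> by auto
  show "data_norm n A bb (\<lambda>x x1. scattered F \<eta> x x1 - (\<Sum>i=1..L. F i (tensor (replicate i \<eta>)) x x1))
    \<le> ennreal (\<Sum>j. b (j + L)) * (W * Ca n B A ui)"
  proof (rule data_norm_potential[OF suminf_nonneg[OF bL b0]])
    show "is_pot (\<lambda>z. scattered F \<eta> z (ch q x1') - (\<Sum>i=1..L. F i (tensor (replicate i \<eta>)) z (ch q x1')))"
      if "q < charts A" "x1' \<in> \<Delta>" for q x1' by (rule scattered_is_pot[OF \<eta> sm ui_measurable[OF that]])
    fix q x1' assume v: "(\<lambda>y. ui y (ch q x1')) \<in> sqint (leb n B)"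
    show "pot_by ((\<Sum>j. b (j + L)) * nrm (leb n B) (\<lambda>y. ui y (ch q x1')))
        (\<lambda>z. scattered F \<eta> z (ch q x1') - (\<Sum>i=1..L. F i (tensor (replicate i \<eta>)) z (ch q x1')))"
      unfolding suminf_mult2[OF bL]
    proof (rule scattered_tail[OF \<eta> sqint_measurable[OF v] _ summable_mult2[OF bL]])
      show "(\<integral>\<^sup>+y. nd (ch q x1') (replicate (Suc (j + L)) \<eta>) y \<partial>leb n B) \<le> ennreal (b (j + L) * nrm (leb n B) (\<lambda>y. ui y (ch q x1')))" for j
        unfolding b_def by (rule ndens_L1[OF v r])
    qed (simp add: b0)
  qed
qed

lemma scattered_limit:
  assumes \<eta>: "\<eta> \<in> sqint (leb n B)" and sm: "k\<^sup>2 * nrm (leb n B) \<eta> * g < 1"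
  shows "(\<lambda>L. data_norm n A bb (\<lambda>x x1. scattered F \<eta> x x1 - (\<Sum>i=1..L. F i (tensor (replicate i \<eta>)) x x1))) \<longlonglongrightarrow> 0"
proof (rule tendsto_sandwich[OF _ _ tendsto_const])
  let ?b = "\<lambda>j. L1c (replicate (Suc j) \<eta>)"
  show "\<forall>\<^sub>F L in sequentially. data_norm n A bb (\<lambda>x x1. scattered F \<eta> x x1 - (\<Sum>i=1..L. F i (tensor (replicate i \<eta>)) x x1))
      \<le> ennreal (\<Sum>j. ?b (j + L)) * (W * Ca n B A ui)"
    by (intro always_eventually allI scattered_partial_sum(1)[OF \<eta> sm])
  have "(\<lambda>L. ennreal (\<Sum>j. ?b (j + L))) \<longlonglongrightarrow> ennreal 0"
    by (intro tendsto_ennrealI suminf_exist_split2 scattered_partial_sum(2)[OF \<eta> sm])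
  from ennreal_tendsto_cmult[OF WCa[unfolded infinity_ennreal_def] this[unfolded ennreal_0]]
  show "(\<lambda>L. ennreal (\<Sum>j. ?b (j + L)) * (W * Ca n B A ui)) \<longlonglongrightarrow> 0" by (simp add: mult.commute)
qed simp

lemma scattered_data_space:
  assumes \<eta>: "\<eta> \<in> sqint (leb n B)" and sm: "k\<^sup>2 * nrm (leb n B) \<eta> * g < 1"
  shows "scattered F \<eta> \<in> data_space n A bb"
  unfolding data_space_def mem_Collect_eq
proof (intro conjI allI impI)
  have "data_norm n A bb (\<lambda>x x1. scattered F \<eta> x x1 - (\<Sum>i=1..0::nat. F i (tensor (replicate i \<eta>)) x x1)) < \<infinity>"
    by (rule le_less_trans[OF scattered_partial_sum(1)[OF \<eta> sm]]) (use WCa in \<open>simp add: ennreal_mult_less_top\<close>)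
  then show "data_norm n A bb (scattered F \<eta>) < \<infinity>" by simp
  fix r q assume rq: "r < charts A" "q < charts A"
  have m: "(\<lambda>p. F (Suc j) (tensor (replicate (Suc j) \<eta>)) (ch r (fst p)) (ch q (snd p))) \<in> borel_measurable (leb d \<Delta> \<Otimes>\<^sub>M leb d \<Delta>)" for j
  proof -
    have "h \<in> borel_measurable (leb n B)" if "h \<in> set (replicate (Suc j) \<eta>)" for h using \<eta> that by auto
    then have "(\<lambda>(x', x1'). F (length (replicate (Suc j) \<eta>)) (tensor (replicate (Suc j) \<eta>)) (ch r x') (ch q x1'))
        \<in> borel_measurable (leb d \<Delta> \<Otimes>\<^sub>M leb d \<Delta>)"
      by (intro forward_measurable rq) simp_all
    then show ?thesis by (simp only: length_replicate case_prod_beta')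
  qed
  have "(\<lambda>p. scattered F \<eta> (ch r (fst p)) (ch q (snd p))) \<in> borel_measurable (leb d \<Delta> \<Otimes>\<^sub>M leb d \<Delta>)"
    unfolding scattered_def by (rule borel_measurable_suminf[OF m])
  then show "(\<lambda>(x', x1'). scattered F \<eta> (ch r x') (ch q x1')) \<in> borel_measurable (leb d \<Delta> \<Otimes>\<^sub>M leb d \<Delta>)"
    by (simp add: case_prod_beta')
qed

end

section \<open>The error estimate\<close>

lemma sum_fun_apply: "(\<Sum>i\<in>I. f i) y = (\<Sum>i\<in>I. f i y)" for f :: "'i \<Rightarrow> 'a \<Rightarrow> 'b::comm_monoid_add"
  by (induction I rule: infinite_finite_induct) simp_all

text \<open>
  \<open>T\<close> may be moved inside the recursion because it is applied to every argument.
\<close>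

lemma inverse_op_inv_tensor:
  "1 \<le> j \<Longrightarrow> length \<phi>s = j \<Longrightarrow>
    inverse_op F T j \<phi>s = inv_tensor (\<lambda>fs. T (F (length fs) (tensor fs))) j (map T \<phi>s)"
proof (induction j arbitrary: \<phi>s rule: less_induct)
  case (less j)
  show ?case
  proof (cases "j \<le> 1")
    case True
    then obtain \<phi> where "\<phi>s = [\<phi>]" using less.prems by (cases \<phi>s) auto
    then show ?thesis using True by (simp add: inverse_op.simps[of F T j] inv_tensor.simps[of _ j])
  next
    case False
    let ?A = "\<lambda>fs. T (F (length fs) (tensor fs))"
    have eq: "inverse_op F T m (map (\<lambda>fs. F (length fs) (tensor fs)) (blocks ns (map T \<phi>s))) =
        inv_tensor ?A m (map ?A (blocks ns (map T \<phi>s)))" if "m \<in> {1..j - 1}" "ns \<in> compositions j m" for m ns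
    proof -
      have "length (map (\<lambda>fs. F (length fs) (tensor fs)) (blocks ns (map T \<phi>s))) = m"
        using that by (simp add: compositions_def)
      moreover have "m < j" "1 \<le> m" using that False by auto
      ultimately show ?thesis using less.IH[of m "map (\<lambda>fs. F (length fs) (tensor fs)) (blocks ns (map T \<phi>s))"]
        by (simp add: comp_def)
    qed
    have "inverse_op F T j \<phi>s y = inv_tensor ?A j (map T \<phi>s) y" for y
    proof -
      have "inverse_op F T j \<phi>s y = - (\<Sum>m\<in>{1..j - 1}. \<Sum>ns\<in>compositions j m.
          inv_tensor ?A m (map ?A (blocks ns (map T \<phi>s))) y)"
      proof -
        have "inverse_op F T j \<phi>s y = - (\<Sum>m\<in>{1..j - 1}. \<Sum>ns\<in>compositions j m.
            inverse_op F T m (map (\<lambda>fs. F (length fs) (tensor fs)) (blocks ns (map T \<phi>s))) y)"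
          by (simp only: inverse_op.simps[of F T j \<phi>s] False if_False)
        then show ?thesis by (simp only: eq cong: sum.cong)
      qed
      also have "\<dots> = inv_tensor ?A j (map T \<phi>s) y"
        using False by (simp add: inv_tensor.simps[of _ j] sum_fun_apply)
      finally show ?thesis .
    qed
    then show ?thesis by blast
  qed
qed

text \<open>
  The infimum in the definition of the operator norm is attained.
\<close>

lemma inverse_norm_bound:
  assumes t: "inverse_norm n A b B s T < \<infinity>" and T: "bounded_inverse n A b B s T" and D: "D \<in> data_space n A b"
  shows "sobolev_norm n B s (T D) \<le> inverse_norm n A b B s T * data_norm n A b D"
proof (cases "data_norm n A b D = 0")
  case True
  obtain e where "e < \<infinity>" "\<forall>\<phi>\<in>data_space n A b. sobolev_norm n B s (T \<phi>) \<le> e * data_norm n A b \<phi>"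
    using T by (auto simp: bounded_inverse_def)
  with D True show ?thesis by force
next
  case False
  have fin: "data_norm n A b D \<noteq> \<infinity>" using D by (auto simp: data_space_def)
  let ?q = "sobolev_norm n B s (T D) / data_norm n A b D"
  have "?q \<le> inverse_norm n A b B s T"
    unfolding inverse_norm_def
  proof (rule Inf_greatest)
    fix e assume "e \<in> {e. \<forall>\<phi>\<in>data_space n A b. sobolev_norm n B s (T \<phi>) \<le> e * data_norm n A b \<phi>}"
    then have "sobolev_norm n B s (T D) \<le> e * data_norm n A b D" using D by blast
    then have "?q \<le> e * data_norm n A b D / data_norm n A b D" by (rule divide_right_mono_ennreal)
    also have "\<dots> = e" using False fin by (simp add: mult_divide_eq_ennreal)
    finally show "?q \<le> e" .
  qed
  then have "?q * data_norm n A b D \<le> inverse_norm n A b B s T * data_norm n A b D" by (rule mult_right_mono) simp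
  moreover have "?q * data_norm n A b D = sobolev_norm n B s (T D)"
    using False fin by (metis ennreal_times_divide mult.commute mult_divide_eq_ennreal infinity_ennreal_def)
  ultimately show ?thesis by simp
qed

lemma sobolev0_diff:
  assumes B: "bset n B" and f: "f \<in> sobolev0 n B s" and g: "g \<in> sobolev0 n B s"
  shows "f - g \<in> sobolev0 n B s"
proof -
  obtain K where K: "compact K" "K \<subseteq> B" "AE x in leb n B. x \<notin> K \<longrightarrow> f x = 0" using f by (auto simp: sobolev0_def)
  obtain L where L: "compact L" "L \<subseteq> B" "AE x in leb n B. x \<notin> L \<longrightarrow> g x = 0" using g by (auto simp: sobolev0_def)
  have "f - g \<in> sobolev n B s"
    using sobolev_lin[OF B, of f s g 1 "-1"] f g by (simp add: sobolev0_def fun_diff_def)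
  moreover have "AE x in leb n B. x \<notin> K \<union> L \<longrightarrow> (f - g) x = 0"
    using K(3) L(3) by eventually_elim auto
  moreover have "compact (K \<union> L)" "K \<union> L \<subseteq> B" using K L by auto
  ultimately show ?thesis unfolding sobolev0_def by blast
qed

lemma sobolev0_sobolev: "f \<in> sobolev0 n B s \<Longrightarrow> f \<in> sobolev n B s" by (simp add: sobolev0_def)

lemma sobolev0_sqint: "f \<in> sobolev0 n B s \<Longrightarrow> f \<in> sqint (leb n B)" by (rule sobolev_sqint[OF sobolev0_sobolev])

lemma sn_diff:
  assumes "exhausted n B" "f \<in> sobolev n B s" "g \<in> sobolev n B s" shows "sn n B s (f - g) \<le> sn n B s f + sn n B s g"
  using sn_lin[OF assms, of 1 "-1"] by (simp add: fun_diff_def)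

text \<open>
  The Green's function vanishes at most at the source. This makes \<open>\<mu> + \<nu>\<close> positive, so that \<open>1 / (\<mu> + \<nu>)\<close> is
  a genuine real number.
\<close>

lemma (in scat) green_norm_pos: "0 < (SUP y\<in>B. l2norm n B (\<lambda>x. G y x))"
proof (rule ccontr)
  assume "\<not> 0 < (SUP y\<in>B. l2norm n B (\<lambda>x. G y x))"
  then have "l2norm n B (\<lambda>x. G c x) = 0"
    using SUP_upper[OF c_B, of "\<lambda>y. l2norm n B (\<lambda>x. G y x)"] by simp
  then have "(\<integral>\<^sup>+x. ennreal ((cmod (G c x))\<^sup>2) \<partial>leb n B) = 0" by (simp add: l2norm_def)
  moreover have "(\<lambda>x. ennreal ((cmod (G c x))\<^sup>2)) \<in> borel_measurable (leb n B)"
    using G_left_measurable[of c] by simp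
  ultimately have "AE x in leb n B. ennreal ((cmod (G c x))\<^sup>2) = 0" by (simp only: nn_integral_0_iff_AE)
  moreover have "AE x in leb n B. x \<in> B" using AE_space[of "leb n B"] unfolding B_space .
  ultimately have AE0: "AE x in leb n B. x \<in> pbox n c 0"
  proof eventually_elim
    case (elim x)
    then have "G c x = 0" by simp
    then have "\<not> 0 < edist n c x" using gr_nonzero[OF k, of "edist n c x" w n] by (auto simp: green_gr)
    then have "edist n c x = 0" using edist_nonneg[of n c x] by linarith
    then have "\<bar>x i - c i\<bar> \<le> 0" if "i < n" for i using abs_le_edist[OF that, of x c] by simp
    then show ?case using elim(2) by (auto simp: pbox_def oball_def)
  qed
  have Bs: "B \<in> sets (lb n)" using B_bset by (simp add: bset_def)
  have P0: "pbox n c 0 \<in> sets (lb n)" by (rule sets_lb_closed[OF compact_imp_closed[OF compact_box] box_subset])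
  have "AE x in leb n B. x \<notin> pbox n c 0"
  proof (rule AE_I)
    show "{x \<in> space (leb n B). \<not> x \<notin> pbox n c 0} \<subseteq> pbox n c 0 \<inter> B" using B_space by auto
    have "emeasure (leb n B) (pbox n c 0 \<inter> B) = emeasure (lb n) (pbox n c 0 \<inter> B)" by (rule emeasure_leb[OF B_bset]) simp
    also have "\<dots> \<le> emeasure (lb n) (pbox n c 0)" by (rule emeasure_mono[OF _ P0]) simp
    also have "\<dots> = 0" unfolding emeasure_box using n1 by simp
    finally show "emeasure (leb n B) (pbox n c 0 \<inter> B) = 0" by simp
    show "pbox n c 0 \<inter> B \<in> sets (leb n B)"
      unfolding leb_def using P0 Bs by (auto simp: sets_restrict_space)
  qed
  with AE0 have "AE x in leb n B. False" by eventually_elim simp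
  then have "emeasure (leb n B) (space (leb n B)) = 0" by (simp only: eventually_False ae_filter_eq_bot_iff)
  then have z: "emeasure (lb n) B = 0" unfolding B_space emeasure_leb[OF B_bset order_refl] .
  have "pbox n c (a / (2 * real n)) \<subseteq> B"
  proof
    fix x assume x: "x \<in> pbox n c (a / (2 * real n))"
    have "edist n c x \<le> (\<Sum>i<n. \<bar>c i - x i\<bar>)" unfolding edist_def by (rule L2_set_le_sum_abs)
    also have "\<dots> \<le> (\<Sum>i<n. a / (2 * real n))"
      using x by (intro sum_mono) (auto simp: pbox_def abs_minus_commute)
    also have "\<dots> < a" using n1 a by simp
    finally show "x \<in> B" using x by (simp add: oball_def pbox_def)
  qed
  then have "emeasure (lb n) (pbox n c (a / (2 * real n))) \<le> 0"
    unfolding z[symmetric] by (rule emeasure_mono[OF _ Bs])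
  then have "ennreal (max 0 (2 * (a / (2 * real n)))) ^ n = 0" unfolding emeasure_box by simp
  moreover have "0 < a / real n" using a n1 by simp
  ultimately show False by (simp add: ennreal_eq_0_iff)
qed

text \<open>
  The abstract setting is entered with \<open>X\<close> the compactly supported Sobolev functions and \<open>AA\<close> the compositions \<open>T K_j\<close>.
\<close>

locale inversion = fwd +
  fixes s :: nat and T :: "data \<Rightarrow> param"
  assumes T: "bounded_inverse n A bb B s T" and t: "inverse_norm n A bb B s T < \<infinity>"
    and small: "(mu w n k a B s + nu w n k a B A ui s bb) * inverse_norm n A bb B s T < 1"
begin

definition "\<tau> = enn2real (inverse_norm n A bb B s T)"
definition "\<mu> = k\<^sup>2 * Pconst s a n * g"
definition "\<nu> = k\<^sup>2 * Pconst s a n * enn2real (W * Ca n B A ui)"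
abbreviation "X \<equiv> sobolev0 n B s"
abbreviation "p \<equiv> sn n B s"
definition "AA fs = T (F (length fs) (tensor fs))" for fs :: "param list"

lemma P_nonneg: "0 < k\<^sup>2 * Pconst s a n" using k Pconst_pos[OF a] by simp

lemma mu_eq: "mu w n k a B s = ennreal \<mu>"
proof -
  have "(SUP y\<in>B. l2norm n B (\<lambda>x. G y x)) = ennreal g" using gsup by (simp add: g_def ennreal_enn2real)
  then show ?thesis unfolding mu_def \<mu>_def using P_nonneg g_nonneg by (simp add: ennreal_mult)
qed

lemma nu_eq: "nu w n k a B A ui s bb = ennreal \<nu>"
proof -
  have "W * Ca n B A ui = ennreal (enn2real (W * Ca n B A ui))" using WCa by (simp add: ennreal_enn2real)
  then have "ennreal \<nu> = ennreal (k\<^sup>2 * Pconst s a n) * (W * Ca n B A ui)"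
    unfolding \<nu>_def using P_nonneg by (simp add: ennreal_mult)
  then show ?thesis unfolding nu_def W_def by (simp add: ac_simps)
qed

lemma T_in: "D \<in> data_space n A bb \<Longrightarrow> T D \<in> X" using T by (simp add: bounded_inverse_def)

lemma T_bound: "D \<in> data_space n A bb \<Longrightarrow> ennreal (p (T D)) \<le> ennreal \<tau> * data_norm n A bb D"
  using inverse_norm_bound[OF t T, of D] t sobolev_norm_sn[OF sobolev0_sobolev[OF T_in]]
  by (simp add: \<tau>_def ennreal_enn2real)

lemma T_diff:
  assumes "D \<in> data_space n A bb" "E \<in> data_space n A bb"
  shows "AE y in leb n B. T (\<lambda>x x1. D x x1 - E x x1) y = T D y - T E y"
proof -
  have "AE y in leb n B. T (\<lambda>x x1. 1 * D x x1 + -1 * E x x1) y = 1 * T D y + -1 * T E y"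
    using T assms unfolding bounded_inverse_def by blast
  then show ?thesis by simp
qed

lemma p_cong:
  assumes "f \<in> X" "h \<in> X" "AE y in leb n B. f y = h y" shows "p f = p h"
  using sobolev0_sqint[OF assms(1)] sobolev0_sqint[OF assms(2)] by (intro sobolev_cong_AE(2)[OF _ _ assms(3) B_bset]) auto

lemma AA_in: "fs \<noteq> [] \<Longrightarrow> set fs \<subseteq> X \<Longrightarrow> AA fs \<in> X"
  unfolding AA_def using sobolev0_sqint by (intro T_in forward_data_space) auto

text \<open>
  The Poincare inequality turns every \<open>L\<^sup>2\<close> norm in \<open>L1c\<close> into a Sobolev norm and yields the constants \<open>\<mu>\<close> and \<open>\<nu>\<close>.
\<close>

lemma AA_bound:
  assumes fs: "fs \<noteq> []" "set fs \<subseteq> X"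
  shows "p (AA fs) \<le> \<tau> * \<nu> * \<mu> ^ (length fs - 1) * prod_list (map p fs)"
proof -
  have fs': "set fs \<subseteq> sqint (leb n B)" using fs sobolev0_sqint by auto
  have prod: "(\<Prod>f\<leftarrow>fs. k\<^sup>2 * nrm (leb n B) f) \<le> (k\<^sup>2 * Pconst s a n) ^ length fs * prod_list (map p fs)"
    using fs(2)
  proof (induction fs)
    case (Cons f fs)
    have 1: "k\<^sup>2 * nrm (leb n B) f \<le> (k\<^sup>2 * Pconst s a n) * p f"
      using poincare[OF c a n1, of f s] Cons.prems by (simp add: mult.assoc mult_left_mono)
    have 2: "0 \<le> (\<Prod>f\<leftarrow>fs. k\<^sup>2 * nrm (leb n B) f)" by (rule prod_list_nonneg) auto
    have "(k\<^sup>2 * nrm (leb n B) f) * (\<Prod>f\<leftarrow>fs. k\<^sup>2 * nrm (leb n B) f)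
        \<le> ((k\<^sup>2 * Pconst s a n) * p f) * ((k\<^sup>2 * Pconst s a n) ^ length fs * prod_list (map p fs))"
      using Cons P_nonneg by (intro mult_mono[OF 1 _ _ 2]) auto
    then show ?case by (simp add: ac_simps)
  qed simp
  obtain m where m: "length fs = Suc m" using fs(1) by (cases fs) auto
  have "L1c fs \<le> (k\<^sup>2 * Pconst s a n) ^ length fs * prod_list (map p fs) * g ^ (length fs - 1)"
    unfolding L1c_def by (intro mult_right_mono prod zero_le_power g_nonneg)
  also have "\<dots> = (k\<^sup>2 * Pconst s a n) * (\<mu> ^ (length fs - 1) * prod_list (map p fs))"
    by (simp add: m \<mu>_def power_mult_distrib ac_simps)
  finally have L: "L1c fs \<le> (k\<^sup>2 * Pconst s a n) * (\<mu> ^ (length fs - 1) * prod_list (map p fs))" .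
  have W0: "W * Ca n B A ui = ennreal (enn2real (W * Ca n B A ui))" using WCa by (simp add: ennreal_enn2real)
  have "ennreal (p (AA fs)) \<le> ennreal \<tau> * (ennreal (L1c fs) * (W * Ca n B A ui))"
    unfolding AA_def
    by (rule order_trans[OF T_bound[OF forward_data_space[OF fs(1) fs']]]) (intro mult_left_mono forward_norm[OF fs(1) fs'], simp)
  also have "\<dots> = ennreal (\<tau> * (L1c fs * enn2real (W * Ca n B A ui)))"
    by (subst W0) (simp add: ennreal_mult L1c_nonneg \<tau>_def)
  finally have "p (AA fs) \<le> \<tau> * (L1c fs * enn2real (W * Ca n B A ui))"
    by (subst (asm) ennreal_le_iff) (simp_all add: L1c_nonneg \<tau>_def)
  also have "\<dots> \<le> \<tau> * ((k\<^sup>2 * Pconst s a n) * (\<mu> ^ (length fs - 1) * prod_list (map p fs)) * enn2real (W * Ca n B A ui))"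
    using L by (intro mult_left_mono mult_right_mono) (simp_all add: \<tau>_def)
  also have "\<dots> = \<tau> * \<nu> * \<mu> ^ (length fs - 1) * prod_list (map p fs)" by (simp add: \<nu>_def ac_simps)
  finally show ?thesis .
qed

lemma AA_diff:
  assumes fs: "set us \<subseteq> X" "set vs \<subseteq> X" "f \<in> X" "h \<in> X"
  shows "p (AA (us @ (f - h) # vs) - (AA (us @ f # vs) - AA (us @ h # vs))) = 0"
proof -
  define K where "K = (\<lambda>f. F (length us + Suc (length vs)) (tensor (us @ f # vs)))"
  have sq: "set us \<subseteq> sqint (leb n B)" "f \<in> sqint (leb n B)" "h \<in> sqint (leb n B)" "set vs \<subseteq> sqint (leb n B)"
    using fs sobolev0_sqint by auto
  have fh: "f - h \<in> X" by (rule sobolev0_diff[OF B_bset fs(3,4)])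
  have AAK: "AA (us @ f # vs) = T (K f)" for f by (simp add: AA_def K_def)
  have KX: "AA (us @ f # vs) \<in> X" if "f \<in> X" for f using fs that by (intro AA_in) auto
  have KD: "K f \<in> data_space n A bb" if "f \<in> X" for f
    using forward_data_space[of "us @ f # vs"] sq(1,4) sobolev0_sqint[OF that] by (auto simp: K_def)
  let ?E = "\<lambda>x x1. K f x x1 - K h x x1"
  let ?D = "\<lambda>x x1. K (f - h) x x1 - ?E x x1"
  have d: "?E \<in> data_space n A bb" "?D \<in> data_space n A bb" "data_norm n A bb ?D = 0"
    unfolding K_def by (rule forward_diff[OF sq])+
  have "AE y in leb n B. T ?D y = T (K (f - h)) y - T ?E y" by (rule T_diff[OF KD[OF fh] d(1)])
  moreover have "AE y in leb n B. T ?E y = T (K f) y - T (K h) y" by (rule T_diff[OF KD[OF fs(3)] KD[OF fs(4)]])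
  ultimately have "AE y in leb n B. (AA (us @ (f - h) # vs) - (AA (us @ f # vs) - AA (us @ h # vs))) y = T ?D y"
    by eventually_elim (simp add: AAK)
  then have "p (AA (us @ (f - h) # vs) - (AA (us @ f # vs) - AA (us @ h # vs))) = p (T ?D)"
    by (intro p_cong sobolev0_diff[OF B_bset] KX fh fs T_in d(2))
  moreover have "ennreal (p (T ?D)) \<le> 0" using T_bound[OF d(2)] d(3) by simp
  ultimately show ?thesis by (simp add: ennreal_eq_0_iff order.antisym)
qed

lemma forward_series: "sobolev0 n B s \<noteq> {} \<Longrightarrow> forward_series X p AA \<tau> \<mu> \<nu>"
proof -
  assume "X \<noteq> {}"
  then obtain f where f: "f \<in> X" by blast
  have zero: "0 \<in> X" using sobolev0_diff[OF B_bset f f] by simp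
  have "p (\<lambda>x. 0) \<le> 0"
    using sn_lin[OF B_exh sobolev0_sobolev[OF f] sobolev0_sobolev[OF f], of 0 0] by simp
  then have p0: "p 0 = 0"
    using sn_nonneg[of n B s "\<lambda>x. 0"] unfolding zero_fun_def by linarith
  have t': "inverse_norm n A bb B s T = ennreal \<tau>" using t by (simp add: \<tau>_def ennreal_enn2real)
  have nn: "0 \<le> \<tau>" "0 \<le> \<mu>" "0 \<le> \<nu>" using P_nonneg g_nonneg by (simp_all add: \<tau>_def \<mu>_def \<nu>_def)
  have "(\<mu> + \<nu>) * \<tau> < 1"
  proof -
    have "ennreal ((\<mu> + \<nu>) * \<tau>) < ennreal 1"
      using small unfolding mu_eq nu_eq t' using nn by (simp add: ennreal_mult ennreal_plus)
    then show ?thesis by (subst (asm) ennreal_less_iff) (use nn in auto)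
  qed
  then show ?thesis
    by unfold_locales (use zero p0 nn sobolev0_diff[OF B_bset] sn_diff[OF B_exh] sobolev0_sobolev AA_in AA_bound AA_diff in auto)
qed

text \<open>
  \<open>T\<close> is linear almost everywhere and bounded, so that the convergence of the forward series in the data norm carries over.
\<close>

lemma T_scattered_limit:
  assumes \<eta>: "\<eta> \<in> X" and sm: "\<mu> * p \<eta> < 1"
  shows "T (scattered F \<eta>) \<in> X"
    and "(\<lambda>L. p (T (scattered F \<eta>) - (\<Sum>i=1..L. AA (replicate i \<eta>)))) \<longlonglongrightarrow> 0"
proof -
  have "k\<^sup>2 * nrm (leb n B) \<eta> * g \<le> k\<^sup>2 * (Pconst s a n * p \<eta>) * g"
    using g_nonneg by (intro mult_right_mono mult_left_mono poincare[OF c a n1 \<eta>]) auto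
  also have "\<dots> < 1" using sm by (simp add: \<mu>_def ac_simps)
  finally have sm': "k\<^sup>2 * nrm (leb n B) \<eta> * g < 1" .
  note sq = sobolev0_sqint[OF \<eta>]
  let ?\<phi> = "scattered F \<eta>"
  let ?r = "\<lambda>L x x1. ?\<phi> x x1 - (\<Sum>i=1..L. F i (tensor (replicate i \<eta>)) x x1)"
  have \<phi>: "?\<phi> \<in> data_space n A bb" by (rule scattered_data_space[OF sq sm'])
  show T\<phi>: "T ?\<phi> \<in> X" by (rule T_in[OF \<phi>])
  have FD: "F (Suc i) (tensor (replicate (Suc i) \<eta>)) \<in> data_space n A bb" for i
  proof -
    have "replicate (Suc i) \<eta> \<noteq> []" "set (replicate (Suc i) \<eta>) \<subseteq> sqint (leb n B)" using sq by auto
    from forward_data_space[OF this] show ?thesis unfolding length_replicate .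
  qed
  have r_Suc: "?r (Suc L) = (\<lambda>x x1. ?r L x x1 - F (Suc L) (tensor (replicate (Suc L) \<eta>)) x x1)" for L
    by (intro ext) (simp add: algebra_simps)
  have r0: "?r 0 = ?\<phi>" by simp
  have fin: "data_norm n A bb (?r L) < \<infinity>" for L
    by (rule le_less_trans[OF scattered_partial_sum(1)[OF sq sm']]) (use WCa in \<open>simp add: ennreal_mult_less_top\<close>)
  have r: "?r L \<in> data_space n A bb" for L
  proof (induction L)
    case (Suc L)
    show ?case using fin[of "Suc L"] unfolding r_Suc
      by (intro data_space_diff_measurable data_space_measurable[OF Suc] data_space_measurable[OF FD])
  qed (use \<phi> in \<open>simp only: r0\<close>)
  have Tr: "AE y in leb n B. T (?r L) y = (T ?\<phi> - (\<Sum>i=1..L. AA (replicate i \<eta>))) y" for L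
  proof (induction L)
    case (Suc L)
    have "AE y in leb n B. T (?r (Suc L)) y = T (?r L) y - T (F (Suc L) (tensor (replicate (Suc L) \<eta>))) y"
      unfolding r_Suc by (rule T_diff[OF r FD])
    with Suc show ?case
    proof eventually_elim
      case (elim y)
      have AAS: "T (F (Suc L) (tensor (replicate (Suc L) \<eta>))) = AA (replicate (Suc L) \<eta>)" unfolding AA_def length_replicate ..
      have "(\<Sum>i=1..Suc L. AA (replicate i \<eta>)) = (\<Sum>i=1..L. AA (replicate i \<eta>)) + AA (replicate (Suc L) \<eta>)" by simp
      then show ?case using elim unfolding AAS by simp
    qed
  qed (simp only: r0, simp)
  have X0: "0 \<in> X" using sobolev0_diff[OF B_bset \<eta> \<eta>] by simp
  have sumX: "T ?\<phi> - (\<Sum>i=1..L. AA (replicate i \<eta>)) \<in> X" for L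
  proof (induction L)
    case (Suc L)
    have "T ?\<phi> - (\<Sum>i=1..Suc L. AA (replicate i \<eta>)) = (T ?\<phi> - (\<Sum>i=1..L. AA (replicate i \<eta>))) - AA (replicate (Suc L) \<eta>)"
      by (simp add: algebra_simps)
    moreover have "AA (replicate (Suc L) \<eta>) \<in> X" using \<eta> by (intro AA_in) auto
    ultimately show ?case using sobolev0_diff[OF B_bset Suc] by (simp only:)
  qed (use T\<phi> in simp)
  have le: "ennreal (p (T ?\<phi> - (\<Sum>i=1..L. AA (replicate i \<eta>)))) \<le> ennreal \<tau> * data_norm n A bb (?r L)" for L
    using T_bound[OF r[of L]] unfolding p_cong[OF T_in[OF r] sumX Tr] .
  have "(\<lambda>L. ennreal \<tau> * data_norm n A bb (?r L)) \<longlonglongrightarrow> ennreal \<tau> * 0"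
    by (rule ennreal_tendsto_cmult[OF _ scattered_limit[OF sq sm']]) simp
  then have "(\<lambda>L. ennreal \<tau> * data_norm n A bb (?r L)) \<longlonglongrightarrow> 0" by simp
  then have "(\<lambda>L. ennreal (p (T ?\<phi> - (\<Sum>i=1..L. AA (replicate i \<eta>))))) \<longlonglongrightarrow> 0"
    by (rule tendsto_sandwich[OF _ _ tendsto_const, rotated 2]) (use le in \<open>auto intro: always_eventually\<close>)
  then have "(\<lambda>L. ennreal (p (T ?\<phi> - (\<Sum>i=1..L. AA (replicate i \<eta>))))) \<longlonglongrightarrow> ennreal 0" by simp
  then show "(\<lambda>L. p (T ?\<phi> - (\<Sum>i=1..L. AA (replicate i \<eta>)))) \<longlonglongrightarrow> 0"
    by (subst (asm) tendsto_ennreal_iff) auto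
qed

end

declare One_nat_def [simp]

theorem theorem4:
  fixes w :: wave and n :: nat and k a :: real and c :: pt
    and \<Omega> :: "pt set" and A :: atlas and S :: "(pt \<Rightarrow> complex) \<Rightarrow> complex" and ui :: data
    and \<aa> \<bb> :: int and \<eta> :: param and T :: "data \<Rightarrow> param" and N :: nat
  defines "B \<equiv> oball n c a"
  defines "s \<equiv> nat \<aa>"
  defines "F \<equiv> forward_op w n k B ui"
  defines "H \<equiv> sobolev_norm n B s"
  defines "\<phi> \<equiv> scattered F \<eta>"
  defines "TK \<eta>' \<equiv> T (F 1 (tensor [\<eta>']))"
  defines "\<kappa> \<equiv> mu w n k a B s + nu w n k a B A ui s \<bb>"
  defines "t \<equiv> inverse_norm n A \<bb> B s T"
  defines "M \<equiv> max (H \<eta>) (H (TK \<eta>))"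
  defines "C \<equiv> enn2real t * exp (1 / (1 - enn2real \<kappa> * enn2real t))"
  defines "Cstar \<equiv> max (1 / enn2real \<kappa>) C"
  defines "Cab \<equiv> Cstar * enn2real \<kappa> / (1 - enn2real \<kappa> * enn2real M)\<^sup>2"
  assumes "n \<in> {1, 2, 3}" and "0 < k" and "0 < a" and "c \<in> Rsp n"
    and "bounded_domain n \<Omega>"
    and "0 < (INF (x, y) \<in> bdry n \<Omega> \<times> B. edist n x y)"
    and "boundary_atlas n \<Omega> A \<bb>"
    and "incident_field w n k S B \<Omega> A ui"
    and "0 \<le> \<aa>"
    and "\<eta> \<in> sobolev0 n B s"
    and "bounded_inverse n A \<bb> B s T"
    and "t < 1 / \<kappa>" and "H (T \<phi>) < 1 / \<kappa>" and "M < 1 / \<kappa>"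
    and "1 \<le> N"
  shows "H (\<lambda>y. \<eta> y - (\<Sum>j=1..N. inverse_op F T j (replicate j \<phi>) y)) \<le>
    ennreal (Cab * enn2real (H (\<lambda>y. \<eta> y - TK \<eta> y))
      + C * (enn2real \<kappa> * enn2real (H (T \<phi>))) ^ (N + 1) / (1 - enn2real \<kappa> * enn2real (H (T \<phi>))))"
proof -
  interpret S0: scat w n k a c \<Omega> A \<bb>
    by unfold_locales (use assms in \<open>simp_all add: B_def\<close>)
  note \<eta>X = \<open>\<eta> \<in> sobolev0 n B s\<close>
  have kP: "0 < k\<^sup>2 * Pconst s a n" using \<open>0 < k\<close> Pconst_pos[OF \<open>0 < a\<close>] by simp
  have \<kappa>fin: "\<kappa> < \<infinity>" using \<open>t < 1 / \<kappa>\<close> by (auto simp: less_top[symmetric])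
  then have fin: "mu w n k a B s < \<infinity>" "nu w n k a B A ui s \<bb> < \<infinity>" by (auto simp: \<kappa>_def)
  have gsup: "(SUP y\<in>B. l2norm n B (\<lambda>x. green w n k y x)) < \<infinity>"
    using fin(1) kP by (auto simp: mu_def ennreal_mult_less_top ennreal_eq_0_iff)
  have "ennreal (k\<^sup>2 * Pconst s a n) * (S0.W * Ca n B A ui) < \<infinity>"
    using fin(2) by (simp add: nu_def S0.W_def B_def[symmetric] ac_simps)
  then have WCa: "S0.W * Ca n B A ui < \<infinity>"
    using kP by (simp only: ennreal_mult_less_top infinity_ennreal_def) (auto simp: ennreal_eq_0_iff)
  interpret S1: fwd w n k a c \<Omega> A \<bb> ui
  proof
    show "(\<lambda>(y, x1'). ui y (chart n A r x1')) \<in> borel_measurable (leb n (oball n c a) \<Otimes>\<^sub>M leb (n - 1) (Delta n A))"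
      if "r < charts A" for r
      using \<open>incident_field w n k S B \<Omega> A ui\<close> that by (simp add: incident_field_def B_def)
  qed (use gsup WCa in \<open>simp_all add: B_def\<close>)
  \<comment> \<open>Since \<open>enn2real\<close> and division by zero have default values, \<open>\<kappa>\<close> must be known to be positive and finite.\<close>
  have \<mu>pos: "0 < mu w n k a B s"
    using kP S0.green_norm_pos by (simp add: mu_def B_def ennreal_zero_less_mult_iff)
  define x where "x = enn2real \<kappa>"
  have \<kappa>x: "\<kappa> = ennreal x" using \<kappa>fin by (simp add: x_def ennreal_enn2real)
  have "0 < \<kappa>" using \<mu>pos by (simp add: \<kappa>_def add_pos_nonneg)
  then have x: "0 < x" unfolding \<kappa>x by simp
  have inv: "1 / \<kappa> = ennreal (1 / x)" unfolding \<kappa>x using x divide_ennreal[of 1 x] by simp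
  have less: "y < \<infinity>" "x * enn2real y < 1" if "y < 1 / \<kappa>" for y
  proof -
    show y: "y < \<infinity>" using that unfolding inv by (rule less_trans) simp
    then obtain z where z: "y = ennreal z" "0 \<le> z" by (cases y) auto
    have "z < 1 / x" using that z x unfolding inv z(1) by (simp add: ennreal_less_iff)
    then show "x * enn2real y < 1" using x z by (simp add: field_simps)
  qed
  have tfin: "t < \<infinity>" by (rule less(1)[OF \<open>t < 1 / \<kappa>\<close>])
  have t': "t = ennreal (enn2real t)" using tfin by (simp add: ennreal_enn2real)
  have "\<kappa> * t = ennreal (x * enn2real t)" using x by (subst t') (simp add: \<kappa>x ennreal_mult)
  then have \<kappa>t: "\<kappa> * t < 1" using less(2)[OF \<open>t < 1 / \<kappa>\<close>] x by (simp add: ennreal_less_one_iff)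
  interpret S2: inversion w n k a c \<Omega> A \<bb> ui s T
  proof
    show "bounded_inverse n A \<bb> (oball n c a) s T" using \<open>bounded_inverse n A \<bb> B s T\<close> by (simp add: B_def)
    show "inverse_norm n A \<bb> (oball n c a) s T < \<infinity>" using tfin by (simp add: t_def B_def)
    show "(mu w n k a (oball n c a) s + nu w n k a (oball n c a) A ui s \<bb>) * inverse_norm n A \<bb> (oball n c a) s T < 1"
      using \<kappa>t by (simp add: \<kappa>_def t_def B_def)
  qed
  interpret I: forward_series "sobolev0 n B s" "sn n B s" S2.AA S2.\<tau> S2.\<mu> S2.\<nu>
    using S2.forward_series \<eta>X unfolding B_def by blast
  have nn: "0 \<le> S2.\<mu>" "0 \<le> S2.\<nu>" by (rule I.\<mu> I.\<nu>)+
  have \<tau>: "S2.\<tau> = enn2real t" by (simp add: S2.\<tau>_def t_def B_def)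
  have "\<kappa> = ennreal S2.\<mu> + ennreal S2.\<nu>"
    unfolding \<kappa>_def B_def S2.mu_eq S2.nu_eq ..
  then have xs: "x = S2.\<mu> + S2.\<nu>" using nn by (simp add: x_def ennreal_plus[symmetric] del: ennreal_plus)
  have HX: "H f = ennreal (sn n B s f)" if "f \<in> sobolev0 n B s" for f
    unfolding H_def by (rule sobolev_norm_sn[OF sobolev0_sobolev[OF that]])
  have AA: "S2.AA [f] = TK f" for f by (simp add: S2.AA_def TK_def F_def B_def)
  have TKX: "TK \<eta> \<in> sobolev0 n B s" using I.A_in[of "[\<eta>]"] \<eta>X by (simp add: AA)
  define m where "m = max (sn n B s \<eta>) (sn n B s (TK \<eta>))"
  have Mm: "M = ennreal m" unfolding M_def HX[OF \<eta>X] HX[OF TKX] m_def by (simp add: max_def ennreal_le_iff)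
  have m0: "0 \<le> m" by (simp add: m_def le_max_iff_disj)
  have M: "enn2real M = m" using m0 by (simp add: Mm)
  have xm: "x * m < 1" using less(2)[OF \<open>M < 1 / \<kappa>\<close>] unfolding M .
  have "S2.\<mu> * sn n B s \<eta> \<le> x * m" using nn m0 by (intro mult_mono) (simp_all add: xs m_def)
  then have sm: "S2.\<mu> * sn n (oball n c a) s \<eta> < 1" using xm by (simp add: B_def)
  have \<phi>: "\<phi> = scattered (forward_op w n k (oball n c a) ui) \<eta>" by (simp add: \<phi>_def F_def B_def)
  note lim = S2.T_scattered_limit[OF \<eta>X[unfolded B_def] sm, folded \<phi> B_def]
  have f1: "x * sn n B s (T \<phi>) < 1" using less(2)[OF \<open>H (T \<phi>) < 1 / \<kappa>\<close>] by (simp add: HX[OF lim(1)])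
  have err: "sn n B s (\<eta> - (\<Sum>j=1..N. I.Q j (replicate j (T \<phi>)))) \<le>
    max (1 / x) I.C * x / (1 - x * m)\<^sup>2 * sn n B s (\<eta> - TK \<eta>) + I.C * (x * sn n B s (T \<phi>)) ^ (N + 1) / (1 - x * sn n B s (T \<phi>))"
    unfolding xs AA[symmetric]
    by (rule I.inverse_series_error[OF \<eta>X]) (use xm f1 x lim \<open>1 \<le> N\<close> in \<open>simp_all add: xs m_def AA\<close>)
  have Q: "inverse_op F T j (replicate j \<phi>) = I.Q j (replicate j (T \<phi>))" if "1 \<le> j" for j
    using inverse_op_inv_tensor[OF that, of "replicate j \<phi>" F T] by (simp add: S2.AA_def[abs_def] F_def B_def)
  have QX: "I.Q j (replicate j (T \<phi>)) \<in> sobolev0 n B s" if "1 \<le> j" for j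
    using that lim(1) by (intro I.Q_in) auto
  have sumX: "\<eta> - (\<Sum>j=1..N. I.Q j (replicate j (T \<phi>))) \<in> sobolev0 n B s"
    by (intro I.diff_in \<eta>X I.sum_in QX) simp
  have eq: "(\<lambda>y. \<eta> y - (\<Sum>j=1..N. inverse_op F T j (replicate j \<phi>) y)) = \<eta> - (\<Sum>j=1..N. I.Q j (replicate j (T \<phi>)))"
    by (intro ext) (simp add: sum_fun_apply Q)
  have eq1: "(\<lambda>y. \<eta> y - TK \<eta> y) = \<eta> - TK \<eta>" by (simp add: fun_diff_def)
  have C: "C = I.C" unfolding C_def x_def[symmetric] xs \<tau>[symmetric] I.C_def ..
  have "H (\<lambda>y. \<eta> y - (\<Sum>j=1..N. inverse_op F T j (replicate j \<phi>) y)) = ennreal (sn n B s (\<eta> - (\<Sum>j=1..N. I.Q j (replicate j (T \<phi>)))))"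
    unfolding eq by (rule HX[OF sumX])
  also have "\<dots> \<le> ennreal (max (1 / x) I.C * x / (1 - x * m)\<^sup>2 * sn n B s (\<eta> - TK \<eta>) + I.C * (x * sn n B s (T \<phi>)) ^ (N + 1) / (1 - x * sn n B s (T \<phi>)))"
    by (rule ennreal_leI[OF err])
  finally show ?thesis
    unfolding eq1 Cab_def Cstar_def C x_def[symmetric] M HX[OF I.diff_in[OF \<eta>X TKX]] HX[OF lim(1)] enn2real_ennreal[OF sn_nonneg] .
qed

end
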